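(* Let $d$ be an odd prime and $N\ge1$ an integer, and let $\widehat\pi$ be the unique invariant probability measure of the affine tangent kernel $\widehat P$ on $\widehat{\mathsf X}$. Let $\overline{\mathcal M}(\theta_M)=\int_{\mathsf X}\mathcal M\,d\pi_{\theta_M}$ be the stationary mana. Then the right derivative $$\kappa_{\mathcal M}^{\sharp}:=\lim_{\theta_M\downarrow0}\frac{\overline{\mathcal M}(\theta_M)-\overline{\mathcal M}(0)}{\theta_M}$$ exists. More precisely, the following integrals are finite and $$\kappa_{\mathcal M}^{\sharp}=\int_{\widehat{\mathsf X}}G(s,v)\,\widehat\pi(d(s,v))=\int_{\widehat{\mathsf X}}\mathfrak m(s,v)\,\widehat\pi(d(s,v))\ge0.$$ Moreover $\kappa_{\mathcal M}^{\sharp}=0$ if $N=1$ and $\kappa_{\mathcal M}^{\sharp}>0$ if $N\ge2$. Equivalently, $\overline{\mathcal M}(\theta_M)=\kappa_{\mathcal M}^{\sharp}\theta_M+o(\theta_M)$ as $\theta_M\downarrow0$.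
   Context: Model. Let $d$ be an odd prime, $N\ge1$, $D=d^N$, $\mathcal H=(\mathbb C^d)^{\otimes N}$, $\omega=e^{2\pi i/d}$, computational basis $|m\rangle$, $m\in\mathbb F_d$ (field elements in exponents are replaced by representatives in $\{0,\dots,d-1\}$). $\mathsf X=\mathbb{CP}^{D-1}$ is the space of rays, $\rho_\psi=|\psi\rangle\langle\psi|$. On one qudit, $X|m\rangle=|m+1\rangle$, $Z|m\rangle=\omega^m|m\rangle$. The projective Pauli group is the group of classes in $PU(D)$ of $\bigotimes_j Z^{p_j}X^{q_j}$; $\mathcal C_{d,N}$ (projective Clifford group) is its normalizer in $PU(D)$, a finite group whose elements are identified with unitary representatives. $F_d=d^{-1/2}\sum_{j,k}\omega^{jk}|j\rangle\langle k|$; for $d=3$, $D_a^{(3)}(\theta)=\mathrm{diag}(1,e^{2\pi i\theta/9},e^{-2\pi i\theta/9})$; for $d>3$, with a fixed $a\in\mathbb F_d^*$, $D_a^{(d)}(\theta)=\sum_k e^{-2\pi i\theta\tau_{a,d}(k)/d}|k\rangle\langle k|$ with $\tau_{a,d}(k)\in\{0,\dots,d-1\}$ the representative of $ak^3$. $R(\theta)=F_d^\dagger D_a^{(d)}(\theta)F_d$ (for all real $\theta$), $R(\theta)^{(1)}=R(\theta)\otimes I^{\otimes(N-1)}$, $\Pi_m=|m\rangle\langle m|\otimes I^{\otimes(N-1)}$. For a branch $J=(U,m)\in\mathcal C_{d,N}\times\mathbb F_d$: $p_{J,\theta}(\psi)=\|\Pi_mR(\theta)^{(1)}U|\psi\rangle\|^2$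 and, if positive, $\Psi_{J,\theta}(\psi)=[U^\dagger\Pi_mR(\theta)^{(1)}U|\psi\rangle]$. For $\theta_M\in[0,1]$, $P_{\theta_M}(\psi,\cdot)=|\mathcal C_{d,N}|^{-1}\sum_{J:p_{J,\theta_M}(\psi)>0}p_{J,\theta_M}(\psi)\delta_{\Psi_{J,\theta_M}(\psi)}$, a Markov kernel on $\mathsf X$ with a unique invariant probability measure $\pi_{\theta_M}$. Mana. For one qudit $A_{(q,p)}=\sum_{\xi\in\mathbb F_d}\omega^{p\xi}|q+\xi/2\rangle\langle q-\xi/2|$, and for $u\in\mathbb F_d^{2N}$ $A_u$ is the corresponding tensor product; $W_{\rho_\psi}(u)=d^{-N}\mathrm{Tr}(A_u\rho_\psi)$ (Gross Wigner function) and $\mathcal M(\psi)=\log_2\sum_{u}|W_{\rho_\psi}(u)|$. Tangent objects. $S$ is the finite set of stabilizer pure states (the $\mathcal C_{d,N}$-orbit of $|0\rangle^{\otimes N}$). For $s\in S$, $L_s\subset\mathbb F_d^{2N}$ is the affine Lagrangian set with $W_{\rho_s}=D^{-1}\mathbf 1_{L_s}$. $\mathsf X$ carries the Fubini–Study metric normalized so that $T_s\mathsf X$ is isometric to $|s\rangle^\perp$ with inner product $\mathrm{Re}\langle\cdot|\cdot\rangle$; $T_s\mathsf X$ is a real Hilbert space. The charts are $\kappa_s=\exp_s^{-1}:U_s=\exp_s(B(0,\varrho))\to B(0,\varrho)\subset T_s\mathsf X$ with a common small radius $\varrho>0$, such that the $U_s$ are pairwise disjoint, each point of $U_s$ has $s$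 as unique nearest stabilizer state in trace distance, the charts are bi-Lipschitz, and $|W_{\rho_{\exp_s(v)}}(u)-D^{-1}|\le\frac1{2D}$ for $u\in L_s$, $v\in B(0,\varrho)$. Set $\widehat{\mathsf X}=\bigsqcup_{s\in S}T_s\mathsf X$. For $J$ with $p_{J,0}(s)>0$ put $s_J=\Psi_{J,0}(s)\in S$, $F_{J,s}(u,\vartheta)=\kappa_{s_J}(\Psi_{J,\vartheta}(\kappa_s^{-1}(u)))$ (well defined and $C^2$ near $(0,0)$), $A_{J,s}=D_uF_{J,s}(0,0)$, $b_{J,s}=\partial_\vartheta F_{J,s}(0,0)$. Kernels on $\widehat{\mathsf X}$: $$\widetilde P((s,v),\cdot)=\tfrac1{|\mathcal C_{d,N}|}\sum_{J:p_{J,0}(s)>0}p_{J,0}(s)\delta_{(s_J,A_{J,s}v)},\quad \widehat P((s,v),\cdot)=\tfrac1{|\mathcal C_{d,N}|}\sum_{J:p_{J,0}(s)>0}p_{J,0}(s)\delta_{(s_J,A_{J,s}v+b_{J,s})}.$$ $\widehat P$ has a unique invariant probability measure $\widehat\pi$. With $\ell_{s,u}:T_s\mathsf X\to\mathbb R$ the differential at $v=0$ of $v\mapsto W_{\rho_{\kappa_s^{-1}(v)}}(u)$, $$\mathfrak m(s,v)=\frac1{\ln2}\Bigl(\sum_{u\in L_s}\ell_{s,u}(v)+\sum_{u\notin L_s}|\ell_{s,u}(v)|\Bigr).$$ The series $\widetilde u=\sum_{n\ge0}\widetilde P^n\mathfrak m$ converges absolutely pointwise, and $G=(\widehat P-\widetilde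 P)\widetilde u$, i.e. $G(s,v)=|\mathcal C_{d,N}|^{-1}\sum_{J:p_{J,0}(s)>0}p_{J,0}(s)[\widetilde u(s_J,A_{J,s}v+b_{J,s})-\widetilde u(s_J,A_{J,s}v)]$. *)

theory Defs
  imports
    "HOL-Probability.Probability_Measure"
    "HOL-Library.Landau_Symbols"
    "Berlekamp_Zassenhaus.Finite_Field"
begin

text \<open>
  The field with \<open>d\<close> elements is \<open>'p mod_ring\<close>, where \<open>d = CARD('p)\<close> is prime by the class
  \<open>prime_card\<close>. The qudits are indexed by the finite type \<open>'n\<close>, so \<open>N = CARD('n)\<close>, and the
  computational basis of the \<open>N\<close>-qudit space is indexed by the strings \<open>'n \<Rightarrow> 'p mod_ring\<close>.
  One qudit is singled out as the first one; it is the parameter \<open>q1\<close> below. The library inner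
  product on \<open>complex ^ 'i\<close> is the real part of the Hermitian one.
\<close>

type_synonym 'i cvec = "complex ^ 'i"
type_synonym 'i cmat = "complex ^ 'i ^ 'i"
type_synonym ('n, 'p) idx = "'n \<Rightarrow> 'p mod_ring"


section \<open>Linear algebra\<close>

definition dagger :: "'i::finite cmat \<Rightarrow> 'i cmat" where
  "dagger A = (\<chi> i j. cnj (A $ j $ i))"

definition unitary :: "'i::finite cmat \<Rightarrow> bool" where
  "unitary U \<longleftrightarrow> U ** dagger U = mat 1 \<and> dagger U ** U = mat 1"

definition braket :: "'i::finite cvec \<Rightarrow> 'i cvec \<Rightarrow> complex" where
  "braket \<phi> \<psi> = (\<Sum>i\<in>UNIV. cnj (\<phi> $ i) * \<psi> $ i)"

definition outer :: "'i::finite cvec \<Rightarrow> 'i cmat" where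
  "outer \<psi> = (\<chi> i j. \<psi> $ i * cnj (\<psi> $ j))"

definition tensor :: "('n::finite \<Rightarrow> 'k::finite cmat) \<Rightarrow> ('n \<Rightarrow> 'k) cmat" where
  "tensor B = (\<chi> x y. \<Prod>j\<in>UNIV. B j $ x j $ y j)"

definition on_qudit :: "'n::finite \<Rightarrow> 'k::finite cmat \<Rightarrow> ('n \<Rightarrow> 'k) cmat" where
  "on_qudit j B = tensor ((\<lambda>_. mat 1)(j := B))"

definition psd :: "'i::finite cmat \<Rightarrow> bool" where
  "psd B \<longleftrightarrow> dagger B = B \<and> (\<forall>x. 0 \<le> Re (braket x (B *v x)))"

definition trace_norm :: "'i::finite cmat \<Rightarrow> real" where
  "trace_norm A = Re (trace (THE B. psd B \<and> B ** B = dagger A ** A))"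

definition trace_dist :: "'i::finite cmat \<Rightarrow> 'i cmat \<Rightarrow> real" where
  "trace_dist \<rho> \<sigma> = trace_norm (\<rho> - \<sigma>) / 2"


section \<open>Rays\<close>

text \<open>
  The ray of a unit vector \<open>\<psi>\<close> is represented by its projector \<open>outer \<psi>\<close>; this embeds the
  projective space, with its topology, into the matrices.
\<close>

definition rays :: "'i::finite cmat set" where
  "rays = {outer \<psi> | \<psi>. norm \<psi> = 1}"

definition ray_space :: "'i::finite cmat measure" where
  "ray_space = restrict_space borel rays"

definition ray :: "'i::finite cvec \<Rightarrow> 'i cmat" where
  "ray \<phi> = outer ((1 / norm \<phi>) *\<^sub>R \<phi>)"

definition rep_vec :: "'i::finite cmat \<Rightarrow> 'i cvec" where
  "rep_vec \<rho> = (SOME \<psi>. norm \<psi> = 1 \<and> outer \<psi> = \<rho>)"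

text \<open>Normalized so that the tangent space at a ray carries the real part of the Hermitian product.\<close>

definition fubini_study_dist :: "'i::finite cmat \<Rightarrow> 'i cmat \<Rightarrow> real" where
  "fubini_study_dist \<rho> \<sigma> = arccos (cmod (braket (rep_vec \<rho>) (rep_vec \<sigma>)))"


section \<open>Paulis, Cliffords and stabilizer states\<close>

definition residue_real :: "'p::prime_card mod_ring \<Rightarrow> real" where
  "residue_real x = of_int (to_int_mod_ring x)"

definition omega_pow :: "'p::prime_card mod_ring \<Rightarrow> complex" where
  "omega_pow x = cis (2 * pi * residue_real x / real CARD('p))"

definition X_pow :: "'p::prime_card mod_ring \<Rightarrow> 'p mod_ring cmat" where
  "X_pow q = (\<chi> k m. if k = m + q then 1 else 0)"

definition Z_pow :: "'p::prime_card mod_ring \<Rightarrow> 'p mod_ring cmat" where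
  "Z_pow p = (\<chi> k m. if k = m then omega_pow (p * m) else 0)"

definition pauli :: "('n::finite, 'p::prime_card) idx \<Rightarrow> ('n, 'p) idx \<Rightarrow> ('n, 'p) idx cmat" where
  "pauli p q = tensor (\<lambda>j. Z_pow (p j) ** X_pow (q j))"

text \<open>Elements of the projective unitary group are represented as sets of proportional unitaries.\<close>

definition proj_class :: "'i::finite cmat \<Rightarrow> 'i cmat set" where
  "proj_class U = {(\<chi> i j. c * U $ i $ j) | c. cmod c = 1}"

definition proj_unitary :: "'i::finite cmat set set" where
  "proj_unitary = {proj_class U | U. unitary U}"

definition proj_pauli :: "('n::finite, 'p::prime_card) idx cmat set set" where
  "proj_pauli = {proj_class (pauli p q) | p q. True}"

definition proj_conj :: "'i::finite cmat set \<Rightarrow> 'i cmat set \<Rightarrow> 'i cmat set" where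
  "proj_conj C W = {U ** V ** dagger U | U V. U \<in> C \<and> V \<in> W}"

definition proj_clifford :: "('n::finite, 'p::prime_card) idx cmat set set" where
  "proj_clifford = {C \<in> proj_unitary. proj_conj C ` proj_pauli = proj_pauli}"

definition rep_unitary :: "'i::finite cmat set \<Rightarrow> 'i cmat" where
  "rep_unitary C = (SOME U. U \<in> C)"

definition stabilizer_states :: "('n::finite, 'p::prime_card) idx cmat set" where
  "stabilizer_states = {ray (rep_unitary C *v axis (\<lambda>_. 0) 1) | C. C \<in> proj_clifford}"


section \<open>The measurement branches and their Markov kernel\<close>

definition fourier :: "'p::prime_card mod_ring cmat" where
  "fourier = (\<chi> j k. omega_pow (j * k) / complex_of_real (sqrt (real CARD('p))))"

definition diag_gate :: "'p::prime_card mod_ring \<Rightarrow> real \<Rightarrow> 'p mod_ring cmat" where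
  "diag_gate a \<theta> = (\<chi> j k. if j \<noteq> k then 0
     else if CARD('p) = 3 then
       (if k = 0 then 1 else if k = 1 then cis (2 * pi * \<theta> / 9) else cis (- 2 * pi * \<theta> / 9))
     else cis (- 2 * pi * \<theta> * residue_real (a * k ^ 3) / real CARD('p)))"

definition rot :: "'p::prime_card mod_ring \<Rightarrow> real \<Rightarrow> 'p mod_ring cmat" where
  "rot a \<theta> = dagger fourier ** diag_gate a \<theta> ** fourier"

definition basis_proj :: "'k::finite \<Rightarrow> 'k cmat" where
  "basis_proj m = (\<chi> i j. if i = m \<and> j = m then 1 else 0)"

type_synonym ('n, 'p) branch = "('n, 'p) idx cmat set \<times> 'p mod_ring"

definition branches :: "('n::finite, 'p::prime_card) branch set" where
  "branches = proj_clifford \<times> UNIV"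

definition branch_vec ::
  "'p::prime_card mod_ring \<Rightarrow> 'n::finite \<Rightarrow> ('n, 'p) branch \<Rightarrow> real \<Rightarrow> ('n, 'p) idx cmat
    \<Rightarrow> ('n, 'p) idx cvec" where
  "branch_vec a q1 J \<theta> \<rho> =
     (on_qudit q1 (basis_proj (snd J)) ** on_qudit q1 (rot a \<theta>) ** rep_unitary (fst J))
       *v rep_vec \<rho>"

definition branch_prob ::
  "'p::prime_card mod_ring \<Rightarrow> 'n::finite \<Rightarrow> ('n, 'p) branch \<Rightarrow> real \<Rightarrow> ('n, 'p) idx cmat \<Rightarrow> real" where
  "branch_prob a q1 J \<theta> \<rho> = (norm (branch_vec a q1 J \<theta> \<rho>))\<^sup>2"

definition branch_post ::
  "'p::prime_card mod_ring \<Rightarrow> 'n::finite \<Rightarrow> ('n, 'p) branch \<Rightarrow> real \<Rightarrow> ('n, 'p) idx cmat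
    \<Rightarrow> ('n, 'p) idx cmat" where
  "branch_post a q1 J \<theta> \<rho> = ray (dagger (rep_unitary (fst J)) *v branch_vec a q1 J \<theta> \<rho>)"

definition active_branches ::
  "'p::prime_card mod_ring \<Rightarrow> 'n::finite \<Rightarrow> real \<Rightarrow> ('n, 'p) idx cmat \<Rightarrow> ('n, 'p) branch set" where
  "active_branches a q1 \<theta> \<rho> = {J \<in> branches. branch_prob a q1 J \<theta> \<rho> > 0}"

definition branch_weight ::
  "'p::prime_card mod_ring \<Rightarrow> 'n::finite \<Rightarrow> ('n, 'p) branch \<Rightarrow> real \<Rightarrow> ('n, 'p) idx cmat \<Rightarrow> real" where
  "branch_weight a q1 J \<theta> \<rho> =
     branch_prob a q1 J \<theta> \<rho> / real (card (proj_clifford :: ('n, 'p) idx cmat set set))"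

text \<open>The measure \<open>\<Sum>j\<in>J. w j \<cdot> \<delta>(t j)\<close> on the measurable space of \<open>M\<close>.\<close>

definition dirac_mixture :: "'b measure \<Rightarrow> 'j set \<Rightarrow> ('j \<Rightarrow> real) \<Rightarrow> ('j \<Rightarrow> 'b) \<Rightarrow> 'b measure" where
  "dirac_mixture M J w t = distr (point_measure J (\<lambda>j. ennreal (w j))) M t"

definition ray_kernel ::
  "'p::prime_card mod_ring \<Rightarrow> 'n::finite \<Rightarrow> real \<Rightarrow> ('n, 'p) idx cmat \<Rightarrow> ('n, 'p) idx cmat measure" where
  "ray_kernel a q1 \<theta> \<rho> =
     dirac_mixture ray_space (active_branches a q1 \<theta> \<rho>)
       (\<lambda>J. branch_weight a q1 J \<theta> \<rho>) (\<lambda>J. branch_post a q1 J \<theta> \<rho>)"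

definition kernel_op :: "('b \<Rightarrow> 'b measure) \<Rightarrow> ('b \<Rightarrow> real) \<Rightarrow> 'b \<Rightarrow> real" where
  "kernel_op K f x = (\<integral>y. f y \<partial>(K x))"

definition invariant_prob :: "'b measure \<Rightarrow> ('b \<Rightarrow> 'b measure) \<Rightarrow> 'b measure \<Rightarrow> bool" where
  "invariant_prob M K \<mu> \<longleftrightarrow> prob_space \<mu> \<and> sets \<mu> = sets M \<and>
     (\<forall>B\<in>sets M. emeasure \<mu> B = (\<integral>\<^sup>+x. emeasure (K x) B \<partial>\<mu>))"


section \<open>Wigner function and mana\<close>

type_synonym ('n, 'p) phase_point = "('n, 'p) idx \<times> ('n, 'p) idx"

definition phase_op1 :: "'p::prime_card mod_ring \<Rightarrow> 'p mod_ring \<Rightarrow> 'p mod_ring cmat" where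
  "phase_op1 q p =
     (\<chi> i j. \<Sum>\<xi>\<in>UNIV. if i = q + \<xi> / 2 \<and> j = q - \<xi> / 2 then omega_pow (p * \<xi>) else 0)"

definition phase_op :: "('n::finite, 'p::prime_card) phase_point \<Rightarrow> ('n, 'p) idx cmat" where
  "phase_op u = tensor (\<lambda>j. phase_op1 (fst u j) (snd u j))"

text \<open>The trace is real for Hermitian \<open>\<rho>\<close>; \<open>Re\<close> only adjusts the type.\<close>

definition wigner :: "('n::finite, 'p::prime_card) idx cmat \<Rightarrow> ('n, 'p) phase_point \<Rightarrow> real" where
  "wigner \<rho> u = Re (trace (phase_op u ** \<rho>)) / real CARD('p) ^ CARD('n)"

definition mana :: "('n::finite, 'p::prime_card) idx cmat \<Rightarrow> real" where
  "mana \<rho> = log 2 (\<Sum>u\<in>UNIV. \<bar>wigner \<rho> u\<bar>)"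

text \<open>
  For a stabilizer state, the only set whose indicator, divided by the dimension, can be the Wigner
  function.
\<close>

definition lagrangian_support ::
  "('n::finite, 'p::prime_card) idx cmat \<Rightarrow> ('n, 'p) phase_point set" where
  "lagrangian_support s = {u. wigner s u = 1 / real CARD('p) ^ CARD('n)}"


section \<open>Tangent objects at the stabilizer states\<close>

text \<open>
  The tangent space at \<open>s\<close> is identified with the orthogonal complement of the fixed unit
  representative of \<open>s\<close>; the Fubini--Study exponential map then follows the great circles.
\<close>

definition tangent :: "'i::finite cmat \<Rightarrow> 'i cvec set" where
  "tangent s = {v. braket (rep_vec s) v = 0}"

definition fs_exp :: "'i::finite cmat \<Rightarrow> 'i cvec \<Rightarrow> 'i cmat" where
  "fs_exp s v = outer (cos (norm v) *\<^sub>R rep_vec s + sin (norm v) *\<^sub>R sgn v)"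

definition tangent_ball :: "real \<Rightarrow> 'i::finite cmat \<Rightarrow> 'i cvec set" where
  "tangent_ball r s = tangent s \<inter> ball 0 r"

definition chart :: "real \<Rightarrow> 'i::finite cmat \<Rightarrow> 'i cmat \<Rightarrow> 'i cvec" where
  "chart r s = inv_into (tangent_ball r s) (fs_exp s)"

definition admissible_radius :: "'n::finite itself \<Rightarrow> 'p::prime_card itself \<Rightarrow> real \<Rightarrow> bool" where
  "admissible_radius _ _ r \<longleftrightarrow> r > 0 \<and>
     (let S = stabilizer_states :: ('n, 'p) idx cmat set;
          D = real CARD('p) ^ CARD('n)
      in disjoint_family_on (\<lambda>s. fs_exp s ` tangent_ball r s) S \<and>
         (\<forall>s\<in>S. inj_on (fs_exp s) (tangent_ball r s) \<and>
           (\<forall>v\<in>tangent_ball r s.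
              (\<forall>s'\<in>S. s' \<noteq> s \<longrightarrow> trace_dist (fs_exp s v) s < trace_dist (fs_exp s v) s') \<and>
              (\<forall>u\<in>lagrangian_support s. \<bar>wigner (fs_exp s v) u - 1 / D\<bar> \<le> 1 / (2 * D))) \<and>
           (\<exists>c>0. \<exists>C. \<forall>v\<in>tangent_ball r s. \<forall>w\<in>tangent_ball r s.
              c * dist v w \<le> fubini_study_dist (fs_exp s v) (fs_exp s w) \<and>
              fubini_study_dist (fs_exp s v) (fs_exp s w) \<le> C * dist v w)))"

definition branch_chart ::
  "'p::prime_card mod_ring \<Rightarrow> 'n::finite \<Rightarrow> real \<Rightarrow> ('n, 'p) branch \<Rightarrow> ('n, 'p) idx cmat
    \<Rightarrow> ('n, 'p) idx cvec \<Rightarrow> real \<Rightarrow> ('n, 'p) idx cvec" where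
  "branch_chart a q1 r J s u \<theta> =
     chart r (branch_post a q1 J 0 s) (branch_post a q1 J \<theta> (fs_exp s u))"

text \<open>
  The derivative within the subspace \<open>tangent s\<close> determines the values on that subspace only, and
  only these are used.
\<close>

definition branch_lin ::
  "'p::prime_card mod_ring \<Rightarrow> 'n::finite \<Rightarrow> real \<Rightarrow> ('n, 'p) branch \<Rightarrow> ('n, 'p) idx cmat
    \<Rightarrow> ('n, 'p) idx cvec \<Rightarrow> ('n, 'p) idx cvec" where
  "branch_lin a q1 r J s =
     frechet_derivative (\<lambda>u. branch_chart a q1 r J s u 0) (at 0 within tangent s)"

definition branch_shift ::
  "'p::prime_card mod_ring \<Rightarrow> 'n::finite \<Rightarrow> real \<Rightarrow> ('n, 'p) branch \<Rightarrow> ('n, 'p) idx cmat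
    \<Rightarrow> ('n, 'p) idx cvec" where
  "branch_shift a q1 r J s = vector_derivative (\<lambda>\<theta>. branch_chart a q1 r J s 0 \<theta>) (at 0)"

type_synonym ('n, 'p) tangent_point = "('n, 'p) idx cmat \<times> ('n, 'p) idx cvec"

definition tangent_union :: "('n::finite, 'p::prime_card) tangent_point set" where
  "tangent_union = (SIGMA s:stabilizer_states. tangent s)"

definition tangent_space :: "('n::finite, 'p::prime_card) tangent_point measure" where
  "tangent_space = restrict_space borel tangent_union"

definition linear_kernel ::
  "'p::prime_card mod_ring \<Rightarrow> 'n::finite \<Rightarrow> real \<Rightarrow> ('n, 'p) tangent_point
    \<Rightarrow> ('n, 'p) tangent_point measure" where
  "linear_kernel a q1 r = (\<lambda>(s, v).
     dirac_mixture tangent_space (active_branches a q1 0 s)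
       (\<lambda>J. branch_weight a q1 J 0 s)
       (\<lambda>J. (branch_post a q1 J 0 s, branch_lin a q1 r J s v)))"

definition affine_kernel ::
  "'p::prime_card mod_ring \<Rightarrow> 'n::finite \<Rightarrow> real \<Rightarrow> ('n, 'p) tangent_point
    \<Rightarrow> ('n, 'p) tangent_point measure" where
  "affine_kernel a q1 r = (\<lambda>(s, v).
     dirac_mixture tangent_space (active_branches a q1 0 s)
       (\<lambda>J. branch_weight a q1 J 0 s)
       (\<lambda>J. (branch_post a q1 J 0 s, branch_lin a q1 r J s v + branch_shift a q1 r J s)))"

definition wigner_diff ::
  "('n::finite, 'p::prime_card) idx cmat \<Rightarrow> ('n, 'p) phase_point \<Rightarrow> ('n, 'p) idx cvec \<Rightarrow> real" where
  "wigner_diff s u = frechet_derivative (\<lambda>v. wigner (fs_exp s v) u) (at 0 within tangent s)"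

definition tangent_mana :: "('n::finite, 'p::prime_card) tangent_point \<Rightarrow> real" where
  "tangent_mana = (\<lambda>(s, v).
     1 / ln 2 * ((\<Sum>u\<in>lagrangian_support s. wigner_diff s u v)
       + (\<Sum>u\<in>- lagrangian_support s. \<bar>wigner_diff s u v\<bar>)))"

definition mana_potential ::
  "'p::prime_card mod_ring \<Rightarrow> 'n::finite \<Rightarrow> real \<Rightarrow> ('n, 'p) tangent_point \<Rightarrow> real" where
  "mana_potential a q1 r x = (\<Sum>n. (kernel_op (linear_kernel a q1 r) ^^ n) tangent_mana x)"

definition mana_source ::
  "'p::prime_card mod_ring \<Rightarrow> 'n::finite \<Rightarrow> real \<Rightarrow> ('n, 'p) tangent_point \<Rightarrow> real" where
  "mana_source a q1 r x =
     kernel_op (affine_kernel a q1 r) (mana_potential a q1 r) x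
     - kernel_op (linear_kernel a q1 r) (mana_potential a q1 r) x"

definition stationary_mana :: "(real \<Rightarrow> ('n::finite, 'p::prime_card) idx cmat measure) \<Rightarrow> real \<Rightarrow> real" where
  "stationary_mana \<pi> \<theta> = (\<integral>\<rho>. mana \<rho> \<partial>(\<pi> \<theta>))"

end

theory Submission
  imports Defs "HOL-Library.Function_Algebras"
begin

text \<open>
  Functions of a ray are treated as functions of a vector that are homogeneous of degree two; the
  kernel then becomes the average \<open>avg\<close> over the branches, with no normalization of the states. At
  \<open>\<theta> = 0\<close> this average contracts \<open>hfun\<close>, the distance to the stabilizer states, by a fixed factor, so
  its stationary mean is \<open>O(\<theta>)\<close>. By invariance the mana may be replaced by its \<open>n\<close>-th iterate, which
  on unit vectors equals \<open>\<theta> g\<^sub>n\<close> up to \<open>O(rate\<^sup>n) hfun\<close> and terms negligible in the mean, where \<open>g\<^sub>n\<close>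
  is the \<open>n\<close>-th iterate of the affine tangent kernel on the tangent mana at the origin; it does not
  depend on the stabilizer state, by Clifford covariance. The affine kernel contracts Lipschitz
  constants, so \<open>g\<^sub>n\<close> tends to the integral of the tangent mana.
  The tangent mana vanishes only at the origin. For one qudit every branch ends in a line, so
  that all tangent maps vanish; for two or more a suitable transvection gives a nonzero shift.
\<close>

section \<open>The Hermitian product\<close>

text \<open>The stationary measure enters only through the mean of \<open>hfun\<close>, which is
  \<open>O(\<theta>)\<close>. The expansion around a stabilizer state has an error quadratic in
  \<open>\<theta>\<close> and the distance together, so it helps only at distances of order
  \<open>\<theta>\<close>, where a bound on the mean does not confine the measure. Hence a cut at
  distance \<open>R * \<theta>\<close>: inside, the error is \<open>O(\<theta>\<^sup>2)\<close> with
  a constant depending on \<open>R\<close>; outside, \<open>\<theta> < hfun / R\<close>, so a crude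
  bound costs only \<open>O(\<theta> / R)\<close> in the mean. Correspondingly
  \<open>\<theta>\<close> tends to 0 before \<open>R\<close> and \<open>n\<close> grow. The
  contraction at \<open>\<theta> = 0\<close> comes from one Clifford unitary, which turns the
  nearest stabilizer state into the zero string and brings a well chosen qudit to the measured
  position. The outcome on that state is then certain, while at least 1 / N of the weight of the
  orthogonal part goes to other outcomes. The gain would degenerate for a vector almost orthogonal
  to all stabilizer states; this is excluded because some basis state carries at least 1 / Dim of
  the weight. Averaging over the group divides the gain by its order.\<close>

lemma braket_add_right: "braket x (y + z) = braket x y + braket x z"
  by (simp add: braket_def algebra_simps sum.distrib)

lemma braket_add_left: "braket (x + y) z = braket x z + braket y z"
  by (simp add: braket_def algebra_simps sum.distrib)

lemma braket_diff_right: "braket x (y - z) = braket x y - braket x z"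
  by (simp add: braket_def algebra_simps sum_subtractf)

lemma braket_smult_right: "braket x (c *s y) = c * braket x y"
  by (simp add: braket_def algebra_simps sum_distrib_left)

lemma braket_smult_left: "braket (c *s x) y = cnj c * braket x y"
  by (simp add: braket_def algebra_simps sum_distrib_left)

lemma scaleR_eq_smult: "r *\<^sub>R (x :: complex ^ 'i) = complex_of_real r *s x"
  unfolding vec_eq_iff vector_scaleR_component vector_smult_component by (simp add: scaleR_conv_of_real)

lemma braket_scaleR_right: "braket x (r *\<^sub>R y) = r * braket x y"
  by (simp add: scaleR_eq_smult braket_smult_right)

lemma braket_scaleR_left: "braket (r *\<^sub>R x) y = r * braket x y"
  by (simp add: scaleR_eq_smult braket_smult_left)

lemma braket_zero [simp]: "braket x 0 = 0" "braket 0 x = 0"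
  by (simp_all add: braket_def)

lemma cnj_braket: "cnj (braket x y) = braket y x"
  by (simp add: braket_def mult.commute)

lemma inner_eq_braket: "inner x y = Re (braket x y)"
  by (simp add: inner_vec_def braket_def inner_complex_def)

lemma braket_self: "braket x x = complex_of_real ((norm x)\<^sup>2)"
proof -
  have "braket x x = complex_of_real (\<Sum>i\<in>UNIV. (cmod (x $ i))\<^sup>2)"
    unfolding braket_def of_real_sum
    by (rule sum.cong) (simp_all only: complex_norm_square mult.commute)
  then show ?thesis
    by (simp add: norm_vec_def L2_set_def sum_nonneg)
qed

lemma norm_smult: "norm (c *s (x :: complex ^ 'i)) = cmod c * norm x"
  by (simp add: norm_vec_def norm_mult L2_set_right_distrib)

text \<open>Reduced to the real inner product: multiplying \<open>x\<close> by the phase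
  \<open>c\<close> of the overlap makes the Hermitian product real and nonnegative.\<close>

lemma braket_Cauchy_Schwarz: "cmod (braket x y) \<le> norm x * norm y"
proof (cases "braket x y = 0")
  case False
  define c where "c = braket x y / cmod (braket x y)"
  have c: "cmod c = 1" using False by (simp add: c_def norm_divide)
  have "cnj c * braket x y = cmod (braket x y)"
    using False by (simp add: c_def complex_norm_square[symmetric] power2_eq_square
        mult.commute[of "cnj _"])
  then have "cmod (braket x y) = inner (c *s x) y"
    by (simp add: inner_eq_braket braket_smult_left)
  also have "\<dots> \<le> norm (c *s x) * norm y" by (rule norm_cauchy_schwarz)
  finally show ?thesis by (simp add: norm_smult c)
qed simp

lemma braket_dagger: "braket x (A *v y) = braket (dagger A *v x) y"
proof -
  have "braket x (A *v y) = (\<Sum>i\<in>UNIV. \<Sum>j\<in>UNIV. cnj (x $ i) * (A $ i $ j * y $ j))"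
    by (simp add: braket_def matrix_vector_mult_def sum_distrib_left)
  also have "\<dots> = (\<Sum>j\<in>UNIV. \<Sum>i\<in>UNIV. cnj (x $ i) * (A $ i $ j * y $ j))"
    by (rule sum.swap)
  also have "\<dots> = braket (dagger A *v x) y"
    by (simp add: braket_def matrix_vector_mult_def sum_distrib_right sum_distrib_left dagger_def mult_ac)
  finally show ?thesis .
qed

lemma dagger_dagger [simp]: "dagger (dagger A) = A"
  by (simp add: dagger_def vec_eq_iff)

lemma dagger_mult: "dagger (A ** B) = dagger B ** dagger A"
  by (simp add: dagger_def vec_eq_iff matrix_matrix_mult_def mult.commute)

lemma dagger_mat_1 [simp]: "dagger (mat 1) = mat 1"
  by (simp add: dagger_def vec_eq_iff mat_def)

lemma matvec_smult: "A *v (c *s x) = c *s (A *v (x :: complex ^ 'i))"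
  by (simp add: vec_eq_iff matrix_vector_mult_def sum_distrib_left mult_ac)

lemma matvec_assoc: "(A ** B) *v x = A *v (B *v (x :: complex ^ 'i))"
  by (simp add: matrix_vector_mul_assoc)

lemma bounded_linear_matvec: "bounded_linear (\<lambda>x :: complex ^ 'i. A *v x)"
  by (rule linear_conv_bounded_linear[THEN iffD1])
    (auto intro!: linearI simp: matrix_vector_right_distrib scaleR_eq_smult matvec_smult)

lemma braket_axis_left: "braket (axis i 1) x = x $ i"
proof -
  have "braket (axis i 1) x = (\<Sum>j\<in>UNIV. if j = i then x $ j else 0)"
    unfolding braket_def by (rule sum.cong) (auto simp: axis_def)
  then show ?thesis by simp
qed

lemma unitary_mult: "unitary A \<Longrightarrow> unitary B \<Longrightarrow> unitary (A ** B)"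
  unfolding unitary_def dagger_mult
  by (metis matrix_mul_assoc matrix_mul_rid)

lemma unitary_dagger: "unitary A \<Longrightarrow> unitary (dagger A)"
  by (simp add: unitary_def)

lemma unitary_mat_1: "unitary (mat 1)"
  by (simp add: unitary_def)

lemma unitary_inverse: "unitary U \<Longrightarrow> dagger U *v (U *v x) = x"
  "unitary U \<Longrightarrow> U *v (dagger U *v x) = x"
  by (simp_all add: unitary_def matrix_vector_mul_assoc)

lemma unitary_braket: "unitary U \<Longrightarrow> braket (U *v x) (U *v y) = braket x y"
  by (simp add: braket_dagger unitary_inverse)

lemma unitary_norm: "unitary U \<Longrightarrow> norm (U *v x) = norm x"
  using unitary_braket[of U x x] by (simp add: braket_self del: of_real_power)

text \<open>Polarization: the form of \<open>A = dagger U ** U - mat 1\<close> vanishes on the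
  diagonal, and testing it on \<open>x + y\<close> and on \<open>x + \<i> *s y\<close> makes it
  vanish everywhere. In finite dimension the left inverse is also a right inverse.\<close>

lemma unitaryI:
  assumes "\<And>x. norm (U *v x) = norm (x :: 'i::finite cvec)"
  shows "unitary U"
proof -
  have self: "braket x (dagger U *v (U *v x) - x) = 0" for x
    using assms[of x]
    by (simp add: braket_diff_right braket_dagger braket_self del: of_real_power)
  define A where "A = dagger U ** U - mat 1"
  have A: "A *v x = dagger U *v (U *v x) - x" for x
    by (simp add: A_def matrix_vector_mult_diff_rdistrib matrix_vector_mul_assoc)
  have q: "braket x (A *v x) = 0" for x using self A by simp
  have "braket x (A *v y) = 0" for x y
  proof -
    have "braket (x + y) (A *v (x + y)) = 0" by (rule q)
    then have 1: "braket x (A *v y) + braket y (A *v x) = 0"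
      by (simp add: matrix_vector_right_distrib braket_add_left braket_add_right q add.commute)
    have "braket (x + \<i> *s y) (A *v (x + \<i> *s y)) = 0" by (rule q)
    then have 2: "\<i> * braket x (A *v y) - \<i> * braket y (A *v x) = 0"
      by (simp add: matrix_vector_right_distrib braket_add_left braket_add_right q
          matvec_smult braket_smult_left braket_smult_right)
    then have "braket x (A *v y) = braket y (A *v x)" by simp
    with 1 show ?thesis by simp
  qed
  then have "A *v y = 0" for y
    by (metis braket_self of_real_eq_0_iff power_eq_0_iff norm_eq_zero)
  then have "dagger U *v (U *v y) = y" for y using A[of y] by simp
  then have "dagger U ** U = mat 1"
    by (simp add: matrix_eq matrix_vector_mul_assoc[symmetric])
  moreover have "U ** dagger U = mat 1"
    using calculation matrix_left_right_inverse by blast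
  ultimately show ?thesis by (simp add: unitary_def)
qed

text \<open>On a matrix \<open>*s\<close> would multiply every row entrywise by a vector, so scaling
  by a complex number is kept as a separate operation.\<close>

definition csc :: "complex \<Rightarrow> 'i::finite cmat \<Rightarrow> 'i cmat" where
  "csc c A = (\<chi> i j. c * A $ i $ j)"

lemma csc_matvec: "csc c A *v x = c *s (A *v x)"
  by (simp add: vec_eq_iff csc_def matrix_vector_mult_def sum_distrib_left mult_ac)

lemma csc_mult_left: "csc c A ** B = csc c (A ** B)"
  by (simp add: vec_eq_iff csc_def matrix_matrix_mult_def sum_distrib_left mult_ac)

lemma csc_mult_right: "A ** csc c B = csc c (A ** B)"
  by (simp add: vec_eq_iff csc_def matrix_matrix_mult_def sum_distrib_left mult_ac)

lemma csc_csc: "csc c (csc e A) = csc (c * e) A"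
  by (simp add: vec_eq_iff csc_def mult_ac)

lemma csc_1 [simp]: "csc 1 A = A"
  by (simp add: vec_eq_iff csc_def)

lemma dagger_csc: "dagger (csc c A) = csc (cnj c) (dagger A)"
  by (simp add: vec_eq_iff csc_def dagger_def)

lemma trace_csc: "trace (csc c A) = c * trace A"
  by (simp add: trace_def csc_def sum_distrib_left)

lemma unitary_csc: "cmod c = 1 \<Longrightarrow> unitary U \<Longrightarrow> unitary (csc c U)"
  by (rule unitaryI) (simp add: csc_matvec norm_smult unitary_norm)

lemma trace_outer: "trace (A ** outer y) = braket y (A *v y)"
  by (simp add: trace_def matrix_matrix_mult_def outer_def braket_def matrix_vector_mult_def
      sum_distrib_left mult_ac)

lemma outer_smult: "outer (c *s y) = csc (complex_of_real ((cmod c)\<^sup>2)) (outer y)"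
  unfolding complex_norm_square by (simp add: outer_def csc_def vec_eq_iff mult_ac)

lemma outer_phase: "cmod c = 1 \<Longrightarrow> outer (c *s y) = outer y"
  by (simp add: outer_smult)

text \<open>The phase is the overlap \<open>braket y x\<close>: apply the common projector to
  \<open>x\<close> itself.\<close>

lemma outer_eq_imp_phase:
  assumes "outer x = outer y" "norm x = 1" "norm y = 1"
  obtains c where "cmod c = 1" "x = c *s y"
proof -
  have *: "x $ i * cnj (x $ j) = y $ i * cnj (y $ j)" for i j
    using assms(1) by (simp add: outer_def vec_eq_iff)
  have "x = braket y x *s y"
  proof -
    have "x $ i = braket y x * y $ i" for i
    proof -
      have "x $ i = x $ i * braket x x" by (simp add: braket_self assms)
      also have "\<dots> = (\<Sum>j\<in>UNIV. (x $ i * cnj (x $ j)) * x $ j)"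
        by (simp add: braket_def sum_distrib_left mult_ac)
      also have "\<dots> = braket y x * y $ i"
        unfolding * by (simp add: braket_def sum_distrib_right sum_distrib_left mult_ac)
      finally show ?thesis .
    qed
    then show ?thesis by (simp add: vec_eq_iff)
  qed
  moreover from this have "cmod (braket y x) = 1"
    using assms by (metis norm_smult mult.right_neutral)
  ultimately show ?thesis by (rule that[rotated])
qed

section \<open>Additive characters\<close>

lemma cis_mod: "cis (2 * pi * of_int (k mod int d) / real d) = cis (2 * pi * of_int k / real d)"
  if "d > 0"
proof -
  have "real_of_int k = real_of_int (k mod int d) + real d * real_of_int (k div int d)"
    by (metis mod_mult_div_eq of_int_add of_int_mult of_int_of_nat_eq)
  then have "2 * pi * of_int k / real d
      = 2 * pi * of_int (k mod int d) / real d + 2 * pi * of_int (k div int d)"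
    using that by (simp add: field_simps)
  moreover have "cis (2 * pi * of_int (k div int d)) = 1"
    by (simp add: cis_multiple_2pi)
  ultimately show ?thesis by (simp add: cis_mult[symmetric])
qed

lemma omega_pow_add: "omega_pow (x + y :: 'p::prime_card mod_ring) = omega_pow x * omega_pow y"
proof -
  have "to_int_mod_ring (x + y) = (to_int_mod_ring x + to_int_mod_ring y) mod int CARD('p)"
    by transfer simp
  then have "omega_pow (x + y) = cis (2 * pi * of_int ((to_int_mod_ring x + to_int_mod_ring y)
      mod int CARD('p)) / real CARD('p))"
    by (simp add: omega_pow_def residue_real_def)
  also have "\<dots> = cis (2 * pi * of_int (to_int_mod_ring x + to_int_mod_ring y) / real CARD('p))"
    by (rule cis_mod) simp
  also have "\<dots> = omega_pow x * omega_pow y"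
    by (simp add: omega_pow_def residue_real_def cis_mult add_divide_distrib algebra_simps)
  finally show ?thesis .
qed

lemma omega_pow_0 [simp]: "omega_pow 0 = 1"
  by (simp add: omega_pow_def residue_real_def)

lemma cmod_omega_pow [simp]: "cmod (omega_pow x) = 1"
  by (simp add: omega_pow_def)

lemma omega_pow_nonzero [simp]: "omega_pow x \<noteq> 0"
  using cmod_omega_pow[of x] by (metis norm_zero zero_neq_one)

lemma omega_pow_minus: "omega_pow (- x) = inverse (omega_pow x)"
  using omega_pow_add[of x "- x"] by (simp add: inverse_unique)

lemma cnj_omega_pow: "cnj (omega_pow x) = omega_pow (- x)"
proof -
  have "omega_pow x * cnj (omega_pow x) = 1"
    using complex_norm_square[of "omega_pow x"] by simp
  then show ?thesis unfolding omega_pow_minus by (simp add: inverse_unique)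
qed

lemma omega_pow_diff: "omega_pow (x - y) = omega_pow x / omega_pow y"
  using omega_pow_add[of x "- y"] by (simp add: omega_pow_minus field_simps)

lemma omega_pow_eq_1_iff: "omega_pow (x :: 'p::prime_card mod_ring) = 1 \<longleftrightarrow> x = 0"
proof
  assume *: "omega_pow x = 1"
  have r: "0 \<le> to_int_mod_ring x" "to_int_mod_ring x < int CARD('p)"
    using range_to_int_mod_ring[where 'a='p] by (auto simp: set_eq_iff image_iff)
  have "cos (2 * pi * residue_real x / real CARD('p)) = 1"
    using * by (auto simp: omega_pow_def cis.ctr complex_eq_iff)
  then obtain n :: int where "2 * pi * residue_real x / real CARD('p) = of_int n * 2 * pi"
    by (auto simp: cos_one_2pi_int)
  then have "residue_real x = of_int (n * int CARD('p))"
    by (simp add: field_simps)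
  then have eq: "to_int_mod_ring x = n * int CARD('p)"
    unfolding residue_real_def by (simp only: of_int_eq_iff)
  have "to_int_mod_ring x div int CARD('p) = 0" using r by (rule div_pos_pos_trivial)
  then have "n = 0" by (simp add: eq)
  then have "to_int_mod_ring x = 0" using eq by simp
  then show "x = 0" by (metis to_int_mod_ring_hom.hom_0_iff)
qed simp

lemma omega_pow_inject: "omega_pow x = omega_pow y \<longleftrightarrow> x = y"
  using omega_pow_eq_1_iff[of "x - y"] by (auto simp: omega_pow_diff)

section \<open>The pairing of strings, its characters and their orthogonality\<close>

definition dotp :: "('n::finite, 'p::prime_card) idx \<Rightarrow> ('n, 'p) idx \<Rightarrow> 'p mod_ring" where
  "dotp p q = (\<Sum>j\<in>UNIV. p j * q j)"

definition scl :: "'p::prime_card mod_ring \<Rightarrow> ('n::finite, 'p) idx \<Rightarrow> ('n, 'p) idx" where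
  "scl k q = (\<lambda>j. k * q j)"

definition unit_idx :: "'n::finite \<Rightarrow> ('n, 'p::prime_card) idx" where
  "unit_idx j = (\<lambda>i. if i = j then 1 else 0)"

lemma dotp_simps:
  "dotp (p + p') q = dotp p q + dotp p' q"
  "dotp p (q + q') = dotp p q + dotp p q'"
  "dotp (p - p') q = dotp p q - dotp p' q"
  "dotp p (q - q') = dotp p q - dotp p q'"
  "dotp (- p) q = - dotp p q"
  "dotp p (- q) = - dotp p q"
  "dotp 0 q = 0"
  "dotp p 0 = 0"
  "dotp (scl k p) q = k * dotp p q"
  "dotp p (scl k q) = k * dotp p q"
  by (simp_all add: dotp_def algebra_simps sum.distrib sum_subtractf sum_negf sum_distrib_left
      scl_def)

lemma dotp_commute: "dotp p q = dotp q p"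
  by (simp add: dotp_def mult.commute)

lemma dotp_unit_idx: "dotp (unit_idx j) q = q j" "dotp q (unit_idx j) = q j"
proof -
  have "dotp (unit_idx j) q = (\<Sum>i\<in>UNIV. if i = j then q i else 0)"
    unfolding dotp_def by (rule sum.cong) (auto simp: unit_idx_def)
  then show "dotp (unit_idx j) q = q j" by simp
  then show "dotp q (unit_idx j) = q j" by (simp add: dotp_commute)
qed

lemma idx_eqI_omega:
  assumes "\<And>p. omega_pow (dotp p x) = omega_pow (dotp p y)"
  shows "x = y"
  using assms[of "unit_idx _"] by (auto simp: dotp_unit_idx omega_pow_inject)

lemma sum_shift:
  fixes g :: "'a :: {finite, group_add} \<Rightarrow> 'b :: comm_monoid_add"
  shows "(\<Sum>x\<in>UNIV. g (x + c)) = (\<Sum>x\<in>UNIV. g x)"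
  by (rule sum.reindex_bij_witness[of _ "\<lambda>x. x - c" "\<lambda>x. x + c"]) auto

lemma character_sum_eq_0:
  fixes f :: "'a :: {finite, group_add} \<Rightarrow> complex"
  assumes "\<And>x y. f (x + y) = f x * f y" and "f c \<noteq> 1"
  shows "(\<Sum>x\<in>UNIV. f x) = 0"
proof -
  have "(\<Sum>x\<in>UNIV. f x) = (\<Sum>x\<in>UNIV. f (x + c))" by (rule sum_shift[symmetric])
  also have "\<dots> = (\<Sum>x\<in>UNIV. f x) * f c" by (simp add: assms(1) sum_distrib_right)
  finally show ?thesis using assms(2) by simp
qed

lemma sum_omega_pow:
  "(\<Sum>x\<in>UNIV. omega_pow (k * x :: 'p::prime_card mod_ring)) = (if k = 0 then of_nat CARD('p) else 0)"
proof (cases "k = 0")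
  case False
  have "(\<Sum>x\<in>UNIV. omega_pow (k * x)) = 0"
    using False by (intro character_sum_eq_0[where c = "1"])
      (auto simp: omega_pow_add distrib_left omega_pow_eq_1_iff)
  with False show ?thesis by simp
qed simp

lemma sum_omega_pow_dotp:
  "(\<Sum>p\<in>UNIV. omega_pow (dotp p (q :: ('n::finite, 'p::prime_card) idx)))
    = (if q = 0 then of_nat CARD(('n, 'p) idx) else 0)"
proof (cases "q = 0")
  case False
  then obtain p where "omega_pow (dotp p q) \<noteq> omega_pow (dotp p 0)"
    using idx_eqI_omega[of q 0] by auto
  then have "(\<Sum>p\<in>UNIV. omega_pow (dotp p q)) = 0"
    by (intro character_sum_eq_0[where c = p]) (auto simp: omega_pow_add dotp_simps)
  with False show ?thesis by simp
qed (simp add: dotp_simps)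

text \<open>The Fourier coefficients \<open>S p\<close> of \<open>f\<close> add up to the order of
  the group times \<open>f 0\<close>, so one of them is nonzero. If \<open>f\<close> differed
  anywhere from the character of that \<open>p\<close>, orthogonality would make this coefficient
  vanish.\<close>

lemma character_eq_omega_pow:
  fixes f :: "('n::finite, 'p::prime_card) idx \<Rightarrow> complex"
  assumes "\<And>x y. f (x + y) = f x * f y" and "f 0 = 1"
  shows "\<exists>p. \<forall>x. f x = omega_pow (dotp p x)"
proof -
  define S where "S p = (\<Sum>x\<in>UNIV. f x * omega_pow (dotp p (- x)))" for p
  have "(\<Sum>p\<in>UNIV. S p) = (\<Sum>x\<in>UNIV. f x * (\<Sum>p\<in>UNIV. omega_pow (dotp p (- x))))"
    unfolding S_def sum_distrib_left by (rule sum.swap)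
  also have "\<dots> = (\<Sum>x\<in>UNIV. if x = (0 :: ('n, 'p) idx) then of_nat CARD(('n, 'p) idx) else 0)"
    unfolding sum_omega_pow_dotp by (intro sum.cong refl) (simp add: assms(2) neg_equal_0_iff_equal)
  also have "\<dots> \<noteq> 0" by simp
  finally obtain p where p: "S p \<noteq> 0" by (meson sum.neutral)
  have "f c = omega_pow (dotp p c)" for c
  proof (rule ccontr)
    assume "f c \<noteq> omega_pow (dotp p c)"
    then have "S p = 0" unfolding S_def
      by (intro character_sum_eq_0[where c = c])
        (auto simp: assms(1) omega_pow_add dotp_simps omega_pow_minus divide_simps omega_pow_diff)
    with p show False by simp
  qed
  then show ?thesis by blast
qed

section \<open>Weyl operators\<close>

text \<open>An opaque name for \<open>1 / 2\<close>: the simplifier diverges on numerals in this type.\<close>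

definition hlf :: "'p::prime_card mod_ring" where
  "hlf = 1 / 2"

text \<open>The phase is symmetric in the row and the column index. With this convention a product
  carries exactly the factor given by half the symplectic form, and the inverse is the operator at
  the negative point.\<close>

definition weyl :: "('n::finite, 'p::prime_card) idx \<Rightarrow> ('n, 'p) idx \<Rightarrow> ('n, 'p) idx cmat" where
  "weyl p q = (\<chi> x y. if x = y + q then omega_pow (hlf * dotp p (x + y)) else 0)"

definition symp :: "('n::finite, 'p::prime_card) idx \<Rightarrow> ('n, 'p) idx \<Rightarrow> ('n, 'p) idx \<Rightarrow> ('n, 'p) idx
    \<Rightarrow> 'p mod_ring" where
  "symp p q p' q' = dotp p q' - dotp p' q"

lemma prod_if_all: "(\<Prod>j\<in>(UNIV::'n::finite set). if P j then g j else (0::complex))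
    = (if \<forall>j. P j then \<Prod>j\<in>UNIV. g j else 0)"
  by (auto intro!: prod_zero)

lemma omega_pow_sum:
  "omega_pow (\<Sum>j\<in>A. f j :: 'p::prime_card mod_ring) = (\<Prod>j\<in>A. omega_pow (f j))"
  by (induction A rule: infinite_finite_induct) (auto simp: omega_pow_add)

lemma omega_pow_dotp: "omega_pow (dotp p q) = (\<Prod>j\<in>UNIV. omega_pow (p j * q j))"
  by (simp add: dotp_def omega_pow_sum)

lemma Z_X_entry:
  "(Z_pow p ** X_pow q) $ k $ m = (if k = m + q then omega_pow (p * k) else 0)"
proof -
  have "(Z_pow p ** X_pow q) $ k $ m
      = (\<Sum>l\<in>UNIV. if l = k then omega_pow (p * k) * (if k = m + q then 1 else 0) else 0)"
    by (simp only: matrix_matrix_mult_def vec_lambda_beta, rule sum.cong)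
      (auto simp: Z_pow_def X_pow_def)
  then show ?thesis by simp
qed

lemma pauli_entry: "pauli p q $ x $ y = (if x = y + q then omega_pow (dotp p x) else 0)"
  by (simp add: pauli_def tensor_def Z_X_entry prod_if_all omega_pow_dotp fun_eq_iff)

text \<open>A condition on one unitary instead of a projective class, and only an inclusion:
  conjugation maps Weyl operators into Weyl operators up to phases. The reverse inclusion follows
  from the finiteness of the phase space (\<open>cliff_dagger\<close>).\<close>

definition cliff :: "('n::finite, 'p::prime_card) idx cmat \<Rightarrow> bool" where
  "cliff U \<longleftrightarrow> unitary U \<and>
    (\<forall>p q. \<exists>c p' q'. cmod c = 1 \<and> (\<forall>\<psi>. U *v (weyl p q *v \<psi>) = c *s (weyl p' q' *v (U *v \<psi>))))"

locale odd_qudit =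
  fixes field_type :: "'p::prime_card itself"
  assumes two: "(2 :: 'p mod_ring) \<noteq> 0"
begin

lemma hlf: "hlf + hlf = (1 :: 'p mod_ring)"
  unfolding hlf_def by (metis mult_2 nonzero_mult_div_cancel_left times_divide_eq_right mult_1_right two)

text \<open>Ring normalization treats \<open>hlf\<close> as an atom. An identity with halves is
  therefore proved by exhibiting the cofactor \<open>t\<close> with which the difference of its
  sides is a multiple of \<open>1 - (hlf + hlf)\<close>.\<close>

lemma hlf_ring:
  assumes "L - R = (1 - (hlf + hlf)) * t"
  shows "L = (R :: 'p mod_ring)"
  using assms by (simp add: hlf)

lemma hlf_double: "hlf * x + hlf * x = (x :: 'p mod_ring)"
  by (simp only: distrib_right[symmetric] hlf mult_1_left)

lemma double_inject: "x + x = y + y \<longleftrightarrow> x = (y :: 'p mod_ring)"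
  by (metis hlf_double distrib_left)

lemma scl_hlf_double: "scl hlf x + scl hlf x = (x :: ('n::finite, 'p) idx)"
  by (simp only: fun_eq_iff scl_def plus_fun_apply hlf_double simp_thms)

lemma double_inject_idx: "x + x = y + y \<longleftrightarrow> x = (y :: ('n::finite, 'p) idx)"
  by (simp only: fun_eq_iff plus_fun_apply double_inject)

lemma divide_2_eq: "x / 2 = hlf * (x :: 'p mod_ring)"
  by (simp only: hlf_def times_divide_eq_left mult_1_left)

lemma pauli_weyl:
  "pauli p (q :: ('n::finite, 'p) idx) = csc (omega_pow (hlf * dotp p q)) (weyl p q)"
proof -
  have "dotp p (y + q) = hlf * dotp p q + hlf * dotp p (y + q + y)" for y
    by (rule hlf_ring[where t = "dotp p y + dotp p q"], simp only: dotp_simps symp_def) (simp add: algebra_simps)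
  note e = this
  have "pauli p q $ x $ y = csc (omega_pow (hlf * dotp p q)) (weyl p q) $ x $ y" for x y
  proof (cases "x = y + q")
    case True
    have "omega_pow (dotp p (y + q))
        = omega_pow (hlf * dotp p q) * omega_pow (hlf * dotp p (y + q + y))"
      by (subst e) (rule omega_pow_add)
    then show ?thesis
      unfolding csc_def weyl_def vec_lambda_beta pauli_entry True by (simp only: if_True simp_thms)
  next
    case False
    then show ?thesis by (simp add: csc_def weyl_def pauli_entry)
  qed
  then show ?thesis by (simp only: vec_eq_iff simp_thms)
qed

lemma weyl_pauli:
  "weyl p (q :: ('n::finite, 'p) idx) = csc (omega_pow (- (hlf * dotp p q))) (pauli p q)"
  by (simp add: pauli_weyl csc_csc omega_pow_add[symmetric])

lemma matvec_shift_entry: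
  fixes A :: "('n::finite, 'p) idx cmat"
  assumes "\<And>y. A $ x $ y = (if y = z then g else 0)"
  shows "(A *v \<psi>) $ x = g * \<psi> $ z"
proof -
  have "(A *v \<psi>) $ x = (\<Sum>y\<in>UNIV. if y = z then g * \<psi> $ z else 0)"
    by (simp only: matrix_vector_mult_def vec_lambda_beta assms, rule sum.cong) auto
  then show ?thesis by simp
qed

lemma weyl_matvec:
  "(weyl p (q :: ('n::finite, 'p) idx) *v \<psi>) $ x
    = omega_pow (dotp p x - hlf * dotp p q) * \<psi> $ (x - q)"
proof (rule matvec_shift_entry)
  fix y
  have "hlf * dotp p (y + q + y) = dotp p (y + q) - hlf * dotp p q"
    by (rule hlf_ring[where t = "- (dotp p y + dotp p q)"], simp only: dotp_simps symp_def) (simp add: algebra_simps)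
  note e = this
  show "weyl p q $ x $ y = (if y = x - q then omega_pow (dotp p x - hlf * dotp p q) else 0)"
  proof (cases "x = y + q")
    case True
    show ?thesis unfolding weyl_def vec_lambda_beta True e by simp
  next
    case False
    then show ?thesis by (auto simp: weyl_def)
  qed
qed

lemma omega_mult_cong:
  "a + b = c + d \<Longrightarrow> y = z \<Longrightarrow>
    omega_pow a * (omega_pow b * y) = omega_pow c * (omega_pow d * z)"
  by (simp only: mult.assoc[symmetric] omega_pow_add[symmetric])

lemma weyl_weyl:
  "weyl p q *v (weyl p' (q' :: ('n::finite, 'p) idx) *v \<psi>)
    = omega_pow (hlf * symp p q p' q') *s (weyl (p + p') (q + q') *v \<psi>)"
proof -
  have "omega_pow (dotp p x - hlf * dotp p q) *
        (omega_pow (dotp p' (x - q) - hlf * dotp p' q') * \<psi> $ (x - q - q'))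
      = omega_pow (hlf * symp p q p' q') *
        (omega_pow (dotp (p + p') x - hlf * dotp (p + p') (q + q')) * \<psi> $ (x - (q + q')))" for x
  proof (rule omega_mult_cong)
    show "dotp p x - hlf * dotp p q + (dotp p' (x - q) - hlf * dotp p' q')
      = hlf * symp p q p' q' + (dotp (p + p') x - hlf * dotp (p + p') (q + q'))"
      by (rule hlf_ring[where t = "- dotp p' q"], simp only: dotp_simps symp_def) (simp add: algebra_simps)
  qed (simp add: diff_diff_eq)
  then show ?thesis by (simp add: vec_eq_iff weyl_matvec)
qed

lemma weyl_0: "weyl 0 (0 :: ('n::finite, 'p) idx) = mat 1"
  by (auto simp: matrix_eq vec_eq_iff weyl_matvec dotp_simps)

lemma weyl_commute:
  "weyl p q *v (weyl p' (q' :: ('n::finite, 'p) idx) *v \<psi>)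
    = omega_pow (symp p q p' q') *s (weyl p' q' *v (weyl p q *v \<psi>))"
proof -
  have *: "symp p q p' q' + hlf * symp p' q' p q = hlf * symp p q p' q'"
    by (rule hlf_ring[where t = "dotp p q' - dotp p' q"], simp only: dotp_simps symp_def) (simp add: algebra_simps)
  show ?thesis
    unfolding weyl_weyl vector_smult_assoc omega_pow_add[symmetric] *
      add.commute[of p' p] add.commute[of q' q] ..
qed

lemma unitary_weyl: "unitary (weyl p (q :: ('n::finite, 'p) idx))"
proof (rule unitaryI)
  fix \<psi> :: "('n, 'p) idx cvec"
  have "(\<Sum>x\<in>UNIV. (cmod ((weyl p q *v \<psi>) $ x))\<^sup>2) = (\<Sum>x\<in>UNIV. (cmod (\<psi> $ (x + (- q))))\<^sup>2)"
    by (simp add: weyl_matvec norm_mult)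
  also have "\<dots> = (\<Sum>x\<in>UNIV. (cmod (\<psi> $ x))\<^sup>2)" by (rule sum_shift)
  finally show "norm (weyl p q *v \<psi>) = norm \<psi>"
    by (simp add: norm_vec_def L2_set_def)
qed

lemma weyl_minus_inverse:
  "weyl (- p) (- q) *v (weyl p (q :: ('n::finite, 'p) idx) *v \<psi>) = \<psi>"
  by (simp add: weyl_weyl weyl_0 symp_def dotp_simps)

section \<open>Phase point operators\<close>

text \<open>At most one \<xi>, namely twice \<open>i - q\<close>, contributes to the sum. The
  operator is thus a monomial matrix: the reflection about \<open>q\<close> with phases.\<close>

lemma phase_op1_entry:
  "phase_op1 q (p :: 'p mod_ring) $ i $ j = (if i + j = q + q then omega_pow (p * (i - j)) else 0)"
proof -
  have eq: "i = q + hlf * \<xi> \<longleftrightarrow> \<xi> = (i - q) + (i - q)" for \<xi>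
    by (metis add_diff_cancel_left' diff_add_cancel add.commute distrib_left hlf_double)
  have "phase_op1 q p $ i $ j = (\<Sum>\<xi>\<in>UNIV. if \<xi> = (i - q) + (i - q) then
      (if j = q - hlf * \<xi> then omega_pow (p * \<xi>) else 0) else 0)"
    by (simp only: phase_op1_def vec_lambda_beta divide_2_eq eq, intro sum.cong) auto
  also have "\<dots> = (if j = q - hlf * ((i - q) + (i - q)) then omega_pow (p * ((i - q) + (i - q))) else 0)"
    by simp
  also have "q - hlf * ((i - q) + (i - q)) = q - (i - q)"
    by (simp only: distrib_left hlf_double)
  also have "(if j = q - (i - q) then omega_pow (p * ((i - q) + (i - q))) else 0)
      = (if i + j = q + q then omega_pow (p * (i - j)) else 0)"
  proof (cases "i + j = q + q")
    case True
    then have j: "j = q + q - i" by (simp only: eq_diff_eq add.commute)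
    have "(i - q) + (i - q) = i - j" "j = q - (i - q)"
      unfolding j by (simp_all add: algebra_simps)
    with True show ?thesis by simp
  next
    case False
    then have "j \<noteq> q - (i - q)" by (auto simp: algebra_simps)
    with False show ?thesis by (simp only: if_False)
  qed
  finally show ?thesis .
qed

lemma phase_op_entry:
  "phase_op (q, p :: ('n::finite, 'p) idx) $ x $ y
    = (if x + y = q + q then omega_pow (dotp p (x - y)) else 0)"
  by (simp add: phase_op_def tensor_def phase_op1_entry prod_if_all omega_pow_dotp fun_eq_iff)

lemma phase_op_matvec:
  "(phase_op (q, p :: ('n::finite, 'p) idx) *v \<psi>) $ x
    = omega_pow (dotp p (x - q) + dotp p (x - q)) * \<psi> $ (q + q - x)"
proof (rule matvec_shift_entry)
  fix y
  have *: "x + y = q + q \<longleftrightarrow> y = q + q - x" by (simp only: eq_diff_eq add.commute)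
  show "phase_op (q, p) $ x $ y = (if y = q + q - x then omega_pow (dotp p (x - q) + dotp p (x - q)) else 0)"
  proof (cases "y = q + q - x")
    case True
    have "dotp p (x - y) = dotp p (x - q) + dotp p (x - q)" unfolding True
      by (simp only: dotp_simps) (simp add: algebra_simps)
    then show ?thesis using True unfolding phase_op_entry * by simp
  next
    case False
    then show ?thesis unfolding phase_op_entry * by simp
  qed
qed

text \<open>The support determines \<open>q\<close>, and the entries in row \<open>q + r / 2\<close>
  and column \<open>q - r / 2\<close> give the character of \<open>p\<close> at every
  \<open>r\<close>.\<close>

lemma phase_op_inject:
  assumes "phase_op u = phase_op (u' :: ('n::finite, 'p) phase_point)"
  shows "u = u'"
proof -
  obtain q p q' p' where u: "u = (q, p)" "u' = (q', p')" by (cases u, cases u')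
  have *: "(if x + y = q + q then omega_pow (dotp p (x - y)) else 0)
      = (if x + y = q' + q' then omega_pow (dotp p' (x - y)) else 0)" for x y
    using arg_cong[OF assms, of "\<lambda>A. A $ x $ y"] by (simp only: u phase_op_entry)
  have "q + q = q' + q'" using *[of q q] by (auto split: if_splits)
  then have "q = q'" by (simp only: double_inject_idx)
  have "omega_pow (dotp r p) = omega_pow (dotp r p')" for r
  proof -
    let ?h = "scl hlf r"
    have e: "(q + ?h) + (q - ?h) = q + q" "(q + ?h) - (q - ?h) = r"
      using scl_hlf_double[of r] by (simp_all add: algebra_simps)
    have "omega_pow (dotp p r) = omega_pow (dotp p' r)"
      using *[of "q + ?h" "q - ?h"] unfolding e using \<open>q = q'\<close> by simp
    then show ?thesis by (simp only: dotp_commute[of r])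
  qed
  then have "p = p'" by (rule idx_eqI_omega)
  then show ?thesis using u \<open>q = q'\<close> by simp
qed

lemma trace_phase_op: "trace (phase_op (u :: ('n::finite, 'p) phase_point)) = 1"
proof -
  obtain q p where u: "u = (q, p)" by (cases u)
  have *: "x + x = q + q \<longleftrightarrow> x = q" for x
    by (rule double_inject_idx)
  have "trace (phase_op u) = (\<Sum>x\<in>UNIV. if x = q then 1 else 0)"
    unfolding trace_def u phase_op_entry * by (rule sum.cong) (auto simp: dotp_simps)
  then show ?thesis by simp
qed

lemma weyl_phase_op:
  "weyl p q *v (phase_op (q0, p0) *v \<psi>)
    = omega_pow (dotp p q0 - dotp p0 q) *s
      (phase_op (q0 + scl hlf q, p0 + scl hlf p :: ('n::finite, 'p) idx) *v \<psi>)"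
proof -
  have h: "scl hlf q + scl hlf q = q"
    by (rule scl_hlf_double)
  have x: "q0 + scl hlf q + (q0 + scl hlf q) - x = q0 + q0 - (x - q)" for x
    using h by (simp add: algebra_simps)
  have "omega_pow (dotp p x - hlf * dotp p q) *
        (omega_pow (dotp p0 (x - q - q0) + dotp p0 (x - q - q0)) * \<psi> $ (q0 + q0 - (x - q)))
      = omega_pow (dotp p q0 - dotp p0 q) *
        (omega_pow (dotp (p0 + scl hlf p) (x - (q0 + scl hlf q)) + dotp (p0 + scl hlf p) (x - (q0 + scl hlf q)))
          * \<psi> $ (q0 + scl hlf q + (q0 + scl hlf q) - x))" for x
    unfolding x
  proof (rule omega_mult_cong[OF _ refl])
    show "dotp p x - hlf * dotp p q + (dotp p0 (x - q - q0) + dotp p0 (x - q - q0))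
      = dotp p q0 - dotp p0 q + (dotp (p0 + scl hlf p) (x - (q0 + scl hlf q))
        + dotp (p0 + scl hlf p) (x - (q0 + scl hlf q)))"
      by (rule hlf_ring[where t = "dotp p x - hlf * dotp p q - dotp p0 q - dotp p q0"], simp only: dotp_simps symp_def) (simp add: algebra_simps)
  qed
  then show ?thesis by (simp add: vec_eq_iff weyl_matvec phase_op_matvec)
qed

text \<open>At the origin the phase point operator is the parity, sending the amplitude at
  \<open>x\<close> to \<open>- x\<close>; it inverts the whole phase space.\<close>

lemma phase_op_weyl:
  "phase_op (0, 0) *v (weyl p (q :: ('n::finite, 'p) idx) *v \<psi>)
    = weyl (- p) (- q) *v (phase_op (0, 0) *v \<psi>)"
  by (auto simp: vec_eq_iff weyl_matvec phase_op_matvec dotp_simps algebra_simps)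

lemma phase_op_square:
  "phase_op (0, 0 :: ('n::finite, 'p) idx) *v (phase_op (0, 0) *v \<psi>) = \<psi>"
  by (auto simp: vec_eq_iff phase_op_matvec dotp_simps)

lemma dagger_phase_op: "dagger (phase_op u) = phase_op (u :: ('n::finite, 'p) phase_point)"
proof -
  obtain q p where u: "u = (q, p)" by (cases u)
  show ?thesis
    by (auto simp: u vec_eq_iff dagger_def phase_op_entry cnj_omega_pow dotp_simps add.commute)
qed

lemma norm_phase_op: "norm (phase_op u *v \<psi>) = norm (\<psi> :: ('n::finite, 'p) idx cvec)"
proof -
  obtain q p where u: "u = (q, p)" by (cases u)
  have "(\<Sum>x\<in>UNIV. (cmod ((phase_op u *v \<psi>) $ x))\<^sup>2) = (\<Sum>x\<in>UNIV. (cmod (\<psi> $ (q + q - x)))\<^sup>2)"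
    by (simp add: u phase_op_matvec norm_mult)
  also have "\<dots> = (\<Sum>x\<in>UNIV. (cmod (\<psi> $ x))\<^sup>2)"
    by (rule sum.reindex_bij_witness[of _ "\<lambda>x. q + q - x" "\<lambda>x. q + q - x"]) auto
  finally show "norm (phase_op u *v \<psi>) = norm \<psi>"
    by (simp add: norm_vec_def L2_set_def)
qed

section \<open>Clifford unitaries\<close>

lemma matvec_axis: "(A *v axis y 1) $ x = (A :: 'i::finite cmat) $ x $ y"
proof -
  have "(A *v axis y 1) $ x = (\<Sum>z\<in>UNIV. if z = y then A $ x $ z else 0)"
    by (simp only: matrix_vector_mult_def vec_lambda_beta, rule sum.cong) (auto simp: axis_def)
  then show ?thesis by simp
qed

text \<open>Commuting up to scalars with the diagonal Weyl operators confines \<open>K\<close> to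
  one shifted diagonal \<open>x = y + q\<close>. Commuting up to scalars with the shifts makes the
  entries along it a multiple of a character, that is, of a second phase space coordinate.\<close>

lemma weyl_of_commuting:
  fixes K :: "('n::finite, 'p) idx cmat"
  assumes comm: "\<And>p q. \<exists>c. \<forall>\<psi>. K *v (weyl p q *v \<psi>) = c *s (weyl p q *v (K *v \<psi>))"
  shows "\<exists>c p q. K = csc c (weyl p q)"
proof (cases "K = 0")
  case True
  then have "K = csc 0 (weyl 0 0)" by (simp add: csc_def vec_eq_iff)
  then show ?thesis by blast
next
  case False
  then obtain x0 y0 where K0: "K $ x0 $ y0 \<noteq> 0" by (auto simp: vec_eq_iff)
  obtain c where c: "\<And>p q \<psi>. K *v (weyl p q *v \<psi>) = c p q *s (weyl p q *v (K *v \<psi>))"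
    using comm by metis
  have col: "(K *v axis y 1) $ x = K $ x $ y" for x y
    by (rule matvec_axis)
  have w: "weyl p q *v axis y 1 = omega_pow (dotp p y + hlf * dotp p q) *s axis (y + q) 1"
    for p q :: "('n, 'p) idx" and y
  proof -
    have "dotp p (y + q) - hlf * dotp p q = dotp p y + hlf * dotp p q"
      by (rule hlf_ring[where t = "dotp p q"], simp only: dotp_simps symp_def) (simp add: algebra_simps)
    note e = this
    have "(weyl p q *v axis y 1) $ x
        = (omega_pow (dotp p y + hlf * dotp p q) *s axis (y + q) 1) $ x" for x
    proof (cases "x = y + q")
      case True
      show ?thesis unfolding True weyl_matvec vector_smult_component e by (simp add: axis_def)
    qed (auto simp: weyl_matvec axis_def)
    then show ?thesis by (simp only: vec_eq_iff simp_thms)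
  qed
  have ent: "omega_pow (dotp p y + hlf * dotp p q) * K $ x $ (y + q)
      = c p q * omega_pow (dotp p x - hlf * dotp p q) * K $ (x - q) $ y" for p q x y
    using arg_cong[OF c[of p q "axis y 1"], of "\<lambda>v. v $ x"]
    by (simp add: w weyl_matvec matvec_smult col)
  define q where "q = x0 - y0"
  have supp: "x = y + q" if "K $ x $ y \<noteq> 0" for x y
  proof -
    have "omega_pow (dotp p (y - x)) = c p 0" if "K $ x $ y \<noteq> 0" for p x y
      using ent[of p y 0 x] that by (simp add: dotp_simps omega_pow_diff field_simps)
    then have "omega_pow (dotp p (y - x)) = omega_pow (dotp p (y0 - x0))" for p
      using K0 that by metis
    then have "y - x = y0 - x0" by (rule idx_eqI_omega)
    then show ?thesis unfolding q_def by (metis add_diff_cancel_left' diff_add_cancel diff_diff_eq2 minus_diff_eq)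
  qed
  \<comment> \<open>The entries on the only nonzero diagonal. Their behaviour under translation
    shows that the scalars \<open>c 0 t\<close> form a character.\<close>
  define k where "k y = K $ (y + q) $ y" for y
  have k: "k (y + t) = c 0 t * k y" for y t
    using ent[of 0 y t "y + t + q"] by (simp add: k_def dotp_simps algebra_simps)
  have k0: "k 0 \<noteq> 0"
    using supp[OF K0] K0 k[of 0 y0] by (auto simp: k_def)
  have hom: "c 0 (s + t) = c 0 s * c 0 t" for s t
  proof -
    have "c 0 (s + t) * k 0 = k (0 + t + s)" using k[of 0 "s + t"] by (simp add: add_ac)
    also have "\<dots> = c 0 s * c 0 t * k 0" unfolding k by simp
    finally show ?thesis using k0 by simp
  qed
  have "c 0 0 = 1" using k[of 0 0] k0 by simp
  then obtain p where p: "\<And>t. c 0 t = omega_pow (dotp p t)"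
    using character_eq_omega_pow[of "c 0"] hom by blast
  have "K $ x $ y = csc (k 0 * omega_pow (- (hlf * dotp p q))) (weyl p q) $ x $ y" for x y
  proof (cases "x = y + q")
    case True
    have "K $ x $ y = k y" by (simp add: True k_def)
    also have "k y = omega_pow (dotp p y) * k 0" using k[of 0 y] by (simp add: p)
    also have "dotp p y = - (hlf * dotp p q) + hlf * dotp p (y + q + y)"
      by (rule hlf_ring[where t = "dotp p y"], simp only: dotp_simps symp_def) (simp add: algebra_simps)
    finally have "K $ x $ y
        = omega_pow (- (hlf * dotp p q)) * omega_pow (hlf * dotp p (y + q + y)) * k 0"
      by (simp only: omega_pow_add)
    then show ?thesis
      unfolding csc_def weyl_def vec_lambda_beta True by (simp only: if_True simp_thms mult_ac)
  next
    case False
    then show ?thesis using supp[of x y] by (auto simp: csc_def weyl_def)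
  qed
  then have "K = csc (k 0 * omega_pow (- (hlf * dotp p q))) (weyl p q)" by (simp add: vec_eq_iff)
  then show ?thesis by blast
qed

lemma cliff_unitary: "cliff U \<Longrightarrow> unitary U"
  by (simp add: cliff_def)

lemma cliffE:
  assumes "cliff U"
  obtains c p' q' where "cmod c = 1" "\<And>\<psi>. U *v (weyl p q *v \<psi>) = c *s (weyl p' q' *v (U *v \<psi>))"
  using assms unfolding cliff_def by meson

lemma weyl_eq_imp:
  assumes "\<And>\<psi>. weyl p q *v \<psi> = c *s (weyl p' (q' :: ('n::finite, 'p) idx) *v \<psi>)"
  shows "p = p' \<and> q = q'"
proof -
  have e: "omega_pow (dotp p x - hlf * dotp p q) * \<psi> $ (x - q)
      = c * (omega_pow (dotp p' x - hlf * dotp p' q') * \<psi> $ (x - q'))" for \<psi> x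
    using arg_cong[OF assms[of \<psi>], of "\<lambda>v. v $ x"] by (simp add: weyl_matvec)
  have "q = q'"
    using e[of q "axis 0 1"] by (auto simp: axis_def dotp_simps split: if_splits)
  have "omega_pow (dotp p x - hlf * dotp p q) = c * omega_pow (dotp p' x - hlf * dotp p' q')" for x
    using e[of x "\<chi> i. 1"] by simp
  note e = this
  have "omega_pow (dotp x p) = omega_pow (dotp x p')" for x
  proof -
    have "omega_pow (dotp p x) * omega_pow (- (hlf * dotp p q))
        = omega_pow (dotp p' x) * (c * omega_pow (- (hlf * dotp p' q')))"
      using e[of x] by (simp only: diff_conv_add_uminus omega_pow_add mult_ac)
    also have "c * omega_pow (- (hlf * dotp p' q')) = omega_pow (- (hlf * dotp p q))"
      using e[of 0] by (simp add: dotp_simps)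
    finally show ?thesis by (simp add: dotp_commute[of x])
  qed
  then show ?thesis using \<open>q = q'\<close> idx_eqI_omega by blast
qed

text \<open>The map that \<open>U\<close> induces on phase space points is injective by
  \<open>weyl_eq_imp\<close>, hence surjective because the phase space is finite. So each Weyl
  operator is, up to a phase, the image of one, and conjugation can be read backwards.\<close>

lemma cliff_dagger:
  fixes U :: "('n::finite, 'p) idx cmat"
  assumes "cliff U"
  shows "cliff (dagger U)"
proof -
  note U = cliff_unitary[OF assms]
  have "\<forall>v. \<exists>c w. cmod c = 1 \<and>
      (\<forall>\<psi>. U *v (weyl (fst v) (snd v) *v \<psi>) = c *s (weyl (fst w) (snd w) *v (U *v \<psi>)))"
    using assms unfolding cliff_def by (metis fst_conv snd_conv)
  then obtain c f where f: "\<And>v. cmod (c v) = 1"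
    "\<And>v \<psi>. U *v (weyl (fst v) (snd v) *v \<psi>) = c v *s (weyl (fst (f v)) (snd (f v)) *v (U *v \<psi>))"
    by metis
  have "inj f"
  proof (rule injI)
    fix v w assume eq: "f v = f w"
    have cw: "c w \<noteq> 0" using f(1)[of w] by auto
    have "U *v (weyl (fst v) (snd v) *v \<psi>) = U *v ((c v / c w) *s (weyl (fst w) (snd w) *v \<psi>))" for \<psi>
      using cw by (simp add: f matvec_smult eq vector_smult_assoc)
    then have "weyl (fst v) (snd v) *v \<psi> = (c v / c w) *s (weyl (fst w) (snd w) *v \<psi>)" for \<psi>
      by (metis unitary_inverse(1)[OF U])
    then show "v = w" using weyl_eq_imp by (metis prod_eqI)
  qed
  then have "surj f" by (simp add: finite_UNIV_inj_surj)
  show ?thesis unfolding cliff_def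
  proof (intro conjI allI unitary_dagger[OF U])
    fix p q :: "('n, 'p) idx"
    obtain v where v: "f v = (p, q)" using \<open>surj f\<close> by (metis surj_def)
    have "dagger U *v (weyl p q *v \<psi>) = inverse (c v) *s (weyl (fst v) (snd v) *v (dagger U *v \<psi>))" for \<psi>
    proof -
      have "U *v (weyl (fst v) (snd v) *v (dagger U *v \<psi>)) = c v *s (weyl p q *v \<psi>)"
        by (simp add: f v unitary_inverse[OF U])
      then have "weyl (fst v) (snd v) *v (dagger U *v \<psi>) = c v *s (dagger U *v (weyl p q *v \<psi>))"
        by (metis unitary_inverse(1)[OF U] matvec_smult)
      moreover have "c v \<noteq> 0" using f(1)[of v] by auto
      ultimately show ?thesis by (simp add: vector_smult_assoc)
    qed
    moreover have "cmod (inverse (c v)) = 1" by (simp add: f norm_inverse)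
    ultimately show "\<exists>c p' q'. cmod c = 1 \<and>
        (\<forall>\<psi>. dagger U *v (weyl p q *v \<psi>) = c *s (weyl p' q' *v (dagger U *v \<psi>)))" by blast
  qed
qed

lemma cliff_mult:
  assumes "cliff U" "cliff (V :: ('n::finite, 'p) idx cmat)"
  shows "cliff (U ** V)"
  unfolding cliff_def
proof (intro conjI allI unitary_mult cliff_unitary assms)
  fix p q
  obtain c p1 q1 where 1: "cmod c = 1" "\<And>\<psi>. V *v (weyl p q *v \<psi>) = c *s (weyl p1 q1 *v (V *v \<psi>))"
    using cliffE[OF assms(2)] by metis
  obtain e p2 q2 where 2: "cmod e = 1" "\<And>\<psi>. U *v (weyl p1 q1 *v \<psi>) = e *s (weyl p2 q2 *v (U *v \<psi>))"
    using cliffE[OF assms(1)] by metis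
  have "(U ** V) *v (weyl p q *v \<psi>) = (c * e) *s (weyl p2 q2 *v ((U ** V) *v \<psi>))" for \<psi>
    by (simp add: matvec_assoc 1 2 matvec_smult vector_smult_assoc)
  moreover have "cmod (c * e) = 1" by (simp add: 1 2 norm_mult)
  ultimately show "\<exists>c p' q'. cmod c = 1 \<and>
      (\<forall>\<psi>. (U ** V) *v (weyl p q *v \<psi>) = c *s (weyl p' q' *v ((U ** V) *v \<psi>)))"
    by blast
qed

lemma cliff_csc:
  assumes "cliff U" "cmod e = 1"
  shows "cliff (csc e U)"
  unfolding cliff_def
proof (intro conjI allI unitary_csc cliff_unitary assms)
  fix p q
  obtain c p1 q1 where 1: "cmod c = 1" "\<And>\<psi>. U *v (weyl p q *v \<psi>) = c *s (weyl p1 q1 *v (U *v \<psi>))"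
    using cliffE[OF assms(1)] by metis
  then show "\<exists>c p' q'. cmod c = 1 \<and>
      (\<forall>\<psi>. csc e U *v (weyl p q *v \<psi>) = c *s (weyl p' q' *v (csc e U *v \<psi>)))"
    by (intro exI[of _ c] exI[of _ p1] exI[of _ q1])
      (auto simp: csc_matvec matvec_smult vector_smult_assoc mult.commute)
qed

lemma cliff_weyl: "cliff (weyl p (q :: ('n::finite, 'p) idx))"
  unfolding cliff_def
proof (intro conjI allI unitary_weyl)
  fix p' q' :: "('n, 'p) idx"
  show "\<exists>c p'' q''. cmod c = 1 \<and>
      (\<forall>\<psi>. weyl p q *v (weyl p' q' *v \<psi>) = c *s (weyl p'' q'' *v (weyl p q *v \<psi>)))"
    using weyl_commute[of p q p' q'] cmod_omega_pow by blast
qed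

lemma cliff_mat_1: "cliff (mat 1 :: ('n::finite, 'p) idx cmat)"
  using cliff_weyl[of 0 0] by (simp add: weyl_0)

text \<open>\<open>K\<close> is the conjugated parity times the parity. Each factor inverts phase
  space, so \<open>K\<close> commutes up to scalars with all Weyl operators and is a multiple of one
  of them. Multiplying by the parity again, the conjugated parity is a multiple of a phase point
  operator, and the trace, equal to 1 on both sides, fixes the multiple.\<close>

lemma cliff_phase_op_0:
  fixes U :: "('n::finite, 'p) idx cmat"
  assumes "cliff U"
  shows "\<exists>u. U ** phase_op (0, 0) ** dagger U = phase_op u"
proof -
  note U = cliff_unitary[OF assms]
  define K where "K = U ** phase_op (0, 0) ** dagger U ** phase_op (0, 0)"
  have "\<exists>c. \<forall>\<psi>. K *v (weyl p q *v \<psi>) = c *s (weyl p q *v (K *v \<psi>))" for p q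
  proof -
    obtain c p' q' where c: "cmod c = 1"
      "\<And>\<psi>. dagger U *v (weyl p q *v \<psi>) = c *s (weyl p' q' *v (dagger U *v \<psi>))"
      using cliffE[OF cliff_dagger[OF assms]] by metis
    then have cnz: "c \<noteq> 0" by auto
    have *: "dagger U *v (weyl (-p) (-q) *v \<psi>) = inverse c *s (weyl (-p') (-q') *v (dagger U *v \<psi>))" for \<psi>
    proof -
      have "dagger U *v \<psi> = dagger U *v (weyl p q *v (weyl (-p) (-q) *v \<psi>))"
        using weyl_minus_inverse[of "-p" "-q" \<psi>] by simp
      also have "\<dots> = c *s (weyl p' q' *v (dagger U *v (weyl (-p) (-q) *v \<psi>)))" by (rule c)
      finally show ?thesis
        using cnz by (simp add: matvec_smult weyl_minus_inverse vector_smult_assoc)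
    qed
    have **: "U *v (weyl p' q' *v \<psi>) = inverse c *s (weyl p q *v (U *v \<psi>))" for \<psi>
    proof -
      have "dagger U *v (weyl p q *v (U *v \<psi>)) = c *s (weyl p' q' *v \<psi>)"
        by (simp add: c unitary_inverse[OF U])
      then have "weyl p q *v (U *v \<psi>) = c *s (U *v (weyl p' q' *v \<psi>))"
        by (metis unitary_inverse(2)[OF U] matvec_smult)
      then show ?thesis using cnz by (simp add: vector_smult_assoc)
    qed
    have "K *v (weyl p q *v \<psi>) = (inverse c * inverse c) *s (weyl p q *v (K *v \<psi>))" for \<psi>
      using phase_op_weyl[of "-p'" "-q'"]
      by (simp add: K_def matvec_assoc phase_op_weyl * ** matvec_smult vector_smult_assoc)
    then show ?thesis by blast
  qed
  then obtain c p q where K: "K = csc c (weyl p q)"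
    using weyl_of_commuting by blast
  define B where "B = U ** phase_op (0, 0) ** dagger U"
  have "B *v \<psi> = c *s (phase_op (scl hlf q, scl hlf p) *v \<psi>)" for \<psi>
  proof -
    have "B *v \<psi> = K *v (phase_op (0, 0) *v \<psi>)"
      by (simp add: K_def B_def matvec_assoc phase_op_square)
    also have "\<dots> = c *s (weyl p q *v (phase_op (0, 0) *v \<psi>))" by (simp add: K csc_matvec)
    finally show ?thesis by (simp add: weyl_phase_op dotp_simps)
  qed
  then have B: "B = csc c (phase_op (scl hlf q, scl hlf p))"
    by (simp add: matrix_eq csc_matvec)
  have "trace B = trace (phase_op (0, 0) ** dagger U ** U)"
    unfolding B_def by (metis matrix_mul_assoc trace_mul_sym)
  also have "\<dots> = 1" using U by (simp add: unitary_def matrix_mul_assoc[symmetric] trace_phase_op)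
  finally have "c = 1" by (simp add: B trace_csc trace_phase_op)
  then show ?thesis using B unfolding B_def by auto
qed

lemma weyl_phase_op_weyl:
  "weyl p q *v (phase_op u *v \<psi>) = phase_op (fst u + q, snd u + p) *v
    (weyl p (q :: ('n::finite, 'p) idx) *v \<psi>)"
proof -
  obtain q0 p0 where u: "u = (q0, p0)" by (cases u)
  have x: "q0 + q + (q0 + q) - x - q = q0 + q0 - (x - q)" for x by (simp add: algebra_simps)
  have "omega_pow (dotp p x - hlf * dotp p q) *
        (omega_pow (dotp p0 (x - q - q0) + dotp p0 (x - q - q0)) * \<psi> $ (q0 + q0 - (x - q)))
      = omega_pow (dotp (p0 + p) (x - (q0 + q)) + dotp (p0 + p) (x - (q0 + q))) *
        (omega_pow (dotp p (q0 + q + (q0 + q) - x) - hlf * dotp p q)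
          * \<psi> $ (q0 + q + (q0 + q) - x - q))" for x
    unfolding x
  proof (rule omega_mult_cong[OF _ refl])
    show "dotp p x - hlf * dotp p q + (dotp p0 (x - q - q0) + dotp p0 (x - q - q0))
      = dotp (p0 + p) (x - (q0 + q)) + dotp (p0 + p) (x - (q0 + q))
        + (dotp p (q0 + q + (q0 + q) - x) - hlf * dotp p q)"
      by (simp only: dotp_simps) (simp add: algebra_simps)
  qed
  then show ?thesis unfolding u vec_eq_iff weyl_matvec phase_op_matvec fst_conv snd_conv by blast
qed

text \<open>Every phase point operator is the parity conjugated by the Weyl operator at the same
  point, so the case of the origin suffices.\<close>

lemma cliff_phase_op:
  fixes U :: "('n::finite, 'p) idx cmat"
  assumes "cliff U"
  shows "\<exists>u'. \<forall>\<psi>. U *v (phase_op u *v \<psi>) = phase_op u' *v (U *v \<psi>)"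
proof -
  note U = cliff_unitary[OF assms]
  obtain q0 p0 where u: "u = (q0, p0)" by (cases u)
  obtain v where v: "phase_op v = U ** phase_op (0, 0) ** dagger U"
    using cliff_phase_op_0[OF assms] by metis
  have v: "U *v (phase_op (0, 0) *v \<psi>) = phase_op v *v (U *v \<psi>)" for \<psi>
    by (simp only: v matvec_assoc unitary_inverse(1)[OF U])
  obtain c p' q' where c: "cmod c = 1"
    "\<And>\<psi>. U *v (weyl p0 q0 *v \<psi>) = c *s (weyl p' q' *v (U *v \<psi>))"
    using cliffE[OF assms] by metis
  have w0: "weyl p0 q0 *v (phase_op (0, 0) *v \<psi>) = phase_op u *v (weyl p0 q0 *v \<psi>)" for \<psi>
    using weyl_phase_op_weyl[of p0 q0 "(0,0)" \<psi>] by (simp add: u)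
  have "U *v (phase_op u *v (weyl p0 q0 *v \<psi>))
      = phase_op (fst v + q', snd v + p') *v (U *v (weyl p0 q0 *v \<psi>))" for \<psi>
  proof -
    have "U *v (phase_op u *v (weyl p0 q0 *v \<psi>))
        = c *s (weyl p' q' *v (phase_op v *v (U *v \<psi>)))"
      by (simp only: w0[symmetric] c v)
    also have "\<dots> = phase_op (fst v + q', snd v + p') *v (c *s (weyl p' q' *v (U *v \<psi>)))"
      by (simp only: weyl_phase_op_weyl matvec_smult)
    finally show ?thesis by (simp only: c)
  qed
  then have "U *v (phase_op u *v \<psi>) = phase_op (fst v + q', snd v + p') *v (U *v \<psi>)" for \<psi>
    using weyl_minus_inverse[of "-p0" "-q0" \<psi>] by (metis minus_minus)
  then show ?thesis by blast
qed

end

section \<open>The projective Clifford group\<close>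

lemma proj_class_eq: "proj_class U = {csc c U | c. cmod c = 1}"
  by (simp add: proj_class_def csc_def)

lemma in_proj_class_self: "U \<in> proj_class U"
  unfolding proj_class_eq by (rule CollectI, rule exI[of _ 1]) simp

lemma proj_class_cong: "V \<in> proj_class U \<Longrightarrow> proj_class V = proj_class U"
proof -
  assume "V \<in> proj_class U"
  then obtain c where c: "cmod c = 1" "V = csc c U" by (auto simp: proj_class_eq)
  have "csc e U = csc (e * cnj c) V" "csc e V = csc (e * c) U" for e
    using c complex_norm_square[of c] by (simp_all add: csc_csc mult.assoc mult.commute[of "cnj c"])
  moreover have "cmod (e * cnj c) = 1" "cmod (e * c) = 1" if "cmod e = 1" for e
    using that c by (simp_all add: norm_mult)
  ultimately show ?thesis unfolding proj_class_eq by blast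
qed

lemma rep_unitary_proj_class: "\<exists>c. cmod c = 1 \<and> rep_unitary (proj_class U) = csc c U"
proof -
  have "rep_unitary (proj_class U) \<in> proj_class U"
    unfolding rep_unitary_def by (rule someI, rule in_proj_class_self)
  then show ?thesis by (auto simp: proj_class_eq)
qed

lemma proj_conj_proj_class:
  "proj_conj (proj_class U) (proj_class P) = proj_class (U ** P ** dagger U)"
proof -
  have *: "csc c U ** csc e P ** dagger (csc c U) = csc e (U ** P ** dagger U)" if "cmod c = 1" for c e
  proof -
    have "cnj c * (e * c) = e"
      using that complex_norm_square[of c] by (simp add: mult_ac)
    then show ?thesis by (simp only: dagger_csc csc_mult_left csc_mult_right csc_csc)
  qed
  show ?thesis
    unfolding proj_conj_def proj_class_eq using * by (auto; metis norm_one)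
qed

context odd_qudit
begin

lemma pauli_matvec: "pauli p (q :: ('n::finite, 'p) idx) *v \<psi> = omega_pow (hlf * dotp p q) *s (weyl p q *v \<psi>)"
  by (simp add: pauli_weyl csc_matvec)

lemma weyl_pauli_matvec: "weyl p (q :: ('n::finite, 'p) idx) *v \<psi> = omega_pow (- (hlf * dotp p q)) *s (pauli p q *v \<psi>)"
  by (simp add: weyl_pauli csc_matvec)

lemma cliff_iff_pauli:
  fixes U :: "('n::finite, 'p) idx cmat"
  shows "cliff U \<longleftrightarrow> unitary U \<and>
    (\<forall>p q. \<exists>p' q'. proj_class (U ** pauli p q ** dagger U) = proj_class (pauli p' q'))"
proof (intro iffI conjI allI)
  assume U: "cliff U"
  show un: "unitary U" using U by (rule cliff_unitary)
  fix p q :: "('n, 'p) idx"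
  obtain c p' q' where c: "cmod c = 1" "\<And>\<psi>. U *v (weyl p q *v \<psi>) = c *s (weyl p' q' *v (U *v \<psi>))"
    using cliffE[OF U] by metis
  have "U ** pauli p q ** dagger U
      = csc (omega_pow (hlf * dotp p q) * c * omega_pow (- (hlf * dotp p' q'))) (pauli p' q')"
    by (simp add: matrix_eq csc_matvec matvec_assoc pauli_matvec[of p q] matvec_smult c
        weyl_pauli_matvec[of p' q'] unitary_inverse[OF un] vector_smult_assoc mult_ac)
  then have "U ** pauli p q ** dagger U \<in> proj_class (pauli p' q')"
    unfolding proj_class_eq using c by (auto simp: norm_mult)
  then show "\<exists>p' q'. proj_class (U ** pauli p q ** dagger U) = proj_class (pauli p' q')"
    using proj_class_cong by blast
next
  assume A: "unitary U \<and> (\<forall>p q. \<exists>p' q'. proj_class (U ** pauli p q ** dagger U) = proj_class (pauli p' q'))"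
  then have un: "unitary U" by blast
  show "cliff U" unfolding cliff_def
  proof (intro conjI allI un)
    fix p q
    obtain p' q' where "proj_class (U ** pauli p q ** dagger U) = proj_class (pauli p' q')"
      using A by blast
    then have "U ** pauli p q ** dagger U \<in> proj_class (pauli p' q')"
      using in_proj_class_self by blast
    then obtain c where c: "cmod c = 1" "U ** pauli p q ** dagger U = csc c (pauli p' q')"
      by (auto simp: proj_class_eq)
    have "U *v (pauli p q *v \<psi>) = c *s (pauli p' q' *v (U *v \<psi>))" for \<psi>
      using arg_cong[OF c(2), of "\<lambda>A. A *v (U *v \<psi>)"]
      by (simp add: matvec_assoc csc_matvec unitary_inverse[OF un])
    then have "U *v (weyl p q *v \<psi>)
        = (omega_pow (- (hlf * dotp p q)) * c * omega_pow (hlf * dotp p' q')) *s (weyl p' q' *v (U *v \<psi>))" for \<psi>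
      by (simp add: weyl_pauli_matvec[of p q] matvec_smult pauli_matvec[of p' q'] vector_smult_assoc mult_ac)
    moreover have "cmod (omega_pow (- (hlf * dotp p q)) * c * omega_pow (hlf * dotp p' q')) = 1"
      using c by (simp add: norm_mult)
    ultimately show "\<exists>c p' q'. cmod c = 1 \<and> (\<forall>\<psi>. U *v (weyl p q *v \<psi>) = c *s (weyl p' q' *v (U *v \<psi>)))"
      by blast
  qed
qed

lemma proj_class_in_proj_clifford_iff:
  fixes U :: "('n::finite, 'p) idx cmat"
  assumes un: "unitary U"
  shows "proj_class U \<in> proj_clifford \<longleftrightarrow> cliff U"
proof
  assume "proj_class U \<in> proj_clifford"
  then have im: "proj_conj (proj_class U) ` proj_pauli = proj_pauli"
    by (simp add: proj_clifford_def)
  have "\<exists>p' q'. proj_class (U ** pauli p q ** dagger U) = proj_class (pauli p' q')" for p q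
  proof -
    have "proj_class (pauli p q) \<in> proj_pauli" by (auto simp: proj_pauli_def)
    then have "proj_conj (proj_class U) (proj_class (pauli p q)) \<in> proj_pauli"
      using im by blast
    then show ?thesis by (auto simp: proj_conj_proj_class proj_pauli_def)
  qed
  then show "cliff U" using un by (simp add: cliff_iff_pauli)
next
  assume U: "cliff U"
  have "proj_conj (proj_class U) ` proj_pauli \<subseteq> proj_pauli"
    using U by (auto simp: cliff_iff_pauli proj_conj_proj_class proj_pauli_def)
  moreover have "W \<in> proj_conj (proj_class U) ` proj_pauli" if "W \<in> proj_pauli" for W
  proof -
    obtain p q where W: "W = proj_class (pauli p q)" using \<open>W \<in> proj_pauli\<close> by (auto simp: proj_pauli_def)
    obtain p' q' where "proj_class (dagger U ** pauli p q ** U) = proj_class (pauli p' q')"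
      using cliff_dagger[OF U] by (auto simp: cliff_iff_pauli) metis
    then have "proj_conj (proj_class U) (proj_class (pauli p' q'))
        = proj_conj (proj_class U) (proj_class (dagger U ** pauli p q ** U))" by simp
    also have "\<dots> = proj_class (U ** (dagger U ** pauli p q ** U) ** dagger U)"
      by (rule proj_conj_proj_class)
    also have "U ** (dagger U ** pauli p q ** U) ** dagger U = pauli p q"
      by (simp add: matrix_eq matvec_assoc unitary_inverse[OF un])
    finally show ?thesis unfolding W proj_pauli_def by blast
  qed
  ultimately have "proj_conj (proj_class U) ` proj_pauli = proj_pauli" by blast
  then show "proj_class U \<in> proj_clifford"
    using un by (auto simp: proj_clifford_def proj_unitary_def)
qed

lemma proj_clifford_rep:
  assumes "C \<in> (proj_clifford :: ('n::finite, 'p) idx cmat set set)"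
  shows "cliff (rep_unitary C)" "proj_class (rep_unitary C) = C"
proof -
  obtain U where U: "unitary U" "C = proj_class U"
    using assms by (auto simp: proj_clifford_def proj_unitary_def)
  obtain c where c: "cmod c = 1" "rep_unitary C = csc c U"
    using rep_unitary_proj_class U by blast
  show "cliff (rep_unitary C)"
    using c U assms proj_class_in_proj_clifford_iff cliff_csc by metis
  have "rep_unitary C \<in> C" using c U by (auto simp: proj_class_eq)
  then show "proj_class (rep_unitary C) = C" using U proj_class_cong by blast
qed

text \<open>Right translation permutes the group, and the phase invariance of \<open>\<Phi>\<close>
  absorbs the arbitrary choice in \<open>rep_unitary\<close>. This is the source of the Clifford
  invariance of the branch average.\<close>

lemma sum_proj_clifford_shift:
  fixes V :: "('n::finite, 'p) idx cmat" and \<Phi> :: "('n, 'p) idx cmat \<Rightarrow> 'b::comm_monoid_add"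
  assumes V: "cliff V" and \<Phi>: "\<And>c U. cmod c = 1 \<Longrightarrow> \<Phi> (csc c U) = \<Phi> U"
  shows "(\<Sum>C\<in>proj_clifford. \<Phi> (rep_unitary C ** V)) = (\<Sum>C\<in>proj_clifford. \<Phi> (rep_unitary C))"
proof (rule sum.reindex_bij_witness[of _ "\<lambda>C. proj_class (rep_unitary C ** dagger V)"
      "\<lambda>C. proj_class (rep_unitary C ** V)"])
  have *: "proj_class (rep_unitary C ** W) \<in> proj_clifford \<and>
      proj_class (rep_unitary (proj_class (rep_unitary C ** W)) ** dagger W) = C"
    if C: "C \<in> proj_clifford" and W: "cliff W" for C and W :: "('n, 'p) idx cmat"
  proof
    have cw: "cliff (rep_unitary C ** W)" using proj_clifford_rep[OF C] W by (simp add: cliff_mult)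
    then show "proj_class (rep_unitary C ** W) \<in> proj_clifford"
      by (simp add: proj_class_in_proj_clifford_iff cliff_unitary)
    obtain c where c: "cmod c = 1"
      "rep_unitary (proj_class (rep_unitary C ** W)) = csc c (rep_unitary C ** W)"
      using rep_unitary_proj_class by blast
    have "rep_unitary (proj_class (rep_unitary C ** W)) ** dagger W = csc c (rep_unitary C)"
      using cliff_unitary[OF W] unfolding c(2)
      by (simp add: matrix_eq csc_matvec matvec_assoc unitary_inverse)
    then have "rep_unitary (proj_class (rep_unitary C ** W)) ** dagger W \<in> proj_class (rep_unitary C)"
      using c by (auto simp: proj_class_eq)
    then show "proj_class (rep_unitary (proj_class (rep_unitary C ** W)) ** dagger W) = C"
      using proj_class_cong proj_clifford_rep(2)[OF C] by blast
  qed
  fix C :: "('n, 'p) idx cmat set"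
  assume C: "C \<in> proj_clifford"
  show "proj_class (rep_unitary C ** V) \<in> proj_clifford"
    "proj_class (rep_unitary (proj_class (rep_unitary C ** V)) ** dagger V) = C"
    using *[OF C V] by auto
  show "proj_class (rep_unitary C ** dagger V) \<in> proj_clifford"
    "proj_class (rep_unitary (proj_class (rep_unitary C ** dagger V)) ** V) = C"
    using *[OF C cliff_dagger[OF V]] by auto
  show "\<Phi> (rep_unitary (proj_class (rep_unitary C ** V))) = \<Phi> (rep_unitary C ** V)"
    using rep_unitary_proj_class[of "rep_unitary C ** V"] \<Phi> by metis
qed

end

section \<open>Clifford gates\<close>

text \<open>Permutes the qudits. It is used for the transposition that carries a chosen qudit to the
  measured position.\<close>

definition perm_gate :: "('n::finite \<Rightarrow> 'n) \<Rightarrow> ('n, 'p::prime_card) idx cmat" where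
  "perm_gate \<sigma> = (\<chi> x y. if x = y \<circ> \<sigma> then 1 else 0)"

text \<open>A normalized quadratic Gauss sum of powers of a Weyl operator: a symplectic transvection.\<close>

definition quad_gate :: "'p::prime_card mod_ring \<Rightarrow> ('n::finite, 'p) idx \<Rightarrow> ('n, 'p) idx \<Rightarrow> ('n, 'p) idx cmat" where
  "quad_gate \<mu> p q = csc (1 / sqrt (real CARD('p)))
     (\<Sum>k\<in>UNIV. csc (omega_pow (\<mu> * (k * k))) (weyl (scl k p) (scl k q)))"

context odd_qudit
begin

lemma perm_gate_matvec:
  assumes "\<sigma> \<circ> \<sigma> = id"
  shows "(perm_gate \<sigma> *v (\<psi> :: ('n::finite, 'p) idx cvec)) $ x = \<psi> $ (x \<circ> \<sigma>)"
proof -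
  have *: "x = y \<circ> \<sigma> \<longleftrightarrow> y = x \<circ> \<sigma>" for y :: "('n, 'p) idx"
    using assms by (metis comp_assoc comp_id)
  show ?thesis using matvec_shift_entry[of "perm_gate \<sigma>" x "x \<circ> \<sigma>" 1 \<psi>]
    by (simp add: perm_gate_def *)
qed

lemma cliff_perm_gate:
  assumes \<sigma>: "\<sigma> \<circ> \<sigma> = id"
  shows "cliff (perm_gate \<sigma> :: ('n::finite, 'p) idx cmat)"
proof -
  have \<sigma>': "\<sigma> (\<sigma> j) = j" for j using \<sigma> by (metis comp_apply id_apply)
  then have b: "bij \<sigma>" by (metis bijI' )
  have dot: "dotp (p \<circ> \<sigma>) x = dotp p (x \<circ> \<sigma>)" for p x :: "('n, 'p) idx"
    unfolding dotp_def by (rule sum.reindex_bij_witness[of _ \<sigma> \<sigma>]) (auto simp: \<sigma>')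
  have un: "unitary (perm_gate \<sigma> :: ('n, 'p) idx cmat)"
  proof (rule unitaryI)
    fix \<psi> :: "('n, 'p) idx cvec"
    have "(\<Sum>x\<in>UNIV. (cmod ((perm_gate \<sigma> *v \<psi>) $ x))\<^sup>2) = (\<Sum>x\<in>UNIV. (cmod (\<psi> $ (x \<circ> \<sigma>)))\<^sup>2)"
      by (simp add: perm_gate_matvec[OF \<sigma>])
    also have "\<dots> = (\<Sum>x\<in>UNIV. (cmod (\<psi> $ x))\<^sup>2)"
      by (rule sum.reindex_bij_witness[of _ "\<lambda>x. x \<circ> \<sigma>" "\<lambda>x. x \<circ> \<sigma>"])
        (auto simp: comp_assoc \<sigma>)
    finally show "norm (perm_gate \<sigma> *v \<psi>) = norm \<psi>"
      by (simp add: norm_vec_def L2_set_def)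
  qed
  have "perm_gate \<sigma> *v (weyl p q *v \<psi>) = 1 *s (weyl (p \<circ> \<sigma>) (q \<circ> \<sigma>) *v (perm_gate \<sigma> *v \<psi>))"
    for p q :: "('n, 'p) idx" and \<psi>
  proof -
    have e: "(x - (q \<circ> \<sigma>)) \<circ> \<sigma> = (x \<circ> \<sigma>) - q" for x
      by (auto simp: fun_eq_iff \<sigma>')
    show ?thesis
      unfolding vec_eq_iff vector_smult_component perm_gate_matvec[OF \<sigma>] weyl_matvec e dot by (simp add: comp_assoc \<sigma>)
  qed
  then show ?thesis unfolding cliff_def using un norm_one by blast
qed

lemma matvec_sum_left: "(\<Sum>k\<in>A. B k) *v x = (\<Sum>k\<in>A. B k *v (x :: complex ^ 'i::finite))"
  by (induction A rule: infinite_finite_induct) (simp_all add: matrix_vector_mult_add_rdistrib)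

lemma smult_sum_right: "c *s (\<Sum>k\<in>A. f k) = (\<Sum>k\<in>A. c *s (f k :: complex ^ 'i::finite))"
  by (induction A rule: infinite_finite_induct) (simp_all add: vector_add_ldistrib)

lemma braket_sum_right: "braket x (\<Sum>k\<in>A. f k) = (\<Sum>k\<in>A. braket x (f k))"
  by (induction A rule: infinite_finite_induct) (simp_all add: braket_add_right)

lemma braket_sum_left: "braket (\<Sum>k\<in>A. f k) x = (\<Sum>k\<in>A. braket (f k) x)"
  by (induction A rule: infinite_finite_induct) (simp_all add: braket_add_left)

lemma quad_gate_matvec:
  "quad_gate \<mu> p q *v \<psi> = complex_of_real (1 / sqrt (real CARD('p))) *s
    (\<Sum>k\<in>UNIV. omega_pow (\<mu> * (k * k)) *s (weyl (scl k p) (scl k (q :: ('n::finite, 'p) idx)) *v \<psi>))"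
  by (simp add: quad_gate_def csc_matvec matvec_sum_left)

lemma scl_simps: "scl (k + l) x = scl k x + scl l x" "scl (k - l) x = scl k x - scl l x"
  "scl (- k) x = - scl k (x :: ('n::finite, 'p) idx)" "scl 1 x = x" "scl 0 x = 0"
  "scl k (x + y) = scl k x + scl k y" "scl k (x - y) = scl k x - scl k y" "scl k (- x) = - scl k x"
  by (simp_all add: scl_def fun_eq_iff algebra_simps)

lemma weyl_inner_weyl:
  "braket (weyl (scl k p) (scl k q) *v \<psi>) (weyl (scl l p) (scl l q) *v \<psi>)
    = braket \<psi> (weyl (scl (l - k) p) (scl (l - k) (q :: ('n::finite, 'p) idx)) *v \<psi>)"
proof -
  have "scl l p = scl k p + scl (l - k) p" "scl l q = scl k q + scl (l - k) q"
    by (simp_all add: scl_simps)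
  then have "weyl (scl l p) (scl l q) *v \<psi>
      = weyl (scl k p) (scl k q) *v (weyl (scl (l - k) p) (scl (l - k) q) *v \<psi>)"
    by (simp add: weyl_weyl symp_def dotp_simps mult_ac)
  then show ?thesis by (simp add: unitary_braket[OF unitary_weyl])
qed

text \<open>In the expanded norm, group the pairs of summands by the difference \<open>t\<close> of
  their indices. The quadratic phases leave, for each \<open>t\<close>, a full character sum over
  \<open>k\<close> with frequency \<open>(\<mu> + \<mu>) * t\<close>, so only \<open>t = 0\<close>
  survives.\<close>

lemma unitary_quad_gate:
  assumes "\<mu> \<noteq> 0"
  shows "unitary (quad_gate \<mu> p (q :: ('n::finite, 'p) idx))"
proof (rule unitaryI)
  fix \<psi> :: "('n, 'p) idx cvec"
  define g where "g t = braket \<psi> (weyl (scl t p) (scl t q) *v \<psi>)" for t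
  define v where "v = (\<Sum>k\<in>UNIV. omega_pow (\<mu> * (k * k)) *s (weyl (scl k p) (scl k q) *v \<psi>))"
  have mu2: "\<mu> + \<mu> \<noteq> 0" using assms double_inject[of \<mu> 0] by simp
  have "braket v v = (\<Sum>k\<in>UNIV. \<Sum>l\<in>UNIV. omega_pow (\<mu> * (l * l) - \<mu> * (k * k)) * g (l - k))"
    unfolding v_def braket_sum_left braket_sum_right braket_smult_left braket_smult_right
      weyl_inner_weyl g_def cnj_omega_pow
    by (simp add: omega_pow_diff omega_pow_minus divide_simps sum_distrib_left, subst sum.swap, rule refl)
  also have "\<dots> = (\<Sum>k\<in>UNIV. \<Sum>t\<in>UNIV. omega_pow (\<mu> * ((t + k) * (t + k)) - \<mu> * (k * k)) * g (t + k - k))"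
    by (rule sum.cong[OF refl], rule sum_shift[symmetric])
  also have "\<dots> = (\<Sum>k\<in>UNIV. \<Sum>t\<in>UNIV. (omega_pow (\<mu> * (t * t)) * g t) * omega_pow (((\<mu> + \<mu>) * t) * k))"
  proof (intro sum.cong refl)
    fix k t
    have "\<mu> * ((t + k) * (t + k)) - \<mu> * (k * k) = \<mu> * (t * t) + ((\<mu> + \<mu>) * t) * k"
      by (simp add: algebra_simps)
    then have "omega_pow (\<mu> * ((t + k) * (t + k)) - \<mu> * (k * k))
        = omega_pow (\<mu> * (t * t)) * omega_pow (((\<mu> + \<mu>) * t) * k)"
      by (simp only: omega_pow_add)
    then show "omega_pow (\<mu> * ((t + k) * (t + k)) - \<mu> * (k * k)) * g (t + k - k)
        = (omega_pow (\<mu> * (t * t)) * g t) * omega_pow (((\<mu> + \<mu>) * t) * k)"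
      by (simp only: add_diff_cancel_right' mult_ac)
  qed
  also have "\<dots> = (\<Sum>t\<in>UNIV. (omega_pow (\<mu> * (t * t)) * g t) * (\<Sum>k\<in>UNIV. omega_pow (((\<mu> + \<mu>) * t) * k)))"
    unfolding sum_distrib_left by (rule sum.swap)
  also have "\<dots> = (\<Sum>t\<in>UNIV. if t = (0 :: 'p mod_ring) then of_nat CARD('p) * braket \<psi> \<psi> else 0)"
    unfolding sum_omega_pow using mu2
    by (intro sum.cong refl) (auto simp: g_def scl_simps weyl_0 simp del: mult_2 mult_2_right)
  also have "\<dots> = of_nat CARD('p) * braket \<psi> \<psi>" by simp
  finally have "complex_of_real ((norm v)\<^sup>2) = complex_of_real (real CARD('p) * (norm \<psi>)\<^sup>2)"
    by (simp add: braket_self)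
  then have "(norm v)\<^sup>2 = real CARD('p) * (norm \<psi>)\<^sup>2" by (simp only: of_real_eq_iff)
  then have "(norm (quad_gate \<mu> p q *v \<psi>))\<^sup>2 = (norm \<psi>)\<^sup>2"
    unfolding quad_gate_matvec v_def[symmetric] norm_smult power_mult_distrib
    by (simp add: power_divide real_sqrt_pow2 norm_divide)
  then show "norm (quad_gate \<mu> p q *v \<psi>) = norm \<psi>"
    by (simp add: power2_eq_iff_nonneg)
qed

text \<open>Moving \<open>weyl p' q'\<close> from one side of the \<open>k\<close>-th summand to the
  other changes its phase by a term linear in \<open>k\<close>. Shifting the summation index by
  \<open>c\<close> changes the quadratic phase by a linear term too, and the hypothesis on
  \<open>c\<close> makes the two cancel.\<close>

lemma quad_gate_weyl:
  fixes p q p' q' :: "('n::finite, 'p) idx"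
  assumes c: "symp p q p' q' = - ((\<mu> + \<mu>) * c)"
  shows "\<exists>e :: 'p mod_ring. \<forall>\<psi>. quad_gate \<mu> p q *v (weyl p' q' *v \<psi>)
    = omega_pow e *s (weyl (p' + scl c p) (q' + scl c q) *v (quad_gate \<mu> p q *v \<psi>))"
proof -
  define s where "s = symp p q p' q'"
  define e where "e = - (\<mu> * (c * c)) - hlf * (c * s)"
  have "quad_gate \<mu> p q *v (weyl p' q' *v \<psi>)
    = omega_pow e *s (weyl (p' + scl c p) (q' + scl c q) *v (quad_gate \<mu> p q *v \<psi>))" for \<psi>
  proof -
  define W where "W k = weyl (scl k p + p') (scl k q + q') *v \<psi>" for k
  have L: "omega_pow (\<mu> * (k * k)) *s (weyl (scl k p) (scl k q) *v (weyl p' q' *v \<psi>))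
      = omega_pow (\<mu> * (k * k) + hlf * (k * s)) *s W k" for k
    by (simp add: weyl_weyl vector_smult_assoc omega_pow_add[symmetric] W_def symp_def dotp_simps s_def algebra_simps)
  have R: "omega_pow (\<mu> * (k * k)) *s (weyl (p' + scl c p) (q' + scl c q) *v (weyl (scl k p) (scl k q) *v \<psi>))
      = omega_pow (\<mu> * (k * k) - hlf * (k * s)) *s W (k + c)" for k
  proof -
    have "symp (p' + scl c p) (q' + scl c q) (scl k p) (scl k q) = - (k * s)"
      by (simp add: symp_def s_def dotp_simps algebra_simps)
    note sy = this
    have pq: "p' + scl c p + scl k p = scl (k + c) p + p'" "q' + scl c q + scl k q = scl (k + c) q + q'"
      by (simp_all add: scl_simps)
    show ?thesis
      unfolding weyl_weyl sy pq vector_smult_assoc W_def omega_pow_add[symmetric] by simp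
  qed
  have "(\<Sum>k\<in>UNIV. omega_pow (\<mu> * (k * k) + hlf * (k * s)) *s W k)
      = (\<Sum>k\<in>UNIV. omega_pow (\<mu> * ((k + c) * (k + c)) + hlf * ((k + c) * s)) *s W (k + c))"
    by (rule sum_shift[symmetric])
  also have "\<dots> = (\<Sum>k\<in>UNIV. omega_pow e *s (omega_pow (\<mu> * (k * k) - hlf * (k * s)) *s W (k + c)))"
  proof (intro sum.cong refl)
    fix k
    have s: "s = - (\<mu> * c) - \<mu> * c" using c by (simp add: s_def algebra_simps)
    have ks: "k * s = hlf * (k * s) + hlf * (k * s)" "c * s = hlf * (c * s) + hlf * (c * s)"
      by (simp_all only: hlf_double)
    have "k * s = - (\<mu> * (k * c)) - \<mu> * (k * c)" "c * s = - (\<mu> * (c * c)) - \<mu> * (c * c)"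
      unfolding s by (simp_all add: algebra_simps)
    then have "\<mu> * ((k + c) * (k + c)) + hlf * ((k + c) * s)
        - (e + (\<mu> * (k * k) - hlf * (k * s))) = (\<mu> * (k * c) + \<mu> * (k * c) + (hlf * (k * s) + hlf * (k * s)))
         + (\<mu> * (c * c) + \<mu> * (c * c) + (hlf * (c * s) + hlf * (c * s)))"
      by (simp only: e_def) (simp add: algebra_simps)
    also have "\<dots> = 0"
      unfolding hlf_double unfolding s by (simp add: algebra_simps)
    finally have "\<mu> * ((k + c) * (k + c)) + hlf * ((k + c) * s)
        = e + (\<mu> * (k * k) - hlf * (k * s))" by simp
    then show "omega_pow (\<mu> * ((k + c) * (k + c)) + hlf * ((k + c) * s)) *s W (k + c)
        = omega_pow e *s (omega_pow (\<mu> * (k * k) - hlf * (k * s)) *s W (k + c))"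
      by (simp only: vector_smult_assoc omega_pow_add)
  qed
  finally have eq: "(\<Sum>k\<in>UNIV. omega_pow (\<mu> * (k * k) + hlf * (k * s)) *s W k)
    = omega_pow e *s (\<Sum>k\<in>UNIV. omega_pow (\<mu> * (k * k) - hlf * (k * s)) *s W (k + c))"
    by (simp only: smult_sum_right)
  have sum_mv: "A *v (\<Sum>k\<in>UNIV. f k) = (\<Sum>k\<in>UNIV. A *v f k)"
    for A :: "('n, 'p) idx cmat" and f :: "'p mod_ring \<Rightarrow> _"
    by (rule linear_sum[OF bounded_linear.linear[OF bounded_linear_matvec]])
  show "quad_gate \<mu> p q *v (weyl p' q' *v \<psi>)
    = omega_pow e *s (weyl (p' + scl c p) (q' + scl c q) *v (quad_gate \<mu> p q *v \<psi>))"
    unfolding quad_gate_matvec matvec_smult sum_mv L R eq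
    by (simp add: vector_smult_assoc mult.commute)
  qed
  note main = this
  show ?thesis by (rule exI[of _ e], rule allI, rule main)
qed

lemma cliff_quad_gate:
  assumes "\<mu> \<noteq> 0"
  shows "cliff (quad_gate \<mu> p (q :: ('n::finite, 'p) idx))"
  unfolding cliff_def
proof (intro conjI allI unitary_quad_gate assms)
  fix p' q' :: "('n, 'p) idx"
  have "\<mu> + \<mu> \<noteq> 0" using assms double_inject[of \<mu> 0] by simp
  then have "symp p q p' q' = - ((\<mu> + \<mu>) * (- symp p q p' q' / (\<mu> + \<mu>)))"
    by (simp only: times_divide_eq_right nonzero_mult_div_cancel_left minus_minus simp_thms)
  then show "\<exists>c p'' q''. cmod c = 1 \<and>
      (\<forall>\<psi>. quad_gate \<mu> p q *v (weyl p' q' *v \<psi>) = c *s (weyl p'' q'' *v (quad_gate \<mu> p q *v \<psi>)))"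
    using quad_gate_weyl cmod_omega_pow by blast
qed

end

section \<open>Stabilizer vectors\<close>

definition stab_vec :: "('n::finite, 'p::prime_card) idx cvec \<Rightarrow> bool" where
  "stab_vec \<phi> \<longleftrightarrow> (\<exists>U. cliff U \<and> \<phi> = U *v axis (\<lambda>_. 0) 1)"

definition meas :: "'n::finite \<Rightarrow> 'p::prime_card mod_ring \<Rightarrow> ('n, 'p) idx cmat" where
  "meas q1 m = on_qudit q1 (basis_proj m)"

lemma norm_axis_1 [simp]: "norm (axis i (1 :: complex)) = 1"
proof -
  have "complex_of_real ((norm (axis i (1 :: complex)))\<^sup>2) = 1"
    unfolding braket_self[symmetric] braket_axis_left by simp
  then have "(norm (axis i (1 :: complex)))\<^sup>2 = 1" by (simp only: of_real_eq_1_iff)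
  then show ?thesis by (simp add: power2_eq_1_iff)
qed

lemma smult_eq_imp: "c *s x = y \<Longrightarrow> c \<noteq> 0 \<Longrightarrow> x = inverse c *s (y :: complex ^ 'i)"
  by (auto simp: vector_smult_assoc)

lemma smult_phase_ray:
  assumes "c \<noteq> 0"
  shows "ray (c *s y) = ray y"
proof -
  have "(1 / norm (c *s y)) *\<^sub>R (c *s y) = (c / cmod c) *s ((1 / norm y) *\<^sub>R y)"
    by (simp add: scaleR_eq_smult norm_smult vector_smult_assoc)
  moreover have "cmod (c / cmod c) = 1" using assms by (simp add: norm_divide)
  ultimately show ?thesis unfolding ray_def by (simp only: outer_phase)
qed

lemma ray_unit: "norm y = 1 \<Longrightarrow> ray y = outer y"
  by (simp add: ray_def)

lemma rays_rep_vec: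
  assumes "\<rho> \<in> rays"
  shows "norm (rep_vec \<rho>) = 1" "outer (rep_vec \<rho>) = \<rho>"
proof -
  have "\<exists>\<psi>. norm \<psi> = 1 \<and> outer \<psi> = \<rho>" using assms by (auto simp: rays_def)
  then have "norm (rep_vec \<rho>) = 1 \<and> outer (rep_vec \<rho>) = \<rho>"
    unfolding rep_vec_def by (rule someI_ex)
  then show "norm (rep_vec \<rho>) = 1" "outer (rep_vec \<rho>) = \<rho>" by auto
qed

lemma outer_in_rays: "norm y = 1 \<Longrightarrow> outer y \<in> rays"
  by (auto simp: rays_def)

lemma ray_in_rays: "y \<noteq> 0 \<Longrightarrow> ray y \<in> rays"
  unfolding ray_def by (rule outer_in_rays) simp

lemma rep_vec_outer:
  assumes "norm y = 1"
  obtains c where "cmod c = 1" "rep_vec (outer y) = c *s y"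
  using outer_eq_imp_phase[of "rep_vec (outer y)" y] rays_rep_vec[OF outer_in_rays[OF assms]] assms
  by metis

lemma rep_vec_ray:
  assumes "y \<noteq> 0"
  obtains c where "c \<noteq> 0" "rep_vec (ray y) = c *s y" "cmod c = 1 / norm y"
proof -
  have "norm ((1 / norm y) *\<^sub>R y) = 1" using assms by simp
  then obtain c where "cmod c = 1" "rep_vec (ray y) = c *s ((1 / norm y) *\<^sub>R y)"
    unfolding ray_def using rep_vec_outer by metis
  then show ?thesis
    using assms by (intro that[of "c * of_real (1 / norm y)"])
      (auto simp: scaleR_eq_smult vector_smult_assoc norm_mult norm_divide)
qed

lemma on_qudit_entry:
  "on_qudit q1 B $ x $ y = (if \<forall>j. j \<noteq> q1 \<longrightarrow> x j = y j then B $ x q1 $ (y q1) else 0)"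
proof -
  have "on_qudit q1 B $ x $ y
      = (\<Prod>j\<in>UNIV. ((\<lambda>_. mat 1)(q1 := B)) j $ x j $ y j)"
    by (simp add: on_qudit_def tensor_def)
  also have "\<dots> = B $ x q1 $ y q1 * (\<Prod>j\<in>UNIV - {q1}. if x j = y j then 1 else 0)"
    by (subst prod.remove[of _ q1]) (auto simp: mat_def intro!: prod.cong)
  also have "(\<Prod>j\<in>UNIV - {q1}. if x j = y j then 1 else (0::complex))
      = (if \<forall>j. j \<noteq> q1 \<longrightarrow> x j = y j then 1 else 0)"
    by (auto intro!: prod_zero)
  finally have *: "on_qudit q1 B $ x $ y
      = B $ x q1 $ y q1 * (if \<forall>j. j \<noteq> q1 \<longrightarrow> x j = y j then 1 else 0)" .
  define P where "P \<longleftrightarrow> (\<forall>j. j \<noteq> q1 \<longrightarrow> x j = y j)"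
  show ?thesis using * unfolding P_def[symmetric] by (cases P) simp_all
qed

context odd_qudit
begin

lemma stab_vec_norm: "stab_vec (\<phi> :: ('n::finite, 'p) idx cvec) \<Longrightarrow> norm \<phi> = 1"
  by (auto simp: stab_vec_def unitary_norm[OF cliff_unitary])

lemma stab_vec_cliff: "stab_vec \<phi> \<Longrightarrow> cliff U \<Longrightarrow> stab_vec (U *v (\<phi> :: ('n::finite, 'p) idx cvec))"
  unfolding stab_vec_def by (metis cliff_mult matvec_assoc)

lemma stab_vec_phase: "stab_vec \<phi> \<Longrightarrow> cmod c = 1 \<Longrightarrow> stab_vec (c *s (\<phi> :: ('n::finite, 'p) idx cvec))"
  unfolding stab_vec_def by (metis cliff_csc csc_matvec)

lemma stab_vec_axis: "stab_vec (axis x 1 :: ('n::finite, 'p) idx cvec)"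
proof -
  have "weyl 0 x *v axis (\<lambda>_. 0) 1 = (axis x 1 :: ('n, 'p) idx cvec)"
    by (auto simp: vec_eq_iff weyl_matvec axis_def dotp_simps fun_eq_iff)
  then show ?thesis unfolding stab_vec_def using cliff_weyl by metis
qed

lemma stabilizer_states_eq:
  "(stabilizer_states :: ('n::finite, 'p) idx cmat set) = {outer \<phi> | \<phi>. stab_vec \<phi>}"
proof (intro equalityI subsetI)
  fix s :: "('n, 'p) idx cmat"
  assume "s \<in> stabilizer_states"
  then obtain C where C: "C \<in> proj_clifford" "s = ray (rep_unitary C *v axis (\<lambda>_. 0) 1)"
    by (auto simp: stabilizer_states_def)
  have "stab_vec (rep_unitary C *v axis (\<lambda>_. 0) 1)"
    using proj_clifford_rep[OF C(1)] by (auto simp: stab_vec_def)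
  then show "s \<in> {outer \<phi> | \<phi>. stab_vec \<phi>}" using C by (auto simp: ray_unit stab_vec_norm)
next
  fix s :: "('n, 'p) idx cmat"
  assume "s \<in> {outer \<phi> | \<phi>. stab_vec \<phi>}"
  then obtain U where U: "cliff U" "s = outer (U *v axis (\<lambda>_. 0) 1)"
    by (auto simp: stab_vec_def)
  obtain c where c: "cmod c = 1" "rep_unitary (proj_class U) = csc c U"
    using rep_unitary_proj_class by blast
  have "ray (rep_unitary (proj_class U) *v axis (\<lambda>_. 0) 1) = s"
    using c by (simp add: U ray_unit csc_matvec norm_smult unitary_norm[OF cliff_unitary[OF U(1)]]
        outer_phase)
  moreover have "proj_class U \<in> proj_clifford"
    using U by (simp add: proj_class_in_proj_clifford_iff cliff_unitary)
  ultimately show "s \<in> stabilizer_states" unfolding stabilizer_states_def by blast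
qed

lemma stabilizer_states_rays: "(stabilizer_states :: ('n::finite, 'p) idx cmat set) \<subseteq> rays"
  by (auto simp: stabilizer_states_eq outer_in_rays stab_vec_norm)

lemma stab_vec_rep_vec:
  assumes "s \<in> (stabilizer_states :: ('n::finite, 'p) idx cmat set)"
  shows "stab_vec (rep_vec s)"
proof -
  obtain \<phi> where \<phi>: "stab_vec \<phi>" "s = outer \<phi>" using assms by (auto simp: stabilizer_states_eq)
  obtain c where "cmod c = 1" "rep_vec (outer \<phi>) = c *s \<phi>"
    using rep_vec_outer stab_vec_norm[OF \<phi>(1)] by blast
  then show ?thesis using \<phi> by (simp add: stab_vec_phase)
qed

lemma ray_stab_vec: "stab_vec \<phi> \<Longrightarrow> c \<noteq> 0 \<Longrightarrow> ray (c *s \<phi>) \<in> (stabilizer_states :: ('n::finite, 'p) idx cmat set)"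
  by (auto simp: smult_phase_ray ray_unit stab_vec_norm stabilizer_states_eq)

section \<open>Measuring a qudit of a stabilizer state\<close>

lemma meas_matvec: "(meas q1 m *v (\<psi> :: ('n::finite, 'p) idx cvec)) $ x = (if x q1 = m then \<psi> $ x else 0)"
proof -
  have "(meas q1 m *v \<psi>) $ x = (if x q1 = m then 1 else 0) * \<psi> $ x"
  proof (rule matvec_shift_entry)
    fix y
    have "(\<forall>j. j \<noteq> q1 \<longrightarrow> x j = y j) \<and> x q1 = y q1 \<longleftrightarrow> y = x"
      unfolding fun_eq_iff by metis
    then show "meas q1 m $ x $ y = (if y = x then if x q1 = m then 1 else 0 else 0)"
      unfolding meas_def on_qudit_entry basis_proj_def by auto
  qed
  then show ?thesis by simp
qed

lemma norm_meas_sum: "(\<Sum>m\<in>UNIV. (norm (meas q1 m *v (\<psi> :: ('n::finite, 'p) idx cvec)))\<^sup>2) = (norm \<psi>)\<^sup>2"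
proof -
  have sq: "(norm v)\<^sup>2 = (\<Sum>x\<in>UNIV. (cmod (v $ x))\<^sup>2)" for v :: "('n, 'p) idx cvec"
    by (simp add: norm_vec_def L2_set_def sum_nonneg)
  have "(\<Sum>m\<in>UNIV. (norm (meas q1 m *v \<psi>))\<^sup>2)
      = (\<Sum>x\<in>UNIV. \<Sum>m\<in>UNIV. (cmod ((meas q1 m *v \<psi>) $ x))\<^sup>2)"
    unfolding sq by (rule sum.swap)
  also have "\<dots> = (\<Sum>x\<in>UNIV. (cmod (\<psi> $ x))\<^sup>2)"
  proof (rule sum.cong[OF refl])
    fix x
    have "(\<Sum>m\<in>UNIV. (cmod ((meas q1 m *v \<psi>) $ x))\<^sup>2) = (\<Sum>m\<in>UNIV. if x q1 = m then (cmod (\<psi> $ x))\<^sup>2 else 0)"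
      by (rule sum.cong) (auto simp: meas_matvec)
    then show "(\<Sum>m\<in>UNIV. (cmod ((meas q1 m *v \<psi>) $ x))\<^sup>2) = (cmod (\<psi> $ x))\<^sup>2" by simp
  qed
  finally show ?thesis by (simp add: sq)
qed

lemma weyl_unit_idx_matvec:
  "(weyl (scl k (unit_idx q1)) 0 *v (\<psi> :: ('n::finite, 'p) idx cvec)) $ x = omega_pow (k * x q1) * \<psi> $ x"
  by (simp add: weyl_matvec dotp_simps dotp_unit_idx)

text \<open>At every \<open>x\<close> in the support of \<open>\<psi>\<close> the eigenvalue equals
  \<open>omega_pow (x q1)\<close>. As \<open>omega_pow\<close> is injective, the support has a
  single value in the measured coordinate.\<close>

lemma meas_of_eigenvector:
  fixes \<psi> :: "('n::finite, 'p) idx cvec"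
  assumes "weyl (unit_idx q1) 0 *v \<psi> = \<zeta> *s \<psi>" "\<psi> \<noteq> 0"
  shows "\<exists>m. \<forall>m'. meas q1 m' *v \<psi> = (if m' = m then \<psi> else 0)"
proof -
  have e: "omega_pow (x q1) * \<psi> $ x = \<zeta> * \<psi> $ x" for x
    using arg_cong[OF assms(1), of "\<lambda>v. v $ x"] weyl_unit_idx_matvec[of 1 q1 \<psi> x] by (auto simp: scl_simps)
  obtain y where y: "\<psi> $ y \<noteq> 0" using assms(2) by (auto simp: vec_eq_iff)
  have "x q1 = y q1" if "\<psi> $ x \<noteq> 0" for x
    using e[of x] e[of y] that y by (simp add: omega_pow_inject[symmetric])
  then have "meas q1 m' *v \<psi> = (if m' = y q1 then \<psi> else 0)" for m'
    by (auto simp: vec_eq_iff meas_matvec)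
  then show ?thesis by blast
qed

lemma meas_weyl:
  "meas q1 m *v (weyl p q *v (\<psi> :: ('n::finite, 'p) idx cvec)) = weyl p q *v (meas q1 (m - q q1) *v \<psi>)"
  by (auto simp: vec_eq_iff meas_matvec weyl_matvec)

text \<open>Every field element is a natural multiple of 1, so the scaled Weyl operator is a power
  of the original one.\<close>

lemma weyl_power_eigenvector:
  fixes \<phi> :: "('n::finite, 'p) idx cvec"
  assumes "weyl p q *v \<phi> = \<gamma> *s \<phi>" "\<gamma> \<noteq> 0"
  shows "\<exists>c. c \<noteq> 0 \<and> weyl (scl k p) (scl k q) *v \<phi> = c *s \<phi>"
proof -
  have "weyl (scl (of_nat n) p) (scl (of_nat n) q) *v \<phi> = \<gamma> ^ n *s \<phi>" for n
  proof (induction n)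
    case 0
    then show ?case by (simp add: scl_simps weyl_0 weyl_0[unfolded zero_fun_def])
  next
    case (Suc n)
    have "weyl (scl (of_nat (Suc n)) p) (scl (of_nat (Suc n)) q) *v \<phi>
        = weyl (scl (of_nat n) p) (scl (of_nat n) q) *v (weyl p q *v \<phi>)"
      by (simp add: weyl_weyl symp_def dotp_simps scl_simps mult.commute add.commute)
    then show ?case
      unfolding assms(1) matvec_smult Suc.IH by (simp add: vector_smult_assoc)
  qed
  moreover obtain n where "k = of_nat n" using surj_of_nat_mod_ring by blast
  ultimately show ?thesis using assms(2) by (metis power_not_zero)
qed

text \<open>The case in which the measured \<open>Z\<close> commutes with the whole stabilizer group
  of \<open>\<phi>\<close>. Then \<open>w\<close>, the vector \<open>Z \<phi>\<close> pulled back by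
  \<open>B\<close>, is fixed by all diagonal Weyl operators and hence a multiple of the zero basis
  vector. So \<open>\<phi>\<close> is an eigenvector of \<open>Z\<close> and the outcome is
  certain.\<close>

lemma meas_stab_vec_commuting:
  fixes B :: "('n::finite, 'p) idx cmat"
  assumes B: "cliff B" and \<phi>: "\<phi> = B *v axis (\<lambda>_. 0) 1"
    and comm: "\<And>p c p' q'. cmod c = 1 \<Longrightarrow> (\<And>\<psi>. B *v (weyl p 0 *v \<psi>) = c *s (weyl p' q' *v (B *v \<psi>))) \<Longrightarrow> q' q1 = 0"
  shows "\<exists>m. \<forall>m'. meas q1 m' *v \<phi> = (if m' = m then \<phi> else 0)"
proof -
  let ?e = "axis (\<lambda>_. 0) 1 :: ('n, 'p) idx cvec"
  let ?Z = "weyl (unit_idx q1) 0 :: ('n, 'p) idx cmat"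
  note un = cliff_unitary[OF B]
  define w where "w = dagger B *v (?Z *v \<phi>)"
  have e: "weyl p 0 *v ?e = ?e" for p
    by (auto simp: vec_eq_iff weyl_matvec axis_def dotp_simps dotp_def)
  have "weyl p 0 *v w = w" for p
  proof -
    obtain c p' q' where c: "cmod c = 1" "\<And>\<psi>. B *v (weyl p 0 *v \<psi>) = c *s (weyl p' q' *v (B *v \<psi>))"
      using cliffE[OF B] by metis
    have q': "q' q1 = 0" using comm[OF c] .
    have "B *v (weyl p 0 *v w) = c *s (weyl p' q' *v (?Z *v \<phi>))"
      by (simp add: c w_def unitary_inverse[OF un])
    also have "weyl p' q' *v (?Z *v \<phi>) = ?Z *v (weyl p' q' *v \<phi>)"
      by (subst weyl_commute) (simp add: symp_def dotp_simps dotp_unit_idx q')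
    also have "c *s (?Z *v (weyl p' q' *v \<phi>)) = ?Z *v (B *v (weyl p 0 *v ?e))"
      by (simp add: c \<phi> matvec_smult)
    also have "\<dots> = B *v w" by (simp add: e w_def \<phi>[symmetric] unitary_inverse[OF un])
    finally show ?thesis by (metis unitary_inverse(1)[OF un])
  qed
  then have "omega_pow (dotp p x) * w $ x = w $ x" for p x
    using weyl_matvec[of p 0 w x] by (simp add: dotp_simps)
  then have *: "x = 0" if "w $ x \<noteq> 0" for x
    using that idx_eqI_omega[of x 0] by (auto simp: dotp_simps)
  have "w = w $ 0 *s ?e"
    using * by (auto simp: vec_eq_iff axis_def zero_fun_def)
  then have "B *v w = w $ 0 *s \<phi>" using \<phi> matvec_smult by metis
  then have "?Z *v \<phi> = w $ 0 *s \<phi>" by (simp add: w_def unitary_inverse[OF un])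
  moreover have "\<phi> \<noteq> 0" using \<phi> unitary_norm[OF un, of ?e] by auto
  ultimately show ?thesis by (rule meas_of_eigenvector)
qed

text \<open>If a Weyl operator \<open>T v\<close> with \<open>T v \<phi> \<propto> \<phi>\<close> does not commute with the measured \<open>Z\<close>, the
  transvection along \<open>z - v\<close> turns \<open>T v\<close> into \<open>Z\<close>; applied to \<open>\<phi>\<close> it is a polynomial in \<open>Z\<close>.\<close>

lemma meas_stab_vec_noncommuting:
  fixes \<phi> :: "('n::finite, 'p) idx cvec"
  assumes \<phi>: "stab_vec \<phi>" and v: "weyl p q *v \<phi> = \<gamma> *s \<phi>" "\<gamma> \<noteq> 0" and q: "q q1 \<noteq> 0"
  shows "\<exists>c \<phi>'. stab_vec \<phi>' \<and> meas q1 m *v \<phi> = c *s \<phi>'"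
proof -
  let ?z = "unit_idx q1 :: ('n, 'p) idx"
  \<comment> \<open>Chosen so that the transvection adds its direction to the point of
    \<open>T v\<close> with coefficient exactly 1.\<close>
  define \<mu> where "\<mu> = - (hlf * q q1)"
  have mu2: "\<mu> + \<mu> = - q q1"
    using hlf_double[of "q q1"] by (simp add: \<mu>_def)
  have mu: "\<mu> \<noteq> 0" using mu2 q by auto
  define V where "V = quad_gate \<mu> (?z - p) (- q)"
  have V: "cliff V" unfolding V_def using mu by (rule cliff_quad_gate)
  have "symp (?z - p) (- q) p q = - ((\<mu> + \<mu>) * 1)"
    unfolding mu2 by (simp add: symp_def dotp_simps dotp_unit_idx dotp_commute)
  from quad_gate_weyl[OF this] obtain e :: "'p mod_ring" where
    "\<forall>\<psi>. quad_gate \<mu> (?z - p) (- q) *v (weyl p q *v \<psi>) = omega_pow e *s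
      (weyl (p + scl 1 (?z - p)) (q + scl 1 (- q)) *v (quad_gate \<mu> (?z - p) (- q) *v \<psi>))" by blast
  then have e: "V *v (weyl p q *v \<psi>) = omega_pow e *s (weyl ?z 0 *v (V *v \<psi>))" for \<psi>
    by (simp add: V_def scl_simps)
  have "omega_pow (- e) *s (\<gamma> *s (V *v \<phi>)) = omega_pow (- e) *s (omega_pow e *s (weyl ?z 0 *v (V *v \<phi>)))"
    using e[of \<phi>] unfolding v matvec_smult by simp
  then have "weyl ?z 0 *v (V *v \<phi>) = (omega_pow (- e) * \<gamma>) *s (V *v \<phi>)"
    by (simp add: vector_smult_assoc omega_pow_minus)
  moreover have V\<phi>: "stab_vec (V *v \<phi>)" using \<phi> V by (rule stab_vec_cliff)
  then have Vnz: "V *v \<phi> \<noteq> 0" using stab_vec_norm by force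
  ultimately obtain m' where m': "meas q1 m' *v (V *v \<phi>) = V *v \<phi>"
    using meas_of_eigenvector by metis
  \<comment> \<open>The \<open>k\<close>-th summand of the gate is, up to a phase, \<open>Z\<close>
    to the power \<open>k\<close> times a power of \<open>T v\<close>. The latter acts on
    \<open>\<phi>\<close> as a scalar, and on a fixed outcome the former is a scalar as
    well.\<close>
  have expand: "\<exists>c. meas q1 m' *v (weyl (scl k (?z - p)) (scl k (- q)) *v \<phi>) = c *s (meas q1 m' *v \<phi>)" for k
  proof -
    obtain c where c: "weyl (scl (- k) p) (scl (- k) q) *v \<phi> = c *s \<phi>"
      using weyl_power_eigenvector[OF v] by metis
    have dec: "scl k (?z - p) = scl k ?z + scl (- k) p" "scl k (- q) = 0 + scl (- k) q"
      by (simp_all add: scl_simps)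
    define s where "s = symp (scl k ?z) 0 (scl (- k) p) (scl (- k) q)"
    have "omega_pow (hlf * s) *s (weyl (scl k (?z - p)) (scl k (- q)) *v \<phi>)
        = weyl (scl k ?z) 0 *v (weyl (scl (- k) p) (scl (- k) q) *v \<phi>)"
      unfolding dec weyl_weyl s_def ..
    also have "\<dots> = c *s (weyl (scl k ?z) 0 *v \<phi>)" by (simp add: c matvec_smult)
    finally have "omega_pow (- (hlf * s)) *s (omega_pow (hlf * s) *s (weyl (scl k (?z - p)) (scl k (- q)) *v \<phi>))
        = omega_pow (- (hlf * s)) *s (c *s (weyl (scl k ?z) 0 *v \<phi>))" by simp
    then have "weyl (scl k (?z - p)) (scl k (- q)) *v \<phi> = (omega_pow (- (hlf * s)) * c) *s (weyl (scl k ?z) 0 *v \<phi>)"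
      by (simp add: vector_smult_assoc omega_pow_minus)
    moreover have "meas q1 m' *v (weyl (scl k ?z) 0 *v \<phi>) = omega_pow (k * m') *s (meas q1 m' *v \<phi>)"
      by (auto simp: vec_eq_iff meas_matvec weyl_unit_idx_matvec)
    ultimately show ?thesis by (auto simp: matvec_smult vector_smult_assoc)
  qed
  then obtain g where g: "\<And>k. meas q1 m' *v (weyl (scl k (?z - p)) (scl k (- q)) *v \<phi>) = g k *s (meas q1 m' *v \<phi>)"
    by metis
  have sum_mv: "A *v (\<Sum>k\<in>UNIV. f k) = (\<Sum>k\<in>UNIV. A *v f k)"
    for A :: "('n, 'p) idx cmat" and f :: "'p mod_ring \<Rightarrow> _"
    by (rule linear_sum[OF bounded_linear.linear[OF bounded_linear_matvec]])
  have sum_sm: "(\<Sum>k\<in>UNIV. f k *s x) = (\<Sum>k\<in>UNIV. f k) *s x" for f :: "'p mod_ring \<Rightarrow> complex" and x :: "('n, 'p) idx cvec"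
    by (simp add: vec_eq_iff sum_distrib_right)
  define G where "G = complex_of_real (1 / sqrt (real CARD('p))) * (\<Sum>k\<in>UNIV. omega_pow (\<mu> * (k * k)) * g k)"
  have "V *v \<phi> = meas q1 m' *v (V *v \<phi>)" by (simp only: m')
  also have "\<dots> = G *s (meas q1 m' *v \<phi>)"
    unfolding V_def quad_gate_matvec
    by (simp add: matvec_smult sum_mv g vector_smult_assoc sum_sm G_def)
  finally have VG: "V *v \<phi> = G *s (meas q1 m' *v \<phi>)" .
  have m\<phi>: "meas q1 m' *v \<phi> = inverse G *s (V *v \<phi>)"
    unfolding VG using Vnz VG by (cases "G = 0") (auto simp: vector_smult_assoc)
  \<comment> \<open>Only one outcome \<open>m'\<close> has been treated. The power \<open>j\<close>
    of \<open>T v\<close> fixes the line of \<open>\<phi>\<close> and shifts the measured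
    coordinate, which carries outcome \<open>m'\<close> to outcome \<open>m\<close>.\<close>
  define j where "j = (m - m') / q q1"
  have j: "m - (scl j q) q1 = m'" using q by (simp add: j_def scl_def)
  obtain c where c: "c \<noteq> 0" "weyl (scl j p) (scl j q) *v \<phi> = c *s \<phi>"
    using weyl_power_eigenvector[OF v] by metis
  have "c *s (meas q1 m *v \<phi>) = meas q1 m *v (weyl (scl j p) (scl j q) *v \<phi>)"
    by (simp add: c matvec_smult)
  also have "\<dots> = inverse G *s (weyl (scl j p) (scl j q) *v (V *v \<phi>))"
    by (simp add: meas_weyl j m\<phi> matvec_smult)
  finally have E: "c *s (meas q1 m *v \<phi>) = inverse G *s (weyl (scl j p) (scl j q) *v (V *v \<phi>))" .
  have "meas q1 m *v \<phi> = (inverse c * inverse G) *s (weyl (scl j p) (scl j q) *v (V *v \<phi>))"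
    using smult_eq_imp[OF E c(1)] by (simp add: vector_smult_assoc)
  then show ?thesis using stab_vec_cliff[OF V\<phi> cliff_weyl] by blast
qed

text \<open>The stabilizer group of \<open>\<phi>\<close> is the image under \<open>B\<close> of the
  diagonal Weyl operators. Either one of its elements shifts the measured coordinate, or all of them
  commute with the measured \<open>Z\<close>.\<close>

lemma meas_stab_vec:
  fixes \<phi> :: "('n::finite, 'p) idx cvec"
  assumes "stab_vec \<phi>"
  shows "\<exists>c \<phi>'. stab_vec \<phi>' \<and> meas q1 m *v \<phi> = c *s \<phi>'"
proof -
  obtain B where B: "cliff B" "\<phi> = B *v axis (\<lambda>_. 0) 1" using assms by (auto simp: stab_vec_def)
  show ?thesis
  proof (cases "\<exists>p c p' q'. cmod c = 1 \<and> (\<forall>\<psi>. B *v (weyl p 0 *v \<psi>) = c *s (weyl p' q' *v (B *v \<psi>))) \<and> q' q1 \<noteq> 0")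
    case True
    then obtain p c p' q' where c: "cmod c = 1" "\<And>\<psi>. B *v (weyl p 0 *v \<psi>) = c *s (weyl p' q' *v (B *v \<psi>))"
      and q': "q' q1 \<noteq> 0" by blast
    have "weyl p 0 *v axis (\<lambda>_. 0) 1 = (axis (\<lambda>_. 0) 1 :: ('n, 'p) idx cvec)"
      by (auto simp: vec_eq_iff weyl_matvec axis_def dotp_simps dotp_def)
    then have "\<phi> = c *s (weyl p' q' *v \<phi>)" using c(2)[of "axis (\<lambda>_. 0) 1"] B by simp
    moreover have cnz: "c \<noteq> 0" using c by auto
    ultimately have "weyl p' q' *v \<phi> = inverse c *s \<phi>"
      using smult_eq_imp[of c "weyl p' q' *v \<phi>" \<phi>] by simp
    then show ?thesis using meas_stab_vec_noncommuting[of \<phi> p' q' "inverse c" q1 m] assms q' cnz by simp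
  next
    case False
    then obtain m0 where "\<And>m'. meas q1 m' *v \<phi> = (if m' = m0 then \<phi> else 0)"
      using meas_stab_vec_commuting[OF B] by blast
    then have "meas q1 m *v \<phi> = (if m = m0 then 1 else 0) *s \<phi>" by simp
    then show ?thesis using assms by blast
  qed
qed

end

section \<open>The Wigner function on vectors\<close>

definition wig :: "('n::finite, 'p::prime_card) idx cvec \<Rightarrow> ('n, 'p) phase_point \<Rightarrow> real" where
  "wig y u = Re (braket y (phase_op u *v y)) / real CARD('p) ^ CARD('n)"

definition wsum :: "('n::finite, 'p::prime_card) idx cvec \<Rightarrow> real" where
  "wsum y = (\<Sum>u\<in>UNIV. \<bar>wig y u\<bar>)"

lemma wigner_outer: "wigner (outer y) u = wig y u"
  by (simp add: wigner_def wig_def trace_outer)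

lemma mana_outer: "mana (outer y) = log 2 (wsum y)"
  by (simp add: mana_def wigner_outer wsum_def)

lemma wig_smult: "wig (c *s y) u = (cmod c)\<^sup>2 * wig y u"
proof -
  have "braket (c *s y) (phase_op u *v (c *s y)) = complex_of_real ((cmod c)\<^sup>2) * braket y (phase_op u *v y)"
    unfolding complex_norm_square
    by (simp add: matvec_smult braket_smult_left braket_smult_right mult_ac)
  then show ?thesis by (simp add: wig_def)
qed

lemma wsum_smult: "wsum (c *s y) = (cmod c)\<^sup>2 * wsum y"
  by (simp add: wsum_def wig_smult abs_mult sum_distrib_left)

context odd_qudit
begin

lemma card_idx: "real CARD(('n::finite, 'p) idx) = real CARD('p) ^ CARD('n)"
  by (simp add: card_fun)

text \<open>Summing over the momenta leaves only reflections whose centre is the row index itself.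
  Taking expectations, the Wigner function sums to the squared norm.\<close>

lemma sum_phase_op_matvec:
  "(\<Sum>u\<in>UNIV. phase_op u *v (\<psi> :: ('n::finite, 'p) idx cvec)) = of_nat CARD(('n, 'p) idx) *s \<psi>"
proof -
  have "(\<Sum>u\<in>UNIV. phase_op u *v \<psi>) $ x = of_nat CARD(('n, 'p) idx) * \<psi> $ x" for x
  proof -
    have "(\<Sum>u\<in>UNIV. phase_op u *v \<psi>) $ x = (\<Sum>q\<in>UNIV. \<Sum>p\<in>UNIV. (phase_op (q, p) *v \<psi>) $ x)"
      unfolding sum_component sum.cartesian_product UNIV_Times_UNIV by (simp add: case_prod_unfold)
    also have "\<dots> = (\<Sum>q\<in>UNIV. (\<Sum>p\<in>UNIV. omega_pow (dotp p ((x - q) + (x - q)))) * \<psi> $ (q + q - x))"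
      unfolding phase_op_matvec dotp_simps(2) sum_distrib_right ..
    also have "\<dots> = (\<Sum>q\<in>UNIV. if q = x then of_nat CARD(('n, 'p) idx) * \<psi> $ x else 0)"
    proof (rule sum.cong[OF refl])
      fix q
      have "x - q + (x - q) = 0 \<longleftrightarrow> q = x"
        using double_inject_idx[of "x - q" 0] by (auto simp del: mult_2 mult_2_right)
      then show "(\<Sum>p\<in>UNIV. omega_pow (dotp p ((x - q) + (x - q)))) * \<psi> $ (q + q - x)
          = (if q = x then of_nat CARD(('n, 'p) idx) * \<psi> $ x else 0)"
        unfolding sum_omega_pow_dotp by auto
    qed
    finally show ?thesis by simp
  qed
  then show ?thesis by (simp add: vec_eq_iff)
qed

lemma sum_wig: "(\<Sum>u\<in>UNIV. wig (y :: ('n::finite, 'p) idx cvec) u) = (norm y)\<^sup>2"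
proof -
  have "(\<Sum>u\<in>UNIV. wig y u) = Re (braket y (\<Sum>u\<in>UNIV. phase_op u *v y)) / real CARD('p) ^ CARD('n)"
    by (simp add: wig_def sum_divide_distrib[symmetric] braket_sum_right Re_sum)
  also have "\<dots> = (norm y)\<^sup>2"
    unfolding sum_phase_op_matvec braket_smult_right braket_self card_idx[symmetric] by simp
  finally show ?thesis .
qed

lemma wig_cliff:
  fixes U :: "('n::finite, 'p) idx cmat"
  assumes "cliff U"
  shows "\<exists>f. bij f \<and> (\<forall>y u. wig (U *v y) (f u) = wig y u)"
proof -
  note un = cliff_unitary[OF assms]
  obtain f where f: "\<And>u \<psi>. U *v (phase_op u *v \<psi>) = phase_op (f u) *v (U *v \<psi>)"
    using cliff_phase_op[OF assms] by metis
  have "inj f"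
  proof (rule injI)
    fix u w assume "f u = f w"
    then have "U *v (phase_op u *v \<psi>) = U *v (phase_op w *v \<psi>)" for \<psi> by (simp add: f)
    then have "phase_op u *v \<psi> = phase_op w *v \<psi>" for \<psi> by (metis unitary_inverse(1)[OF un])
    then show "u = w" by (intro phase_op_inject) (simp add: matrix_eq)
  qed
  then have "bij f" by (simp add: bij_def finite_UNIV_inj_surj)
  moreover have "wig (U *v y) (f u) = wig y u" for y u
    by (simp add: wig_def f[symmetric] unitary_braket[OF un])
  ultimately show ?thesis by blast
qed

lemma wsum_cliff:
  assumes "cliff U"
  shows "wsum (U *v y) = wsum (y :: ('n::finite, 'p) idx cvec)"
proof -
  obtain f where f: "bij f" "\<And>y u. wig (U *v y) (f u) = wig y u" using wig_cliff[OF assms] by blast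
  have "wsum (U *v y) = (\<Sum>u\<in>UNIV. \<bar>wig (U *v y) (f u)\<bar>)"
    unfolding wsum_def using f(1) by (rule sum.reindex_bij_betw[symmetric])
  then show ?thesis by (simp add: f wsum_def)
qed

lemma wig_axis_0:
  "wig (axis (\<lambda>_. 0) 1 :: ('n::finite, 'p) idx cvec) u \<in> {0, 1 / real CARD('p) ^ CARD('n)}"
proof -
  obtain q p where u: "u = (q, p)" by (cases u)
  have "braket (axis (\<lambda>_. 0) 1) (phase_op u *v axis (\<lambda>_. 0) 1) = phase_op u $ (\<lambda>_. 0) $ (\<lambda>_. 0)"
    by (simp only: braket_axis_left matvec_axis)
  also have "\<dots> \<in> {0, 1}" by (auto simp: u phase_op_entry dotp_def)
  finally show ?thesis by (auto simp: wig_def)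
qed

lemma wig_stab_vec:
  assumes "stab_vec (\<phi> :: ('n::finite, 'p) idx cvec)"
  shows "wig \<phi> u \<in> {0, 1 / real CARD('p) ^ CARD('n)}"
proof -
  obtain U where U: "cliff U" "\<phi> = U *v axis (\<lambda>_. 0) 1" using assms by (auto simp: stab_vec_def)
  obtain f where f: "bij f" "\<And>y u. wig (U *v y) (f u) = wig y u" using wig_cliff[OF U(1)] by blast
  obtain u' where "u = f u'" using f(1) by (metis bij_pointE)
  then show ?thesis using f(2) U wig_axis_0 by metis
qed

end

section \<open>The rotation\<close>

text \<open>The speeds of the eigenphases: with them both forms of \<open>diag_gate\<close> become
  the diagonal matrix of \<open>cis (\<theta> * gam a k)\<close>.\<close>

definition gam :: "'p::prime_card mod_ring \<Rightarrow> 'p mod_ring \<Rightarrow> real" where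
  "gam a k = (if CARD('p) = 3 then (if k = 0 then 0 else if k = 1 then 2 * pi / 9 else - (2 * pi / 9))
     else - (2 * pi * residue_real (a * k ^ 3) / real CARD('p)))"

text \<open>The derivative of \<open>rot a \<theta>\<close> at \<open>\<theta> = 0\<close>, that is,
  the diagonal matrix of \<open>\<i> * gam a\<close> conjugated by the Fourier matrix and written
  out entrywise.\<close>

definition rot_deriv :: "'p::prime_card mod_ring \<Rightarrow> 'p mod_ring cmat" where
  "rot_deriv a = (\<chi> j k. (\<Sum>l\<in>UNIV. omega_pow (l * (k - j)) * (\<i> * gam a l)) / of_nat CARD('p))"

lemma diag_gate_entry:
  "diag_gate a \<theta> $ j $ k = (if j = k then cis (\<theta> * gam a k) else 0)"
  by (simp add: diag_gate_def gam_def mult_ac)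

lemma on_qudit_matvec:
  "(on_qudit q1 B *v \<psi>) $ x = (\<Sum>l\<in>UNIV. B $ (x q1) $ l * \<psi> $ (x(q1 := l)))"
  for \<psi> :: "('n::finite, 'p::prime_card) idx cvec"
proof -
  have "(on_qudit q1 B *v \<psi>) $ x = (\<Sum>y\<in>UNIV. on_qudit q1 B $ x $ y * \<psi> $ y)"
    by (simp add: matrix_vector_mult_def)
  also have "\<dots> = (\<Sum>y\<in>range (\<lambda>l. x(q1 := l)). on_qudit q1 B $ x $ y * \<psi> $ y)"
  proof (rule sum.mono_neutral_right)
    show "\<forall>y\<in>UNIV - range (\<lambda>l. x(q1 := l)). on_qudit q1 B $ x $ y * \<psi> $ y = 0"
    proof
      fix y assume "y \<in> UNIV - range (\<lambda>l. x(q1 := l))"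
      then have "y \<noteq> x(q1 := y q1)" by blast
      then obtain j where "y j \<noteq> (x(q1 := y q1)) j" by (auto simp: fun_eq_iff)
      then have "(\<forall>j. j \<noteq> q1 \<longrightarrow> x j = y j) = False" by (auto split: if_splits)
      then show "on_qudit q1 B $ x $ y * \<psi> $ y = 0" unfolding on_qudit_entry by (simp only: if_False mult_zero_left)
    qed
  qed auto
  also have "\<dots> = (\<Sum>l\<in>UNIV. on_qudit q1 B $ x $ (x(q1 := l)) * \<psi> $ (x(q1 := l)))"
    by (subst sum.reindex) (auto intro!: injI dest: fun_upd_eqD)
  also have "\<dots> = (\<Sum>l\<in>UNIV. B $ (x q1) $ l * \<psi> $ (x(q1 := l)))"
    unfolding on_qudit_entry by simp
  finally show ?thesis .
qed

lemma on_qudit_mult: "on_qudit q1 A ** on_qudit q1 B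
    = (on_qudit q1 (A ** B) :: ('n::finite, 'p::prime_card) idx cmat)"
proof -
  have "((on_qudit q1 A ** on_qudit q1 B) *v \<psi>) $ x = (on_qudit q1 (A ** B) *v \<psi>) $ x"
    for \<psi> :: "('n, 'p) idx cvec" and x
  proof -
    have "((on_qudit q1 A ** on_qudit q1 B) *v \<psi>) $ x
        = (\<Sum>l\<in>UNIV. \<Sum>k\<in>UNIV. A $ (x q1) $ l * (B $ l $ k * \<psi> $ (x(q1 := k))))"
      by (simp add: matvec_assoc on_qudit_matvec sum_distrib_left)
    also have "\<dots> = (\<Sum>k\<in>UNIV. \<Sum>l\<in>UNIV. A $ (x q1) $ l * (B $ l $ k * \<psi> $ (x(q1 := k))))"
      by (rule sum.swap)
    also have "\<dots> = (on_qudit q1 (A ** B) *v \<psi>) $ x"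
      by (simp add: on_qudit_matvec matrix_matrix_mult_def sum_distrib_right mult.assoc)
    finally show ?thesis .
  qed
  then show ?thesis by (simp add: matrix_eq vec_eq_iff)
qed

lemma on_qudit_mat_1: "on_qudit q1 (mat 1) = (mat 1 :: ('n::finite, 'p::prime_card) idx cmat)"
proof -
  have "(on_qudit q1 (mat 1) *v \<psi>) $ x = \<psi> $ x" for \<psi> :: "('n, 'p) idx cvec" and x
  proof -
    have "(on_qudit q1 (mat 1) *v \<psi>) $ x = (\<Sum>l\<in>UNIV. if l = x q1 then \<psi> $ x else 0)"
      unfolding on_qudit_matvec by (rule sum.cong) (auto simp: mat_def)
    then show ?thesis by simp
  qed
  then show ?thesis by (simp add: matrix_eq vec_eq_iff)
qed

lemma dagger_on_qudit: "dagger (on_qudit q1 A) = (on_qudit q1 (dagger A) :: ('n::finite, 'p::prime_card) idx cmat)"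
proof -
  have "cnj (\<Prod>j\<in>UNIV. ((\<lambda>_. mat 1)(q1 := A)) j $ y j $ x j)
      = (\<Prod>j\<in>UNIV. ((\<lambda>_. mat 1)(q1 := dagger A)) j $ x j $ y j)" for x y :: "('n, 'p) idx"
    unfolding cnj_prod by (rule prod.cong) (auto simp: dagger_def mat_def)
  then show ?thesis by (simp add: on_qudit_def tensor_def dagger_def[of "\<chi> x y. _ x y"] vec_eq_iff)
qed

lemma unitary_on_qudit: "unitary A \<Longrightarrow> unitary (on_qudit q1 A :: ('n::finite, 'p::prime_card) idx cmat)"
  by (simp add: unitary_def dagger_on_qudit on_qudit_mult on_qudit_mat_1)

lemma fourier_dagger_fourier: "dagger fourier ** fourier = (mat 1 :: 'p::prime_card mod_ring cmat)"
proof -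
  have "(dagger fourier ** fourier) $ j $ k = (mat 1 :: 'p mod_ring cmat) $ j $ k" for j k
  proof -
    have "(dagger fourier ** fourier) $ j $ k
        = (\<Sum>l\<in>UNIV. omega_pow ((k - j) * l)) / of_nat CARD('p)"
      unfolding sum_divide_distrib matrix_matrix_mult_def dagger_def fourier_def vec_lambda_beta
    proof (rule sum.cong[OF refl])
      fix l :: "'p mod_ring"
      have "complex_of_real (sqrt (real CARD('p))) * complex_of_real (sqrt (real CARD('p))) = of_nat CARD('p)"
        by (simp flip: of_real_mult)
      moreover have "omega_pow ((k - j) * l) = omega_pow (- (l * j)) * omega_pow (l * k)"
        by (simp add: omega_pow_add[symmetric] algebra_simps)
      ultimately show "cnj (omega_pow (l * j) / complex_of_real (sqrt (real CARD('p)))) *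
          (omega_pow (l * k) / complex_of_real (sqrt (real CARD('p))))
        = omega_pow ((k - j) * l) / of_nat CARD('p)"
        by (simp add: cnj_omega_pow)
    qed
    then show ?thesis by (auto simp: sum_omega_pow mat_def)
  qed
  then show ?thesis by (simp add: vec_eq_iff)
qed

lemma unitary_fourier: "unitary (fourier :: 'p::prime_card mod_ring cmat)"
  unfolding unitary_def using fourier_dagger_fourier matrix_left_right_inverse by blast

lemma unitary_diag_gate: "unitary (diag_gate a \<theta> :: 'p::prime_card mod_ring cmat)"
proof (rule unitaryI)
  fix y :: "'p mod_ring cvec"
  have "(diag_gate a \<theta> *v y) $ k = cis (\<theta> * gam a k) * y $ k" for k
  proof -
    have "(diag_gate a \<theta> *v y) $ k = (\<Sum>l\<in>UNIV. if l = k then cis (\<theta> * gam a k) * y $ k else 0)"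
      by (simp only: matrix_vector_mult_def vec_lambda_beta, rule sum.cong) (auto simp: diag_gate_entry)
    then show ?thesis by simp
  qed
  then show "norm (diag_gate a \<theta> *v y) = norm y"
    by (simp add: norm_vec_def L2_set_def norm_mult)
qed

lemma unitary_rot: "unitary (rot a \<theta> :: 'p::prime_card mod_ring cmat)"
  unfolding rot_def by (intro unitary_mult unitary_dagger unitary_fourier unitary_diag_gate)

lemma rot_entry:
  "(rot a \<theta> :: 'p::prime_card mod_ring cmat) $ j $ k
    = (\<Sum>l\<in>UNIV. omega_pow (l * (k - j)) * cis (\<theta> * gam a l)) / of_nat CARD('p)"
proof -
  have D: "(diag_gate a \<theta> ** fourier) $ l $ k = cis (\<theta> * gam a l) * fourier $ l $ k" for l
  proof -
    have "(diag_gate a \<theta> ** fourier) $ l $ k = (\<Sum>i\<in>UNIV. if i = l then cis (\<theta> * gam a l) * fourier $ l $ k else 0)"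
      by (simp only: matrix_matrix_mult_def vec_lambda_beta, rule sum.cong) (auto simp: diag_gate_entry)
    then show ?thesis by simp
  qed
  have "rot a \<theta> $ j $ k = (\<Sum>l\<in>UNIV. dagger fourier $ j $ l * (cis (\<theta> * gam a l) * fourier $ l $ k))"
    unfolding rot_def matrix_mul_assoc[symmetric]
    by (simp only: matrix_matrix_mult_def[of "dagger fourier"] vec_lambda_beta D)
  also have "\<dots> = (\<Sum>l\<in>UNIV. omega_pow (l * (k - j)) * cis (\<theta> * gam a l)) / of_nat CARD('p)"
    unfolding sum_divide_distrib
  proof (rule sum.cong[OF refl])
    fix l :: "'p mod_ring"
    have "complex_of_real (sqrt (real CARD('p))) * complex_of_real (sqrt (real CARD('p))) = of_nat CARD('p)"
      by (simp flip: of_real_mult)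
    moreover have "omega_pow (l * (k - j)) = omega_pow (- (l * j)) * omega_pow (l * k)"
      by (simp add: omega_pow_add[symmetric] algebra_simps)
    ultimately show "dagger fourier $ j $ l * (cis (\<theta> * gam a l) * fourier $ l $ k)
        = omega_pow (l * (k - j)) * cis (\<theta> * gam a l) / of_nat CARD('p)"
      by (simp add: cnj_omega_pow dagger_def fourier_def)
  qed
  finally show ?thesis .
qed

lemma rot_0: "rot a 0 = (mat 1 :: 'p::prime_card mod_ring cmat)"
proof -
  have "diag_gate a 0 = (mat 1 :: 'p mod_ring cmat)"
    by (simp add: vec_eq_iff diag_gate_entry mat_def)
  then show ?thesis by (simp add: rot_def fourier_dagger_fourier)
qed

lemma cis_second_order: "cmod (cis x - 1 - \<i> * x) \<le> x\<^sup>2"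
proof -
  have "cmod (exp (\<i> * x) - (\<Sum>i\<le>1. (\<i> * x) ^ i / fact i)) \<le> exp \<bar>Re (\<i> * x)\<bar> * (cmod (\<i> * x)) ^ Suc 1 / fact 1"
    by (rule Taylor_exp)
  then show ?thesis
    by (simp add: cis_conv_exp norm_mult power2_eq_square algebra_simps)
qed

lemma rot_second_order:
  "cmod (((rot a \<theta> - rot a 0) $ j $ k) - \<theta> * rot_deriv a $ j $ k) \<le> \<theta>\<^sup>2 * (\<Sum>l\<in>UNIV. (gam a l)\<^sup>2)"
  for j :: "'p::prime_card mod_ring"
proof -
  have "((rot a \<theta> - rot a 0) $ j $ k) - \<theta> * rot_deriv a $ j $ k
     = (\<Sum>l\<in>UNIV. omega_pow (l * (k - j)) * (cis (\<theta> * gam a l) - 1 - \<i> * (\<theta> * gam a l))) / of_nat CARD('p)"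
    by (simp add: rot_entry rot_deriv_def sum_distrib_left sum_subtractf sum_divide_distrib
        diff_divide_distrib add_divide_distrib sum.distrib algebra_simps)
  also have "cmod \<dots> \<le> cmod (\<Sum>l\<in>UNIV. omega_pow (l * (k - j)) * (cis (\<theta> * gam a l) - 1 - \<i> * (\<theta> * gam a l)))"
    by (simp add: norm_divide divide_le_eq mult_le_cancel_left1)
  also have "\<dots> \<le> (\<Sum>l\<in>UNIV. cmod (omega_pow (l * (k - j)) * (cis (\<theta> * gam a l) - 1 - \<i> * (\<theta> * gam a l))))"
    by (rule norm_sum)
  also have "\<dots> \<le> (\<Sum>l\<in>UNIV. (\<theta> * gam a l)\<^sup>2)"
    by (intro sum_mono) (simp only: norm_mult[of "omega_pow _"] cmod_omega_pow mult_1_left of_real_mult[symmetric] cis_second_order)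
  finally show ?thesis by (simp add: sum_distrib_left power_mult_distrib)
qed

text \<open>Otherwise the Fourier transform of \<open>gam a\<close> would vanish outside 0, so
  \<open>gam a\<close> would be constant by Fourier inversion; but it vanishes at 0 and not at
  1.\<close>

lemma rot_deriv_off_diagonal:
  assumes "CARD('p::prime_card) > 2" "CARD('p) > 3 \<Longrightarrow> a \<noteq> 0"
  shows "\<exists>m k :: 'p mod_ring. m \<noteq> k \<and> rot_deriv a $ m $ k \<noteq> 0"
proof (rule ccontr)
  assume "\<not> ?thesis"
  then have *: "rot_deriv a $ m $ k = 0" if "m \<noteq> k" for m k :: "'p mod_ring" using that by metis
  define S where "S t = (\<Sum>l\<in>UNIV. omega_pow (l * t) * (\<i> * gam a l))" for t :: "'p mod_ring"
  have S: "S t = 0" if "t \<noteq> 0" for t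
  proof -
    have "0 = of_nat CARD('p) * rot_deriv a $ 0 $ t" using *[OF that[symmetric]] by (simp only: mult_zero_right)
    also have "\<dots> = S t" unfolding rot_deriv_def S_def vec_lambda_beta diff_zero by simp
    finally show ?thesis by (rule sym)
  qed
  have "of_nat CARD('p) * (\<i> * gam a k) = S 0" for k :: "'p mod_ring"
  proof -
    have "S 0 = (\<Sum>t\<in>UNIV. if t = 0 then omega_pow (- (k * t)) * S t else 0)" by simp
    also have "\<dots> = (\<Sum>t\<in>UNIV. omega_pow (- (k * t)) * S t)"
      by (rule sum.cong) (auto simp: S)
    also have "\<dots> = (\<Sum>t\<in>UNIV. \<Sum>l\<in>UNIV. (\<i> * gam a l) * omega_pow ((l - k) * t))"
      unfolding S_def sum_distrib_left
    proof (intro sum.cong refl)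
      fix t l
      have "omega_pow ((l - k) * t) = omega_pow (- (k * t)) * omega_pow (l * t)"
        by (simp add: omega_pow_add[symmetric] algebra_simps)
      then show "omega_pow (- (k * t)) * (omega_pow (l * t) * (\<i> * complex_of_real (gam a l)))
          = \<i> * complex_of_real (gam a l) * omega_pow ((l - k) * t)"
        by (simp only: mult_ac)
    qed
    also have "\<dots> = (\<Sum>l\<in>UNIV. (\<i> * gam a l) * (\<Sum>t\<in>UNIV. omega_pow ((l - k) * t)))"
      unfolding sum_distrib_left by (rule sum.swap)
    also have "\<dots> = (\<Sum>l\<in>UNIV. if l = k then (\<i> * gam a k) * of_nat CARD('p) else 0)"
      unfolding sum_omega_pow right_minus_eq
    proof (intro sum.cong refl)
      fix l
      show "\<i> * complex_of_real (gam a l) * (if l = k then of_nat CARD('p) else 0)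
          = (if l = k then \<i> * complex_of_real (gam a k) * of_nat CARD('p) else 0)"
        by (cases "l = k") simp_all
    qed
    also have "\<dots> = \<i> * complex_of_real (gam a k) * of_nat CARD('p)"
      by simp
    finally show ?thesis by (simp only: mult.commute)
  qed
  note eq = this
  have "complex_of_nat CARD('p) * (\<i> * gam a (1 :: 'p mod_ring)) = of_nat CARD('p) * (\<i> * gam a (0 :: 'p mod_ring))"
    by (simp only: eq)
  then have "gam a (1 :: 'p mod_ring) = gam a 0" by simp
  moreover have "gam a (0 :: 'p mod_ring) = 0" by (simp add: gam_def residue_real_def)
  moreover have "gam a (1 :: 'p mod_ring) \<noteq> 0"
  proof (cases "CARD('p) = 3")
    case False
    then have "a \<noteq> 0" using assms by simp
    then have *: "to_int_mod_ring a \<noteq> 0" by (simp only: to_int_mod_ring_hom.hom_0_iff not_False_eq_True)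
    have "gam a (1 :: 'p mod_ring) = - (2 * pi * residue_real a / real CARD('p))"
      unfolding gam_def using False by (simp only: if_False power_one mult_1_right)
    moreover have "residue_real a \<noteq> 0" unfolding residue_real_def using * by simp
    ultimately show ?thesis by simp
  next
    case True
    then have "gam a (1 :: 'p mod_ring) = 2 * pi / 9"
      unfolding gam_def by (simp only: if_True one_neq_zero if_False refl)
    moreover have "2 * pi / 9 \<noteq> 0" by simp
    ultimately show ?thesis by (simp only: not_False_eq_True)
  qed
  ultimately show False by simp
qed

section \<open>The component orthogonal to a unit vector\<close>

definition prp :: "'i::finite cvec \<Rightarrow> 'i cvec \<Rightarrow> 'i cvec" where
  "prp s y = y - braket s y *s s"

lemma prp_add: "prp s (x + y) = prp s x + prp s y"
  by (simp add: prp_def braket_add_right vector_sadd_rdistrib)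

lemma prp_diff: "prp s (x - y) = prp s x - prp s y"
  by (simp add: prp_def braket_diff_right vector_sub_rdistrib)

lemma prp_smult: "prp s (c *s y) = c *s prp s y"
  by (simp add: prp_def braket_smult_right vector_ssub_ldistrib vector_smult_assoc)

lemma prp_self: "norm s = 1 \<Longrightarrow> prp s s = 0"
  by (simp add: prp_def braket_self)

lemma braket_prp: "norm s = 1 \<Longrightarrow> braket s (prp s y) = 0"
  by (simp add: prp_def braket_diff_right braket_smult_right braket_self)

lemma prp_orthogonal: "braket s v = 0 \<Longrightarrow> prp s v = v"
  by (simp add: prp_def)

lemma prp_decomp: "y = braket s y *s s + prp s y"
  by (simp add: prp_def)

lemma norm_orthogonal_sum:
  assumes "braket x y = 0"
  shows "(norm (x + y))\<^sup>2 = (norm x)\<^sup>2 + (norm y)\<^sup>2"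
proof -
  have "inner x y = 0" using assms by (simp add: inner_eq_braket)
  then show ?thesis by (simp add: power2_norm_eq_inner inner_add_left inner_add_right inner_commute)
qed

lemma norm_prp:
  assumes "norm s = 1"
  shows "(norm y)\<^sup>2 = (cmod (braket s y))\<^sup>2 + (norm (prp s y))\<^sup>2"
proof -
  have "(norm (braket s y *s s + prp s y))\<^sup>2 = (norm (braket s y *s s))\<^sup>2 + (norm (prp s y))\<^sup>2"
    by (rule norm_orthogonal_sum) (simp add: braket_smult_left braket_prp assms)
  then show ?thesis unfolding prp_decomp[symmetric] by (simp only: norm_smult assms mult_1_right)
qed

lemma norm_prp_le: "norm s = 1 \<Longrightarrow> norm (prp s y) \<le> norm y"
proof (rule power2_le_imp_le)
  assume "norm s = 1"
  then show "(norm (prp s y))\<^sup>2 \<le> (norm y)\<^sup>2"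
    unfolding norm_prp[OF \<open>norm s = 1\<close>, of y] by (simp only: le_add_same_cancel2 zero_le_power2)
qed (rule norm_ge_zero)

lemma prp_phase:
  assumes "cmod c = 1"
  shows "prp (c *s s) y = prp s y"
proof -
  have "cnj c * z * c = z" for z
  proof -
    have "cnj c * z * c = (c * cnj c) * z" by (simp only: mult_ac)
    also have "c * cnj c = 1" using assms complex_norm_square[of c] by simp
    finally show ?thesis by simp
  qed
  then show ?thesis by (simp add: prp_def braket_smult_left vector_smult_assoc)
qed

section \<open>The branch operators\<close>

text \<open>The Kraus operator of a branch, including the final \<open>dagger U\<close>. It does not
  change when \<open>U\<close> is multiplied by a phase (\<open>KU_phase\<close>), so the
  representative of the projective class is immaterial.\<close>

definition KU :: "'p::prime_card mod_ring \<Rightarrow> 'n::finite \<Rightarrow> ('n, 'p) idx cmat \<Rightarrow> 'p mod_ring \<Rightarrow> real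
    \<Rightarrow> ('n, 'p) idx cmat" where
  "KU a q1 U m \<theta> = dagger U ** meas q1 m ** on_qudit q1 (rot a \<theta>) ** U"

text \<open>The derivative of \<open>KU\<close> in \<theta> at 0.\<close>

definition KD :: "'p::prime_card mod_ring \<Rightarrow> 'n::finite \<Rightarrow> ('n, 'p) idx cmat \<Rightarrow> 'p mod_ring
    \<Rightarrow> ('n, 'p) idx cmat" where
  "KD a q1 U m = dagger U ** meas q1 m ** on_qudit q1 (rot_deriv a) ** U"

lemma unitary_on_rot: "unitary (on_qudit q1 (rot a \<theta>) :: ('n::finite, 'p::prime_card) idx cmat)"
  by (intro unitary_on_qudit unitary_rot)

lemma on_rot_0: "on_qudit q1 (rot a 0) = (mat 1 :: ('n::finite, 'p::prime_card) idx cmat)"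
  by (simp add: rot_0 on_qudit_mat_1)

lemma norm_le_sum_components: "norm (y :: ('i::finite) cvec) \<le> (\<Sum>i\<in>UNIV. cmod (y $ i))"
  unfolding norm_vec_def by (rule L2_set_le_sum) simp

lemma on_rot_second_order:
  "\<exists>B\<ge>0. \<forall>\<theta> (y :: ('n::finite, 'p::prime_card) idx cvec).
    norm (on_qudit q1 (rot a \<theta>) *v y - y - \<theta> *\<^sub>R (on_qudit q1 (rot_deriv a) *v y)) \<le> B * \<theta>\<^sup>2 * norm y"
proof (intro exI conjI allI)
  let ?G = "\<Sum>l\<in>UNIV. (gam a l)\<^sup>2"
  let ?B = "real CARD(('n, 'p) idx) * (real CARD('p) * ?G)"
  show "0 \<le> ?B" by (simp add: sum_nonneg)
  fix \<theta> :: real and y :: "('n, 'p) idx cvec"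
  define z where "z = on_qudit q1 (rot a \<theta>) *v y - y - \<theta> *\<^sub>R (on_qudit q1 (rot_deriv a) *v y)"
  have "cmod (z $ x) \<le> real CARD('p) * (\<theta>\<^sup>2 * ?G * norm y)" for x
  proof -
    have y0: "y $ x = (\<Sum>l\<in>UNIV. rot a 0 $ (x q1) $ l * y $ (x(q1 := l)))"
      unfolding on_qudit_matvec[symmetric] by (simp add: on_rot_0)
    have lin: "(\<Sum>l\<in>UNIV. A l * Y l) - (\<Sum>l\<in>UNIV. B l * Y l) - t * (\<Sum>l\<in>UNIV. D l * Y l)
        = (\<Sum>l\<in>UNIV. ((A l - B l) - t * D l) * Y l)" for A B D Y :: "'p mod_ring \<Rightarrow> complex" and t
      by (simp add: sum_distrib_left sum_subtractf sum.distrib algebra_simps)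
    have "z $ x = (on_qudit q1 (rot a \<theta>) *v y) $ x - y $ x
        - complex_of_real \<theta> * (on_qudit q1 (rot_deriv a) *v y) $ x"
      by (simp only: z_def vector_minus_component vector_scaleR_component scaleR_conv_of_real[where 'a = complex])
    also have "\<dots> = (\<Sum>l\<in>UNIV. (((rot a \<theta> - rot a 0) $ (x q1) $ l) - \<theta> * rot_deriv a $ (x q1) $ l) * y $ (x(q1 := l)))"
      unfolding on_qudit_matvec vector_minus_component by (subst y0, rule lin)
    finally have "z $ x = (\<Sum>l\<in>UNIV. (((rot a \<theta> - rot a 0) $ (x q1) $ l) - \<theta> * rot_deriv a $ (x q1) $ l) * y $ (x(q1 := l)))" .
    note zx = this
    have "cmod (z $ x) \<le> (\<Sum>l\<in>(UNIV :: 'p mod_ring set). cmod ((((rot a \<theta> - rot a 0) $ (x q1) $ l) - \<theta> * rot_deriv a $ (x q1) $ l) * y $ (x(q1 := l))))"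
      unfolding zx by (rule norm_sum)
    also have "\<dots> \<le> (\<Sum>l\<in>(UNIV :: 'p mod_ring set). \<theta>\<^sup>2 * ?G * norm y)"
    proof (rule sum_mono)
      fix l
      show "cmod ((((rot a \<theta> - rot a 0) $ (x q1) $ l) - \<theta> * rot_deriv a $ (x q1) $ l) * y $ (x(q1 := l))) \<le> \<theta>\<^sup>2 * ?G * norm y"
        unfolding norm_mult
        by (rule mult_mono[OF rot_second_order Finite_Cartesian_Product.norm_nth_le])
          (auto intro!: sum_nonneg mult_nonneg_nonneg)
    qed
    finally show ?thesis by simp
  qed
  then have "(\<Sum>x\<in>UNIV. cmod (z $ x)) \<le> (\<Sum>x\<in>(UNIV :: ('n, 'p) idx set). real CARD('p) * (\<theta>\<^sup>2 * ?G * norm y))"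
    by (intro sum_mono)
  then have "norm z \<le> (\<Sum>x\<in>(UNIV :: ('n, 'p) idx set). real CARD('p) * (\<theta>\<^sup>2 * ?G * norm y))"
    using norm_le_sum_components[of z] by (rule order_trans[rotated])
  then show "norm (on_qudit q1 (rot a \<theta>) *v y - y - \<theta> *\<^sub>R (on_qudit q1 (rot_deriv a) *v y)) \<le> ?B * \<theta>\<^sup>2 * norm y"
    unfolding z_def[symmetric] by (simp add: mult_ac)
qed

context odd_qudit
begin

lemma norm_meas_le: "norm (meas q1 m *v (\<psi> :: ('n::finite, 'p) idx cvec)) \<le> norm \<psi>"
proof -
  have "(norm (meas q1 m *v \<psi>))\<^sup>2 \<le> (\<Sum>m\<in>UNIV. (norm (meas q1 m *v \<psi>))\<^sup>2)"
    by (rule member_le_sum) auto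
  then show ?thesis by (simp add: norm_meas_sum power2_le_iff_abs_le)
qed

lemma KU_matvec: "KU a q1 U m \<theta> *v y = dagger U *v (meas q1 m *v (on_qudit q1 (rot a \<theta>) *v (U *v y)))"
  for U :: "('n::finite, 'p) idx cmat"
  by (simp add: KU_def matvec_assoc)

lemma KD_matvec: "KD a q1 U m *v y = dagger U *v (meas q1 m *v (on_qudit q1 (rot_deriv a) *v (U *v y)))"
  for U :: "('n::finite, 'p) idx cmat"
  by (simp add: KD_def matvec_assoc)

lemma KU_0_matvec: "KU a q1 U m 0 *v y = dagger U *v (meas q1 m *v (U *v y))"
  for U :: "('n::finite, 'p) idx cmat"
  by (simp add: KU_matvec on_rot_0)

lemma KU_norm_sum:
  assumes "unitary (U :: ('n::finite, 'p) idx cmat)"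
  shows "(\<Sum>m\<in>UNIV. (norm (KU a q1 U m \<theta> *v y))\<^sup>2) = (norm y)\<^sup>2"
  by (simp add: KU_matvec unitary_norm[OF unitary_dagger[OF assms]] norm_meas_sum
      unitary_norm[OF unitary_on_rot] unitary_norm[OF assms])

lemma norm_KU_le:
  assumes "unitary (U :: ('n::finite, 'p) idx cmat)"
  shows "norm (KU a q1 U m \<theta> *v y) \<le> norm y"
  using norm_meas_le[of q1 m "on_qudit q1 (rot a \<theta>) *v (U *v y)"]
  by (simp add: KU_matvec unitary_norm[OF unitary_dagger[OF assms]]
      unitary_norm[OF unitary_on_rot] unitary_norm[OF assms])

lemma KU_phase:
  assumes "cmod c = 1"
  shows "KU a q1 (csc c U) m \<theta> = KU a q1 U m \<theta>"
proof -
  have "cnj c * c = 1" using assms complex_norm_square[of c] by (simp add: mult.commute)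
  then show ?thesis by (simp add: KU_def dagger_csc csc_mult_left csc_mult_right csc_csc mult.commute)
qed

lemma KU_mult: "KU a q1 (U ** V) m \<theta> *v y = dagger V *v (KU a q1 U m \<theta> *v (V *v y))"
  for U :: "('n::finite, 'p) idx cmat"
  by (simp add: KU_matvec matvec_assoc dagger_mult)

text \<open>One constant serves all \<open>U\<close>: only the rotation depends on \<theta>, and the
  other factors are unitary or a projection.\<close>

lemma KU_second_order:
  "\<exists>B\<ge>1. \<forall>(U :: ('n::finite, 'p) idx cmat) m y. unitary U \<longrightarrow> norm (KD a q1 U m *v y) \<le> B * norm y \<and>
    (\<forall>\<theta>. norm (KU a q1 U m \<theta> *v y - KU a q1 U m 0 *v y - \<theta> *\<^sub>R (KD a q1 U m *v y)) \<le> B * \<theta>\<^sup>2 * norm y)"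
proof -
  obtain B where B: "B \<ge> 0" "\<And>\<theta> (y :: ('n, 'p) idx cvec).
    norm (on_qudit q1 (rot a \<theta>) *v y - y - \<theta> *\<^sub>R (on_qudit q1 (rot_deriv a) *v y)) \<le> B * \<theta>\<^sup>2 * norm y"
    using on_rot_second_order[of q1 a] by blast
  obtain B' where B': "\<And>y :: ('n, 'p) idx cvec. norm (on_qudit q1 (rot_deriv a) *v y) \<le> norm y * B'"
    using bounded_linear.bounded[OF bounded_linear_matvec] by blast
  define C where "C = max 1 (max B B')"
  have C: "B * t \<le> C * t" "B' * t \<le> C * t" if "t \<ge> 0" for t
    using that by (auto intro!: mult_right_mono simp: C_def)
  have "norm (KD a q1 U m *v y) \<le> C * norm y \<and>
    (\<forall>\<theta>. norm (KU a q1 U m \<theta> *v y - KU a q1 U m 0 *v y - \<theta> *\<^sub>R (KD a q1 U m *v y)) \<le> C * \<theta>\<^sup>2 * norm y)"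
    if U: "unitary U" for U :: "('n, 'p) idx cmat" and m y
  proof (intro conjI allI)
    have le: "norm (dagger U *v (meas q1 m *v z)) \<le> norm z" for z
      using norm_meas_le by (simp add: unitary_norm[OF unitary_dagger[OF U]])
    have "norm (KD a q1 U m *v y) \<le> norm (U *v y) * B'"
      unfolding KD_matvec using le B' by (rule order_trans)
    then show "norm (KD a q1 U m *v y) \<le> C * norm y"
      using C(2)[of "norm y"] by (simp add: unitary_norm[OF U] mult.commute)
    fix \<theta>
    have "KU a q1 U m \<theta> *v y - KU a q1 U m 0 *v y - \<theta> *\<^sub>R (KD a q1 U m *v y)
      = dagger U *v (meas q1 m *v (on_qudit q1 (rot a \<theta>) *v (U *v y) - U *v y
          - \<theta> *\<^sub>R (on_qudit q1 (rot_deriv a) *v (U *v y))))"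
      by (simp add: KU_matvec KU_0_matvec KD_matvec matrix_vector_mult_diff_distrib scaleR_eq_smult matvec_smult on_rot_0)
    then have "norm (KU a q1 U m \<theta> *v y - KU a q1 U m 0 *v y - \<theta> *\<^sub>R (KD a q1 U m *v y)) \<le> B * \<theta>\<^sup>2 * norm (U *v y)"
      using order_trans[OF le B(2)] by simp
    then show "norm (KU a q1 U m \<theta> *v y - KU a q1 U m 0 *v y - \<theta> *\<^sub>R (KD a q1 U m *v y)) \<le> C * \<theta>\<^sup>2 * norm y"
      using C(1)[of "\<theta>\<^sup>2 * norm y"] by (simp add: unitary_norm[OF U] mult.assoc)
  qed
  moreover have "C \<ge> 1" by (simp add: C_def)
  ultimately show ?thesis by blast
qed

lemma KU_stab_vec:
  fixes U :: "('n::finite, 'p) idx cmat"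
  assumes "cliff U" "stab_vec \<phi>"
  shows "\<exists>c \<phi>'. stab_vec \<phi>' \<and> KU a q1 U m 0 *v \<phi> = c *s \<phi>'"
proof -
  obtain c \<phi>' where "stab_vec \<phi>'" "meas q1 m *v (U *v \<phi>) = c *s \<phi>'"
    using meas_stab_vec[OF stab_vec_cliff[OF assms(2,1)]] by blast
  then have "KU a q1 U m 0 *v \<phi> = c *s (dagger U *v \<phi>')" "stab_vec (dagger U *v \<phi>')"
    by (simp_all add: KU_0_matvec matvec_smult stab_vec_cliff cliff_dagger[OF assms(1)])
  then show ?thesis by blast
qed

lemma meas_perm_gate:
  assumes "\<sigma> \<circ> \<sigma> = id"
  shows "meas q1 m *v (perm_gate \<sigma> *v (\<psi> :: ('n::finite, 'p) idx cvec)) = perm_gate \<sigma> *v (meas (\<sigma> q1) m *v \<psi>)"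
proof -
  have "\<sigma> (\<sigma> q1) = q1" using assms by (metis comp_apply id_apply)
  then show ?thesis by (simp add: vec_eq_iff meas_matvec perm_gate_matvec[OF assms])
qed

text \<open>Every string that occurs in \<open>w\<close> has a nonzero letter at some qudit
  \<open>i\<close>, where the outcome 0 rejects it. So over all qudits a string is kept at most N -
  1 times, and some qudit keeps no more than the average.\<close>

lemma exists_measured_qudit:
  fixes w :: "('n::finite, 'p) idx cvec"
  assumes "w $ (\<lambda>_. 0) = 0"
  shows "\<exists>j. (norm (meas j 0 *v w))\<^sup>2 \<le> (1 - 1 / real CARD('n)) * (norm w)\<^sup>2"
proof (rule ccontr)
  assume "\<not> ?thesis"
  then have gt: "(norm (meas j 0 *v w))\<^sup>2 > (1 - 1 / real CARD('n)) * (norm w)\<^sup>2" for j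
    by (auto simp: not_le)
  have sq: "(norm v)\<^sup>2 = (\<Sum>x\<in>UNIV. (cmod (v $ x))\<^sup>2)" for v :: "('n, 'p) idx cvec"
    by (simp add: norm_vec_def L2_set_def sum_nonneg)
  have "(\<Sum>j\<in>(UNIV :: 'n set). (1 - 1 / real CARD('n)) * (norm w)\<^sup>2) < (\<Sum>j\<in>UNIV. (norm (meas j 0 *v w))\<^sup>2)"
    by (rule sum_strict_mono) (auto simp: gt)
  also have "\<dots> = (\<Sum>x\<in>UNIV. \<Sum>j\<in>UNIV. (cmod ((meas j 0 *v w) $ x))\<^sup>2)"
    unfolding sq by (rule sum.swap)
  also have "\<dots> \<le> (\<Sum>x\<in>UNIV. (real CARD('n) - 1) * (cmod (w $ x))\<^sup>2)"
  proof (rule sum_mono)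
    fix x :: "('n, 'p) idx"
    show "(\<Sum>j\<in>UNIV. (cmod ((meas j 0 *v w) $ x))\<^sup>2) \<le> (real CARD('n) - 1) * (cmod (w $ x))\<^sup>2"
    proof (cases "w $ x = 0")
      case False
      then obtain i where i: "x i \<noteq> 0" using assms by (metis ext)
      have "(\<Sum>j\<in>UNIV. (cmod ((meas j 0 *v w) $ x))\<^sup>2) = (\<Sum>j\<in>UNIV - {i}. (cmod ((meas j 0 *v w) $ x))\<^sup>2)"
        using i by (intro sum.mono_neutral_right) (auto simp: meas_matvec)
      also have "\<dots> \<le> (\<Sum>j\<in>UNIV - {i}. (cmod (w $ x))\<^sup>2)"
        by (rule sum_mono) (auto simp: meas_matvec)
      also have "\<dots> = (real CARD('n) - 1) * (cmod (w $ x))\<^sup>2"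
        by (simp add: card_Diff_singleton of_nat_diff Suc_leI)
      finally show ?thesis .
    next
      case True
      have "(cmod ((meas j 0 *v w) $ x))\<^sup>2 = 0" for j by (simp add: meas_matvec True)
      then show ?thesis using True by simp
    qed
  qed
  also have "\<dots> = (real CARD('n) - 1) * (norm w)\<^sup>2" by (simp add: sq sum_distrib_left)
  finally show False by (simp add: field_simps)
qed

text \<open>Undo the preparation \<open>B\<close> of \<open>\<phi>\<close>, so that it becomes the
  zero string, and swap the qudit of \<open>exists_measured_qudit\<close> into the measured
  position. On \<open>\<phi>\<close> the outcome 0 is then certain and leaves it unchanged, while
  \<open>v\<close> has no component on the zero string and loses the stated share.\<close>

lemma exists_contracting_clifford:
  fixes v :: "('n::finite, 'p) idx cvec"
  assumes \<phi>: "stab_vec \<phi>" and v: "braket \<phi> v = 0"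
  shows "\<exists>C\<in>proj_clifford. \<exists>m0. (\<forall>m. KU a q1 (rep_unitary C) m 0 *v \<phi> = (if m = m0 then \<phi> else 0)) \<and>
    (norm (KU a q1 (rep_unitary C) m0 0 *v v))\<^sup>2 \<le> (1 - 1 / real CARD('n)) * (norm v)\<^sup>2"
proof -
  let ?e = "axis (\<lambda>_. 0) 1 :: ('n, 'p) idx cvec"
  obtain B where B: "cliff B" "\<phi> = B *v ?e" using \<phi> by (auto simp: stab_vec_def)
  note unB = cliff_unitary[OF B(1)]
  define w where "w = dagger B *v v"
  have "w $ (\<lambda>_. 0) = braket ?e w" by (simp add: braket_axis_left)
  also have "\<dots> = braket (B *v ?e) (B *v w)" by (simp add: unitary_braket[OF unB])
  also have "\<dots> = 0" using v by (simp add: w_def unitary_inverse[OF unB] B(2))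
  finally obtain j where j: "(norm (meas j 0 *v w))\<^sup>2 \<le> (1 - 1 / real CARD('n)) * (norm w)\<^sup>2"
    using exists_measured_qudit by blast
  define \<sigma> where "\<sigma> = id(q1 := j, j := q1)"
  have \<sigma>: "\<sigma> \<circ> \<sigma> = id" "\<sigma> q1 = j" by (auto simp: \<sigma>_def fun_eq_iff)
  define U where "U = perm_gate \<sigma> ** dagger B"
  have U: "cliff U" unfolding U_def by (intro cliff_mult cliff_perm_gate \<sigma> cliff_dagger B)
  note unU = cliff_unitary[OF U]
  obtain c where c: "cmod c = 1" "rep_unitary (proj_class U) = csc c U"
    using rep_unitary_proj_class by blast
  have K: "KU a q1 (rep_unitary (proj_class U)) m 0 = KU a q1 U m 0" for m
    by (simp add: c KU_phase)
  have "KU a q1 U m 0 *v \<phi> = (if m = 0 then \<phi> else 0)" for m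
  proof -
    have "meas j m *v ?e = (if m = 0 then ?e else 0)"
      by (auto simp: vec_eq_iff meas_matvec axis_def)
    then have "meas q1 m *v (U *v \<phi>) = (if m = 0 then U *v \<phi> else 0)"
      by (simp add: U_def matvec_assoc B(2) unitary_inverse[OF unB] meas_perm_gate[OF \<sigma>(1)] \<sigma>(2))
    then show ?thesis by (simp add: KU_0_matvec unitary_inverse[OF unU])
  qed
  note KU\<phi> = this
  have "U *v v = perm_gate \<sigma> *v w" by (simp add: U_def matvec_assoc w_def)
  then have nv: "norm (KU a q1 U 0 0 *v v) = norm (meas j 0 *v w)"
    by (simp add: KU_0_matvec unitary_norm[OF unitary_dagger[OF unU]]
        meas_perm_gate[OF \<sigma>(1)] \<sigma>(2) unitary_norm[OF cliff_unitary[OF cliff_perm_gate[OF \<sigma>(1)]]])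
  have nw: "norm w = norm v" by (simp add: w_def unitary_norm[OF unitary_dagger[OF unB]])
  have "proj_class U \<in> proj_clifford"
    using U by (simp add: proj_class_in_proj_clifford_iff unU)
  moreover have "\<forall>m. KU a q1 (rep_unitary (proj_class U)) m 0 *v \<phi> = (if m = 0 then \<phi> else 0)"
    unfolding K using KU\<phi> by blast
  moreover have "(norm (KU a q1 (rep_unitary (proj_class U)) 0 0 *v v))\<^sup>2
      \<le> (1 - 1 / real CARD('n)) * (norm v)\<^sup>2"
    unfolding K nv nw[symmetric] by (rule j)
  ultimately show ?thesis by blast
qed

end

section \<open>The elementary inequalities behind the contraction\<close>

lemma sum_norm_mult_le:
  fixes f g :: "'i \<Rightarrow> real"
  assumes "\<And>i. f i \<ge> 0" "\<And>i. g i \<ge> 0"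
  shows "(\<Sum>i\<in>A. f i * g i) \<le> sqrt (\<Sum>i\<in>A. (f i)\<^sup>2) * sqrt (\<Sum>i\<in>A. (g i)\<^sup>2)"
  using L2_set_mult_ineq[of f g A] assms by (simp add: L2_set_def)

text \<open>The defect is \<open>(Y W - t)\<^sup>2 - (Y\<^sup>2 - t) (W\<^sup>2 - t) = t (Y - W)\<^sup>2\<close>.\<close>

lemma contraction_inequality:
  fixes Y W t a0 n :: real
  assumes W: "0 \<le> W" "W \<le> a0 * Y" and a0: "0 \<le> a0" "a0 \<le> 1" and n: "n \<ge> 1"
    and t: "W\<^sup>2 / n \<le> t" "t \<le> W\<^sup>2" and Y: "Y \<ge> 0"
  shows "sqrt ((Y\<^sup>2 - t) * (W\<^sup>2 - t)) + t \<le> Y * W * (1 - (1 - a0)\<^sup>2 / (2 * n))"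
proof (cases "Y * W = 0")
  case True
  then have "W = 0" using W a0 Y by (auto simp: mult_eq_0_iff)
  then have "t = 0" using t by simp
  then show ?thesis using \<open>W = 0\<close> by simp
next
  case False
  then have pos: "Y > 0" "W > 0" using W Y by (auto simp: less_le)
  have WY: "W \<le> Y" using W a0 Y by (metis mult_left_le_one_le order_trans mult.commute)
  have t0: "t \<ge> 0" using t(1) n by (meson divide_nonneg_nonneg order_trans zero_le_power2 zero_le_one)
  define A where "A = Y * W - t"
  have A: "A \<ge> 0" unfolding A_def using t(2) mult_right_mono[OF WY W(1)] by (simp add: power2_eq_square)
  \<comment> \<open>The linear term in the expansion of the square root of
    \<open>A\<^sup>2 - t * (Y - W)\<^sup>2\<close>, with \<open>A\<close> in the denominator
    replaced by the larger \<open>Y * W\<close>.\<close>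
  define e where "e = t * (Y - W)\<^sup>2 / (2 * (Y * W))"
  have e0: "e \<ge> 0" using t0 pos by (simp add: e_def)
  have id: "(Y\<^sup>2 - t) * (W\<^sup>2 - t) = A\<^sup>2 - t * (Y - W)\<^sup>2"
    by (simp add: A_def power2_eq_square algebra_simps)
  have te: "t * (Y - W)\<^sup>2 = e * (2 * (Y * W))" using pos by (simp add: e_def)
  have "A * e \<le> (Y * W) * e" using e0 t0 by (intro mult_right_mono) (auto simp: A_def)
  then have "2 * (A * e) \<le> e * e + 2 * ((Y * W) * e)" using zero_le_square[of e] by linarith
  then have le: "A\<^sup>2 - t * (Y - W)\<^sup>2 \<le> (A - e)\<^sup>2"
    unfolding te by (simp add: power2_eq_square algebra_simps)
  \<comment> \<open>Ensures that the root of \<open>(A - e)\<^sup>2\<close> is \<open>A - e\<close>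
    and not its negative.\<close>
  have eA: "e \<le> A"
  proof -
    have "t * (Y - W)\<^sup>2 \<le> W\<^sup>2 * (Y - W)\<^sup>2" using t by (intro mult_right_mono) auto
    moreover have "W\<^sup>2 * (Y - W)\<^sup>2 \<le> (Y * W) * (Y * W - W\<^sup>2)"
    proof -
      have "W * (Y - W) \<le> Y * W" using pos WY by (simp add: algebra_simps)
      then have "W * (Y - W) * (W * (Y - W)) \<le> (Y * W) * (W * (Y - W))"
        using pos WY by (intro mult_right_mono) auto
      then show ?thesis by (simp add: power2_eq_square algebra_simps)
    qed
    moreover have "(Y * W) * (Y * W - W\<^sup>2) \<le> (Y * W) * A"
      using pos t by (intro mult_left_mono) (auto simp: A_def)
    ultimately have "e * (2 * (Y * W)) \<le> A * (Y * W)" unfolding te by (simp add: mult.commute)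
    then have "e * 2 \<le> A" using pos by (simp add: mult.assoc[symmetric])
    then show ?thesis using e0 by simp
  qed
  have "sqrt ((Y\<^sup>2 - t) * (W\<^sup>2 - t)) \<le> A - e"
    unfolding id using le eA by (intro real_le_lsqrt) auto
  moreover have "Y * W * ((1 - a0)\<^sup>2 / (2 * n)) \<le> e"
  proof -
    have "Y * (1 - a0) \<le> Y - W" using W by (simp add: algebra_simps)
    then have "(Y * (1 - a0))\<^sup>2 \<le> (Y - W)\<^sup>2" using a0 Y by (intro power_mono) auto
    then have "W\<^sup>2 / n * (Y * (1 - a0))\<^sup>2 \<le> t * (Y - W)\<^sup>2"
      using t(1) t0 by (intro mult_mono) auto
    then have "W\<^sup>2 / n * (Y * (1 - a0))\<^sup>2 / (2 * (Y * W)) \<le> e"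
      unfolding e_def using pos by (intro divide_right_mono) auto
    moreover have "W\<^sup>2 / n * (Y * (1 - a0))\<^sup>2 / (2 * (Y * W)) = Y * W * ((1 - a0)\<^sup>2 / (2 * n))"
      unfolding power_mult_distrib
      using pos n by (simp add: power2_eq_square[of W] power2_eq_square[of Y] divide_simps)
    ultimately show ?thesis by simp
  qed
  ultimately show ?thesis by (simp add: A_def algebra_simps)
qed

section \<open>The branch average and the distance to the stabilizer states\<close>

definition avg :: "'p::prime_card mod_ring \<Rightarrow> 'n::finite \<Rightarrow> real \<Rightarrow> (('n, 'p) idx cvec \<Rightarrow> real)
    \<Rightarrow> ('n, 'p) idx cvec \<Rightarrow> real" where
  "avg a q1 \<theta> f y = (\<Sum>C\<in>proj_clifford. \<Sum>m\<in>UNIV. f (KU a q1 (rep_unitary C) m \<theta> *v y))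
     / real (card (proj_clifford :: ('n, 'p) idx cmat set set))"

text \<open>The distance of \<open>y\<close> from the nearest complex line spanned by a stabilizer
  state, without normalizing \<open>y\<close>.\<close>

definition sdist :: "('n::finite, 'p::prime_card) idx cvec \<Rightarrow> real" where
  "sdist y = Min ((\<lambda>s. norm (prp (rep_vec s) y)) ` stabilizer_states)"

text \<open>The factor \<open>norm y\<close> makes it homogeneous of degree two, like the branch
  probabilities. On unit vectors it is the sine of the Fubini-Study distance to the stabilizer
  states.\<close>

definition hfun :: "('n::finite, 'p::prime_card) idx cvec \<Rightarrow> real" where
  "hfun y = norm y * sdist y"

text \<open>The three constants are parameters tied to their values by equations, so that they stay
  atomic in calculations. The finiteness of the group is assumed here and later derived from the
  existence of an invariant probability (\<open>finite_proj_clifford\<close>).\<close>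

locale monitored = odd_qudit field_type for field_type :: "'p::prime_card itself" +
  fixes a :: "'p mod_ring" and q1 :: "'n::finite" and Nc Dim nn :: real
  assumes fin_cl: "finite (proj_clifford :: ('n, 'p) idx cmat set set)"
    and Nc_def: "Nc = real (card (proj_clifford :: ('n, 'p) idx cmat set set))"
    and Dim_def: "Dim = real CARD('p) ^ CARD('n)"
    and nn_def: "nn = real CARD('n)"
begin

abbreviation Cl :: "('n, 'p) idx cmat set set" where "Cl \<equiv> proj_clifford"
abbreviation Stab :: "('n, 'p) idx cmat set" where "Stab \<equiv> stabilizer_states"
abbreviation K where "K C m \<theta> \<equiv> KU a q1 (rep_unitary (C :: ('n, 'p) idx cmat set)) m \<theta>"

lemma Cl_nonempty: "Cl \<noteq> {}"
proof -
  have "proj_class (mat 1 :: ('n, 'p) idx cmat) \<in> proj_clifford"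
    using cliff_mat_1 by (simp add: proj_class_in_proj_clifford_iff unitary_mat_1)
  then show ?thesis by blast
qed

lemma Nc_pos: "Nc > 0" and Nc_ge_1: "Nc \<ge> 1"
  unfolding Nc_def using fin_cl Cl_nonempty card_gt_0_iff[of Cl] by (auto simp: Suc_le_eq)

lemma nn_ge_1: "nn \<ge> 1"
  by (simp add: nn_def Suc_le_eq)

lemma Dim_gt_1: "Dim > 1"
proof -
  have "real CARD('p) > 1" using nontriv[where 'a = 'p] by simp
  then show ?thesis unfolding Dim_def by (intro one_less_power) auto
qed

lemma Stab_finite: "finite Stab"
proof -
  have "Stab = (\<lambda>C. ray (rep_unitary C *v axis (\<lambda>_. 0) 1)) ` Cl"
    by (auto simp: stabilizer_states_def)
  note eq = this
  show ?thesis unfolding eq by (rule finite_imageI[OF fin_cl])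
qed

lemma Stab_nonempty: "Stab \<noteq> {}"
  unfolding stabilizer_states_eq using stab_vec_axis by blast

lemma rep_unitary_cliff: "C \<in> Cl \<Longrightarrow> cliff (rep_unitary C)"
  and rep_unitary_unitary: "C \<in> Cl \<Longrightarrow> unitary (rep_unitary C)"
  using proj_clifford_rep(1) cliff_unitary by blast+

lemma rep_vec_norm: "s \<in> Stab \<Longrightarrow> norm (rep_vec s) = 1"
  by (simp add: stab_vec_norm stab_vec_rep_vec)

lemma avg_mono: "(\<And>y. f y \<le> g y) \<Longrightarrow> avg a q1 \<theta> f y \<le> avg a q1 \<theta> g (y :: ('n, 'p) idx cvec)"
  unfolding avg_def by (intro divide_right_mono sum_mono) auto

lemma avg_add: "avg a q1 \<theta> (\<lambda>y. f y + g y) y = avg a q1 \<theta> f y + avg a q1 \<theta> g (y :: ('n, 'p) idx cvec)"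
  by (simp add: avg_def sum.distrib add_divide_distrib)

lemma avg_cmult: "avg a q1 \<theta> (\<lambda>y. c * f y) y = c * avg a q1 \<theta> f (y :: ('n, 'p) idx cvec)"
  by (simp add: avg_def sum_distrib_left)

lemma avg_norm: "avg a q1 \<theta> (\<lambda>y. (norm y)\<^sup>2) y = (norm (y :: ('n, 'p) idx cvec))\<^sup>2"
proof -
  have "(\<Sum>C\<in>Cl. \<Sum>m\<in>UNIV. (norm (K C m \<theta> *v y))\<^sup>2) = (\<Sum>C\<in>Cl. (norm y)\<^sup>2)"
    by (intro sum.cong refl KU_norm_sum rep_unitary_unitary)
  then show ?thesis using Nc_pos by (simp add: avg_def Nc_def)
qed

lemma avg_smult:
  assumes "\<And>c y. f (c *s y) = (cmod c)\<^sup>2 * f y"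
  shows "avg a q1 \<theta> f (c *s y) = (cmod c)\<^sup>2 * avg a q1 \<theta> f (y :: ('n, 'p) idx cvec)"
  by (simp add: avg_def matvec_smult assms sum_distrib_left)

text \<open>Replacing \<open>y\<close> by \<open>V *v y\<close> translates the group element of each
  branch by \<open>V\<close>, and the leftover \<open>dagger V\<close> is invisible to
  \<open>f\<close>.\<close>

lemma avg_cliff:
  fixes y :: "('n, 'p) idx cvec"
  assumes V: "cliff V" and f: "\<And>V y. cliff V \<Longrightarrow> f (V *v y) = f y"
  shows "avg a q1 \<theta> f (V *v y) = avg a q1 \<theta> f y"
proof -
  let ?\<Phi> = "\<lambda>U. \<Sum>m\<in>UNIV. f (KU a q1 U m \<theta> *v y)"
  have "(\<Sum>C\<in>Cl. \<Sum>m\<in>UNIV. f (K C m \<theta> *v (V *v y))) = (\<Sum>C\<in>Cl. ?\<Phi> (rep_unitary C ** V))"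
    by (simp only: KU_mult f[OF cliff_dagger[OF V]])
  also have "\<dots> = (\<Sum>C\<in>Cl. ?\<Phi> (rep_unitary C))"
    by (rule sum_proj_clifford_shift[OF V, where \<Phi> = ?\<Phi>]) (simp only: KU_phase)
  finally show ?thesis by (simp add: avg_def)
qed

subsection \<open>Distance to the stabilizer states\<close>

lemma prp_stab_in: "stab_vec \<phi> \<Longrightarrow> norm (prp \<phi> y) \<in> (\<lambda>s. norm (prp (rep_vec s) y)) ` Stab"
proof -
  assume \<phi>: "stab_vec (\<phi> :: ('n, 'p) idx cvec)"
  obtain c where "cmod c = 1" "rep_vec (outer \<phi>) = c *s \<phi>"
    using rep_vec_outer[OF stab_vec_norm[OF \<phi>]] by blast
  then have "norm (prp (rep_vec (outer \<phi>)) y) = norm (prp \<phi> y)" by (simp add: prp_phase)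
  moreover have "outer \<phi> \<in> Stab" using \<phi> by (auto simp: stabilizer_states_eq)
  ultimately show ?thesis by (intro image_eqI[where x = "outer \<phi>"]) auto
qed

lemma sdist_le: "stab_vec \<phi> \<Longrightarrow> sdist y \<le> norm (prp \<phi> (y :: ('n, 'p) idx cvec))"
  unfolding sdist_def using prp_stab_in Stab_finite by (intro Min_le) auto

lemma sdist_attained:
  obtains s where "s \<in> Stab" "sdist y = norm (prp (rep_vec s) (y :: ('n, 'p) idx cvec))"
proof -
  have "sdist y \<in> (\<lambda>s. norm (prp (rep_vec s) y)) ` Stab"
    unfolding sdist_def using Stab_finite Stab_nonempty by (intro Min_in) auto
  then show ?thesis using that by blast
qed

lemma sdist_nonneg: "sdist (y :: ('n, 'p) idx cvec) \<ge> 0"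
  by (rule sdist_attained[of y]) simp

lemma sdist_le_norm: "sdist (y :: ('n, 'p) idx cvec) \<le> norm y"
  by (rule sdist_attained[of y]) (simp add: norm_prp_le rep_vec_norm)

lemma sdist_diff_le: "sdist y \<le> sdist z + norm (y - z :: ('n, 'p) idx cvec)"
proof -
  obtain s where s: "s \<in> Stab" "sdist z = norm (prp (rep_vec s) z)" by (rule sdist_attained)
  have "sdist y \<le> norm (prp (rep_vec s) y)" using s sdist_le stab_vec_rep_vec by blast
  also have "prp (rep_vec s) y = prp (rep_vec s) z + prp (rep_vec s) (y - z)" by (simp add: prp_diff)
  also have "norm \<dots> \<le> norm (prp (rep_vec s) z) + norm (prp (rep_vec s) (y - z))" by (rule norm_triangle_ineq)
  also have "\<dots> \<le> sdist z + norm (y - z)" using s by (simp add: norm_prp_le rep_vec_norm)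
  finally show ?thesis .
qed

lemma sdist_smult: "sdist (c *s y) = cmod c * sdist (y :: ('n, 'p) idx cvec)"
proof -
  have "(\<lambda>s. norm (prp (rep_vec s) (c *s y))) ` Stab = (\<lambda>x. cmod c * x) ` (\<lambda>s. norm (prp (rep_vec s) y)) ` Stab"
    by (simp add: prp_smult norm_smult image_image)
  moreover have "Min ((\<lambda>x. cmod c * x) ` (\<lambda>s. norm (prp (rep_vec s) y)) ` Stab)
      = cmod c * Min ((\<lambda>s. norm (prp (rep_vec s) y)) ` Stab)"
  proof (rule mono_Min_commute[symmetric])
    show "mono (\<lambda>x :: real. cmod c * x)" by (intro monoI mult_left_mono norm_ge_zero)
  qed (simp_all add: Stab_finite Stab_nonempty)
  ultimately show ?thesis by (simp add: sdist_def)
qed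

text \<open>Computational basis states are stabilizer states, and one of them carries at least the
  fraction \<open>1 / Dim\<close> of the weight of \<open>y\<close>. This keeps the orthogonal part
  strictly shorter than \<open>y\<close>, as \<open>contraction_inequality\<close> requires for a
  gain.\<close>

lemma sdist_norm_bound: "(sdist y)\<^sup>2 \<le> (1 - 1 / Dim) * (norm (y :: ('n, 'p) idx cvec))\<^sup>2"
proof -
  have sq: "(norm y)\<^sup>2 = (\<Sum>x\<in>UNIV. (cmod (y $ x))\<^sup>2)"
    by (simp add: norm_vec_def L2_set_def sum_nonneg)
  have "\<exists>x. (cmod (y $ x))\<^sup>2 \<ge> (norm y)\<^sup>2 / Dim"
  proof (rule ccontr)
    assume "\<not> ?thesis"
    then have "(\<Sum>x\<in>(UNIV :: ('n, 'p) idx set). (cmod (y $ x))\<^sup>2) < (\<Sum>x\<in>(UNIV :: ('n, 'p) idx set). (norm y)\<^sup>2 / Dim)"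
      by (intro sum_strict_mono) (auto simp: not_le)
    also have "\<dots> = real CARD(('n, 'p) idx) * ((norm y)\<^sup>2 / Dim)" by simp
    also have "\<dots> = (norm y)\<^sup>2" unfolding card_idx Dim_def[symmetric] using Dim_gt_1 by simp
    finally show False unfolding sq[symmetric] by simp
  qed
  then obtain x where x: "(cmod (y $ x))\<^sup>2 \<ge> (norm y)\<^sup>2 / Dim" by blast
  have "(norm y)\<^sup>2 = (cmod (y $ x))\<^sup>2 + (norm (prp (axis x 1) y))\<^sup>2"
    by (rule norm_prp[OF norm_axis_1[of x], of y, unfolded braket_axis_left])
  moreover have "(sdist y)\<^sup>2 \<le> (norm (prp (axis x 1) y))\<^sup>2"
    by (intro power_mono sdist_le stab_vec_axis sdist_nonneg)
  moreover have "(1 - 1 / Dim) * (norm y)\<^sup>2 = (norm y)\<^sup>2 - (norm y)\<^sup>2 / Dim"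
    by (simp add: left_diff_distrib)
  ultimately show ?thesis using x by linarith
qed

lemma hfun_nonneg: "hfun (y :: ('n, 'p) idx cvec) \<ge> 0"
  by (simp add: hfun_def sdist_nonneg)

lemma hfun_le: "stab_vec \<phi> \<Longrightarrow> hfun y \<le> norm y * norm (prp \<phi> (y :: ('n, 'p) idx cvec))"
  by (simp add: hfun_def mult_left_mono sdist_le)

lemma hfun_smult: "hfun (c *s y) = (cmod c)\<^sup>2 * hfun (y :: ('n, 'p) idx cvec)"
  by (simp add: hfun_def sdist_smult norm_smult power2_eq_square)

lemma hfun_le_norm: "hfun y \<le> (norm (y :: ('n, 'p) idx cvec))\<^sup>2"
  by (simp add: hfun_def power2_eq_square mult_left_mono sdist_le_norm)

lemma hfun_diff_le: "hfun y \<le> hfun z + (norm y + norm z) * norm (y - z :: ('n, 'p) idx cvec)"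
proof -
  have "hfun y - hfun z = (norm y - norm z) * sdist z + norm y * (sdist y - sdist z)"
    by (simp add: hfun_def algebra_simps)
  also have "\<dots> \<le> norm (y - z) * norm z + norm y * norm (y - z)"
  proof (rule add_mono)
    have "(norm y - norm z) * sdist z \<le> norm (y - z) * sdist z"
      by (intro mult_right_mono norm_triangle_ineq2 sdist_nonneg)
    also have "\<dots> \<le> norm (y - z) * norm z" by (intro mult_left_mono sdist_le_norm norm_ge_zero)
    finally show "(norm y - norm z) * sdist z \<le> norm (y - z) * norm z" .
    show "norm y * (sdist y - sdist z) \<le> norm y * norm (y - z)"
      using sdist_diff_le[of y z] by (intro mult_left_mono) auto
  qed
  finally show ?thesis by (simp add: algebra_simps)
qed

text \<open>The branch maps the line of \<open>\<phi>\<close> into the line of a stabilizer vector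
  \<open>\<phi>'\<close>, so only the part of \<open>y\<close> orthogonal to \<open>\<phi>\<close>
  contributes to the distance of the image from \<open>\<phi>'\<close>.\<close>

lemma hfun_branch:
  assumes C: "C \<in> Cl" and \<phi>: "stab_vec \<phi>"
  shows "hfun (K C m 0 *v y) \<le> norm (K C m 0 *v y) * norm (K C m 0 *v prp \<phi> (y :: ('n, 'p) idx cvec))"
proof -
  obtain c \<phi>' where c: "stab_vec \<phi>'" "K C m 0 *v \<phi> = c *s \<phi>'"
    using KU_stab_vec[OF rep_unitary_cliff[OF C] \<phi>] by blast
  have "K C m 0 *v y = (braket \<phi> y * c) *s \<phi>' + K C m 0 *v prp \<phi> y"
    by (subst prp_decomp[of y \<phi>]) (simp add: matrix_vector_right_distrib matvec_smult c vector_smult_assoc)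
  then have "prp \<phi>' (K C m 0 *v y) = prp \<phi>' (K C m 0 *v prp \<phi> y)"
    using prp_self[OF stab_vec_norm[OF c(1)]] by (simp add: prp_add prp_smult)
  then have "norm (prp \<phi>' (K C m 0 *v y)) \<le> norm (K C m 0 *v prp \<phi> y)"
    using norm_prp_le[OF stab_vec_norm[OF c(1)]] by simp
  then show ?thesis
    using hfun_le[OF c(1), of "K C m 0 *v y"]
    by (elim order_trans) (intro mult_left_mono norm_ge_zero)
qed

text \<open>The gain of \<open>contraction_inequality\<close> for
  \<open>a0 = sqrt (1 - 1 / Dim)\<close> and \<open>n = nn\<close>, divided by the number of
  Clifford classes, since only one of them is known to gain.\<close>

definition gap :: real where
  "gap = (1 - sqrt (1 - 1 / Dim))\<^sup>2 / (2 * nn) / Nc"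

definition rate :: real where
  "rate = 1 - gap"

lemma gap_pos: "gap > 0"
proof -
  have "sqrt (1 - 1 / Dim) < 1" using Dim_gt_1 by simp
  then show ?thesis using Nc_pos nn_ge_1 by (simp add: gap_def)
qed

lemma gap_lt_1: "gap < 1"
proof -
  have "0 \<le> sqrt (1 - 1 / Dim)" "sqrt (1 - 1 / Dim) < 1" using Dim_gt_1 by simp_all
  then have "(1 - sqrt (1 - 1 / Dim))\<^sup>2 \<le> 1" by (intro power_le_one) auto
  moreover have "2 * nn * Nc \<ge> 2 * 1 * 1"
    using Nc_ge_1 nn_ge_1 by (intro mult_mono) auto
  ultimately show ?thesis using Nc_ge_1 nn_ge_1 by (simp add: gap_def divide_simps)
qed

lemma rate: "0 < rate" "rate < 1"
  using gap_pos gap_lt_1 by (auto simp: rate_def)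

lemma branch_sum_le:
  assumes "C \<in> Cl"
  shows "(\<Sum>m\<in>UNIV. norm (K C m \<theta> *v y) * norm (K C m \<theta> *v z)) \<le> norm y * norm (z :: ('n, 'p) idx cvec)"
  using sum_norm_mult_le[of "\<lambda>m. norm (K C m \<theta> *v y)" "\<lambda>m. norm (K C m \<theta> *v z)" UNIV]
  by (simp add: KU_norm_sum[OF rep_unitary_unitary[OF assms]])

text \<open>One Clifford class gains the factor \<open>1 - e\<close> and the others do not lose;
  averaging dilutes the gain by \<open>Nc\<close>.\<close>

lemma sum_Cl_gain:
  assumes "\<And>C. C \<in> Cl \<Longrightarrow> F C \<le> (B :: real)" and "C0 \<in> Cl" "F C0 \<le> B * (1 - e)"
    and "B \<ge> 0" "e \<ge> gap * Nc"
  shows "(\<Sum>C\<in>Cl. F C) / Nc \<le> rate * B"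
proof -
  have "(\<Sum>C\<in>Cl. F C) = F C0 + (\<Sum>C\<in>Cl - {C0}. F C)"
    using fin_cl assms(2) by (rule sum.remove)
  also have "\<dots> \<le> B * (1 - e) + (\<Sum>C\<in>Cl - {C0}. B)"
    using assms by (intro add_mono sum_mono) auto
  also have "(\<Sum>C\<in>Cl - {C0}. B) = (Nc - 1) * B"
    using assms(2) fin_cl Nc_ge_1 by (simp add: card_Diff_singleton of_nat_diff Nc_def)
  finally have "(\<Sum>C\<in>Cl. F C) \<le> Nc * B - e * B" by (simp add: algebra_simps)
  also have "\<dots> \<le> Nc * B - (gap * Nc) * B" using assms by (intro diff_left_mono mult_right_mono) auto
  finally show ?thesis unfolding pos_divide_le_eq[OF Nc_pos] rate_def by (simp add: algebra_simps)
qed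

lemma gap_Nc: "gap * Nc = (1 - sqrt (1 - 1 / Dim))\<^sup>2 / (2 * nn)"
  using Nc_pos by (simp add: gap_def)

text \<open>For the contracting Clifford \<open>\<phi>\<close> survives only in the outcome
  \<open>m0\<close>, so its sum is a single norm, shortened by the root of
  \<open>1 - 1 / nn\<close>. This gain exceeds the one that \<open>gap\<close> provides for, and for
  the other Cliffords Cauchy-Schwarz suffices.\<close>

lemma tangent_contraction:
  fixes v :: "('n, 'p) idx cvec"
  assumes \<phi>: "stab_vec \<phi>" and v: "braket \<phi> v = 0"
  shows "(\<Sum>C\<in>Cl. \<Sum>m\<in>UNIV. norm (K C m 0 *v \<phi>) * norm (K C m 0 *v v)) / Nc \<le> rate * norm v"
proof -
  obtain C m0 where C: "C \<in> Cl" "\<And>m. K C m 0 *v \<phi> = (if m = m0 then \<phi> else 0)"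
    "(norm (K C m0 0 *v v))\<^sup>2 \<le> (1 - 1 / nn) * (norm v)\<^sup>2"
    using exists_contracting_clifford[OF \<phi> v, of a q1] unfolding nn_def by blast
  note n1 = nn_ge_1
  have "(\<Sum>m\<in>UNIV. norm (K C m 0 *v \<phi>) * norm (K C m 0 *v v)) = (\<Sum>m\<in>UNIV. if m = m0 then norm (K C m0 0 *v v) else 0)"
    using stab_vec_norm[OF \<phi>] by (intro sum.cong) (auto simp: C(2))
  also have "\<dots> = norm (K C m0 0 *v v)" by simp
  also have "\<dots> \<le> norm v * (1 - 1 / (2 * nn))"
  proof (rule power2_le_imp_le)
    have "1 - 1 / nn \<le> (1 - 1 / (2 * nn))\<^sup>2"
      using n1 by (simp add: power2_eq_square field_simps)
    then have "(1 - 1 / nn) * (norm v)\<^sup>2 \<le> (1 - 1 / (2 * nn))\<^sup>2 * (norm v)\<^sup>2"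
      by (rule mult_right_mono) simp
    then show "(norm (K C m0 0 *v v))\<^sup>2 \<le> (norm v * (1 - 1 / (2 * nn)))\<^sup>2"
      using C(3) unfolding power_mult_distrib by (simp add: mult.commute)
    show "0 \<le> norm v * (1 - 1 / (2 * nn))" using n1 by (simp add: divide_simps)
  qed
  finally have gain: "(\<Sum>m\<in>UNIV. norm (K C m 0 *v \<phi>) * norm (K C m 0 *v v)) \<le> norm v * (1 - 1 / (2 * nn))" .
  have "gap * Nc \<le> 1 / (2 * nn)"
  proof -
    have "0 \<le> sqrt (1 - 1 / Dim)" "sqrt (1 - 1 / Dim) < 1" using Dim_gt_1 by simp_all
    then have "(1 - sqrt (1 - 1 / Dim))\<^sup>2 \<le> 1" by (intro power_le_one) auto
    then show ?thesis unfolding gap_Nc using n1 by (intro divide_right_mono) auto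
  qed
  then show ?thesis
    using branch_sum_le[of _ 0 \<phi> v] stab_vec_norm[OF \<phi>] C(1) gain
    by (intro sum_Cl_gain[where e = "1 / (2 * nn)"]) auto
qed

text \<open>Let \<open>\<phi>\<close> be nearest to \<open>y\<close> and \<open>w\<close> the
  orthogonal part. For the contracting Clifford the outcome \<open>m0\<close> is bounded by
  \<open>hfun_branch\<close> and every other outcome by the squared norm of its image;
  \<open>contraction_inequality\<close> turns their sum into a gain. For any other Clifford,
  \<open>hfun_branch\<close> and Cauchy-Schwarz over the outcomes give no increase.\<close>

lemma avg_hfun_0: "avg a q1 0 hfun y \<le> rate * hfun (y :: ('n, 'p) idx cvec)"
proof -
  obtain s where s: "s \<in> Stab" "sdist y = norm (prp (rep_vec s) y)" by (rule sdist_attained)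
  define \<phi> where "\<phi> = rep_vec s"
  have \<phi>: "stab_vec \<phi>" using s by (simp add: \<phi>_def stab_vec_rep_vec)
  define w where "w = prp \<phi> y"
  have W: "norm w = sdist y" using s by (simp add: w_def \<phi>_def)
  have wo: "braket \<phi> w = 0" unfolding w_def by (rule braket_prp[OF stab_vec_norm[OF \<phi>]])
  obtain C m0 where C: "C \<in> Cl" "\<And>m. K C m 0 *v \<phi> = (if m = m0 then \<phi> else 0)"
    "(norm (K C m0 0 *v w))\<^sup>2 \<le> (1 - 1 / nn) * (norm w)\<^sup>2"
    using exists_contracting_clifford[OF \<phi> wo, of a q1] unfolding nn_def by blast
  note un = rep_unitary_unitary[OF C(1)]
  note n1 = nn_ge_1
  \<comment> \<open>The weight that \<open>w\<close> loses to the outcomes other than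
    \<open>m0\<close>. These annihilate \<open>\<phi>\<close>, so they act on \<open>y\<close> as on
    \<open>w\<close>, and \<open>y\<close> loses the same weight.\<close>
  define t where "t = (norm w)\<^sup>2 - (norm (K C m0 0 *v w))\<^sup>2"
  have yw: "K C m 0 *v y = K C m 0 *v w" if "m \<noteq> m0" for m
    unfolding w_def by (subst prp_decomp[of y \<phi>]) (simp add: matrix_vector_right_distrib matvec_smult C(2) that)
  have split: "(\<Sum>m\<in>UNIV. g m) = g m0 + (\<Sum>m\<in>UNIV - {m0}. g m)" for g :: "'p mod_ring \<Rightarrow> real"
    by (rule sum.remove) auto
  have t_sum: "t = (\<Sum>m\<in>UNIV - {m0}. (norm (K C m 0 *v w))\<^sup>2)"
    using KU_norm_sum[OF un, of a q1 0 w] split[of "\<lambda>m. (norm (K C m 0 *v w))\<^sup>2"] by (simp add: t_def)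
  have y0: "(norm (K C m0 0 *v y))\<^sup>2 = (norm y)\<^sup>2 - t"
    using KU_norm_sum[OF un, of a q1 0 y] split[of "\<lambda>m. (norm (K C m 0 *v y))\<^sup>2"]
    by (simp add: t_sum yw)
  have w0: "(norm (K C m0 0 *v w))\<^sup>2 = (norm w)\<^sup>2 - t" by (simp add: t_def)
  have "(\<Sum>m\<in>UNIV. hfun (K C m 0 *v y)) \<le> norm (K C m0 0 *v y) * norm (K C m0 0 *v w)
      + (\<Sum>m\<in>UNIV - {m0}. (norm (K C m 0 *v w))\<^sup>2)"
    unfolding split[of "\<lambda>m. hfun (K C m 0 *v y)"]
  proof (intro add_mono sum_mono)
    show "hfun (K C m0 0 *v y) \<le> norm (K C m0 0 *v y) * norm (K C m0 0 *v w)"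
      unfolding w_def by (rule hfun_branch[OF C(1) \<phi>])
    show "hfun (K C m 0 *v y) \<le> (norm (K C m 0 *v w))\<^sup>2" if "m \<in> UNIV - {m0}" for m
      using that yw hfun_le_norm by auto
  qed
  also have "norm (K C m0 0 *v y) * norm (K C m0 0 *v w) = sqrt (((norm y)\<^sup>2 - t) * ((norm w)\<^sup>2 - t))"
    unfolding y0[symmetric] w0[symmetric] by (simp add: real_sqrt_mult)
  also have "sqrt (((norm y)\<^sup>2 - t) * ((norm w)\<^sup>2 - t)) + (\<Sum>m\<in>UNIV - {m0}. (norm (K C m 0 *v w))\<^sup>2)
      \<le> norm y * norm w * (1 - (1 - sqrt (1 - 1 / Dim))\<^sup>2 / (2 * nn))"
    unfolding t_sum[symmetric]
  proof (rule contraction_inequality[OF norm_ge_zero _ _ _ n1])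
    show "norm w \<le> sqrt (1 - 1 / Dim) * norm y"
      using sdist_norm_bound[of y] Dim_gt_1 unfolding W
      by (rule_tac power2_le_imp_le) (simp_all add: power_mult_distrib)
    show "(norm w)\<^sup>2 / nn \<le> t" using C(3) by (simp add: t_def algebra_simps)
    show "t \<le> (norm w)\<^sup>2" by (simp add: t_def)
  qed (use Dim_gt_1 in auto)
  finally have gain: "(\<Sum>m\<in>UNIV. hfun (K C m 0 *v y)) \<le> hfun y * (1 - gap * Nc)"
    by (simp add: hfun_def W gap_Nc)
  have "(\<Sum>m\<in>UNIV. hfun (K C m 0 *v y)) \<le> hfun y" if "C \<in> Cl" for C
  proof -
    have "(\<Sum>m\<in>UNIV. hfun (K C m 0 *v y)) \<le> (\<Sum>m\<in>UNIV. norm (K C m 0 *v y) * norm (K C m 0 *v w))"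
      unfolding w_def by (intro sum_mono hfun_branch that \<phi>)
    also have "\<dots> \<le> norm y * norm w" by (rule branch_sum_le[OF that])
    finally show ?thesis by (simp add: hfun_def W)
  qed
  then show ?thesis unfolding avg_def Nc_def[symmetric]
    using C(1) gain hfun_nonneg by (intro sum_Cl_gain[where e = "gap * Nc"]) auto
qed

section \<open>Dependence of the average on the angle\<close>

lemma branch_lipschitz:
  "\<exists>B\<ge>1. \<forall>C\<in>Cl. \<forall>m \<theta> (y :: ('n, 'p) idx cvec). 0 \<le> \<theta> \<and> \<theta> \<le> 1 \<longrightarrow>
    norm (K C m \<theta> *v y - K C m 0 *v y) \<le> B * \<theta> * norm y"
proof -
  obtain B where B: "B \<ge> 1" "\<And>(U :: ('n, 'p) idx cmat) m y. unitary U \<Longrightarrow> norm (KD a q1 U m *v y) \<le> B * norm y"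
    "\<And>(U :: ('n, 'p) idx cmat) m y \<theta>. unitary U \<Longrightarrow>
     norm (KU a q1 U m \<theta> *v y - KU a q1 U m 0 *v y - \<theta> *\<^sub>R (KD a q1 U m *v y)) \<le> B * \<theta>\<^sup>2 * norm y"
    using KU_second_order[of a q1] by blast
  have "norm (K C m \<theta> *v y - K C m 0 *v y) \<le> (2 * B) * \<theta> * norm y"
    if "C \<in> Cl" "0 \<le> \<theta>" "\<theta> \<le> 1" for C m \<theta> and y :: "('n, 'p) idx cvec"
  proof -
    note un = rep_unitary_unitary[OF that(1)]
    have "norm (K C m \<theta> *v y - K C m 0 *v y)
        \<le> norm (K C m \<theta> *v y - K C m 0 *v y - \<theta> *\<^sub>R (KD a q1 (rep_unitary C) m *v y))
          + norm (\<theta> *\<^sub>R (KD a q1 (rep_unitary C) m *v y))"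
      using norm_triangle_ineq[of "K C m \<theta> *v y - K C m 0 *v y - \<theta> *\<^sub>R (KD a q1 (rep_unitary C) m *v y)"
          "\<theta> *\<^sub>R (KD a q1 (rep_unitary C) m *v y)"] by (simp only: diff_add_cancel)
    also have "\<dots> \<le> B * \<theta>\<^sup>2 * norm y + \<theta> * (B * norm y)"
      using B(2,3)[OF un] that by (intro add_mono) (auto intro!: mult_left_mono)
    also have "\<dots> \<le> B * \<theta> * norm y + \<theta> * (B * norm y)"
      using that B(1) by (intro add_mono mult_right_mono mult_left_mono) (auto simp: power2_eq_square mult_left_le)
    finally show ?thesis by (simp add: algebra_simps)
  qed
  then show ?thesis using B(1) by (intro exI[of _ "2 * B"]) auto
qed

text \<open>The Lyapunov drift: passing from angle 0 to \<theta> moves each branch vector by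
  \<open>O(\<theta> * norm y)\<close>, and \<open>hfun\<close> changes by at most the sum of the
  norms times the displacement.\<close>

lemma avg_hfun:
  "\<exists>B\<ge>0. \<forall>\<theta> (y :: ('n, 'p) idx cvec). 0 \<le> \<theta> \<and> \<theta> \<le> 1 \<longrightarrow>
    avg a q1 \<theta> hfun y \<le> rate * hfun y + B * \<theta> * (norm y)\<^sup>2"
proof -
  obtain B where B: "B \<ge> 1" "\<And>C m \<theta> (y :: ('n, 'p) idx cvec). C \<in> Cl \<Longrightarrow> 0 \<le> \<theta> \<Longrightarrow> \<theta> \<le> 1 \<Longrightarrow>
    norm (K C m \<theta> *v y - K C m 0 *v y) \<le> B * \<theta> * norm y"
    using branch_lipschitz by blast
  have "avg a q1 \<theta> hfun y \<le> rate * hfun y + (real CARD('p) * 2 * B) * \<theta> * (norm y)\<^sup>2"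
    if \<theta>: "0 \<le> \<theta>" "\<theta> \<le> 1" for \<theta> and y :: "('n, 'p) idx cvec"
  proof -
    have "hfun (K C m \<theta> *v y) \<le> hfun (K C m 0 *v y) + 2 * B * \<theta> * (norm y)\<^sup>2" if C: "C \<in> Cl" for C m
    proof -
      note le = norm_KU_le[OF rep_unitary_unitary[OF C]]
      have "(norm (K C m \<theta> *v y) + norm (K C m 0 *v y)) * norm (K C m \<theta> *v y - K C m 0 *v y)
          \<le> (norm y + norm y) * (B * \<theta> * norm y)"
        using B(2)[OF C \<theta>] by (intro mult_mono add_mono le) auto
      then show ?thesis
        using hfun_diff_le[of "K C m \<theta> *v y" "K C m 0 *v y"] by (simp add: power2_eq_square algebra_simps)
    qed
    then have "(\<Sum>C\<in>Cl. \<Sum>m\<in>UNIV. hfun (K C m \<theta> *v y))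
        \<le> (\<Sum>C\<in>Cl. \<Sum>m\<in>(UNIV :: 'p mod_ring set). hfun (K C m 0 *v y) + 2 * B * \<theta> * (norm y)\<^sup>2)"
      by (intro sum_mono)
    also have "\<dots> = (\<Sum>C\<in>Cl. \<Sum>m\<in>UNIV. hfun (K C m 0 *v y)) + Nc * (real CARD('p) * 2 * B * \<theta> * (norm y)\<^sup>2)"
      by (simp add: sum.distrib Nc_def)
    finally have "avg a q1 \<theta> hfun y \<le> avg a q1 0 hfun y + (real CARD('p) * 2 * B) * \<theta> * (norm y)\<^sup>2"
      using Nc_pos unfolding avg_def Nc_def[symmetric] by (simp add: field_simps)
    then show ?thesis using avg_hfun_0[of y] by linarith
  qed
  then show ?thesis using B(1) by (intro exI[of _ "real CARD('p) * 2 * B"]) auto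
qed

end

section \<open>The mana on vectors\<close>

definition mfun :: "('n::finite, 'p::prime_card) idx cvec \<Rightarrow> real" where
  "mfun y = (norm y)\<^sup>2 * log 2 (wsum y / (norm y)\<^sup>2)"

text \<open>The polarization of the quadratic form \<open>wig\<close> (see \<open>wig_add\<close>).
  On tangent vectors it is the differential of the Wigner function.\<close>

definition ell :: "('n::finite, 'p::prime_card) idx cvec \<Rightarrow> ('n, 'p) phase_point \<Rightarrow> ('n, 'p) idx cvec \<Rightarrow> real" where
  "ell s u v = 2 * Re (braket s (phase_op u *v v)) / real CARD('p) ^ CARD('n)"

definition lsup :: "('n::finite, 'p::prime_card) idx cvec \<Rightarrow> ('n, 'p) phase_point set" where
  "lsup s = {u. wig s u = 1 / real CARD('p) ^ CARD('n)}"

definition tmana :: "('n::finite, 'p::prime_card) idx cvec \<Rightarrow> ('n, 'p) idx cvec \<Rightarrow> real" where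
  "tmana s v = 1 / ln 2 * ((\<Sum>u\<in>lsup s. ell s u v) + (\<Sum>u\<in>- lsup s. \<bar>ell s u v\<bar>))"

lemma ell_add: "ell s u (v + w) = ell s u v + ell s u w"
  by (simp add: ell_def matrix_vector_right_distrib braket_add_right add_divide_distrib distrib_left)

lemma ell_diff: "ell s u (v - w) = ell s u v - ell s u w"
  by (simp add: ell_def matrix_vector_mult_diff_distrib braket_diff_right diff_divide_distrib right_diff_distrib)

lemma ell_scaleR: "ell s u (t *\<^sub>R v) = t * ell s u v"
  by (simp add: ell_def scaleR_eq_smult matvec_smult braket_smult_right)

lemma tmana_scaleR: "t \<ge> 0 \<Longrightarrow> tmana s (t *\<^sub>R v) = t * tmana s v"
  by (simp add: tmana_def ell_scaleR abs_mult sum_distrib_left algebra_simps)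

lemma tmana_0: "tmana s 0 = 0"
  using tmana_scaleR[of 0 s 0] by simp

context odd_qudit
begin

lemma wsum_ge: "(norm (y :: ('n::finite, 'p) idx cvec))\<^sup>2 \<le> wsum y"
  unfolding sum_wig[symmetric] wsum_def by (rule sum_mono) simp

lemma mfun_nonneg: "mfun (y :: ('n::finite, 'p) idx cvec) \<ge> 0"
proof (cases "y = 0")
  case False
  then have "wsum y / (norm y)\<^sup>2 \<ge> 1" using wsum_ge[of y] by (simp add: divide_simps)
  then show ?thesis by (simp add: mfun_def)
qed (simp add: mfun_def)

lemma mfun_smult: "mfun (c *s y) = (cmod c)\<^sup>2 * mfun (y :: ('n::finite, 'p) idx cvec)"
  by (cases "c = 0") (simp_all add: mfun_def wsum_smult norm_smult power_mult_distrib)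

lemma mfun_cliff: "cliff U \<Longrightarrow> mfun (U *v y) = mfun (y :: ('n::finite, 'p) idx cvec)"
  by (simp add: mfun_def wsum_cliff unitary_norm[OF cliff_unitary])

lemma mana_eq_mfun: "norm y = 1 \<Longrightarrow> mana (outer y) = mfun (y :: ('n::finite, 'p) idx cvec)"
  by (simp add: mana_outer mfun_def)

lemma abs_ell_le: "\<bar>ell s u v\<bar> \<le> 2 * norm s * norm (v :: ('n::finite, 'p) idx cvec)"
proof -
  let ?D = "real CARD('p) ^ CARD('n)"
  have D: "?D \<ge> 1" by (simp add: one_le_power Suc_le_eq)
  have "\<bar>Re (braket s (phase_op u *v v))\<bar> \<le> norm s * norm v"
    using abs_Re_le_cmod[of "braket s (phase_op u *v v)"] braket_Cauchy_Schwarz[of s "phase_op u *v v"]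
    by (simp add: norm_phase_op)
  then have "2 * \<bar>Re (braket s (phase_op u *v v))\<bar> / ?D \<le> 2 * (norm s * norm v) / 1"
    using D by (intro frac_le) auto
  then show ?thesis by (simp add: ell_def abs_mult)
qed

lemma abs_wig_le: "\<bar>wig v u\<bar> \<le> (norm (v :: ('n::finite, 'p) idx cvec))\<^sup>2"
  using abs_ell_le[of v u v] by (simp add: ell_def wig_def power2_eq_square)

lemma wig_add: "wig (s + v) u = wig s u + ell s u v + wig (v :: ('n::finite, 'p) idx cvec) u"
proof -
  have "braket v (phase_op u *v s) = cnj (braket s (phase_op u *v v))"
    unfolding cnj_braket braket_dagger[of v] dagger_phase_op ..
  then have "Re (braket v (phase_op u *v s)) = Re (braket s (phase_op u *v v))" by simp
  then show ?thesis
    by (simp add: wig_def ell_def matrix_vector_right_distrib braket_add_left braket_add_right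
        add_divide_distrib[symmetric])
qed

section \<open>First-order expansion of the mana at a stabilizer state\<close>

lemma wsum_stab_vec:
  assumes "stab_vec (\<phi> :: ('n::finite, 'p) idx cvec)"
  shows "wsum \<phi> = 1"
proof -
  have "\<bar>wig \<phi> u\<bar> = wig \<phi> u" for u
    using wig_stab_vec[OF assms, of u] by auto
  then have "wsum \<phi> = (norm \<phi>)\<^sup>2" by (simp add: wsum_def sum_wig)
  then show ?thesis by (simp add: stab_vec_norm[OF assms])
qed

definition npts :: "'n::finite itself \<Rightarrow> real" where
  "npts _ = real CARD(('n, 'p) phase_point)"

lemma wsum_near:
  assumes "stab_vec (\<phi> :: ('n::finite, 'p) idx cvec)"
  shows "wsum (c *s \<phi> + w) \<le> (norm (c *s \<phi>))\<^sup>2 + npts TYPE('n) * (2 * norm (c *s \<phi>) * norm w + (norm w)\<^sup>2)"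
proof -
  have "wsum (c *s \<phi> + w) \<le> (\<Sum>u\<in>UNIV. \<bar>wig (c *s \<phi>) u\<bar> + (2 * norm (c *s \<phi>) * norm w + (norm w)\<^sup>2))"
    unfolding wsum_def
  proof (rule sum_mono)
    fix u
    show "\<bar>wig (c *s \<phi> + w) u\<bar> \<le> \<bar>wig (c *s \<phi>) u\<bar> + (2 * norm (c *s \<phi>) * norm w + (norm w)\<^sup>2)"
      using abs_ell_le[of "c *s \<phi>" u w] abs_wig_le[of w u] unfolding wig_add by linarith
  qed
  also have "\<dots> = wsum (c *s \<phi>) + npts TYPE('n) * (2 * norm (c *s \<phi>) * norm w + (norm w)\<^sup>2)"
    by (simp add: sum.distrib wsum_def npts_def)
  also have "wsum (c *s \<phi>) = (norm (c *s \<phi>))\<^sup>2"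
    by (simp add: wsum_smult wsum_stab_vec[OF assms] norm_smult stab_vec_norm[OF assms])
  finally show ?thesis .
qed

text \<open>A stabilizer vector has a nonnegative Wigner function and therefore no excess; adding
  the orthogonal part changes each value by a term linear in its length. The bound has the shape of
  \<open>hfun\<close>.\<close>

lemma wsum_excess:
  assumes \<phi>: "stab_vec (\<phi> :: ('n::finite, 'p) idx cvec)"
  shows "wsum y - (norm y)\<^sup>2 \<le> npts TYPE('n) * 3 * norm y * norm (prp \<phi> y)"
proof -
  note n\<phi> = stab_vec_norm[OF \<phi>]
  define c w where "c = braket \<phi> y" and "w = prp \<phi> y"
  have y: "c *s \<phi> + w = y" by (simp add: c_def w_def prp_def)
  have ny: "(norm (c *s \<phi>))\<^sup>2 + (norm w)\<^sup>2 = (norm y)\<^sup>2"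
    by (simp add: norm_smult n\<phi> c_def w_def norm_prp[OF n\<phi>, of y])
  have le: "norm (c *s \<phi>) \<le> norm y" "norm w \<le> norm y"
    by (rule power2_le_imp_le; simp add: ny[symmetric])+
  have "2 * norm (c *s \<phi>) * norm w + (norm w)\<^sup>2 \<le> 2 * norm y * norm w + norm y * norm w"
    unfolding power2_eq_square using le by (intro add_mono mult_right_mono mult_left_mono) auto
  then have "2 * norm (c *s \<phi>) * norm w + (norm w)\<^sup>2 \<le> 3 * norm y * norm w" by linarith
  then have "npts TYPE('n) * (2 * norm (c *s \<phi>) * norm w + (norm w)\<^sup>2) \<le> npts TYPE('n) * (3 * norm y * norm w)"
    by (rule mult_left_mono) (simp add: npts_def)
  moreover have "(norm (c *s \<phi>))\<^sup>2 \<le> (norm y)\<^sup>2" using le by (intro power_mono) auto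
  ultimately show ?thesis using wsum_near[OF \<phi>, of c w] unfolding y w_def[symmetric] mult.assoc
    by linarith
qed

lemma mfun_le_excess: "mfun y \<le> (wsum y - (norm y)\<^sup>2) / ln 2" for y :: "('n::finite, 'p) idx cvec"
proof (cases "y = 0")
  case False
  then have n: "(norm y)\<^sup>2 > 0" by simp
  have q: "wsum y / (norm y)\<^sup>2 > 0" using wsum_ge[of y] n by (meson divide_pos_pos less_le_trans)
  have "ln (wsum y / (norm y)\<^sup>2) \<le> wsum y / (norm y)\<^sup>2 - 1" using q by (rule ln_le_minus_one)
  then have "(norm y)\<^sup>2 * ln (wsum y / (norm y)\<^sup>2) \<le> (norm y)\<^sup>2 * (wsum y / (norm y)\<^sup>2 - 1)"
    using n by (intro mult_left_mono) auto
  also have "\<dots> = wsum y - (norm y)\<^sup>2" using n by (simp add: right_diff_distrib)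
  finally have "(norm y)\<^sup>2 * ln (wsum y / (norm y)\<^sup>2) / ln 2 \<le> (wsum y - (norm y)\<^sup>2) / ln 2"
    by (intro divide_right_mono) auto
  then show ?thesis by (simp add: mfun_def log_def)
next
  case True
  have "0 \<le> wsum y / ln 2" by (intro divide_nonneg_nonneg) (simp_all add: wsum_def sum_nonneg)
  then show ?thesis using True by (simp add: mfun_def)
qed

lemma mfun_le:
  assumes "stab_vec (\<phi> :: ('n::finite, 'p) idx cvec)"
  shows "mfun y \<le> (npts TYPE('n) * 3 / ln 2) * (norm y * norm (prp \<phi> y))"
proof -
  have "mfun y \<le> (npts TYPE('n) * 3 * norm y * norm (prp \<phi> y)) / ln 2"
    using wsum_excess[OF assms, of y] by (intro order_trans[OF mfun_le_excess] divide_right_mono) auto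
  then show ?thesis by (simp add: mult_ac)
qed

text \<open>Together with \<open>mfun_le_excess\<close> this encloses the mana between multiples of
  the excess \<open>wsum y - (norm y)\<^sup>2\<close> up to a quadratic error. Behind it is
  \<open>t - t\<^sup>2 \<le> ln (1 + t)\<close>, whose left side is not positive once
  \<open>t\<close> exceeds 1.\<close>

lemma mfun_excess_lower:
  fixes y :: "('n::finite, 'p) idx cvec"
  assumes "y \<noteq> 0"
  shows "(wsum y - (norm y)\<^sup>2) / ln 2 - (wsum y - (norm y)\<^sup>2)\<^sup>2 / (norm y)\<^sup>2 / ln 2 \<le> mfun y"
proof -
  define t where "t = wsum y / (norm y)\<^sup>2 - 1"
  have n: "(norm y)\<^sup>2 > 0" using assms by simp
  have t0: "t \<ge> 0" using wsum_ge[of y] n by (simp add: t_def divide_simps)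
  have "t - t\<^sup>2 \<le> ln (1 + t)"
  proof (cases "t \<le> 1")
    case True
    then show ?thesis using t0 by (intro ln_one_plus_pos_lower_bound) auto
  next
    case False
    then have "t - t\<^sup>2 \<le> 0" by (simp add: power2_eq_square mult_le_cancel_left1)
    also have "0 \<le> ln (1 + t)" using t0 by simp
    finally show ?thesis .
  qed
  then have "(norm y)\<^sup>2 * (t - t\<^sup>2) \<le> (norm y)\<^sup>2 * ln (1 + t)" using n by (intro mult_left_mono) auto
  moreover have "wsum y - (norm y)\<^sup>2 = (norm y)\<^sup>2 * t" using n by (simp add: t_def right_diff_distrib)
  then have "(norm y)\<^sup>2 * (t - t\<^sup>2) = (wsum y - (norm y)\<^sup>2) - (wsum y - (norm y)\<^sup>2)\<^sup>2 / (norm y)\<^sup>2"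
    using n by (simp add: power_mult_distrib power2_eq_square right_diff_distrib)
  moreover have "(norm y)\<^sup>2 * ln (1 + t) = mfun y * ln 2" by (simp add: mfun_def log_def t_def)
  ultimately have "(wsum y - (norm y)\<^sup>2) - (wsum y - (norm y)\<^sup>2)\<^sup>2 / (norm y)\<^sup>2 \<le> mfun y * ln 2" by simp
  then have "((wsum y - (norm y)\<^sup>2) - (wsum y - (norm y)\<^sup>2)\<^sup>2 / (norm y)\<^sup>2) / ln 2 \<le> mfun y"
    by (simp add: pos_divide_le_eq)
  then show ?thesis by (simp add: diff_divide_distrib)
qed

text \<open>The two quantities differ only when \<open>- l > b\<close>, and then the difference is
  at most \<open>2 * (- l)\<close>, which the ratio \<open>- l / b > 1\<close> raises to a quadratic
  bound.\<close>

lemma abs_shift_le: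
  fixes b l :: real
  assumes "b > 0"
  shows "\<bar>\<bar>b + l\<bar> - (b + l)\<bar> \<le> 2 * l\<^sup>2 / b"
proof (cases "b + l \<ge> 0")
  case True
  then show ?thesis using assms by simp
next
  case False
  then have l: "- l > b" by simp
  have "\<bar>\<bar>b + l\<bar> - (b + l)\<bar> = 2 * (- l - b)" using False by simp
  also have "\<dots> \<le> 2 * (- l)" using assms by simp
  also have "\<dots> \<le> 2 * (l\<^sup>2 / b)"
  proof -
    have "(- l) * b \<le> (- l) * (- l)" using l assms by (intro mult_left_mono) auto
    then show ?thesis using assms by (simp add: pos_le_divide_eq power2_eq_square mult.commute[of b])
  qed
  finally show ?thesis by simp
qed

text \<open>On the support the Wigner function is positive, so its absolute value is linear to first
  order; off the support only the modulus of the differential is left. The bound holds for every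
  \<open>w\<close>: where a sign on the support flips, \<open>w\<close> is so long that the
  quadratic error covers it.\<close>

lemma wsum_expansion:
  assumes \<phi>: "stab_vec (\<phi> :: ('n::finite, 'p) idx cvec)"
  shows "\<bar>wsum (\<phi> + w) - 1 - ln 2 * tmana \<phi> w\<bar>
    \<le> (npts TYPE('n) * (1 + 8 * real CARD('p) ^ CARD('n))) * (norm w)\<^sup>2"
proof -
  let ?D = "real CARD('p) ^ CARD('n)"
  have D: "?D \<ge> 1" by (simp add: one_le_power Suc_le_eq)
  note n\<phi> = stab_vec_norm[OF \<phi>]
  have term1: "\<bar>\<bar>wig (\<phi> + w) u\<bar> - (wig \<phi> u + (if u \<in> lsup \<phi> then ell \<phi> u w else \<bar>ell \<phi> u w\<bar>))\<bar>
      \<le> (1 + 8 * ?D) * (norm w)\<^sup>2" for u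
  proof (cases "u \<in> lsup \<phi>")
    case True
    then have wd: "wig \<phi> u = 1 / ?D" by (simp add: lsup_def)
    have "\<bar>\<bar>1 / ?D + ell \<phi> u w\<bar> - (1 / ?D + ell \<phi> u w)\<bar> \<le> 2 * (ell \<phi> u w)\<^sup>2 / (1 / ?D)"
      using D by (intro abs_shift_le) auto
    also have "\<dots> = 2 * ?D * (ell \<phi> u w)\<^sup>2" by simp
    also have "(ell \<phi> u w)\<^sup>2 \<le> (2 * norm w)\<^sup>2"
      using abs_ell_le[of \<phi> u w] n\<phi> by (intro power2_le_iff_abs_le[THEN iffD2]) auto
    then have "2 * ?D * (ell \<phi> u w)\<^sup>2 \<le> 2 * ?D * (2 * norm w)\<^sup>2" using D by (intro mult_left_mono) auto
    finally have 1: "\<bar>\<bar>1 / ?D + ell \<phi> u w\<bar> - (1 / ?D + ell \<phi> u w)\<bar> \<le> 8 * ?D * (norm w)\<^sup>2"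
      by (simp add: power_mult_distrib)
    have "\<bar>\<bar>wig (\<phi> + w) u\<bar> - \<bar>1 / ?D + ell \<phi> u w\<bar>\<bar> \<le> (norm w)\<^sup>2"
      using abs_wig_le[of w u] unfolding wig_add wd by linarith
    then have "\<bar>\<bar>wig (\<phi> + w) u\<bar> - (1 / ?D + ell \<phi> u w)\<bar> \<le> 8 * ?D * (norm w)\<^sup>2 + (norm w)\<^sup>2"
      using 1 by linarith
    then show ?thesis using True by (simp add: wd distrib_right add.commute)
  next
    case False
    then have wd: "wig \<phi> u = 0" using wig_stab_vec[OF \<phi>, of u] by (auto simp: lsup_def)
    have "\<bar>\<bar>wig (\<phi> + w) u\<bar> - \<bar>ell \<phi> u w\<bar>\<bar> \<le> (norm w)\<^sup>2"
      using abs_wig_le[of w u] unfolding wig_add wd by linarith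
    moreover have "(norm w)\<^sup>2 \<le> (1 + 8 * ?D) * (norm w)\<^sup>2"
      using D by (simp add: mult_le_cancel_right1)
    ultimately show ?thesis using False by (simp add: wd)
  qed
  have "(\<Sum>u\<in>UNIV. wig \<phi> u + (if u \<in> lsup \<phi> then ell \<phi> u w else \<bar>ell \<phi> u w\<bar>)) = 1 + ln 2 * tmana \<phi> w"
  proof -
    have "(\<Sum>u\<in>UNIV. if u \<in> lsup \<phi> then ell \<phi> u w else \<bar>ell \<phi> u w\<bar>) = ln 2 * tmana \<phi> w"
      by (subst sum.If_cases) (simp_all add: tmana_def Collect_neg_eq)
    then show ?thesis by (simp add: sum.distrib sum_wig n\<phi>)
  qed
  then have "wsum (\<phi> + w) - 1 - ln 2 * tmana \<phi> w
      = (\<Sum>u\<in>UNIV. \<bar>wig (\<phi> + w) u\<bar> - (wig \<phi> u + (if u \<in> lsup \<phi> then ell \<phi> u w else \<bar>ell \<phi> u w\<bar>)))"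
    unfolding sum_subtractf wsum_def by simp
  also have "\<bar>\<dots>\<bar> \<le> (\<Sum>u\<in>(UNIV :: ('n, 'p) phase_point set). (1 + 8 * ?D) * (norm w)\<^sup>2)"
    by (rule order_trans[OF sum_abs], rule sum_mono, rule term1)
  finally show ?thesis by (simp add: npts_def mult.assoc)
qed

text \<open>The bound holds for every \<open>w\<close>, not only near 0: by
  \<open>wsum_excess\<close> the excess is at most a multiple of \<open>norm y * norm w\<close>, so
  its square divided by \<open>(norm y)\<^sup>2\<close> is at most quadratic in
  \<open>norm w\<close>.\<close>

lemma mfun_expansion:
  "\<exists>B\<ge>0. \<forall>\<phi> w :: ('n::finite, 'p) idx cvec. stab_vec \<phi> \<and> braket \<phi> w = 0 \<longrightarrow>
    \<bar>mfun (\<phi> + w) - tmana \<phi> w\<bar> \<le> B * (norm w)\<^sup>2"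
proof -
  \<comment> \<open>The added 1 pays for the difference between \<open>(norm y)\<^sup>2\<close> and
    1, which is \<open>(norm w)\<^sup>2\<close>.\<close>
  define A where "A = npts TYPE('n) * (1 + 8 * real CARD('p) ^ CARD('n)) + 1"
  define E where "E = npts TYPE('n) * 3"
  have A0: "A \<ge> 0" "E \<ge> 0" by (simp_all add: A_def E_def npts_def)
  have "\<bar>mfun (\<phi> + w) - tmana \<phi> w\<bar> \<le> ((A + E\<^sup>2) / ln 2) * (norm w)\<^sup>2"
    if \<phi>: "stab_vec \<phi>" and w: "braket \<phi> w = 0" for \<phi> w :: "('n, 'p) idx cvec"
  proof -
    note n\<phi> = stab_vec_norm[OF \<phi>]
    define y where "y = \<phi> + w"
    have ny: "(norm y)\<^sup>2 = 1 + (norm w)\<^sup>2" unfolding y_def norm_orthogonal_sum[OF w] by (simp add: n\<phi>)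
    have ynz: "y \<noteq> 0" using ny by (auto simp: add_nonneg_eq_0_iff)
    have "prp \<phi> y = w" by (simp add: y_def prp_add prp_self[OF n\<phi>] prp_orthogonal[OF w])
    then have ex: "wsum y - (norm y)\<^sup>2 \<le> E * (norm y * norm w)"
      using wsum_excess[OF \<phi>, of y] by (simp add: E_def mult_ac)
    define x where "x = wsum y - (norm y)\<^sup>2"
    have x0: "x \<ge> 0" using wsum_ge[of y] by (simp add: x_def)
    have "x\<^sup>2 \<le> (E * (norm y * norm w))\<^sup>2" using ex x0 unfolding x_def by (intro power_mono) auto
    then have "x\<^sup>2 / (norm y)\<^sup>2 \<le> (E * (norm y * norm w))\<^sup>2 / (norm y)\<^sup>2" by (intro divide_right_mono) auto
    also have "\<dots> = E\<^sup>2 * (norm w)\<^sup>2" using ynz by (simp add: power_mult_distrib)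
    finally have x2: "x\<^sup>2 / (norm y)\<^sup>2 / ln 2 \<le> E\<^sup>2 * (norm w)\<^sup>2 / ln 2" by (intro divide_right_mono) auto
    have m: "x / ln 2 - x\<^sup>2 / (norm y)\<^sup>2 / ln 2 \<le> mfun y" "mfun y \<le> x / ln 2"
      using mfun_excess_lower[OF ynz] mfun_le_excess[of y] by (simp_all add: x_def)
    have "\<bar>x - ln 2 * tmana \<phi> w\<bar> \<le> A * (norm w)\<^sup>2"
    proof -
      have "\<bar>wsum y - 1 - ln 2 * tmana \<phi> w\<bar> \<le> (A - 1) * (norm w)\<^sup>2"
        using wsum_expansion[OF \<phi>, of w] by (simp add: A_def y_def)
      moreover have "(A - 1) * (norm w)\<^sup>2 = A * (norm w)\<^sup>2 - (norm w)\<^sup>2"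
        by (simp add: left_diff_distrib)
      ultimately show ?thesis unfolding x_def ny using zero_le_power2[of "norm w"] by linarith
    qed
    then have "\<bar>x - ln 2 * tmana \<phi> w\<bar> / ln 2 \<le> A * (norm w)\<^sup>2 / ln 2" by (intro divide_right_mono) auto
    moreover have "x / ln 2 - tmana \<phi> w = (x - ln 2 * tmana \<phi> w) / ln 2"
      by (simp add: diff_divide_distrib)
    then have "\<bar>x - ln 2 * tmana \<phi> w\<bar> / ln 2 = \<bar>x / ln 2 - tmana \<phi> w\<bar>"
      by (simp only: abs_divide) simp
    ultimately have "\<bar>x / ln 2 - tmana \<phi> w\<bar> \<le> A * (norm w)\<^sup>2 / ln 2" by simp
    moreover have "((A + E\<^sup>2) / ln 2) * (norm w)\<^sup>2 = A * (norm w)\<^sup>2 / ln 2 + E\<^sup>2 * (norm w)\<^sup>2 / ln 2"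
      by (simp add: distrib_right add_divide_distrib)
    ultimately show ?thesis using m x2 unfolding y_def[symmetric] by linarith
  qed
  moreover have "(A + E\<^sup>2) / ln 2 \<ge> 0" using A0 by simp
  ultimately show ?thesis by blast
qed

lemma tmana_lipschitz:
  assumes \<phi>: "stab_vec (\<phi> :: ('n::finite, 'p) idx cvec)"
  shows "\<bar>tmana \<phi> v - tmana \<phi> w\<bar> \<le> (npts TYPE('n) * 4 / ln 2) * norm (v - w)"
proof -
  have e: "\<bar>ell \<phi> u v - ell \<phi> u w\<bar> \<le> 2 * norm (v - w)" for u
    using abs_ell_le[of \<phi> u "v - w"] by (simp add: ell_diff stab_vec_norm[OF \<phi>])
  have "\<bar>(\<Sum>u\<in>lsup \<phi>. ell \<phi> u v) - (\<Sum>u\<in>lsup \<phi>. ell \<phi> u w)\<bar> \<le> (\<Sum>u\<in>lsup \<phi>. 2 * norm (v - w))"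
    unfolding sum_subtractf[symmetric] by (rule order_trans[OF sum_abs], rule sum_mono, rule e)
  also have "\<dots> \<le> (\<Sum>u\<in>(UNIV :: ('n, 'p) phase_point set). 2 * norm (v - w))"
    by (rule sum_mono2) auto
  finally have 1: "\<bar>(\<Sum>u\<in>lsup \<phi>. ell \<phi> u v) - (\<Sum>u\<in>lsup \<phi>. ell \<phi> u w)\<bar> \<le> npts TYPE('n) * (2 * norm (v - w))"
    by (simp add: npts_def)
  have "\<bar>(\<Sum>u\<in>- lsup \<phi>. \<bar>ell \<phi> u v\<bar>) - (\<Sum>u\<in>- lsup \<phi>. \<bar>ell \<phi> u w\<bar>)\<bar> \<le> (\<Sum>u\<in>- lsup \<phi>. 2 * norm (v - w))"
    unfolding sum_subtractf[symmetric]
    by (rule order_trans[OF sum_abs], rule sum_mono, rule order_trans[OF abs_triangle_ineq3 e])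
  also have "\<dots> \<le> (\<Sum>u\<in>(UNIV :: ('n, 'p) phase_point set). 2 * norm (v - w))"
    by (rule sum_mono2) auto
  finally have 2: "\<bar>(\<Sum>u\<in>- lsup \<phi>. \<bar>ell \<phi> u v\<bar>) - (\<Sum>u\<in>- lsup \<phi>. \<bar>ell \<phi> u w\<bar>)\<bar> \<le> npts TYPE('n) * (2 * norm (v - w))"
    by (simp add: npts_def)
  define P Q where "P v = (\<Sum>u\<in>lsup \<phi>. ell \<phi> u v)" and "Q v = (\<Sum>u\<in>- lsup \<phi>. \<bar>ell \<phi> u v\<bar>)" for v
  have "tmana \<phi> v - tmana \<phi> w = ((P v - P w) + (Q v - Q w)) / ln 2"
    by (simp add: tmana_def P_def[symmetric] Q_def[symmetric] diff_divide_distrib add_divide_distrib)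
  moreover have "\<bar>(P v - P w) + (Q v - Q w)\<bar> \<le> npts TYPE('n) * 4 * norm (v - w)"
    using 1 2 unfolding P_def[symmetric] Q_def[symmetric] by linarith
  ultimately have "\<bar>tmana \<phi> v - tmana \<phi> w\<bar> \<le> npts TYPE('n) * 4 * norm (v - w) / ln 2"
    by (simp add: abs_divide divide_right_mono)
  then show ?thesis by (simp add: mult_ac)
qed

text \<open>Along the half-line of positive multiples of \<open>w\<close> the nonnegative
  \<open>mfun\<close> equals \<open>t * tmana \<phi> w\<close> up to \<open>O(t\<^sup>2)\<close>, so
  a negative slope is impossible.\<close>

lemma tmana_nonneg:
  assumes \<phi>: "stab_vec (\<phi> :: ('n::finite, 'p) idx cvec)" and w: "braket \<phi> w = 0"
  shows "tmana \<phi> w \<ge> 0"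
proof (rule ccontr)
  assume neg: "\<not> tmana \<phi> w \<ge> 0"
  obtain B where B: "B \<ge> 0" and exp: "\<forall>\<phi> w :: ('n, 'p) idx cvec. stab_vec \<phi> \<and> braket \<phi> w = 0 \<longrightarrow>
    \<bar>mfun (\<phi> + w) - tmana \<phi> w\<bar> \<le> B * (norm w)\<^sup>2"
    using mfun_expansion by blast
  have B2: "\<bar>mfun (\<phi> + t *\<^sub>R w) - tmana \<phi> (t *\<^sub>R w)\<bar> \<le> B * (norm (t *\<^sub>R w))\<^sup>2" for t
    using exp[rule_format, of \<phi> "t *\<^sub>R w"] \<phi> w by (simp add: braket_scaleR_right)
  define \<epsilon> where "\<epsilon> = - tmana \<phi> w"
  have \<epsilon>: "\<epsilon> > 0" using neg by (simp add: \<epsilon>_def)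
  have *: "\<epsilon> \<le> B * t * (norm w)\<^sup>2" if "t > 0" for t
  proof -
    have "t * \<epsilon> \<le> t * (B * t * (norm w)\<^sup>2)"
      using B2[of t] mfun_nonneg[of "\<phi> + t *\<^sub>R w"] that
      by (simp add: tmana_scaleR \<epsilon>_def power_mult_distrib power2_eq_square[of t] mult_ac)
    then show ?thesis using that by simp
  qed
  define b where "b = B * (norm w)\<^sup>2 + 1"
  have b: "b \<ge> 1" using B by (simp add: b_def)
  have "\<epsilon> \<le> (b - 1) * (\<epsilon> / (2 * b))"
    using *[of "\<epsilon> / (2 * b)"] \<epsilon> b by (simp add: b_def mult_ac)
  also have "\<dots> \<le> b * (\<epsilon> / (2 * b))" using \<epsilon> b by (intro mult_right_mono) auto
  also have "\<dots> = \<epsilon> / 2" using b by simp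
  finally show False using \<epsilon> by simp
qed

end

section \<open>The branches near the stabilizer states\<close>

lemma finite_uniform_bound:
  fixes P :: "'x \<Rightarrow> real \<Rightarrow> bool"
  assumes "finite X" "\<And>x. x \<in> X \<Longrightarrow> \<exists>B. P x B" "\<And>x B B'. P x B \<Longrightarrow> B \<le> B' \<Longrightarrow> P x B'"
  shows "\<exists>B\<ge>1. \<forall>x\<in>X. P x B"
  using assms(1,2)
proof (induction X rule: finite_induct)
  case (insert x X)
  then obtain B where B: "B \<ge> 1" "\<forall>x\<in>X. P x B" by blast
  obtain B' where B': "P x B'" using insert by blast
  have "\<forall>y\<in>insert x X. P y (max B B')"
  proof
    fix y assume "y \<in> insert x X"
    then consider "y = x" | "y \<in> X" by blast
    then show "P y (max B B')"
    proof cases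
      case 1
      show ?thesis unfolding 1 by (rule assms(3)[OF B' max.cobounded2])
    next
      case 2
      show ?thesis by (rule assms(3)[OF bspec[OF B(2) 2] max.cobounded1])
    qed
  qed
  moreover have "max B B' \<ge> 1" using B by simp
  ultimately show ?case by blast
qed (auto intro: exI[of _ 1])

context monitored
begin

definition post :: "('n, 'p) idx cmat set \<Rightarrow> 'p mod_ring \<Rightarrow> ('n, 'p) idx cmat \<Rightarrow> ('n, 'p) idx cmat" where
  "post C m s = ray (K C m 0 *v rep_vec s)"

definition amp :: "('n, 'p) idx cmat set \<Rightarrow> 'p mod_ring \<Rightarrow> ('n, 'p) idx cmat \<Rightarrow> complex" where
  "amp C m s = braket (rep_vec (post C m s)) (K C m 0 *v rep_vec s)"

definition wt :: "('n, 'p) idx cmat set \<Rightarrow> 'p mod_ring \<Rightarrow> ('n, 'p) idx cmat \<Rightarrow> real" where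
  "wt C m s = (norm (K C m 0 *v rep_vec s))\<^sup>2"

text \<open>The derivative in \<open>v\<close> of the projective coordinate \<open>x\<close> of the
  image, which is written as \<open>c *s (\<sigma> + x)\<close> with \<sigma> the vector of the
  post-measurement state; to leading order \<open>c\<close> is \<open>amp C m s\<close>. For a
  branch of weight 0 the amplitude and its \<open>inverse\<close> are 0, so this map and
  \<open>bsh\<close> vanish.\<close>

definition Alin :: "('n, 'p) idx cmat set \<Rightarrow> 'p mod_ring \<Rightarrow> ('n, 'p) idx cmat \<Rightarrow> ('n, 'p) idx cvec \<Rightarrow> ('n, 'p) idx cvec" where
  "Alin C m s v = inverse (amp C m s) *s prp (rep_vec (post C m s)) (K C m 0 *v v)"

definition bsh :: "('n, 'p) idx cmat set \<Rightarrow> 'p mod_ring \<Rightarrow> ('n, 'p) idx cmat \<Rightarrow> ('n, 'p) idx cvec" where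
  "bsh C m s = inverse (amp C m s) *s prp (rep_vec (post C m s)) (KD a q1 (rep_unitary C) m *v rep_vec s)"

lemma active_branch:
  assumes C: "C \<in> Cl" and s: "s \<in> Stab" and nz: "K C m 0 *v rep_vec s \<noteq> 0"
  shows "post C m s \<in> Stab" "amp C m s \<noteq> 0" "K C m 0 *v rep_vec s = amp C m s *s rep_vec (post C m s)"
    "wt C m s = (cmod (amp C m s))\<^sup>2"
proof -
  obtain c \<phi> where \<phi>: "stab_vec \<phi>" "K C m 0 *v rep_vec s = c *s \<phi>"
    using KU_stab_vec[OF rep_unitary_cliff[OF C] stab_vec_rep_vec[OF s]] by blast
  have "c \<noteq> 0" using nz \<phi> by auto
  then show st: "post C m s \<in> Stab" unfolding post_def \<phi>(2) by (rule ray_stab_vec[OF \<phi>(1)])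
  obtain e where e: "e \<noteq> 0" "rep_vec (post C m s) = e *s (K C m 0 *v rep_vec s)"
    unfolding post_def using rep_vec_ray[OF nz] by blast
  have y: "K C m 0 *v rep_vec s = inverse e *s rep_vec (post C m s)"
    by (rule smult_eq_imp[OF e(2)[symmetric] e(1)])
  have amp: "amp C m s = inverse e"
    unfolding amp_def y by (simp add: braket_smult_right braket_self rep_vec_norm[OF st])
  show "amp C m s \<noteq> 0" using amp e by simp
  show "K C m 0 *v rep_vec s = amp C m s *s rep_vec (post C m s)" unfolding amp by (rule y)
  then show "wt C m s = (cmod (amp C m s))\<^sup>2"
    unfolding wt_def by (simp add: norm_smult rep_vec_norm[OF st])
qed

lemma wt_nonneg: "wt C m s \<ge> 0"
  by (simp add: wt_def)

lemma wt_le_1: "C \<in> Cl \<Longrightarrow> s \<in> Stab \<Longrightarrow> wt C m s \<le> 1"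
  using norm_KU_le[OF rep_unitary_unitary, of C a q1 m 0 "rep_vec s"] rep_vec_norm[of s]
  unfolding wt_def by (simp add: power_le_one)

lemma wt_sum: "C \<in> Cl \<Longrightarrow> s \<in> Stab \<Longrightarrow> (\<Sum>m\<in>UNIV. wt C m s) = 1"
  unfolding wt_def using KU_norm_sum[OF rep_unitary_unitary, of C a q1 0 "rep_vec s"] rep_vec_norm[of s] by simp

lemma Alin_tangent: "C \<in> Cl \<Longrightarrow> s \<in> Stab \<Longrightarrow> wt C m s \<noteq> 0 \<Longrightarrow> braket (rep_vec (post C m s)) (Alin C m s v) = 0"
  using active_branch(1)[of C s m] by (simp add: wt_def Alin_def braket_smult_right braket_prp rep_vec_norm)

lemma bsh_tangent: "C \<in> Cl \<Longrightarrow> s \<in> Stab \<Longrightarrow> wt C m s \<noteq> 0 \<Longrightarrow> braket (rep_vec (post C m s)) (bsh C m s) = 0"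
  using active_branch(1)[of C s m] by (simp add: wt_def bsh_def braket_smult_right braket_prp rep_vec_norm)

lemma Alin_diff: "Alin C m s v - Alin C m s w = Alin C m s (v - w)"
  by (simp add: Alin_def prp_diff matrix_vector_mult_diff_distrib vector_ssub_ldistrib)

lemma Alin_add: "Alin C m s (v + w) = Alin C m s v + Alin C m s w"
  by (simp add: Alin_def prp_add matrix_vector_right_distrib vector_add_ldistrib)

lemma Alin_scaleR: "Alin C m s (t *\<^sub>R v) = t *\<^sub>R Alin C m s v"
  by (simp add: Alin_def scaleR_eq_smult matvec_smult prp_smult vector_smult_assoc mult.commute)

text \<open>The weight is the squared modulus of the amplitude, and one factor cancels the division
  in \<open>Alin\<close>. What remains are the products summed in
  \<open>tangent_contraction\<close>.\<close>

lemma wt_norm_Alin: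
  assumes "C \<in> Cl" "s \<in> Stab"
  shows "wt C m s * norm (Alin C m s v) \<le> norm (K C m 0 *v rep_vec s) * norm (K C m 0 *v v)"
proof (cases "K C m 0 *v rep_vec s = 0")
  case False
  note ab = active_branch[OF assms False]
  have "wt C m s * norm (Alin C m s v) = cmod (amp C m s) * norm (prp (rep_vec (post C m s)) (K C m 0 *v v))"
    using ab(2,4) by (simp add: Alin_def norm_smult norm_inverse power2_eq_square)
  also have "\<dots> \<le> cmod (amp C m s) * norm (K C m 0 *v v)"
    by (intro mult_left_mono norm_prp_le rep_vec_norm ab) simp
  also have "cmod (amp C m s) = norm (K C m 0 *v rep_vec s)"
    unfolding ab(3) by (simp add: norm_smult rep_vec_norm[OF ab(1)])
  finally show ?thesis .
qed (simp add: wt_def)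

lemma Alin_contraction:
  assumes s: "s \<in> Stab" and v: "braket (rep_vec s) v = 0"
  shows "(\<Sum>C\<in>Cl. \<Sum>m\<in>UNIV. wt C m s * norm (Alin C m s v)) / Nc \<le> rate * norm v"
proof -
  have "(\<Sum>C\<in>Cl. \<Sum>m\<in>UNIV. wt C m s * norm (Alin C m s v)) / Nc
      \<le> (\<Sum>C\<in>Cl. \<Sum>m\<in>UNIV. norm (K C m 0 *v rep_vec s) * norm (K C m 0 *v v)) / Nc"
    using Nc_pos s by (intro divide_right_mono sum_mono wt_norm_Alin) auto
  also have "\<dots> \<le> rate * norm v" by (rule tangent_contraction[OF stab_vec_rep_vec[OF s] v])
  finally show ?thesis .
qed

text \<open>All estimates for one active branch with a single constant, which also gives the radius
  \<open>1 / B\<close> of validity. Displacement and angle count as quantities of the same order;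
  \<open>c\<close> and \<open>x\<close> are the amplitude and the projective coordinate of the
  image.\<close>

definition lin_bound :: "('n, 'p) idx cmat set \<times> 'p mod_ring \<times> ('n, 'p) idx cmat \<Rightarrow> real \<Rightarrow> bool" where
  "lin_bound = (\<lambda>(C, m, s) B. B \<ge> 1 \<and> (\<forall>w \<theta>. norm (Alin C m s w + \<theta> *\<^sub>R bsh C m s) \<le> B * (norm w + \<bar>\<theta>\<bar>)) \<and>
    (\<forall>w \<theta>. norm w + \<bar>\<theta>\<bar> \<le> 1 / B \<longrightarrow> (let y = K C m \<theta> *v (rep_vec s + w); \<sigma> = rep_vec (post C m s);
        c = braket \<sigma> y; x = inverse c *s prp \<sigma> y in
      c \<noteq> 0 \<and> y = c *s (\<sigma> + x) \<and> norm x \<le> B * (norm w + \<bar>\<theta>\<bar>) \<and>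
      norm (x - (Alin C m s w + \<theta> *\<^sub>R bsh C m s)) \<le> B * (norm w + \<bar>\<theta>\<bar>)\<^sup>2 \<and>
      \<bar>(cmod c)\<^sup>2 - wt C m s\<bar> \<le> B * (norm w + \<bar>\<theta>\<bar>))))"

text \<open>The image is a perturbation \<delta> of \<open>c0 *s \<sigma>'\<close>, linear in the
  displacement and the angle up to quadratic errors. Within the chosen radius the new amplitude
  \<open>c\<close> keeps at least half of the modulus \<open>k\<close> of \<open>c0\<close>, so
  dividing by it preserves the order of all errors.\<close>

lemma lin_bound_exists:
  assumes C: "C \<in> Cl" and s: "s \<in> Stab" and nz: "K C m 0 *v rep_vec s \<noteq> 0"
  shows "\<exists>B. lin_bound (C, m, s) B"
proof -
  note ab = active_branch[OF C s nz]
  note un = rep_unitary_unitary[OF C]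
  define \<sigma> \<sigma>' where "\<sigma> = rep_vec s" and "\<sigma>' = rep_vec (post C m s)"
  have n\<sigma>: "norm \<sigma> = 1" "norm \<sigma>' = 1" by (simp_all add: \<sigma>_def \<sigma>'_def rep_vec_norm s ab(1))
  define c0 where "c0 = amp C m s"
  define k where "k = cmod c0"
  have k: "k > 0" using ab(2) by (simp add: k_def c0_def)
  have K0: "K C m 0 *v \<sigma> = c0 *s \<sigma>'" using ab(3) by (simp add: \<sigma>_def \<sigma>'_def c0_def)
  have k1: "k \<le> 1"
    using norm_KU_le[OF un, of a q1 m 0 \<sigma>] by (simp add: K0 norm_smult n\<sigma> k_def)
  obtain B where B: "B \<ge> 1" "\<And>y :: ('n, 'p) idx cvec. norm (KD a q1 (rep_unitary C) m *v y) \<le> B * norm y"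
    "\<And>(y :: ('n, 'p) idx cvec) \<theta>. norm (K C m \<theta> *v y - K C m 0 *v y - \<theta> *\<^sub>R (KD a q1 (rep_unitary C) m *v y)) \<le> B * \<theta>\<^sup>2 * norm y"
    using KU_second_order[of a q1] un by blast
  define lin where "lin w \<theta> = K C m 0 *v w + \<theta> *\<^sub>R (KD a q1 (rep_unitary C) m *v \<sigma>)" for w \<theta>
  have lin_le: "norm (lin w \<theta>) \<le> B * (norm w + \<bar>\<theta>\<bar>)" for w \<theta>
  proof -
    have "norm (lin w \<theta>) \<le> norm (K C m 0 *v w) + norm (\<theta> *\<^sub>R (KD a q1 (rep_unitary C) m *v \<sigma>))"
      unfolding lin_def by (rule norm_triangle_ineq)
    also have "\<dots> \<le> 1 * norm w + \<bar>\<theta>\<bar> * B"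
      using norm_KU_le[OF un, of a q1 m 0 w] B(2)[of \<sigma>] by (intro add_mono) (auto simp: n\<sigma> intro!: mult_left_mono)
    also have "\<dots> \<le> B * norm w + \<bar>\<theta>\<bar> * B" using B(1) by (intro add_mono mult_right_mono) auto
    finally show ?thesis by (simp add: algebra_simps)
  qed
  have Ab: "Alin C m s w + \<theta> *\<^sub>R bsh C m s = inverse c0 *s prp \<sigma>' (lin w \<theta>)" for w \<theta>
    by (simp add: Alin_def bsh_def lin_def \<sigma>_def \<sigma>'_def c0_def prp_add vector_add_ldistrib
        scaleR_eq_smult prp_smult vector_smult_assoc mult.commute)
  \<comment> \<open>A sum that dominates every constant below: the first two terms are the quadratic
    error of \<open>x\<close>, \<open>6 * B / k\<close> bounds \<open>x\<close> and also secures
    \<open>3 * B * r \<le> k / 2\<close>, \<open>9 * B\<close> is the error of the squared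
    amplitude, and \<open>B / k\<close> bounds the linear part.\<close>
  define M where "M = 18 * B\<^sup>2 / k\<^sup>2 + 2 * B / k + 6 * B / k + 9 * B + B / k"
  have pos: "18 * B\<^sup>2 / k\<^sup>2 \<ge> 0" "2 * B / k \<ge> 0" "6 * B / k \<ge> 0" "9 * B \<ge> 0" "B / k \<ge> 0"
    using B(1) k by auto
  have M1: "M \<ge> 1" using pos B(1) unfolding M_def by linarith
  have M6: "6 * B / k \<le> M" and M9: "9 * B \<le> M" and MB: "B / k \<le> M"
    and Msq: "18 * B\<^sup>2 / k\<^sup>2 + 2 * B / k \<le> M" using pos unfolding M_def by linarith+
  have "lin_bound (C, m, s) M"
    unfolding lin_bound_def case_prod_conv
  proof (intro conjI allI impI M1)
    fix w \<theta>
    have "norm (Alin C m s w + \<theta> *\<^sub>R bsh C m s) = norm (prp \<sigma>' (lin w \<theta>)) / k"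
      unfolding Ab by (simp add: norm_smult norm_inverse k_def divide_inverse mult.commute)
    also have "\<dots> \<le> B * (norm w + \<bar>\<theta>\<bar>) / k"
      using k norm_prp_le[OF n\<sigma>(2)] lin_le by (intro divide_right_mono) (auto intro: order_trans)
    also have "\<dots> = B / k * (norm w + \<bar>\<theta>\<bar>)" by simp
    also have "\<dots> \<le> M * (norm w + \<bar>\<theta>\<bar>)" using MB by (rule mult_right_mono) simp
    finally show "norm (Alin C m s w + \<theta> *\<^sub>R bsh C m s) \<le> M * (norm w + \<bar>\<theta>\<bar>)" .
  next
    fix w :: "('n, 'p) idx cvec" and \<theta> :: real
    assume small: "norm w + \<bar>\<theta>\<bar> \<le> 1 / M"
    define r where "r = norm w + \<bar>\<theta>\<bar>"
    have r0: "r \<ge> 0" and w_r: "norm w \<le> r" and \<theta>_r: "\<bar>\<theta>\<bar> \<le> r" by (simp_all add: r_def)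
    have "1 / M \<le> 1 / 1" using M1 by (intro frac_le) auto
    then have r1: "r \<le> 1" using small by (simp add: r_def)
    have "r \<le> k / (6 * B)"
    proof -
      have "1 / M \<le> 1 / (6 * B / k)" using M6 B(1) k by (intro frac_le) auto
      then show ?thesis using small by (simp add: r_def)
    qed
    then have r6: "3 * B * r \<le> k / 2" using B(1) by (simp add: field_simps)
    define y where "y = K C m \<theta> *v (\<sigma> + w)"
    define \<delta> where "\<delta> = y - c0 *s \<sigma>'"
    have \<delta>lin: "norm (\<delta> - lin w \<theta>) \<le> 2 * B * r\<^sup>2"
    proof -
      have e: "\<delta> - lin w \<theta> = (K C m \<theta> *v \<sigma> - K C m 0 *v \<sigma> - \<theta> *\<^sub>R (KD a q1 (rep_unitary C) m *v \<sigma>))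
          + (K C m \<theta> *v w - K C m 0 *v w - \<theta> *\<^sub>R (KD a q1 (rep_unitary C) m *v w)) + \<theta> *\<^sub>R (KD a q1 (rep_unitary C) m *v w)"
        by (simp add: \<delta>_def y_def lin_def K0 matrix_vector_right_distrib)
      have "norm (\<delta> - lin w \<theta>) \<le> B * \<theta>\<^sup>2 * 1 + B * \<theta>\<^sup>2 * norm w + \<bar>\<theta>\<bar> * (B * norm w)"
        unfolding e
      proof (intro norm_triangle_le add_mono)
        show "norm (K C m \<theta> *v \<sigma> - K C m 0 *v \<sigma> - \<theta> *\<^sub>R (KD a q1 (rep_unitary C) m *v \<sigma>)) \<le> B * \<theta>\<^sup>2 * 1"
          using B(3)[of \<theta> \<sigma>] by (simp add: n\<sigma>)
        show "norm (\<theta> *\<^sub>R (KD a q1 (rep_unitary C) m *v w)) \<le> \<bar>\<theta>\<bar> * (B * norm w)"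
          using B(2)[of w] by (simp add: mult_left_mono)
      qed (rule B(3))
      also have "\<dots> \<le> 2 * B * r\<^sup>2"
      proof -
        have \<theta>1: "\<bar>\<theta>\<bar> \<le> 1" using \<theta>_r r1 by simp
        have "\<bar>\<theta>\<bar> * \<bar>\<theta>\<bar> \<le> \<bar>\<theta>\<bar>" using mult_left_mono[OF \<theta>1, of "\<bar>\<theta>\<bar>"] by simp
        then have "\<theta>\<^sup>2 \<le> \<bar>\<theta>\<bar>" by (simp add: power2_eq_square)
        then have "\<theta>\<^sup>2 * norm w \<le> \<bar>\<theta>\<bar> * norm w" by (rule mult_right_mono) simp
        then have "\<theta>\<^sup>2 + \<theta>\<^sup>2 * norm w + \<bar>\<theta>\<bar> * norm w \<le> \<theta>\<^sup>2 + 2 * (\<bar>\<theta>\<bar> * norm w)" by simp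
        also have "\<dots> \<le> r\<^sup>2" by (simp add: r_def power2_sum)
        also have "\<dots> \<le> 2 * r\<^sup>2" by simp
        finally have "B * (\<theta>\<^sup>2 + \<theta>\<^sup>2 * norm w + \<bar>\<theta>\<bar> * norm w) \<le> B * (2 * r\<^sup>2)"
          using B(1) by (intro mult_left_mono) auto
        then show ?thesis by (simp add: algebra_simps)
      qed
      finally show ?thesis .
    qed
    have r2: "r\<^sup>2 \<le> r" using r0 r1 by (simp add: power2_eq_square mult_left_le)
    have \<delta>_le: "norm \<delta> \<le> 3 * B * r"
    proof -
      have "norm \<delta> \<le> norm (lin w \<theta>) + norm (\<delta> - lin w \<theta>)" using norm_triangle_ineq[of "lin w \<theta>" "\<delta> - lin w \<theta>"] by simp
      also have "\<dots> \<le> B * r + 2 * B * r\<^sup>2" using lin_le \<delta>lin by (intro add_mono) (auto simp: r_def)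
      also have "\<dots> \<le> B * r + 2 * B * r" using B(1) r2 by simp
      finally show ?thesis by simp
    qed
    define c where "c = braket \<sigma>' y"
    have y: "y = c0 *s \<sigma>' + \<delta>" by (simp add: \<delta>_def)
    have cc: "c = c0 + braket \<sigma>' \<delta>"
      unfolding c_def y by (simp add: braket_add_right braket_smult_right braket_self n\<sigma>)
    have cdiff: "cmod (c - c0) \<le> 3 * B * r"
      using braket_Cauchy_Schwarz[of \<sigma>' \<delta>] \<delta>_le by (simp add: cc n\<sigma>)
    have ck: "cmod c \<ge> k / 2"
      using norm_triangle_ineq2[of c0 "c0 - c"] cdiff r6 norm_minus_commute[of c c0] by (simp add: k_def)
    have cnz: "c \<noteq> 0" using ck k by auto
    define x where "x = inverse c *s prp \<sigma>' y"
    have py: "prp \<sigma>' y = prp \<sigma>' \<delta>" unfolding y by (simp add: prp_add prp_smult prp_self n\<sigma>)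
    have yx: "y = c *s (\<sigma>' + x)"
      using cnz prp_decomp[of y \<sigma>'] by (simp add: x_def vector_add_ldistrib vector_smult_assoc c_def)
    have p\<delta>: "norm (prp \<sigma>' \<delta>) \<le> 3 * B * r" using norm_prp_le[OF n\<sigma>(2), of \<delta>] \<delta>_le by simp
    have ic: "cmod (inverse c) \<le> 2 / k"
    proof -
      have "1 / cmod c \<le> 1 / (k / 2)" using ck k by (intro frac_le) auto
      moreover have "cmod (inverse c) = 1 / cmod c" using norm_inverse[of c] by (simp only: inverse_eq_divide)
      ultimately show ?thesis by simp
    qed
    have xn: "norm x \<le> 6 * B / k * r"
    proof -
      have "norm x \<le> 2 / k * (3 * B * r)"
        unfolding x_def norm_smult py using ic p\<delta> k by (intro mult_mono) auto
      then show ?thesis by simp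
    qed
    have xlin: "norm (x - (Alin C m s w + \<theta> *\<^sub>R bsh C m s)) \<le> (18 * B\<^sup>2 / k\<^sup>2 + 2 * B / k) * r\<^sup>2"
    proof -
      have "x - (Alin C m s w + \<theta> *\<^sub>R bsh C m s)
          = (inverse c - inverse c0) *s prp \<sigma>' \<delta> + inverse c0 *s prp \<sigma>' (\<delta> - lin w \<theta>)"
        unfolding Ab x_def py prp_diff vector_ssub_ldistrib vector_sub_rdistrib by simp
      then have "norm (x - (Alin C m s w + \<theta> *\<^sub>R bsh C m s))
          \<le> cmod (inverse c - inverse c0) * norm (prp \<sigma>' \<delta>) + cmod (inverse c0) * norm (prp \<sigma>' (\<delta> - lin w \<theta>))"
        using norm_triangle_ineq by (simp add: norm_smult[symmetric])
      also have "\<dots> \<le> (6 * B * r / k\<^sup>2) * (3 * B * r) + (1 / k) * (2 * B * r\<^sup>2)"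
      proof (intro add_mono mult_mono p\<delta>)
        have c0nz: "c0 \<noteq> 0" using k by (auto simp: k_def)
        have "inverse c - inverse c0 = inverse c * (c0 - c) * inverse c0"
          using cnz c0nz by (simp add: field_simps)
        then have "cmod (inverse c - inverse c0) = cmod (inverse c) * cmod (c - c0) * (1 / k)"
          by (simp add: norm_mult norm_minus_commute norm_inverse k_def divide_inverse)
        also have "\<dots> \<le> (2 / k) * (3 * B * r) * (1 / k)"
          using ic cdiff k B(1) r0 by (intro mult_mono) auto
        also have "\<dots> = 6 * B * r / k\<^sup>2" by (simp add: power2_eq_square)
        finally show "cmod (inverse c - inverse c0) \<le> 6 * B * r / k\<^sup>2" .
        show "cmod (inverse c0) \<le> 1 / k" by (simp add: k_def norm_inverse divide_inverse)
        show "norm (prp \<sigma>' (\<delta> - lin w \<theta>)) \<le> 2 * B * r\<^sup>2"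
          using norm_prp_le[OF n\<sigma>(2), of "\<delta> - lin w \<theta>"] \<delta>lin by simp
      qed (use B(1) r0 k in auto)
      also have "\<dots> = (18 * B\<^sup>2 / k\<^sup>2 + 2 * B / k) * r\<^sup>2" by (simp add: power2_eq_square algebra_simps)
      finally show ?thesis .
    qed
    have csq: "\<bar>(cmod c)\<^sup>2 - wt C m s\<bar> \<le> 9 * B * r"
    proof -
      have "norm y \<le> 2"
      proof -
        have "norm y \<le> norm (\<sigma> + w)" unfolding y_def by (rule norm_KU_le[OF un])
        also have "\<dots> \<le> 1 + norm w" using norm_triangle_ineq[of \<sigma> w] by (simp add: n\<sigma>)
        finally show ?thesis using w_r r1 by simp
      qed
      then have c2: "cmod c \<le> 2" using braket_Cauchy_Schwarz[of \<sigma>' y] by (simp add: c_def n\<sigma>)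
      have "\<bar>(cmod c)\<^sup>2 - k\<^sup>2\<bar> = \<bar>cmod c - k\<bar> * (cmod c + k)"
        using k by (simp add: power2_eq_square square_diff_square_factored abs_mult)
      also have "\<dots> \<le> (3 * B * r) * 3"
        using cdiff c2 k1 k B(1) r0 norm_triangle_ineq3[of c c0] by (intro mult_mono) (auto simp: k_def)
      finally show ?thesis using ab(4) by (simp add: k_def c0_def)
    qed
    have "let y = y; \<sigma> = \<sigma>'; c = braket \<sigma> y; x = inverse c *s prp \<sigma> y
      in c \<noteq> 0 \<and> y = c *s (\<sigma> + x) \<and> norm x \<le> M * r \<and>
         norm (x - (Alin C m s w + \<theta> *\<^sub>R bsh C m s)) \<le> M * r\<^sup>2 \<and> \<bar>(cmod c)\<^sup>2 - wt C m s\<bar> \<le> M * r"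
      unfolding Let_def c_def[symmetric] x_def[symmetric]
    proof (intro conjI cnz yx)
      show "norm x \<le> M * r" using xn mult_right_mono[OF M6 r0] by simp
      show "\<bar>(cmod c)\<^sup>2 - wt C m s\<bar> \<le> M * r" using csq mult_right_mono[OF M9 r0] by simp
      show "norm (x - (Alin C m s w + \<theta> *\<^sub>R bsh C m s)) \<le> M * r\<^sup>2"
        using xlin mult_right_mono[OF Msq, of "r\<^sup>2"] by simp
    qed
    then show "let y = K C m \<theta> *v (rep_vec s + w); \<sigma> = rep_vec (post C m s); c = braket \<sigma> y; x = inverse c *s prp \<sigma> y
      in c \<noteq> 0 \<and> y = c *s (\<sigma> + x) \<and> norm x \<le> M * (norm w + \<bar>\<theta>\<bar>) \<and>
         norm (x - (Alin C m s w + \<theta> *\<^sub>R bsh C m s)) \<le> M * (norm w + \<bar>\<theta>\<bar>)\<^sup>2 \<and>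
         \<bar>(cmod c)\<^sup>2 - wt C m s\<bar> \<le> M * (norm w + \<bar>\<theta>\<bar>)"
      unfolding y_def \<sigma>_def \<sigma>'_def r_def .
  qed
  then show ?thesis by blast
qed

end

section \<open>Iterating the first-order expansion\<close>

context monitored
begin

definition tang :: "('n, 'p) idx cmat \<Rightarrow> ('n, 'p) idx cvec \<Rightarrow> bool" where
  "tang s v \<longleftrightarrow> braket (rep_vec s) v = 0"

text \<open>One operator for both tangent kernels: the shift \<open>bsh\<close> gives the affine
  kernel, the shift 0 the linear one. Inactive branches may stay in the sum because their weight is
  0.\<close>

definition Pgen :: "(('n, 'p) idx cmat set \<Rightarrow> 'p mod_ring \<Rightarrow> ('n, 'p) idx cmat \<Rightarrow> ('n, 'p) idx cvec)
    \<Rightarrow> (('n, 'p) idx cmat \<Rightarrow> ('n, 'p) idx cvec \<Rightarrow> real) \<Rightarrow> ('n, 'p) idx cmat \<Rightarrow> ('n, 'p) idx cvec \<Rightarrow> real" where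
  "Pgen \<beta> \<nu> s v = (\<Sum>C\<in>Cl. \<Sum>m\<in>UNIV. wt C m s * \<nu> (post C m s) (Alin C m s v + \<beta> C m s)) / Nc"

abbreviation "Paff \<equiv> Pgen bsh"
abbreviation "Plin \<equiv> Pgen (\<lambda>_ _ _. 0)"

definition lips :: "real \<Rightarrow> (('n, 'p) idx cmat \<Rightarrow> ('n, 'p) idx cvec \<Rightarrow> real) \<Rightarrow> bool" where
  "lips L \<nu> \<longleftrightarrow> L \<ge> 0 \<and> (\<forall>s\<in>Stab. \<forall>v w. tang s v \<and> tang s w \<longrightarrow> \<bar>\<nu> s v - \<nu> s w\<bar> \<le> L * norm (v - w))"

definition tshift :: "(('n, 'p) idx cmat set \<Rightarrow> 'p mod_ring \<Rightarrow> ('n, 'p) idx cmat \<Rightarrow> ('n, 'p) idx cvec) \<Rightarrow> bool" where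
  "tshift \<beta> \<longleftrightarrow> (\<forall>C\<in>Cl. \<forall>m. \<forall>s\<in>Stab. wt C m s \<noteq> 0 \<longrightarrow> tang (post C m s) (\<beta> C m s))"

lemma tang_simps: "tang s 0" "tang s v \<Longrightarrow> tang s w \<Longrightarrow> tang s (v + w)" "tang s v \<Longrightarrow> tang s w \<Longrightarrow> tang s (v - w)"
  "tang s v \<Longrightarrow> tang s (t *\<^sub>R v)" "tang s v \<Longrightarrow> tang s (c *s v)"
  by (simp_all add: tang_def braket_add_right braket_diff_right braket_scaleR_right braket_smult_right)

lemma tshift_bsh: "tshift bsh"
  by (simp add: tshift_def tang_def bsh_tangent)

lemma tshift_0: "tshift (\<lambda>_ _ _. 0)"
  by (simp add: tshift_def tang_simps)

lemma post_Stab: "C \<in> Cl \<Longrightarrow> s \<in> Stab \<Longrightarrow> wt C m s \<noteq> 0 \<Longrightarrow> post C m s \<in> Stab"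
  by (intro active_branch(1)) (auto simp: wt_def)

lemma tang_Alin: "C \<in> Cl \<Longrightarrow> s \<in> Stab \<Longrightarrow> wt C m s \<noteq> 0 \<Longrightarrow> tang (post C m s) (Alin C m s v)"
  by (simp add: tang_def Alin_tangent)

lemma tang_step: "tshift \<beta> \<Longrightarrow> C \<in> Cl \<Longrightarrow> s \<in> Stab \<Longrightarrow> wt C m s \<noteq> 0 \<Longrightarrow> tang (post C m s) (Alin C m s v + \<beta> C m s)"
  unfolding tshift_def by (intro tang_simps tang_Alin) auto

lemma lipsD: "lips L \<nu> \<Longrightarrow> s \<in> Stab \<Longrightarrow> tang s v \<Longrightarrow> tang s w \<Longrightarrow> \<bar>\<nu> s v - \<nu> s w\<bar> \<le> L * norm (v - w)"
  by (simp add: lips_def)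

text \<open>The shift cancels in differences, so \<open>Alin_contraction\<close> contracts Lipschitz
  constants by the same \<open>rate\<close> for both kernels.\<close>

lemma lips_Pgen:
  assumes L: "lips L \<nu>" and \<beta>: "tshift \<beta>"
  shows "lips (rate * L) (Pgen \<beta> \<nu>)"
  unfolding lips_def
proof (intro conjI ballI allI impI)
  have L0: "L \<ge> 0" using L by (simp add: lips_def)
  then show "rate * L \<ge> 0" using rate by simp
  fix s v w assume s: "s \<in> Stab" and vw: "tang s v \<and> tang s w"
  have *: "\<bar>wt C m s * \<nu> (post C m s) (Alin C m s v + \<beta> C m s) - wt C m s * \<nu> (post C m s) (Alin C m s w + \<beta> C m s)\<bar>
      \<le> L * (wt C m s * norm (Alin C m s (v - w)))" if C: "C \<in> Cl" for C m
  proof (cases "wt C m s = 0")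
    case False
    have "\<bar>\<nu> (post C m s) (Alin C m s v + \<beta> C m s) - \<nu> (post C m s) (Alin C m s w + \<beta> C m s)\<bar>
        \<le> L * norm ((Alin C m s v + \<beta> C m s) - (Alin C m s w + \<beta> C m s))"
      using False C s \<beta> by (intro lipsD[OF L] post_Stab tang_step)
    also have "(Alin C m s v + \<beta> C m s) - (Alin C m s w + \<beta> C m s) = Alin C m s (v - w)"
      by (simp add: Alin_diff[symmetric])
    finally have "wt C m s * \<bar>\<nu> (post C m s) (Alin C m s v + \<beta> C m s) - \<nu> (post C m s) (Alin C m s w + \<beta> C m s)\<bar>
        \<le> wt C m s * (L * norm (Alin C m s (v - w)))" by (rule mult_left_mono[OF _ wt_nonneg])
    then show ?thesis by (simp add: right_diff_distrib[symmetric] abs_mult wt_nonneg mult.left_commute)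
  qed simp
  have "\<bar>Pgen \<beta> \<nu> s v - Pgen \<beta> \<nu> s w\<bar>
      = \<bar>\<Sum>C\<in>Cl. \<Sum>m\<in>UNIV. wt C m s * \<nu> (post C m s) (Alin C m s v + \<beta> C m s) - wt C m s * \<nu> (post C m s) (Alin C m s w + \<beta> C m s)\<bar> / Nc"
    using Nc_pos by (simp add: Pgen_def sum_subtractf diff_divide_distrib[symmetric] abs_divide)
  also have "\<dots> \<le> (\<Sum>C\<in>Cl. \<Sum>m\<in>UNIV. L * (wt C m s * norm (Alin C m s (v - w)))) / Nc"
    using Nc_pos
    by (intro divide_right_mono order_trans[OF sum_abs] sum_mono order_trans[OF sum_abs] *) auto
  also have "\<dots> = L * ((\<Sum>C\<in>Cl. \<Sum>m\<in>UNIV. wt C m s * norm (Alin C m s (v - w))) / Nc)"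
    by (simp add: sum_distrib_left)
  also have "\<dots> \<le> L * (rate * norm (v - w))"
  proof (rule mult_left_mono[OF Alin_contraction[OF s] L0])
    show "braket (rep_vec s) (v - w) = 0" using vw by (simp add: tang_def braket_diff_right)
  qed
  finally show "\<bar>Pgen \<beta> \<nu> s v - Pgen \<beta> \<nu> s w\<bar> \<le> rate * L * norm (v - w)" by (simp add: mult_ac)
qed

text \<open>A blow-up at the scale \<theta>: near \<open>s\<close> the function
  \<open>f \<theta>\<close> is \<theta> times \<nu> in the rescaled coordinate
  \<open>w / \<theta>\<close>. The error is quadratic in both quantities jointly and is required for
  every tangent \<open>w\<close>.\<close>

definition approx :: "(real \<Rightarrow> ('n, 'p) idx cvec \<Rightarrow> real) \<Rightarrow> (('n, 'p) idx cmat \<Rightarrow> ('n, 'p) idx cvec \<Rightarrow> real) \<Rightarrow> bool" where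
  "approx f \<nu> \<longleftrightarrow> (\<exists>B. \<forall>s\<in>Stab. \<forall>w \<theta>. tang s w \<and> 0 < \<theta> \<and> \<theta> \<le> 1 \<longrightarrow>
    \<bar>f \<theta> (rep_vec s + w) - \<theta> * \<nu> s ((1 / \<theta>) *\<^sub>R w)\<bar> \<le> B * (\<theta> + norm w)\<^sup>2)"

text \<open>Three cases. In a branch of weight 0 the image has length
  \<open>O(\<theta> + norm w)\<close>, so \<open>f\<close>, being of degree two, is already of the
  size of the error. For small \<open>r\<close> the branch is linearized: homogeneity extracts the
  amplitude \<open>c\<close>, and the Lipschitz property of \<nu> replaces \<open>x\<close> by its
  linear part. For larger \<open>r\<close> one has \<open>1 \<le> B1 * r\<close>, which raises
  constant and linear bounds to quadratic ones.\<close>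

lemma approx_branch:
  assumes ap: "\<And>s w \<theta>. s \<in> Stab \<Longrightarrow> tang s w \<Longrightarrow> 0 < \<theta> \<Longrightarrow> \<theta> \<le> 1 \<Longrightarrow>
      \<bar>f \<theta> (rep_vec s + w) - \<theta> * \<nu> s ((1 / \<theta>) *\<^sub>R w)\<bar> \<le> B0 * (\<theta> + norm w)\<^sup>2" and B0: "B0 \<ge> 0"
    and L: "lips L \<nu>" and hom: "\<And>\<theta> c y. f \<theta> (c *s y) = (cmod c)\<^sup>2 * f \<theta> y"
    and bd: "\<And>\<theta> y. \<bar>f \<theta> y\<bar> \<le> M * (norm y)\<^sup>2" and M: "M \<ge> 0"
    and C: "C \<in> Cl" and s: "s \<in> Stab"
  shows "\<exists>B. \<forall>w \<theta>. tang s w \<and> 0 < \<theta> \<and> \<theta> \<le> 1 \<longrightarrow>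
    \<bar>f \<theta> (K C m \<theta> *v (rep_vec s + w)) - \<theta> * (wt C m s * \<nu> (post C m s) (Alin C m s ((1 / \<theta>) *\<^sub>R w) + bsh C m s))\<bar>
      \<le> B * (\<theta> + norm w)\<^sup>2"
proof (cases "wt C m s = 0")
  case True
  obtain B where B: "B \<ge> 1" "\<And>C m \<theta> (y :: ('n, 'p) idx cvec). C \<in> Cl \<Longrightarrow> 0 \<le> \<theta> \<Longrightarrow> \<theta> \<le> 1 \<Longrightarrow>
    norm (K C m \<theta> *v y - K C m 0 *v y) \<le> B * \<theta> * norm y"
    using branch_lipschitz by blast
  have K0: "K C m 0 *v rep_vec s = 0" using True by (simp add: wt_def)
  have "\<bar>f \<theta> (K C m \<theta> *v (rep_vec s + w))\<bar> \<le> (M * B\<^sup>2) * (\<theta> + norm w)\<^sup>2"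
    if \<theta>: "0 < \<theta>" "\<theta> \<le> 1" for w \<theta>
  proof -
    have "norm (K C m \<theta> *v (rep_vec s + w)) \<le> norm (K C m \<theta> *v rep_vec s) + norm (K C m \<theta> *v w)"
      unfolding matrix_vector_right_distrib by (rule norm_triangle_ineq)
    also have "\<dots> \<le> B * \<theta> + norm w"
      using B(2)[OF C, of \<theta> m "rep_vec s"] \<theta> norm_KU_le[OF rep_unitary_unitary[OF C]]
      by (intro add_mono) (auto simp: K0 rep_vec_norm[OF s])
    also have "\<dots> \<le> B * \<theta> + B * norm w" using B(1) by (simp add: mult_le_cancel_right1)
    finally have "norm (K C m \<theta> *v (rep_vec s + w)) \<le> B * (\<theta> + norm w)" by (simp add: distrib_left)
    then have "(norm (K C m \<theta> *v (rep_vec s + w)))\<^sup>2 \<le> (B * (\<theta> + norm w))\<^sup>2" by (intro power_mono) auto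
    then have "M * (norm (K C m \<theta> *v (rep_vec s + w)))\<^sup>2 \<le> M * (B * (\<theta> + norm w))\<^sup>2"
      using M by (rule mult_left_mono)
    then show ?thesis using bd[of \<theta> "K C m \<theta> *v (rep_vec s + w)"] by (simp add: power_mult_distrib mult.assoc)
  qed
  then show ?thesis using True by (intro exI[of _ "M * B\<^sup>2"]) auto
next
  case False
  then have nz: "K C m 0 *v rep_vec s \<noteq> 0" by (auto simp: wt_def)
  define s' where "s' = post C m s"
  have s': "s' \<in> Stab" unfolding s'_def using post_Stab[OF C s False] .
  obtain B1 where lb: "lin_bound (C, m, s) B1" using lin_bound_exists[OF C s nz] by blast
  have B1: "B1 \<ge> 1" using lb unfolding lin_bound_def case_prod_conv by (rule conjunct1)
  have lin1: "norm (Alin C m s w + \<theta> *\<^sub>R bsh C m s) \<le> B1 * (norm w + \<bar>\<theta>\<bar>)" for w \<theta>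
    using lb unfolding lin_bound_def case_prod_conv by blast
  have L0: "L \<ge> 0" using L by (simp add: lips_def)
  define N0 where "N0 = \<bar>\<nu> s' 0\<bar>"
  define Q1 where "Q1 = B0 * (2 * B1)\<^sup>2 + L * B1"
  define Q2 where "Q2 = N0 + L * B1"
  have Q: "Q1 \<ge> 0" "Q2 \<ge> 0" using B0 B1 L0 by (simp_all add: Q1_def Q2_def N0_def)
  have nlin: "\<bar>\<theta> * \<nu> s' (Alin C m s ((1 / \<theta>) *\<^sub>R w) + bsh C m s)\<bar> \<le> Q2 * (\<theta> + norm w)" if \<theta>: "0 < \<theta>" for w \<theta>
  proof -
    define z where "z = Alin C m s ((1 / \<theta>) *\<^sub>R w) + bsh C m s"
    have tz: "tang s' z" unfolding z_def s'_def by (rule tang_step[OF tshift_bsh C s False])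
    have sz: "\<theta> *\<^sub>R z = Alin C m s w + \<theta> *\<^sub>R bsh C m s"
      using \<theta> by (simp add: z_def scaleR_add_right Alin_scaleR[symmetric])
    have "\<bar>\<nu> s' z\<bar> \<le> N0 + L * norm z"
      using lipsD[OF L s' tz tang_simps(1)] by (simp add: N0_def)
    then have "\<theta> * \<bar>\<nu> s' z\<bar> \<le> \<theta> * (N0 + L * norm z)" using \<theta> by (intro mult_left_mono) auto
    also have "\<dots> = \<theta> * N0 + L * norm (\<theta> *\<^sub>R z)" using \<theta> by (simp add: algebra_simps)
    also have "\<dots> \<le> (\<theta> + norm w) * N0 + L * (B1 * (norm w + \<theta>))"
      unfolding sz using lin1[of w \<theta>] \<theta> L0 by (intro add_mono mult_right_mono mult_left_mono) (auto simp: N0_def)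
    also have "\<dots> = Q2 * (\<theta> + norm w)" by (simp add: Q2_def algebra_simps)
    finally show ?thesis using \<theta> by (simp add: z_def abs_mult)
  qed
  \<comment> \<open>The first bracket serves the case \<open>r \<le> 1 / B1\<close>, where 4 bounds
    the squared amplitude; the second serves the case of larger \<open>r\<close>.\<close>
  define B where "B = (4 * Q1 + B1 * Q2) + (M * (B1\<^sup>2 + 1) + Q2 * B1)"
  have main: "\<bar>f \<theta> (K C m \<theta> *v (rep_vec s + w)) - \<theta> * (wt C m s * \<nu> s' (Alin C m s ((1 / \<theta>) *\<^sub>R w) + bsh C m s))\<bar>
      \<le> B * (\<theta> + norm w)\<^sup>2" if w: "tang s w" and \<theta>: "0 < \<theta>" "\<theta> \<le> 1" for w \<theta>
  proof -
    define r where "r = \<theta> + norm w"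
    have r0: "r > 0" using \<theta> by (simp add: r_def add_pos_nonneg)
    define z where "z = Alin C m s ((1 / \<theta>) *\<^sub>R w) + bsh C m s"
    define y where "y = K C m \<theta> *v (rep_vec s + w)"
    have nl: "\<bar>\<theta> * \<nu> s' z\<bar> \<le> Q2 * r" using nlin[OF \<theta>(1)] by (simp add: z_def r_def)
    have tz: "tang s' z" unfolding z_def s'_def by (rule tang_step[OF tshift_bsh C s False])
    have sz: "\<theta> *\<^sub>R z = Alin C m s w + \<theta> *\<^sub>R bsh C m s"
      using \<theta> by (simp add: z_def scaleR_add_right Alin_scaleR[symmetric])
    have p1: "wt C m s \<le> 1" by (rule wt_le_1[OF C s])
    have ny: "(norm y)\<^sup>2 \<le> 1 + (norm w)\<^sup>2"
    proof -
      have "(norm y)\<^sup>2 \<le> (norm (rep_vec s + w))\<^sup>2"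
        unfolding y_def by (intro power_mono norm_KU_le rep_unitary_unitary[OF C]) auto
      also have "\<dots> = 1 + (norm w)\<^sup>2"
        using w by (simp add: norm_orthogonal_sum tang_def rep_vec_norm[OF s])
      finally show ?thesis .
    qed
    show ?thesis
    proof (cases "r \<le> 1 / B1")
      case True
      define c where "c = braket (rep_vec s') y"
      define x where "x = inverse c *s prp (rep_vec s') y"
      have small: "norm w + \<bar>\<theta>\<bar> \<le> 1 / B1" using True \<theta> by (simp add: r_def)
      have "c \<noteq> 0 \<and> y = c *s (rep_vec s' + x) \<and> norm x \<le> B1 * (norm w + \<bar>\<theta>\<bar>) \<and>
        norm (x - (Alin C m s w + \<theta> *\<^sub>R bsh C m s)) \<le> B1 * (norm w + \<bar>\<theta>\<bar>)\<^sup>2 \<and>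
        \<bar>(cmod c)\<^sup>2 - wt C m s\<bar> \<le> B1 * (norm w + \<bar>\<theta>\<bar>)"
        using lb small unfolding lin_bound_def case_prod_conv Let_def c_def x_def y_def s'_def by blast
      moreover have "norm w + \<bar>\<theta>\<bar> = r" using \<theta> by (simp add: r_def)
      ultimately have cx: "c \<noteq> 0" "y = c *s (rep_vec s' + x)" "norm x \<le> B1 * r"
        "norm (x - \<theta> *\<^sub>R z) \<le> B1 * r\<^sup>2" "\<bar>(cmod c)\<^sup>2 - wt C m s\<bar> \<le> B1 * r"
        by (simp_all only: sz not_False_eq_True)
      have r1: "r \<le> 1" using True B1 by (elim order_trans) simp
      have tx: "tang s' x"
        by (simp add: x_def tang_def braket_smult_right braket_prp rep_vec_norm[OF s'])
      have "\<bar>f \<theta> (rep_vec s' + x) - \<theta> * \<nu> s' ((1 / \<theta>) *\<^sub>R x)\<bar> \<le> B0 * (\<theta> + norm x)\<^sup>2"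
        by (rule ap[OF s' tx \<theta>])
      also have "\<dots> \<le> B0 * (2 * B1 * r)\<^sup>2"
      proof (intro mult_left_mono power_mono B0)
        have "\<theta> \<le> 1 * r" by (simp add: r_def)
        also have "\<dots> \<le> B1 * r" using B1 r0 by (intro mult_right_mono) auto
        finally show "\<theta> + norm x \<le> 2 * B1 * r" using cx(3) by simp
      qed (use \<theta> in auto)
      finally have e1: "\<bar>f \<theta> (rep_vec s' + x) - \<theta> * \<nu> s' ((1 / \<theta>) *\<^sub>R x)\<bar> \<le> B0 * (2 * B1)\<^sup>2 * r\<^sup>2"
        by (simp add: power_mult_distrib mult.assoc)
      have "\<bar>\<nu> s' ((1 / \<theta>) *\<^sub>R x) - \<nu> s' z\<bar> \<le> L * norm ((1 / \<theta>) *\<^sub>R x - z)"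
        by (intro lipsD[OF L s'] tang_simps tx tz)
      then have "\<theta> * \<bar>\<nu> s' ((1 / \<theta>) *\<^sub>R x) - \<nu> s' z\<bar> \<le> \<theta> * (L * norm ((1 / \<theta>) *\<^sub>R x - z))"
        using \<theta> by (intro mult_left_mono) auto
      also have "\<dots> = L * norm (\<theta> *\<^sub>R ((1 / \<theta>) *\<^sub>R x - z))" using \<theta> by simp
      also have "\<theta> *\<^sub>R ((1 / \<theta>) *\<^sub>R x - z) = x - \<theta> *\<^sub>R z" using \<theta> by (simp add: scaleR_diff_right)
      also have "L * norm (x - \<theta> *\<^sub>R z) \<le> L * (B1 * r\<^sup>2)" by (intro mult_left_mono cx L0)
      finally have e2: "\<bar>\<theta> * \<nu> s' ((1 / \<theta>) *\<^sub>R x) - \<theta> * \<nu> s' z\<bar> \<le> L * B1 * r\<^sup>2"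
        using \<theta> by (simp add: right_diff_distrib[symmetric] abs_mult mult.assoc)
      have e12: "\<bar>f \<theta> (rep_vec s' + x) - \<theta> * \<nu> s' z\<bar> \<le> Q1 * r\<^sup>2"
        using e1 e2 unfolding Q1_def distrib_right by linarith
      have c4: "(cmod c)\<^sup>2 \<le> 4"
      proof -
        have "(cmod c)\<^sup>2 \<le> (norm y)\<^sup>2"
          using norm_prp[OF rep_vec_norm[OF s'], of y] by (simp add: c_def)
        moreover have "(norm w)\<^sup>2 \<le> 1" using r1 \<theta> by (intro power_le_one) (auto simp: r_def)
        ultimately show ?thesis using ny by linarith
      qed
      have fy: "f \<theta> y = (cmod c)\<^sup>2 * f \<theta> (rep_vec s' + x)" by (subst cx(2)) (rule hom)
      have "f \<theta> y - \<theta> * (wt C m s * \<nu> s' z)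
          = (cmod c)\<^sup>2 * (f \<theta> (rep_vec s' + x) - \<theta> * \<nu> s' z) + ((cmod c)\<^sup>2 - wt C m s) * (\<theta> * \<nu> s' z)"
        unfolding fy by (simp add: algebra_simps)
      also have "\<bar>\<dots>\<bar> \<le> (cmod c)\<^sup>2 * \<bar>f \<theta> (rep_vec s' + x) - \<theta> * \<nu> s' z\<bar> + \<bar>(cmod c)\<^sup>2 - wt C m s\<bar> * \<bar>\<theta> * \<nu> s' z\<bar>"
        by (rule order_trans[OF abs_triangle_ineq]) (simp add: abs_mult)
      also have "\<dots> \<le> 4 * (Q1 * r\<^sup>2) + (B1 * r) * (Q2 * r)"
        using c4 e12 cx(5) nl B1 r0 Q by (intro add_mono mult_mono) auto
      also have "\<dots> = (4 * Q1 + B1 * Q2) * r\<^sup>2" by (simp add: power2_eq_square algebra_simps)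
      also have "\<dots> \<le> B * r\<^sup>2"
        using M Q B1 by (intro mult_right_mono) (auto simp: B_def)
      finally show ?thesis by (simp add: y_def z_def r_def)
    next
      case False
      then have "B1 * (1 / B1) \<le> B1 * r" using B1 by (intro mult_left_mono) auto
      then have rB: "1 \<le> B1 * r" using B1 by simp
      then have rB2: "1 \<le> B1\<^sup>2 * r\<^sup>2" unfolding power_mult_distrib[symmetric] by (rule one_le_power)
      have "(norm w)\<^sup>2 \<le> r\<^sup>2" using \<theta> by (intro power_mono) (auto simp: r_def)
      then have "(norm y)\<^sup>2 \<le> (B1\<^sup>2 + 1) * r\<^sup>2" using ny rB2 by (simp add: distrib_right)
      then have "M * (norm y)\<^sup>2 \<le> M * ((B1\<^sup>2 + 1) * r\<^sup>2)" using M by (rule mult_left_mono)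
      then have f1: "\<bar>f \<theta> y\<bar> \<le> M * (B1\<^sup>2 + 1) * r\<^sup>2" using bd[of \<theta> y] by (simp add: mult.assoc)
      have "\<bar>\<theta> * (wt C m s * \<nu> s' z)\<bar> = wt C m s * \<bar>\<theta> * \<nu> s' z\<bar>" using wt_nonneg by (simp add: abs_mult)
      also have "\<dots> \<le> 1 * (Q2 * r)" using p1 nl wt_nonneg Q by (intro mult_mono) auto
      also have "\<dots> \<le> (Q2 * r) * (B1 * r)" using rB Q r0 mult_left_mono[OF rB, of "Q2 * r"] by simp
      also have "\<dots> = Q2 * B1 * r\<^sup>2" by (simp add: power2_eq_square)
      finally have "\<bar>f \<theta> y - \<theta> * (wt C m s * \<nu> s' z)\<bar> \<le> (M * (B1\<^sup>2 + 1) + Q2 * B1) * r\<^sup>2"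
        using f1 unfolding distrib_right[of "M * _"] by linarith
      also have "\<dots> \<le> B * r\<^sup>2"
        using M Q B1 by (intro mult_right_mono) (auto simp: B_def)
      finally show ?thesis by (simp add: y_def z_def r_def)
    qed
  qed
  then show ?thesis unfolding s'_def[symmetric] by blast
qed

lemma approx_step:
  assumes ap: "approx f \<nu>" and L: "lips L \<nu>" and hom: "\<And>\<theta> c y. f \<theta> (c *s y) = (cmod c)\<^sup>2 * f \<theta> y"
    and bd: "\<And>\<theta> y. \<bar>f \<theta> y\<bar> \<le> M * (norm y)\<^sup>2" and M: "M \<ge> 0"
  shows "approx (\<lambda>\<theta>. avg a q1 \<theta> (f \<theta>)) (Paff \<nu>)"
proof -
  obtain B where B: "\<And>s w \<theta>. s \<in> Stab \<Longrightarrow> tang s w \<Longrightarrow> 0 < \<theta> \<Longrightarrow> \<theta> \<le> 1 \<Longrightarrow>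
      \<bar>f \<theta> (rep_vec s + w) - \<theta> * \<nu> s ((1 / \<theta>) *\<^sub>R w)\<bar> \<le> B * (\<theta> + norm w)\<^sup>2"
    using ap unfolding approx_def by blast
  have ap0: "\<bar>f \<theta> (rep_vec s + w) - \<theta> * \<nu> s ((1 / \<theta>) *\<^sub>R w)\<bar> \<le> max B 0 * (\<theta> + norm w)\<^sup>2"
    if "s \<in> Stab" "tang s w" "0 < \<theta>" "\<theta> \<le> 1" for s w \<theta>
    using B[OF that] by (rule order_trans) (intro mult_right_mono, auto)
  define P where "P = (\<lambda>(C, m, s) B. \<forall>w \<theta>. tang s w \<and> 0 < \<theta> \<and> \<theta> \<le> 1 \<longrightarrow>
    \<bar>f \<theta> (K C m \<theta> *v (rep_vec s + w)) - \<theta> * (wt C m s * \<nu> (post C m s) (Alin C m s ((1 / \<theta>) *\<^sub>R w) + bsh C m s))\<bar>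
      \<le> B * (\<theta> + norm w)\<^sup>2)"
  have "\<exists>B\<ge>1. \<forall>t\<in>Cl \<times> UNIV \<times> Stab. P t B"
  proof (rule finite_uniform_bound)
    show "finite (Cl \<times> (UNIV :: 'p mod_ring set) \<times> Stab)" using fin_cl Stab_finite by simp
    show "\<exists>B. P t B" if "t \<in> Cl \<times> UNIV \<times> Stab" for t
    proof -
      obtain C m s where t: "t = (C, m, s)" by (cases t)
      show ?thesis unfolding P_def t case_prod_conv
        using that t by (intro approx_branch[OF ap0 max.cobounded2 L hom bd M]) auto
    qed
    show "P t B'" if "P t B" "B \<le> B'" for t B B'
    proof -
      obtain C m s where t: "t = (C, m, s)" by (cases t)
      show ?thesis unfolding P_def t case_prod_conv
      proof (intro allI impI)
        fix w and \<theta> :: real assume w: "tang s w \<and> 0 < \<theta> \<and> \<theta> \<le> 1"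
        have "\<bar>f \<theta> (K C m \<theta> *v (rep_vec s + w)) - \<theta> * (wt C m s * \<nu> (post C m s) (Alin C m s ((1 / \<theta>) *\<^sub>R w) + bsh C m s))\<bar>
          \<le> B * (\<theta> + norm w)\<^sup>2"
          using that(1) w unfolding P_def t case_prod_conv by blast
        also have "\<dots> \<le> B' * (\<theta> + norm w)\<^sup>2" by (rule mult_right_mono[OF that(2)]) simp
        finally show "\<bar>f \<theta> (K C m \<theta> *v (rep_vec s + w)) - \<theta> * (wt C m s * \<nu> (post C m s) (Alin C m s ((1 / \<theta>) *\<^sub>R w) + bsh C m s))\<bar>
          \<le> B' * (\<theta> + norm w)\<^sup>2" .
      qed
    qed
  qed
  then obtain B2 where B2: "\<And>C m s w \<theta>. C \<in> Cl \<Longrightarrow> s \<in> Stab \<Longrightarrow> tang s w \<Longrightarrow> 0 < \<theta> \<Longrightarrow> \<theta> \<le> 1 \<Longrightarrow>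
    \<bar>f \<theta> (K C m \<theta> *v (rep_vec s + w)) - \<theta> * (wt C m s * \<nu> (post C m s) (Alin C m s ((1 / \<theta>) *\<^sub>R w) + bsh C m s))\<bar>
      \<le> B2 * (\<theta> + norm w)\<^sup>2"
    unfolding P_def by fast
  have "\<bar>avg a q1 \<theta> (f \<theta>) (rep_vec s + w) - \<theta> * Paff \<nu> s ((1 / \<theta>) *\<^sub>R w)\<bar> \<le> (real CARD('p) * B2) * (\<theta> + norm w)\<^sup>2"
    if s: "s \<in> Stab" and w: "tang s w" and \<theta>: "0 < \<theta>" "\<theta> \<le> 1" for s w \<theta>
  proof -
    define F where "F C m = f \<theta> (K C m \<theta> *v (rep_vec s + w))
      - \<theta> * (wt C m s * \<nu> (post C m s) (Alin C m s ((1 / \<theta>) *\<^sub>R w) + bsh C m s))" for C m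
    have "avg a q1 \<theta> (f \<theta>) (rep_vec s + w) - \<theta> * Paff \<nu> s ((1 / \<theta>) *\<^sub>R w) = (\<Sum>C\<in>Cl. \<Sum>m\<in>UNIV. F C m) / Nc"
      by (simp add: avg_def Pgen_def F_def Nc_def[symmetric] sum_subtractf diff_divide_distrib sum_distrib_left)
    also have "\<bar>\<dots>\<bar> = \<bar>\<Sum>C\<in>Cl. \<Sum>m\<in>UNIV. F C m\<bar> / Nc" using Nc_pos by (simp add: abs_divide)
    also have "\<dots> \<le> (\<Sum>C\<in>Cl. \<Sum>m\<in>(UNIV :: 'p mod_ring set). B2 * (\<theta> + norm w)\<^sup>2) / Nc"
      unfolding F_def using Nc_pos
      by (intro divide_right_mono order_trans[OF sum_abs] sum_mono order_trans[OF sum_abs] B2 s w \<theta>) auto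
    also have "\<dots> = (real CARD('p) * B2) * (\<theta> + norm w)\<^sup>2"
      using Nc_pos by (simp add: Nc_def[symmetric])
    finally show ?thesis .
  qed
  then show ?thesis unfolding approx_def by blast
qed

end

section \<open>The stationary mana up to first order\<close>

context monitored
begin

definition fiter :: "nat \<Rightarrow> real \<Rightarrow> ('n, 'p) idx cvec \<Rightarrow> real" where
  "fiter n \<theta> = (avg a q1 \<theta> ^^ n) mfun"

definition nu :: "nat \<Rightarrow> ('n, 'p) idx cmat \<Rightarrow> ('n, 'p) idx cvec \<Rightarrow> real" where
  "nu n = (Paff ^^ n) (\<lambda>s. tmana (rep_vec s))"

lemma fiter_Suc: "fiter (Suc n) \<theta> = avg a q1 \<theta> (fiter n \<theta>)"
  by (simp add: fiter_def)

lemma fiter_smult: "fiter n \<theta> (c *s y) = (cmod c)\<^sup>2 * fiter n \<theta> y"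
proof (induction n arbitrary: c y)
  case 0
  then show ?case by (simp add: fiter_def mfun_smult)
next
  case (Suc n)
  show ?case unfolding fiter_Suc by (rule avg_smult) (rule Suc)
qed

lemma fiter_nonneg: "fiter n \<theta> y \<ge> 0"
proof (induction n arbitrary: y)
  case 0
  then show ?case by (simp add: fiter_def mfun_nonneg)
next
  case (Suc n)
  show ?case unfolding fiter_Suc avg_def by (intro divide_nonneg_nonneg sum_nonneg Suc) auto
qed

lemma fiter_cliff: "cliff V \<Longrightarrow> fiter n \<theta> (V *v y) = fiter n \<theta> y"
proof (induction n arbitrary: V y)
  case 0
  then show ?case by (simp add: fiter_def mfun_cliff)
next
  case (Suc n)
  show ?case unfolding fiter_Suc by (rule avg_cliff[OF Suc.prems]) (rule Suc.IH)
qed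

lemma mfun_le_hfun: "\<exists>E\<ge>0. \<forall>y :: ('n, 'p) idx cvec. mfun y \<le> E * hfun y"
proof (intro exI conjI allI)
  let ?E = "npts TYPE('n) * 3 / ln 2"
  show "?E \<ge> 0" by (simp add: npts_def)
  fix y :: "('n, 'p) idx cvec"
  obtain s where s: "s \<in> Stab" "sdist y = norm (prp (rep_vec s) y)" by (rule sdist_attained)
  show "mfun y \<le> ?E * hfun y"
    using mfun_le[OF stab_vec_rep_vec[OF s(1)], of y] by (simp add: hfun_def s(2))
qed

text \<open>Iterates the drift of \<open>avg_hfun\<close>. The induction carries the partial
  geometric sum, which reproduces itself exactly; only afterwards is it replaced by its limit, which
  makes the bound uniform in \<open>n\<close>.\<close>

lemma fiter_le:
  "\<exists>E\<ge>0. \<exists>B\<ge>0. \<forall>n \<theta> y. 0 \<le> \<theta> \<and> \<theta> \<le> 1 \<longrightarrow> fiter n \<theta> y \<le> E * (rate ^ n * hfun y + B * \<theta> * (norm y)\<^sup>2)"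
proof -
  obtain E where E: "E \<ge> 0" "\<And>y :: ('n, 'p) idx cvec. mfun y \<le> E * hfun y" using mfun_le_hfun by blast
  obtain B where B: "B \<ge> 0" "\<And>\<theta> (y :: ('n, 'p) idx cvec). 0 \<le> \<theta> \<Longrightarrow> \<theta> \<le> 1 \<Longrightarrow>
    avg a q1 \<theta> hfun y \<le> rate * hfun y + B * \<theta> * (norm y)\<^sup>2" using avg_hfun by blast
  have main: "fiter n \<theta> y \<le> E * (rate ^ n * hfun y + (B * (1 - rate ^ n) / (1 - rate)) * \<theta> * (norm y)\<^sup>2)"
    if \<theta>: "0 \<le> \<theta>" "\<theta> \<le> 1" for n \<theta> y
  proof (induction n arbitrary: y)
    case 0
    then show ?case using E(2) by (simp add: fiter_def)
  next
    case (Suc n)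
    let ?b = "B * (1 - rate ^ n) / (1 - rate)"
    have "fiter (Suc n) \<theta> y \<le> avg a q1 \<theta> (\<lambda>y. E * (rate ^ n * hfun y + (?b * \<theta>) * (norm y)\<^sup>2)) y"
      unfolding fiter_Suc by (rule avg_mono) (rule Suc)
    also have "\<dots> = E * (rate ^ n * avg a q1 \<theta> hfun y + (?b * \<theta>) * (norm y)\<^sup>2)"
      unfolding avg_cmult avg_add avg_norm ..
    also have "\<dots> \<le> E * (rate ^ n * (rate * hfun y + B * \<theta> * (norm y)\<^sup>2) + (?b * \<theta>) * (norm y)\<^sup>2)"
      by (rule mult_left_mono[OF add_right_mono[OF mult_left_mono[OF B(2)[OF \<theta>]]] E(1)]) (use rate in simp)
    also have "\<dots> = E * (rate ^ Suc n * hfun y + (B * rate ^ n + ?b) * \<theta> * (norm y)\<^sup>2)"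
      by (simp add: algebra_simps)
    also have "B * rate ^ n + ?b = B * (1 - rate ^ Suc n) / (1 - rate)"
      using rate by (simp add: field_simps)
    finally show ?case .
  qed
  have "fiter n \<theta> y \<le> E * (rate ^ n * hfun y + (B / (1 - rate)) * \<theta> * (norm y)\<^sup>2)"
    if \<theta>: "0 \<le> \<theta>" "\<theta> \<le> 1" for n \<theta> y
  proof -
    have "rate ^ n \<ge> 0" using rate by simp
    then have "B * (1 - rate ^ n) \<le> B * 1" using B(1) by (intro mult_left_mono) auto
    then have "B * (1 - rate ^ n) / (1 - rate) \<le> B / (1 - rate)"
      using rate by (intro divide_right_mono) auto
    then have "(B * (1 - rate ^ n) / (1 - rate)) * \<theta> * (norm y)\<^sup>2 \<le> (B / (1 - rate)) * \<theta> * (norm y)\<^sup>2"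
      using \<theta> by (intro mult_right_mono) auto
    then have "E * (rate ^ n * hfun y + (B * (1 - rate ^ n) / (1 - rate)) * \<theta> * (norm y)\<^sup>2)
        \<le> E * (rate ^ n * hfun y + (B / (1 - rate)) * \<theta> * (norm y)\<^sup>2)"
      using E(1) by (intro mult_left_mono add_left_mono)
    with main[OF \<theta>] show ?thesis by (rule order_trans)
  qed
  moreover have "B / (1 - rate) \<ge> 0" using B rate by simp
  ultimately show ?thesis using E(1) by blast
qed

lemma mfun_bounded: "\<exists>M\<ge>0. \<forall>y :: ('n, 'p) idx cvec. mfun y \<le> M * (norm y)\<^sup>2"
proof -
  obtain E where E: "E \<ge> 0" "\<And>y :: ('n, 'p) idx cvec. mfun y \<le> E * hfun y" using mfun_le_hfun by blast
  have "mfun y \<le> E * (norm y)\<^sup>2" for y :: "('n, 'p) idx cvec"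
    using E(2)[of y] mult_left_mono[OF hfun_le_norm[of y] E(1)] by linarith
  then show ?thesis using E(1) by blast
qed

lemma fiter_bounded: "\<exists>M\<ge>0. \<forall>n \<theta> y. \<bar>fiter n \<theta> y\<bar> \<le> M * (norm y)\<^sup>2"
proof -
  obtain M where M: "M \<ge> 0" "\<And>y :: ('n, 'p) idx cvec. mfun y \<le> M * (norm y)\<^sup>2" using mfun_bounded by blast
  have "fiter n \<theta> y \<le> M * (norm y)\<^sup>2" for n \<theta> y
  proof (induction n arbitrary: y)
    case 0
    then show ?case using M(2) by (simp add: fiter_def)
  next
    case (Suc n)
    have "fiter (Suc n) \<theta> y \<le> avg a q1 \<theta> (\<lambda>y. M * (norm y)\<^sup>2) y"
      unfolding fiter_Suc by (rule avg_mono) (rule Suc)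
    also have "\<dots> = M * (norm y)\<^sup>2" unfolding avg_cmult avg_norm ..
    finally show ?case .
  qed
  then show ?thesis using M(1) fiter_nonneg by (metis abs_of_nonneg)
qed

lemma tmana_lips: "\<exists>L. lips L (\<lambda>s. tmana (rep_vec s))"
proof -
  have "lips (npts TYPE('n) * 4 / ln 2) (\<lambda>s. tmana (rep_vec s))"
    unfolding lips_def
  proof (intro conjI ballI allI impI)
    show "0 \<le> npts TYPE('n) * 4 / ln 2" by (simp add: npts_def)
  qed (rule tmana_lipschitz[OF stab_vec_rep_vec])
  then show ?thesis by blast
qed

lemma nu_lips: "lips L (\<lambda>s. tmana (rep_vec s)) \<Longrightarrow> lips (rate ^ n * L) (nu n)"
proof (induction n)
  case 0
  then show ?case by (simp add: nu_def)
next
  case (Suc n)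
  have "lips (rate * (rate ^ n * L)) (Paff (nu n))" by (rule lips_Pgen[OF Suc.IH[OF Suc.prems] tshift_bsh])
  then show ?case by (simp add: nu_def mult.assoc)
qed

lemma approx_fiter: "approx (fiter n) (nu n)"
proof (induction n)
  case 0
  obtain B where B: "\<forall>\<phi> w :: ('n, 'p) idx cvec. stab_vec \<phi> \<and> braket \<phi> w = 0 \<longrightarrow>
    \<bar>mfun (\<phi> + w) - tmana \<phi> w\<bar> \<le> B * (norm w)\<^sup>2" and B0: "B \<ge> 0" using mfun_expansion by blast
  have "\<bar>mfun (rep_vec s + w) - \<theta> * tmana (rep_vec s) ((1 / \<theta>) *\<^sub>R w)\<bar> \<le> B * (\<theta> + norm w)\<^sup>2"
    if "s \<in> Stab" "tang s w" "0 < \<theta>" for s w \<theta>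
  proof -
    have "\<bar>mfun (rep_vec s + w) - tmana (rep_vec s) w\<bar> \<le> B * (norm w)\<^sup>2"
      using B stab_vec_rep_vec[OF that(1)] that(2) unfolding tang_def by blast
    also have "\<dots> \<le> B * (\<theta> + norm w)\<^sup>2" using that B0 by (intro mult_left_mono power_mono) auto
    finally show ?thesis using that by (simp add: tmana_scaleR)
  qed
  then show ?case unfolding approx_def fiter_def nu_def funpow_0 by blast
next
  case (Suc n)
  obtain L where L: "lips L (\<lambda>s. tmana (rep_vec s))" using tmana_lips by blast
  obtain M where M: "M \<ge> 0" "\<And>n \<theta> y. \<bar>fiter n \<theta> y\<bar> \<le> M * (norm y)\<^sup>2" using fiter_bounded by blast
  have "approx (\<lambda>\<theta>. avg a q1 \<theta> (fiter n \<theta>)) (Paff (nu n))"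
    by (rule approx_step[OF Suc.IH nu_lips[OF L] fiter_smult M(2,1)])
  moreover have "(\<lambda>\<theta>. avg a q1 \<theta> (fiter n \<theta>)) = fiter (Suc n)" by (simp add: fiter_Suc fun_eq_iff)
  ultimately show ?case by (simp add: nu_def)
qed

section \<open>Independence of the stabilizer state, and the comparison on all unit vectors\<close>

lemma stab_transitive:
  assumes "stab_vec \<phi>" "stab_vec (\<psi> :: ('n, 'p) idx cvec)"
  shows "\<exists>V. cliff V \<and> \<psi> = V *v \<phi>"
proof -
  obtain U W where U: "cliff U" "\<phi> = U *v axis (\<lambda>_. 0) 1" and W: "cliff W" "\<psi> = W *v axis (\<lambda>_. 0) 1"
    using assms by (auto simp: stab_vec_def)
  have "\<psi> = (W ** dagger U) *v \<phi>"
    by (simp add: matvec_assoc U(2) W(2) unitary_inverse[OF cliff_unitary[OF U(1)]])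
  moreover have "cliff (W ** dagger U)" by (intro cliff_mult cliff_dagger U W)
  ultimately show ?thesis by blast
qed

text \<open>By \<open>approx_fiter\<close> this number is the limit of
  \<open>fiter n \<theta> (rep_vec s) / \<theta>\<close>, and \<open>fiter\<close> takes the same
  value on all stabilizer vectors by Clifford invariance.\<close>

lemma nu_0_const:
  assumes s: "s \<in> Stab" "t \<in> Stab"
  shows "nu n s 0 = nu n t 0"
proof -
  obtain B where B: "\<And>s w \<theta>. s \<in> Stab \<Longrightarrow> tang s w \<Longrightarrow> 0 < \<theta> \<Longrightarrow> \<theta> \<le> 1 \<Longrightarrow>
      \<bar>fiter n \<theta> (rep_vec s + w) - \<theta> * nu n s ((1 / \<theta>) *\<^sub>R w)\<bar> \<le> B * (\<theta> + norm w)\<^sup>2"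
    using approx_fiter[of n] unfolding approx_def by blast
  obtain V where V: "cliff V" "rep_vec t = V *v rep_vec s"
    using stab_transitive stab_vec_rep_vec s by blast
  have *: "\<bar>nu n s 0 - nu n t 0\<bar> \<le> 2 * B * \<theta>" if \<theta>: "0 < \<theta>" "\<theta> \<le> 1" for \<theta>
  proof -
    have e: "fiter n \<theta> (rep_vec t) = fiter n \<theta> (rep_vec s)" unfolding V(2) by (rule fiter_cliff[OF V(1)])
    have 1: "\<bar>fiter n \<theta> (rep_vec s) - \<theta> * nu n s 0\<bar> \<le> B * \<theta>\<^sup>2" using B[OF s(1) tang_simps(1) \<theta>] by simp
    have 2: "\<bar>fiter n \<theta> (rep_vec s) - \<theta> * nu n t 0\<bar> \<le> B * \<theta>\<^sup>2" using B[OF s(2) tang_simps(1) \<theta>] e by simp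
    have "\<bar>\<theta> * nu n s 0 - \<theta> * nu n t 0\<bar> \<le> 2 * (B * \<theta>\<^sup>2)" using 1 2 by linarith
    then have "\<theta> * \<bar>nu n s 0 - nu n t 0\<bar> \<le> \<theta> * (2 * B * \<theta>)"
      using \<theta> by (simp add: right_diff_distrib[symmetric] abs_mult power2_eq_square mult_ac)
    then show ?thesis using \<theta> by simp
  qed
  have "((\<lambda>\<theta>. 2 * B * \<theta>) \<longlongrightarrow> 2 * B * 0) (at_right 0)" by (intro tendsto_intros)
  moreover have "\<forall>\<^sub>F \<theta> in at_right 0. \<bar>nu n s 0 - nu n t 0\<bar> \<le> 2 * B * \<theta>"
    using eventually_at_right_real[OF zero_less_one] by (rule eventually_mono) (auto intro!: *)
  ultimately have "\<bar>nu n s 0 - nu n t 0\<bar> \<le> 2 * B * 0"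
    by (rule tendsto_lowerbound) simp
  then show ?thesis by simp
qed

text \<open>Close to the stabilizer states the tangent contraction applies; elsewhere the distance pays for
  the error.\<close>

lemma fiter_compare:
  "\<exists>c\<ge>0. \<forall>n. \<exists>g\<ge>0. \<forall>R\<ge>1. \<exists>Q. \<forall>\<theta> y s. 0 < \<theta> \<and> \<theta> \<le> 1 \<and> norm y = 1 \<and> s \<in> Stab \<longrightarrow>
    \<bar>fiter n \<theta> y - \<theta> * nu n s 0\<bar> \<le> c * rate ^ n * hfun y + Q * \<theta>\<^sup>2 + g * hfun y / R"
proof -
  obtain L where L: "lips L (\<lambda>s. tmana (rep_vec s))" using tmana_lips by blast
  have L0: "L \<ge> 0" using L by (simp add: lips_def)
  obtain E B where E: "E \<ge> 0" and B: "B \<ge> 0" and EB: "\<And>n \<theta> y. 0 \<le> \<theta> \<Longrightarrow> \<theta> \<le> 1 \<Longrightarrow>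
    fiter n \<theta> y \<le> E * (rate ^ n * hfun y + B * \<theta> * (norm y)\<^sup>2)" using fiter_le by blast
  \<comment> \<open>The overlap of a unit vector with its nearest stabilizer vector is at least
    \<open>1 / sD\<close>, so passing from the orthogonal part to the projective coordinate
    \<open>w\<close> stretches by at most \<open>sD\<close>.\<close>
  define sD where "sD = sqrt Dim"
  have sD: "sD \<ge> 1" using Dim_gt_1 by (simp add: sD_def)
  define c where "c = E + L * sD"
  have c0: "c \<ge> 0" using E L0 sD by (simp add: c_def)
  have "\<exists>g\<ge>0. \<forall>R\<ge>1. \<exists>Q. \<forall>\<theta> y s. 0 < \<theta> \<and> \<theta> \<le> 1 \<and> norm y = 1 \<and> s \<in> Stab \<longrightarrow>
    \<bar>fiter n \<theta> y - \<theta> * nu n s 0\<bar> \<le> c * rate ^ n * hfun y + Q * \<theta>\<^sup>2 + g * hfun y / R" for n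
  proof -
    obtain Bn where Bn: "\<And>s w \<theta>. s \<in> Stab \<Longrightarrow> tang s w \<Longrightarrow> 0 < \<theta> \<Longrightarrow> \<theta> \<le> 1 \<Longrightarrow>
      \<bar>fiter n \<theta> (rep_vec s + w) - \<theta> * nu n s ((1 / \<theta>) *\<^sub>R w)\<bar> \<le> Bn * (\<theta> + norm w)\<^sup>2"
      using approx_fiter[of n] unfolding approx_def by blast
    define B' where "B' = max Bn 0"
    have B'0: "B' \<ge> 0" by (simp add: B'_def)
    have B': "\<bar>fiter n \<theta> (rep_vec s + w) - \<theta> * nu n s ((1 / \<theta>) *\<^sub>R w)\<bar> \<le> B' * (\<theta> + norm w)\<^sup>2"
      if "s \<in> Stab" "tang s w" "0 < \<theta>" "\<theta> \<le> 1" for s w \<theta>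
      using Bn[OF that] by (rule order_trans) (intro mult_right_mono, auto simp: B'_def)
    obtain s0 where s0: "s0 \<in> Stab" using Stab_nonempty by blast
    define G where "G = \<bar>nu n s0 0\<bar>"
    have G: "\<bar>nu n s 0\<bar> = G" if "s \<in> Stab" for s using nu_0_const[OF that s0] by (simp add: G_def)
    have G0: "G \<ge> 0" by (simp add: G_def)
    have "\<bar>fiter n \<theta> y - \<theta> * nu n s 0\<bar> \<le> c * rate ^ n * hfun y + (B' * (1 + sD * R)\<^sup>2 + G * R) * \<theta>\<^sup>2 + (E * B + G) * hfun y / R"
      if R: "R \<ge> 1" and \<theta>: "0 < \<theta>" "\<theta> \<le> 1" and y: "norm y = 1" and s: "s \<in> Stab" for R \<theta> y s
    proof -
      have h0: "hfun y \<ge> 0" by (rule hfun_nonneg)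
      have rn: "rate ^ n \<ge> 0" using rate by simp
      show ?thesis
      proof (cases "hfun y \<le> R * \<theta>")
        case True
        obtain t where t: "t \<in> Stab" "sdist y = norm (prp (rep_vec t) y)" by (rule sdist_attained)
        note nt = rep_vec_norm[OF t(1)]
        have hy: "hfun y = norm (prp (rep_vec t) y)" by (simp add: hfun_def y t(2))
        define e where "e = braket (rep_vec t) y"
        have e2: "(cmod e)\<^sup>2 = 1 - (hfun y)\<^sup>2"
          using norm_prp[OF nt, of y] unfolding y hy e_def by simp
        have "(hfun y)\<^sup>2 \<le> 1 - 1 / Dim" using sdist_norm_bound[of y] by (simp add: hfun_def y)
        then have eD: "(cmod e)\<^sup>2 \<ge> 1 / Dim" using e2 by simp
        have e_ge: "cmod e \<ge> 1 / sD"
        proof (rule power2_le_imp_le)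
          show "(1 / sD)\<^sup>2 \<le> (cmod e)\<^sup>2" using eD Dim_gt_1 by (simp add: sD_def power_divide)
        qed simp
        have enz: "e \<noteq> 0" using e_ge sD by auto
        define w where "w = inverse e *s prp (rep_vec t) y"
        have tw: "tang t w" by (simp add: w_def tang_def braket_smult_right braket_prp nt)
        have nw: "norm w \<le> sD * hfun y"
        proof -
          have "1 / cmod e \<le> 1 / (1 / sD)" using e_ge sD by (intro frac_le) auto
          then have "1 / cmod e * hfun y \<le> sD * hfun y" using h0 by (intro mult_right_mono) auto
          moreover have "norm w = 1 / cmod e * hfun y"
            by (simp add: w_def norm_smult norm_divide hy inverse_eq_divide)
          ultimately show ?thesis by simp
        qed
        have ye: "y = e *s (rep_vec t + w)"
          using enz prp_decomp[of y "rep_vec t"] by (simp add: w_def vector_add_ldistrib vector_smult_assoc e_def)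
        have fy: "fiter n \<theta> y = (cmod e)\<^sup>2 * fiter n \<theta> (rep_vec t + w)" by (subst ye) (rule fiter_smult)
        have e1: "(cmod e)\<^sup>2 \<le> 1" using e2 by simp
        have d1: "\<bar>fiter n \<theta> (rep_vec t + w) - \<theta> * nu n t ((1 / \<theta>) *\<^sub>R w)\<bar> \<le> B' * (1 + sD * R)\<^sup>2 * \<theta>\<^sup>2"
        proof -
          have "sD * hfun y \<le> sD * (R * \<theta>)" using True sD by (intro mult_left_mono) auto
          then have "norm w \<le> sD * (R * \<theta>)" using nw by linarith
          then have "\<theta> + norm w \<le> (1 + sD * R) * \<theta>" by (simp add: distrib_right mult.assoc)
          then have "B' * (\<theta> + norm w)\<^sup>2 \<le> B' * ((1 + sD * R) * \<theta>)\<^sup>2"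
            using \<theta> B'0 by (intro mult_left_mono power_mono) auto
          then show ?thesis using B'[OF t(1) tw \<theta>] by (simp add: power_mult_distrib mult.assoc)
        qed
        have d2: "\<bar>\<theta> * nu n t ((1 / \<theta>) *\<^sub>R w) - \<theta> * nu n t 0\<bar> \<le> L * sD * rate ^ n * hfun y"
        proof -
          have "\<bar>nu n t ((1 / \<theta>) *\<^sub>R w) - nu n t 0\<bar> \<le> rate ^ n * L * norm ((1 / \<theta>) *\<^sub>R w - 0)"
            by (intro lipsD[OF nu_lips[OF L] t(1)] tang_simps tw)
          then have "\<theta> * \<bar>nu n t ((1 / \<theta>) *\<^sub>R w) - nu n t 0\<bar> \<le> \<theta> * (rate ^ n * L * norm ((1 / \<theta>) *\<^sub>R w - 0))"
            using \<theta> by (intro mult_left_mono) auto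
          also have "\<dots> = rate ^ n * L * norm w" using \<theta> by simp
          also have "\<dots> \<le> rate ^ n * L * (sD * hfun y)" using nw rn L0 by (intro mult_left_mono) auto
          finally show ?thesis using \<theta> by (simp add: right_diff_distrib[symmetric] abs_mult mult_ac)
        qed
        have d3: "\<bar>fiter n \<theta> (rep_vec t + w) - \<theta> * nu n t 0\<bar> \<le> B' * (1 + sD * R)\<^sup>2 * \<theta>\<^sup>2 + L * sD * rate ^ n * hfun y"
          using d1 d2 by linarith
        \<comment> \<open>The squared overlap is \<open>1 - (hfun y)\<^sup>2\<close> instead of 1.
          The correction is of order \<open>\<theta>\<^sup>2\<close>, because \<open>hfun y\<close>
          is at most 1 and at most \<open>R * \<theta>\<close>.\<close>
        have h2: "(hfun y)\<^sup>2 * (\<theta> * G) \<le> G * R * \<theta>\<^sup>2"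
        proof -
          have "hfun y \<le> 1" using hfun_le_norm[of y] y by simp
          then have "(hfun y)\<^sup>2 \<le> hfun y" using h0 by (simp add: power2_eq_square mult_left_le)
          then have "(hfun y)\<^sup>2 \<le> R * \<theta>" using True by simp
          then have "(hfun y)\<^sup>2 * (\<theta> * G) \<le> (R * \<theta>) * (\<theta> * G)" using \<theta> G0 by (intro mult_right_mono) auto
          then show ?thesis by (simp add: power2_eq_square mult_ac)
        qed
        have "fiter n \<theta> y - \<theta> * nu n s 0 = (cmod e)\<^sup>2 * (fiter n \<theta> (rep_vec t + w) - \<theta> * nu n t 0) - (hfun y)\<^sup>2 * (\<theta> * nu n t 0)"
          unfolding fy nu_0_const[OF s t(1)] by (simp add: e2 algebra_simps)
        also have "\<bar>\<dots>\<bar> \<le> (cmod e)\<^sup>2 * \<bar>fiter n \<theta> (rep_vec t + w) - \<theta> * nu n t 0\<bar> + (hfun y)\<^sup>2 * (\<theta> * G)"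
          by (rule order_trans[OF abs_triangle_ineq4]) (use \<theta> G[OF t(1)] in \<open>simp add: abs_mult\<close>)
        also have "\<dots> \<le> 1 * (B' * (1 + sD * R)\<^sup>2 * \<theta>\<^sup>2 + L * sD * rate ^ n * hfun y) + G * R * \<theta>\<^sup>2"
          by (intro add_mono h2 mult_mono[OF e1 d3]) auto
        also have "\<dots> \<le> c * rate ^ n * hfun y + (B' * (1 + sD * R)\<^sup>2 + G * R) * \<theta>\<^sup>2 + (E * B + G) * hfun y / R"
        proof -
          have "0 \<le> E * rate ^ n * hfun y" "0 \<le> (E * B + G) * hfun y / R"
            using E B rn h0 G0 R by auto
          then show ?thesis by (simp add: c_def algebra_simps)
        qed
        finally show ?thesis .
      next
        case False
        then have "\<theta> \<le> hfun y / R" using R by (simp add: pos_le_divide_eq mult.commute)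
        then have far: "(E * B + G) * \<theta> \<le> (E * B + G) * (hfun y / R)" using E B G0 by (intro mult_left_mono) auto
        have "\<bar>fiter n \<theta> y - \<theta> * nu n s 0\<bar> \<le> \<bar>fiter n \<theta> y\<bar> + \<bar>\<theta> * nu n s 0\<bar>" by (rule abs_triangle_ineq4)
        also have "\<dots> = fiter n \<theta> y + \<theta> * G" using \<theta> G[OF s] by (simp add: fiter_nonneg abs_mult)
        also have "\<dots> \<le> E * (rate ^ n * hfun y + B * \<theta> * (norm y)\<^sup>2) + \<theta> * G"
          using EB[of \<theta> n y] \<theta> by simp
        also have "\<dots> = E * rate ^ n * hfun y + (E * B + G) * \<theta>" by (simp add: y algebra_simps)
        also have "\<dots> \<le> E * rate ^ n * hfun y + (E * B + G) * (hfun y / R)" using far by simp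
        also have "\<dots> \<le> c * rate ^ n * hfun y + (B' * (1 + sD * R)\<^sup>2 + G * R) * \<theta>\<^sup>2 + (E * B + G) * hfun y / R"
        proof -
          have "0 \<le> L * sD * rate ^ n * hfun y" "0 \<le> (B' * (1 + sD * R)\<^sup>2 + G * R) * \<theta>\<^sup>2"
            using L0 sD rn h0 G0 R B'0 by auto
          then show ?thesis by (simp add: c_def distrib_right)
        qed
        finally show ?thesis .
      qed
    qed
    moreover have "E * B + G \<ge> 0" using E B G0 by simp
    ultimately show ?thesis by blast
  qed
  then show ?thesis using c0 by blast
qed

end

section \<open>Derivatives in the exponential charts\<close>

lemma has_derivative_quadratic:
  fixes f :: "'a::real_normed_vector \<Rightarrow> 'b::real_normed_vector"
  assumes D: "bounded_linear D" and d: "d > 0" and f0: "f 0 = 0"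
    and q: "\<And>v. v \<in> S \<Longrightarrow> norm v < d \<Longrightarrow> norm (f v - D v) \<le> C * (norm v)\<^sup>2"
  shows "(f has_derivative D) (at 0 within S)"
  unfolding has_derivative_within_alt
proof (intro conjI D allI impI)
  fix e :: real assume e: "e > 0"
  define d' where "d' = min d (e / (\<bar>C\<bar> + 1))"
  have "d' > 0" using d e by (simp add: d'_def)
  moreover have "norm (f y - f 0 - D (y - 0)) \<le> e * norm (y - 0)" if y: "y \<in> S" "norm (y - 0) < d'" for y
  proof -
    have "norm (f y - D y) \<le> C * (norm y)\<^sup>2" using q y by (simp add: d'_def)
    also have "\<dots> \<le> (\<bar>C\<bar> + 1) * (norm y * norm y)" unfolding power2_eq_square by (intro mult_right_mono) auto
    also have "\<dots> = ((\<bar>C\<bar> + 1) * norm y) * norm y" by simp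
    also have "\<dots> \<le> e * norm y"
    proof (rule mult_right_mono)
      have "norm y \<le> e / (\<bar>C\<bar> + 1)" using y by (simp add: d'_def)
      then show "(\<bar>C\<bar> + 1) * norm y \<le> e" by (simp add: pos_le_divide_eq mult.commute)
    qed simp
    finally show ?thesis by (simp add: f0)
  qed
  ultimately show "\<exists>d>0. \<forall>y\<in>S. norm (y - 0) < d \<longrightarrow> norm (f y - f 0 - D (y - 0)) \<le> e * norm (y - 0)"
    by blast
qed

text \<open>Changes the length of a vector by \<open>g\<close> and keeps its direction. With
  \<open>tan\<close> and \<open>arctan\<close> it converts between geodesic and projective
  coordinates.\<close>

definition radial :: "(real \<Rightarrow> real) \<Rightarrow> 'a::real_normed_vector \<Rightarrow> 'a" where
  "radial g v = g (norm v) *\<^sub>R sgn v"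

lemma radial_0 [simp]: "radial g 0 = 0"
  by (simp add: radial_def)

lemma norm_radial: "v \<noteq> 0 \<Longrightarrow> norm (radial g v) = \<bar>g (norm v)\<bar>"
  by (simp add: radial_def norm_sgn)

lemma radial_has_derivative:
  fixes g :: "real \<Rightarrow> real"
  assumes "DERIV g 0 :> 1" "g 0 = 0"
  shows "(radial g has_derivative (\<lambda>v :: 'a::real_normed_vector. v)) (at 0 within S)"
  unfolding has_derivative_within_alt
proof (intro conjI bounded_linear_ident allI impI)
  fix e :: real assume e: "e > 0"
  have mult_1: "(*) (1 :: real) = (\<lambda>t. t)" by (rule ext) simp
  have "(g has_derivative (\<lambda>t. t)) (at 0)" using assms(1) unfolding has_field_derivative_def mult_1 .
  then obtain d where d: "d > 0" "\<And>t. norm (t - 0) < d \<Longrightarrow> norm (g t - g 0 - (t - 0)) \<le> e * norm (t - 0)"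
    using e unfolding has_derivative_at_alt by blast
  have "norm (radial g y - radial g 0 - (y - 0)) \<le> e * norm (y - 0)" if y: "norm (y - 0) < d" for y :: 'a
  proof (cases "y = 0")
    case False
    have sy: "norm y *\<^sub>R sgn y = y" using False by (simp add: sgn_div_norm)
    have "radial g y - norm y *\<^sub>R sgn y = (g (norm y) - norm y) *\<^sub>R sgn y"
      by (simp only: radial_def scaleR_diff_left)
    then have "radial g y - y = (g (norm y) - norm y) *\<^sub>R sgn y" unfolding sy .
    then have "norm (radial g y - y) = \<bar>g (norm y) - norm y\<bar>" using False by (simp add: norm_sgn)
    also have "\<dots> \<le> e * norm y" using d(2)[of "norm y"] y assms(2) by simp
    finally show ?thesis by simp
  qed simp
  then show "\<exists>d>0. \<forall>y\<in>S. norm (y - 0) < d \<longrightarrow> norm (radial g y - radial g 0 - (y - 0)) \<le> e * norm (y - 0)"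
    using d(1) by blast
qed

text \<open>A derivative within a subspace is determined only on the subspace, and
  \<open>frechet_derivative\<close> picks some extension. Restricting to the line through
  \<open>v\<close> restores uniqueness.\<close>

lemma frechet_derivative_on_subspace:
  fixes f :: "'a::real_normed_vector \<Rightarrow> 'b::real_normed_vector"
  assumes D: "(f has_derivative D) (at 0 within T)" and T: "\<And>t. t *\<^sub>R v \<in> T"
  shows "frechet_derivative f (at 0 within T) v = D v"
proof -
  have "(f has_derivative frechet_derivative f (at 0 within T)) (at 0 within T)"
    using differentiableI[OF D] by (simp only: frechet_derivative_works)
  moreover have line: "((\<lambda>t. f (t *\<^sub>R v)) has_derivative (\<lambda>t. E (t *\<^sub>R v))) (at (0 :: real))"
    if "(f has_derivative E) (at 0 within T)" for E
  proof -
    have 1: "((\<lambda>t :: real. t *\<^sub>R v) has_derivative (\<lambda>t. t *\<^sub>R v)) (at 0)"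
      by (auto intro!: derivative_eq_intros)
    have "(f has_derivative E) (at (0 *\<^sub>R v) within range (\<lambda>t :: real. t *\<^sub>R v))"
      using that T by (auto intro: has_derivative_subset)
    from has_derivative_in_compose[OF 1 this] show ?thesis by simp
  qed
  ultimately have "(\<lambda>t :: real. frechet_derivative f (at 0 within T) (t *\<^sub>R v)) = (\<lambda>t. D (t *\<^sub>R v))"
    using has_derivative_unique[OF line line] D by blast
  from fun_cong[OF this, of 1] show ?thesis by simp
qed

lemma fs_exp_eq: "fs_exp s v = outer (cos (norm v) *\<^sub>R rep_vec s + radial sin v)"
  by (simp add: fs_exp_def radial_def)

lemma tangent_unit:
  assumes "norm (rep_vec s) = 1" "braket (rep_vec s) v = 0"
  shows "norm (cos (norm v) *\<^sub>R rep_vec s + radial sin v) = 1"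
proof -
  have "(norm (cos (norm v) *\<^sub>R rep_vec s + radial sin v))\<^sup>2
      = (norm (cos (norm v) *\<^sub>R rep_vec s))\<^sup>2 + (norm (radial sin v))\<^sup>2"
    using assms by (intro norm_orthogonal_sum)
      (simp add: radial_def braket_scaleR_left braket_scaleR_right sgn_div_norm)
  also have "\<dots> = 1"
  proof (cases "v = 0")
    case False
    then show ?thesis by (simp add: assms norm_radial)
  qed (simp add: assms)
  finally show ?thesis
    using power2_eq_imp_eq[of "norm (cos (norm v) *\<^sub>R rep_vec s + radial sin v)" 1] by simp
qed

text \<open>The vector \<open>rep_vec s + x\<close> makes the angle \<open>arctan (norm x)\<close>
  with \<open>rep_vec s\<close>, and this angle is the length of the geodesic that leads to its ray
  in the direction of \<open>x\<close>.\<close>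

lemma fs_exp_arctan:
  assumes n: "norm (rep_vec s) = 1" and x: "braket (rep_vec s) x = 0"
  shows "fs_exp s (radial arctan x) = ray (rep_vec s + x)"
proof (cases "x = 0")
  case True
  then show ?thesis by (simp add: fs_exp_eq ray_unit n)
next
  case False
  define t where "t = norm x"
  have t: "t > 0" using False by (simp add: t_def)
  have nr: "norm (radial arctan x) = arctan t" using False t by (simp add: norm_radial t_def zero_le_arctan_iff)
  have "sgn (sgn x) = sgn x" using sgn_div_norm[of "sgn x"] False by (simp add: norm_sgn)
  then have sg: "sgn (radial arctan x) = sgn x"
    using False t by (simp add: radial_def sgn_scaleR t_def zero_less_arctan_iff)
  have "(norm (rep_vec s + x))\<^sup>2 = 1 + t\<^sup>2" by (simp add: norm_orthogonal_sum[OF x] n t_def)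
  then have nx: "norm (rep_vec s + x) = sqrt (1 + t\<^sup>2)" by (metis norm_ge_zero real_sqrt_unique)
  have "cos (norm (radial arctan x)) *\<^sub>R rep_vec s + radial sin (radial arctan x)
      = (1 / sqrt (1 + t\<^sup>2)) *\<^sub>R (rep_vec s + t *\<^sub>R sgn x)"
    unfolding radial_def[of sin] nr sg cos_arctan sin_arctan by (simp add: scaleR_add_right)
  also have "t *\<^sub>R sgn x = x" using False by (simp add: t_def sgn_div_norm)
  finally show ?thesis by (simp add: fs_exp_eq ray_def nx)
qed

lemma tan_decomp:
  assumes "norm v < pi / 2"
  shows "cos (norm v) *\<^sub>R \<sigma> + radial sin v = cos (norm v) *\<^sub>R (\<sigma> + radial tan v)"
proof -
  have "cos (norm v) \<noteq> 0" using assms cos_gt_zero_pi[of "norm v"] norm_ge_zero[of v] by linarith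
  then show ?thesis by (simp add: radial_def scaleR_add_right tan_def)
qed

context monitored
begin

lemma wigner_eq: "s \<in> Stab \<Longrightarrow> wigner s u = wig (rep_vec s) u"
  using wigner_outer[of "rep_vec s" u] rays_rep_vec(2)[of s] stabilizer_states_rays by auto

lemma lagrangian_support_eq: "s \<in> Stab \<Longrightarrow> lagrangian_support s = lsup (rep_vec s)"
  by (simp add: lagrangian_support_def lsup_def wigner_eq)

lemma tangent_iff: "v \<in> tangent s \<longleftrightarrow> tang s v"
  by (simp add: tangent_def tang_def)

lemma bounded_linear_ell: "bounded_linear (ell \<phi> u :: ('n, 'p) idx cvec \<Rightarrow> real)"
  by (rule linear_conv_bounded_linear[THEN iffD1]) (rule linearI, simp_all only: ell_add ell_scaleR real_scaleR_def)

text \<open>With the endpoint written as \<open>cos t *\<^sub>R \<sigma> + z\<close>, the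
  polarization formula splits the Wigner function into a constant, \<open>ell \<sigma> u z\<close>
  and a remainder \<open>Rm\<close> that is quadratic in \<open>t\<close>. Since
  \<open>z = radial sin v\<close>, the derivative of the linear part is \<open>ell\<close>
  itself.\<close>

lemma wigner_diff_eq:
  assumes s: "s \<in> Stab" and v: "tang s v"
  shows "wigner_diff s u v = ell (rep_vec s) u v"
proof -
  define \<sigma> where "\<sigma> = rep_vec s"
  have n: "norm \<sigma> = 1" using rep_vec_norm[OF s] by (simp add: \<sigma>_def)
  define Rm where "Rm v = wigner (fs_exp s v) u - ell \<sigma> u (radial sin v) - wig \<sigma> u" for v
  have Rm: "norm (Rm v - 0) \<le> 3 * (norm v)\<^sup>2" for v
  proof -
    define t where "t = norm v"
    define z where "z = radial sin v"
    have nz: "norm z \<le> \<bar>sin t\<bar>" by (cases "v = 0") (simp_all add: z_def t_def norm_radial)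
    have st: "\<bar>sin t\<bar> \<le> t" using abs_sin_x_le_abs_x[of t] by (simp add: t_def)
    have "wigner (fs_exp s v) u = wig (cos t *\<^sub>R \<sigma> + z) u"
      unfolding fs_exp_eq by (simp add: wigner_outer t_def z_def \<sigma>_def)
    also have "\<dots> = (cos t)\<^sup>2 * wig \<sigma> u + cos t * ell \<sigma> u z + wig z u"
    proof -
      have "ell (cos t *\<^sub>R \<sigma>) u z = cos t * ell \<sigma> u z" by (simp add: ell_def braket_scaleR_left)
      moreover have "wig (cos t *\<^sub>R \<sigma>) u = (cos t)\<^sup>2 * wig \<sigma> u" by (simp add: scaleR_eq_smult wig_smult)
      ultimately show ?thesis by (simp add: wig_add)
    qed
    finally have "Rm v = - ((sin t)\<^sup>2 * wig \<sigma> u) + (cos t - 1) * ell \<sigma> u z + wig z u"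
      by (simp add: Rm_def z_def[symmetric] cos_squared_eq algebra_simps)
    moreover have "\<bar>(sin t)\<^sup>2 * wig \<sigma> u\<bar> \<le> t\<^sup>2 * 1"
      unfolding abs_mult
    proof (rule mult_mono)
      show "\<bar>(sin t)\<^sup>2\<bar> \<le> t\<^sup>2" using power_mono[OF st, of 2] by simp
      show "\<bar>wig \<sigma> u\<bar> \<le> 1" using abs_wig_le[of \<sigma> u] by (simp add: n)
    qed auto
    moreover have "\<bar>(cos t - 1) * ell \<sigma> u z\<bar> \<le> (t\<^sup>2 / 2) * 2"
      unfolding abs_mult
    proof (rule mult_mono)
      have "cos t = 1 - 2 * (sin (t / 2))\<^sup>2" using cos_double_sin[of "t / 2"] by simp
      moreover have "\<bar>sin (t / 2)\<bar> \<le> t / 2" using abs_sin_x_le_abs_x[of "t / 2"] by (simp add: t_def)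
      then have "(sin (t / 2))\<^sup>2 \<le> (t / 2)\<^sup>2" using power_mono[of "\<bar>sin (t / 2)\<bar>" "t / 2" 2] by simp
      ultimately show "\<bar>cos t - 1\<bar> \<le> t\<^sup>2 / 2" by (simp add: power_divide)
      have "norm z \<le> 1" using nz abs_sin_le_one[of t] by linarith
      then show "\<bar>ell \<sigma> u z\<bar> \<le> 2" using abs_ell_le[of \<sigma> u z] by (simp add: n)
    qed auto
    moreover have "\<bar>wig z u\<bar> \<le> t\<^sup>2"
    proof -
      have "norm z \<le> t" using nz st by linarith
      then have "(norm z)\<^sup>2 \<le> t\<^sup>2" by (rule power_mono) simp
      then show ?thesis using abs_wig_le[of z u] by linarith
    qed
    ultimately show ?thesis by (simp add: t_def)
  qed
  have "((\<lambda>v. Rm v + (ell \<sigma> u (radial sin v) + wig \<sigma> u)) has_derivative (\<lambda>v. 0 + (ell \<sigma> u v + 0))) (at 0 within tangent s)"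
  proof (intro has_derivative_add has_derivative_const)
    show "(Rm has_derivative (\<lambda>v. 0)) (at 0 within tangent s)"
    proof (rule has_derivative_quadratic[where d = 1 and C = 3])
      show "Rm 0 = 0" using Rm[of 0] by simp
    qed (auto intro: Rm[simplified])
    have "(radial sin has_derivative (\<lambda>v. v)) (at (0 :: ('n, 'p) idx cvec) within tangent s)"
      by (rule radial_has_derivative) (auto intro!: derivative_eq_intros)
    then show "((\<lambda>v. ell \<sigma> u (radial sin v)) has_derivative ell \<sigma> u) (at 0 within tangent s)"
      by (rule bounded_linear.has_derivative[OF bounded_linear_ell])
  qed
  moreover have "(\<lambda>v. Rm v + (ell \<sigma> u (radial sin v) + wig \<sigma> u)) = (\<lambda>v. wigner (fs_exp s v) u)"
    by (simp add: Rm_def fun_eq_iff)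
  ultimately have "((\<lambda>v. wigner (fs_exp s v) u) has_derivative ell \<sigma> u) (at 0 within tangent s)" by simp
  then show ?thesis
    unfolding wigner_diff_def \<sigma>_def
    by (rule frechet_derivative_on_subspace) (use v in \<open>simp add: tangent_iff tang_simps\<close>)
qed

lemma tangent_mana_eq: "s \<in> Stab \<Longrightarrow> tang s v \<Longrightarrow> tangent_mana (s, v) = tmana (rep_vec s) v"
  by (simp add: tangent_mana_def tmana_def lagrangian_support_eq wigner_diff_eq)

lemma branch_post_eq: "branch_post a q1 (C, m) \<theta> \<rho> = ray (K C m \<theta> *v rep_vec \<rho>)"
  by (simp add: branch_post_def branch_vec_def KU_matvec matvec_assoc meas_def)

lemma branch_post_0: "branch_post a q1 (C, m) 0 s = post C m s"
  by (simp add: branch_post_eq post_def)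

lemma branch_prob_eq: "C \<in> Cl \<Longrightarrow> branch_prob a q1 (C, m) \<theta> \<rho> = (norm (K C m \<theta> *v rep_vec \<rho>))\<^sup>2"
  by (simp add: branch_prob_def branch_vec_def KU_matvec matvec_assoc meas_def
      unitary_norm[OF unitary_dagger[OF rep_unitary_unitary]])

lemma branch_weight_eq: "C \<in> Cl \<Longrightarrow> branch_weight a q1 (C, m) \<theta> \<rho> = (norm (K C m \<theta> *v rep_vec \<rho>))\<^sup>2 / Nc"
  by (simp add: branch_weight_def branch_prob_eq Nc_def)

text \<open>Since \<open>arctan\<close> does not increase lengths, \<open>radial arctan x\<close>
  lies in the ball on which the exponential map is injective, so the chart must return it.\<close>

lemma chart_eq:
  assumes s: "s \<in> Stab" and inj: "inj_on (fs_exp s) (tangent_ball r s)"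
    and x: "tang s x" "norm x < r"
  shows "chart r s (ray (rep_vec s + x)) = radial arctan x"
proof -
  have "radial arctan x \<in> tangent_ball r s"
  proof -
    have "tang s (radial arctan x)" using x by (simp add: radial_def sgn_div_norm tang_simps)
    moreover have "norm (radial arctan x) \<le> norm x"
      by (cases "x = 0") (simp_all add: norm_radial arctan_le_self)
    ultimately show ?thesis using x by (simp add: tangent_ball_def tangent_iff)
  qed
  then show ?thesis
    unfolding chart_def fs_exp_arctan[OF rep_vec_norm[OF s] x(1)[unfolded tang_def], symmetric]
    by (rule inv_into_f_f[OF inj])
qed

lemma branch_post_fs_exp:
  assumes s: "s \<in> Stab" and u: "tang s u" "norm u < pi / 2"
  shows "branch_post a q1 (C, m) \<theta> (fs_exp s u) = ray (K C m \<theta> *v (rep_vec s + radial tan u))"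
proof -
  let ?e = "cos (norm u) *\<^sub>R rep_vec s + radial sin u"
  have n: "norm ?e = 1" by (rule tangent_unit[OF rep_vec_norm[OF s] u(1)[unfolded tang_def]])
  obtain c where c: "cmod c = 1" "rep_vec (outer ?e) = c *s ?e" using rep_vec_outer[OF n] by blast
  have cosnz: "cos (norm u) \<noteq> 0" using u cos_gt_zero_pi[of "norm u"] norm_ge_zero[of u] by linarith
  have e: "rep_vec (fs_exp s u) = c *s (cos (norm u) *\<^sub>R (rep_vec s + radial tan u))"
    unfolding fs_exp_eq c(2) by (simp only: tan_decomp[OF u(2)])
  have e1: "K C m \<theta> *v rep_vec (fs_exp s u) = (c * cos (norm u)) *s (K C m \<theta> *v (rep_vec s + radial tan u))"
    unfolding e by (simp only: scaleR_eq_smult matvec_smult vector_smult_assoc)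
  have nz: "c * cos (norm u) \<noteq> 0" using c cosnz by auto
  show ?thesis unfolding branch_post_eq e1 by (rule smult_phase_ray[OF nz])
qed

text \<open>In projective coordinates the branch is the map \<open>X\<close>, controlled by
  \<open>lin_bound\<close>. The geodesic charts only conjugate it by \<open>radial tan\<close> and
  \<open>radial arctan\<close>, whose derivative at 0 is the identity, so the derivatives in the
  charts are \<open>Alin\<close> and \<open>bsh\<close>.\<close>

lemma branch_chart_expansion:
  assumes C: "C \<in> Cl" and s: "s \<in> Stab" and wt: "wt C m s \<noteq> 0" and r: "r > 0"
    and inj: "\<And>s. s \<in> Stab \<Longrightarrow> inj_on (fs_exp s) (tangent_ball r s)"
  shows "\<exists>d>0. \<exists>B X. X 0 0 = 0 \<and> (\<forall>w \<theta>. tang s w \<and> norm w + \<bar>\<theta>\<bar> < d \<longrightarrow>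
      norm (X w \<theta> - (Alin C m s w + \<theta> *\<^sub>R bsh C m s)) \<le> B * (norm w + \<bar>\<theta>\<bar>)\<^sup>2) \<and>
    (\<forall>u \<theta>. tang s u \<and> norm u < pi / 2 \<and> norm (radial tan u) + \<bar>\<theta>\<bar> < d \<longrightarrow>
      branch_chart a q1 r (C, m) s u \<theta> = radial arctan (X (radial tan u) \<theta>))"
proof -
  have nz: "K C m 0 *v rep_vec s \<noteq> 0" using wt by (auto simp: wt_def)
  note ab = active_branch[OF C s nz]
  obtain B where lb: "lin_bound (C, m, s) B" using lin_bound_exists[OF C s nz] by blast
  have B1: "B \<ge> 1" using lb unfolding lin_bound_def case_prod_conv by (rule conjunct1)
  let ?\<sigma> = "rep_vec (post C m s)"
  define X where "X w \<theta> = inverse (braket ?\<sigma> (K C m \<theta> *v (rep_vec s + w))) *s prp ?\<sigma> (K C m \<theta> *v (rep_vec s + w))" for w \<theta>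
  \<comment> \<open>The first bound is the radius of \<open>lin_bound\<close>; the second keeps the
    image inside the domain of the chart.\<close>
  define d where "d = min (1 / B) (r / B)"
  have d: "d > 0" using B1 r by (simp add: d_def)
  have X: "braket ?\<sigma> (K C m \<theta> *v (rep_vec s + w)) \<noteq> 0 \<and>
      K C m \<theta> *v (rep_vec s + w) = braket ?\<sigma> (K C m \<theta> *v (rep_vec s + w)) *s (?\<sigma> + X w \<theta>) \<and>
      norm (X w \<theta>) \<le> B * (norm w + \<bar>\<theta>\<bar>) \<and>
      norm (X w \<theta> - (Alin C m s w + \<theta> *\<^sub>R bsh C m s)) \<le> B * (norm w + \<bar>\<theta>\<bar>)\<^sup>2"
    if "norm w + \<bar>\<theta>\<bar> < d" for w \<theta>
  proof -
    have "norm w + \<bar>\<theta>\<bar> \<le> 1 / B" using that by (simp add: d_def)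
    then show ?thesis using lb unfolding lin_bound_def case_prod_conv Let_def X_def by blast
  qed
  have X0: "X 0 0 = 0" using X[of 0 0] d by simp
  have tX: "tang (post C m s) (X w \<theta>)" for w \<theta>
    by (simp add: X_def tang_def braket_smult_right braket_prp rep_vec_norm[OF ab(1)])
  have "branch_chart a q1 r (C, m) s u \<theta> = radial arctan (X (radial tan u) \<theta>)"
    if u: "tang s u" "norm u < pi / 2" "norm (radial tan u) + \<bar>\<theta>\<bar> < d" for u \<theta>
  proof -
    define c where "c = braket ?\<sigma> (K C m \<theta> *v (rep_vec s + radial tan u))"
    have c: "c \<noteq> 0" "K C m \<theta> *v (rep_vec s + radial tan u) = c *s (?\<sigma> + X (radial tan u) \<theta>)"
      and xn: "norm (X (radial tan u) \<theta>) \<le> B * (norm (radial tan u) + \<bar>\<theta>\<bar>)"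
      using X[OF u(3)] unfolding c_def by blast+
    have "B * (norm (radial tan u) + \<bar>\<theta>\<bar>) < B * (r / B)"
      using u(3) B1 by (intro mult_strict_left_mono) (auto simp: d_def)
    then have xr: "norm (X (radial tan u) \<theta>) < r" using xn B1 by simp
    have "branch_chart a q1 r (C, m) s u \<theta> = chart r (post C m s) (ray (?\<sigma> + X (radial tan u) \<theta>))"
      unfolding branch_chart_def branch_post_0 branch_post_fs_exp[OF s u(1,2)] c(2) smult_phase_ray[OF c(1)] ..
    also have "\<dots> = radial arctan (X (radial tan u) \<theta>)"
      by (rule chart_eq[OF ab(1) inj[OF ab(1)] tX xr])
    finally show ?thesis .
  qed
  then show ?thesis using d X0 X by blast
qed

lemma bounded_linear_Alin: "bounded_linear (Alin C m s)"
  by (rule linear_conv_bounded_linear[THEN iffD1]) (rule linearI, simp_all only: Alin_add Alin_scaleR)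

lemma arctan_radial_derivative: "(radial arctan has_derivative (\<lambda>v. v)) (at (0 :: 'b::real_normed_vector) within S)"
  by (rule radial_has_derivative) (auto intro!: derivative_eq_intros)

lemma tan_radial_derivative: "(radial tan has_derivative (\<lambda>v. v)) (at (0 :: 'b::real_normed_vector) within S)"
  by (rule radial_has_derivative) (auto intro!: derivative_eq_intros)

lemma tang_radial: "tang s v \<Longrightarrow> tang s (radial g v)"
  by (simp add: radial_def sgn_div_norm tang_simps)

lemma branch_lin_eq:
  assumes C: "C \<in> Cl" and s: "s \<in> Stab" and wt: "wt C m s \<noteq> 0" and r: "r > 0"
    and inj: "\<And>s. s \<in> Stab \<Longrightarrow> inj_on (fs_exp s) (tangent_ball r s)" and v: "tang s v"
  shows "branch_lin a q1 r (C, m) s v = Alin C m s v"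
proof -
  obtain d B X where d: "d > 0" and X0: "X 0 0 = 0"
    and X: "\<And>w \<theta>. tang s w \<Longrightarrow> norm w + \<bar>\<theta>\<bar> < d \<Longrightarrow>
      norm (X w \<theta> - (Alin C m s w + \<theta> *\<^sub>R bsh C m s)) \<le> B * (norm w + \<bar>\<theta>\<bar>)\<^sup>2"
    and ch: "\<And>u \<theta>. tang s u \<Longrightarrow> norm u < pi / 2 \<Longrightarrow> norm (radial tan u) + \<bar>\<theta>\<bar> < d \<Longrightarrow>
      branch_chart a q1 r (C, m) s u \<theta> = radial arctan (X (radial tan u) \<theta>)"
    using branch_chart_expansion[OF C s wt r inj] by blast
  let ?T = "tangent s :: ('n, 'p) idx cvec set"
  have DX: "((\<lambda>w. X w 0) has_derivative Alin C m s) (at 0 within ?T)"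
  proof (rule has_derivative_quadratic[where f = "\<lambda>w. X w 0" and d = d and C = B])
    show "bounded_linear (Alin C m s)" by (rule bounded_linear_Alin)
    show "d > 0" "X 0 0 = 0" by (rule d X0)+
    fix w assume "w \<in> ?T" "norm w < d"
    then show "norm (X w 0 - Alin C m s w) \<le> B * (norm w)\<^sup>2" using X[of w 0] by (simp add: tangent_iff)
  qed
  have "((\<lambda>u. X (radial tan u) 0) has_derivative (\<lambda>u. Alin C m s u)) (at 0 within ?T)"
  proof (rule has_derivative_in_compose[OF tan_radial_derivative])
    show "((\<lambda>w. X w 0) has_derivative Alin C m s) (at (radial tan 0) within radial tan ` ?T)"
      unfolding radial_0 by (rule has_derivative_subset[OF DX]) (auto simp: tangent_iff tang_radial)
  qed
  from has_derivative_in_compose[OF this, of "radial arctan" "\<lambda>v. v"]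
  have comp: "((\<lambda>u. radial arctan (X (radial tan u) 0)) has_derivative (\<lambda>u. Alin C m s u)) (at 0 within ?T)"
    by (simp add: X0 arctan_radial_derivative)
  have "isCont (radial tan :: ('n, 'p) idx cvec \<Rightarrow> _) 0"
    using has_derivative_continuous[OF tan_radial_derivative[of UNIV]] by simp
  then obtain d1 where d1: "d1 > 0" "\<And>u :: ('n, 'p) idx cvec. dist u 0 < d1 \<Longrightarrow> dist (radial tan u) (radial tan 0) < d"
    using d unfolding continuous_at by (metis LIM_def dist_eq_0_iff d)
  have D: "((\<lambda>u. branch_chart a q1 r (C, m) s u 0) has_derivative (\<lambda>u. Alin C m s u)) (at 0 within ?T)"
  proof (rule has_derivative_transform_within[OF comp, of "min d1 (pi / 2)"])
    show "radial arctan (X (radial tan u) 0) = branch_chart a q1 r (C, m) s u 0"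
      if "u \<in> ?T" "dist u 0 < min d1 (pi / 2)" for u
      using ch[of u 0] that d1(2)[of u] by (simp add: tangent_iff dist_norm)
  qed (use d1 in \<open>auto simp: tangent_iff tang_simps\<close>)
  show ?thesis unfolding branch_lin_def
    by (rule frechet_derivative_on_subspace[OF D]) (use v in \<open>simp add: tangent_iff tang_simps\<close>)
qed

lemma branch_shift_eq:
  assumes C: "C \<in> Cl" and s: "s \<in> Stab" and wt: "wt C m s \<noteq> 0" and r: "r > 0"
    and inj: "\<And>s. s \<in> Stab \<Longrightarrow> inj_on (fs_exp s) (tangent_ball r s)"
  shows "branch_shift a q1 r (C, m) s = bsh C m s"
proof -
  obtain d B X where d: "d > 0" and X0: "X 0 0 = 0"
    and X: "\<And>w \<theta>. tang s w \<Longrightarrow> norm w + \<bar>\<theta>\<bar> < d \<Longrightarrow>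
      norm (X w \<theta> - (Alin C m s w + \<theta> *\<^sub>R bsh C m s)) \<le> B * (norm w + \<bar>\<theta>\<bar>)\<^sup>2"
    and ch: "\<And>u \<theta>. tang s u \<Longrightarrow> norm u < pi / 2 \<Longrightarrow> norm (radial tan u) + \<bar>\<theta>\<bar> < d \<Longrightarrow>
      branch_chart a q1 r (C, m) s u \<theta> = radial arctan (X (radial tan u) \<theta>)"
    using branch_chart_expansion[OF C s wt r inj] by blast
  have A0: "Alin C m s 0 = 0" using Alin_scaleR[of C m s 0 0] by simp
  have DX: "((\<lambda>\<theta>. X 0 \<theta>) has_derivative (\<lambda>\<theta>. \<theta> *\<^sub>R bsh C m s)) (at 0 within UNIV)"
  proof (rule has_derivative_quadratic[where f = "X 0" and d = d and C = B])
    show "bounded_linear (\<lambda>\<theta>. \<theta> *\<^sub>R bsh C m s)" by (rule bounded_linear_scaleR_left)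
    show "d > 0" "X 0 0 = 0" by (rule d X0)+
    fix \<theta> :: real assume "norm \<theta> < d"
    then show "norm (X 0 \<theta> - \<theta> *\<^sub>R bsh C m s) \<le> B * (norm \<theta>)\<^sup>2"
      using X[of 0 \<theta>] by (simp add: A0 tang_simps)
  qed
  from has_derivative_in_compose[OF this, of "radial arctan" "\<lambda>v. v"]
  have comp: "((\<lambda>\<theta>. radial arctan (X 0 \<theta>)) has_derivative (\<lambda>\<theta>. \<theta> *\<^sub>R bsh C m s)) (at 0 within UNIV)"
    by (simp add: X0 arctan_radial_derivative)
  have "((\<lambda>\<theta>. branch_chart a q1 r (C, m) s 0 \<theta>) has_derivative (\<lambda>\<theta>. \<theta> *\<^sub>R bsh C m s)) (at 0 within UNIV)"
  proof (rule has_derivative_transform_within[OF comp d])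
    show "radial arctan (X 0 \<theta>) = branch_chart a q1 r (C, m) s 0 \<theta>" if "dist \<theta> 0 < d" for \<theta>
      using ch[of 0 \<theta>] that by (simp add: tang_simps dist_norm)
  qed simp
  then have "((\<lambda>\<theta>. branch_chart a q1 r (C, m) s 0 \<theta>) has_vector_derivative bsh C m s) (at 0)"
    by (simp add: has_vector_derivative_def)
  then show ?thesis unfolding branch_shift_def by (rule vector_derivative_at)
qed

end

section \<open>Finite mixtures of Dirac measures\<close>

lemma emeasure_dirac_mixture:
  assumes J: "finite J" and t: "\<And>j. j \<in> J \<Longrightarrow> t j \<in> space M" and B: "B \<in> sets M"
  shows "emeasure (dirac_mixture M J w t) B = (\<Sum>j\<in>J. ennreal (w j) * indicator B (t j))"
proof -
  have m: "t \<in> measurable (point_measure J (\<lambda>j. ennreal (w j))) M"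
    using t by (simp add: measurable_point_measure_eq1)
  have "emeasure (dirac_mixture M J w t) B = emeasure (point_measure J (\<lambda>j. ennreal (w j))) {j \<in> J. t j \<in> B}"
    unfolding dirac_mixture_def emeasure_distr[OF m B]
    by (rule arg_cong[where f = "emeasure _"]) (auto simp: space_point_measure)
  also have "\<dots> = (\<Sum>j\<in>{j \<in> J. t j \<in> B}. ennreal (w j))"
    using J by (intro emeasure_point_measure_finite) auto
  also have "\<dots> = (\<Sum>j\<in>J. ennreal (w j) * indicator B (t j))"
    unfolding sum.inter_filter[OF J] by (intro sum.cong) (auto simp: indicator_def)
  finally show ?thesis .
qed

lemma integral_dirac_mixture:
  fixes f :: "'b \<Rightarrow> real"
  assumes J: "finite J" and t: "\<And>j. j \<in> J \<Longrightarrow> t j \<in> space M" and w: "\<And>j. j \<in> J \<Longrightarrow> w j \<ge> 0"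
    and f: "f \<in> borel_measurable M"
  shows "(\<integral>x. f x \<partial>(dirac_mixture M J w t)) = (\<Sum>j\<in>J. w j * f (t j))"
proof -
  have m: "t \<in> measurable (point_measure J (\<lambda>j. ennreal (w j))) M"
    using t by (simp add: measurable_point_measure_eq1)
  show ?thesis unfolding dirac_mixture_def integral_distr[OF m f]
    using lebesgue_integral_point_measure_finite[OF J, of w "\<lambda>j. f (t j)"] w by simp
qed

text \<open>Covers infinite \<open>J\<close> as well, which is the situation to be refuted in
  \<open>finite_proj_clifford\<close>.\<close>

lemma emeasure_dirac_mixture_0:
  assumes "\<And>j. j \<in> J \<Longrightarrow> w j = 0"
  shows "emeasure (dirac_mixture M J w t) B = 0"
proof -
  have z: "emeasure (point_measure J (\<lambda>j. ennreal (w j))) A = 0" for A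
  proof (cases "A \<subseteq> J")
    case True
    then show ?thesis unfolding point_measure_def using assms
      by (subst emeasure_density) (auto simp: nn_integral_0_iff_AE AE_count_space indicator_def)
  next
    case False
    then show ?thesis by (intro emeasure_notin_sets) (simp add: sets_point_measure)
  qed
  show ?thesis unfolding dirac_mixture_def distr_def emeasure_measure_of_conv by (simp add: z)
qed

text \<open>Invariance is defined on measurable sets; the standard induction over nonnegative
  measurable functions extends it. The kernel is resolved into finitely many branches with weights
  and targets depending measurably on the point, so every integrand is an explicit finite
  sum.\<close>

lemma invariant_nn_integral:
  fixes w :: "'j \<Rightarrow> 'b \<Rightarrow> ennreal"
  assumes inv: "invariant_prob M P \<mu>" and J: "finite J"
    and w: "\<And>j. j \<in> J \<Longrightarrow> w j \<in> borel_measurable M" and t: "\<And>j. j \<in> J \<Longrightarrow> t j \<in> measurable M M"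
    and P: "\<And>x B. x \<in> space M \<Longrightarrow> B \<in> sets M \<Longrightarrow> emeasure (P x) B = (\<Sum>j\<in>J. w j x * indicator B (t j x))"
    and f: "f \<in> borel_measurable M"
  shows "(\<integral>\<^sup>+x. f x \<partial>\<mu>) = (\<integral>\<^sup>+x. (\<Sum>j\<in>J. w j x * f (t j x)) \<partial>\<mu>)"
proof -
  have s: "sets \<mu> = sets M" and sp: "space \<mu> = space M"
    using inv sets_eq_imp_space_eq unfolding invariant_prob_def by blast+
  note mc = measurable_cong_sets[OF s refl]
  have wm [measurable]: "\<And>j. j \<in> J \<Longrightarrow> w j \<in> borel_measurable \<mu>" using w by (simp add: mc)
  have tm: "\<And>j. j \<in> J \<Longrightarrow> t j \<in> measurable \<mu> M" using t by (simp add: mc)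
  from f show ?thesis
  proof (induction rule: borel_measurable_induct)
    case (cong f g)
    have "(\<integral>\<^sup>+x. f x \<partial>\<mu>) = (\<integral>\<^sup>+x. g x \<partial>\<mu>)" using cong(3) by (intro nn_integral_cong) (simp add: sp)
    moreover have "(\<integral>\<^sup>+x. (\<Sum>j\<in>J. w j x * f (t j x)) \<partial>\<mu>) = (\<integral>\<^sup>+x. (\<Sum>j\<in>J. w j x * g (t j x)) \<partial>\<mu>)"
      using cong(3) measurable_space[OF t] by (intro nn_integral_cong sum.cong) (simp_all add: sp)
    ultimately show ?case using cong(4) by simp
  next
    case (set A)
    have "(\<integral>\<^sup>+x. indicator A x \<partial>\<mu>) = emeasure \<mu> A" using set by (simp add: s)
    also have "\<dots> = (\<integral>\<^sup>+x. emeasure (P x) A \<partial>\<mu>)" using inv set unfolding invariant_prob_def by blast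
    also have "\<dots> = (\<integral>\<^sup>+x. (\<Sum>j\<in>J. w j x * indicator A (t j x)) \<partial>\<mu>)"
      using set by (intro nn_integral_cong P) (simp_all add: sp)
    finally show ?case .
  next
    case (mult u c)
    have um: "\<And>j. j \<in> J \<Longrightarrow> (\<lambda>x. u (t j x)) \<in> borel_measurable \<mu>"
      by (rule measurable_compose[OF tm mult(2)])
    have u: "u \<in> borel_measurable \<mu>" using mult(2) by (simp add: mc)
    have "(\<integral>\<^sup>+x. (\<Sum>j\<in>J. w j x * (c * u (t j x))) \<partial>\<mu>) = (\<integral>\<^sup>+x. c * (\<Sum>j\<in>J. w j x * u (t j x)) \<partial>\<mu>)"
      by (simp add: sum_distrib_left mult.left_commute)
    also have "\<dots> = c * (\<integral>\<^sup>+x. (\<Sum>j\<in>J. w j x * u (t j x)) \<partial>\<mu>)"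
      using um by (intro nn_integral_cmult) auto
    finally show ?case using mult(4) u by (simp add: nn_integral_cmult)
  next
    case (add u v)
    have um: "\<And>j. j \<in> J \<Longrightarrow> (\<lambda>x. u (t j x)) \<in> borel_measurable \<mu>" and vm: "\<And>j. j \<in> J \<Longrightarrow> (\<lambda>x. v (t j x)) \<in> borel_measurable \<mu>"
      using measurable_compose[OF tm] add by blast+
    have u: "u \<in> borel_measurable \<mu>" "v \<in> borel_measurable \<mu>" using add by (simp_all add: mc)
    have "(\<integral>\<^sup>+x. (\<Sum>j\<in>J. w j x * (v (t j x) + u (t j x))) \<partial>\<mu>)
        = (\<integral>\<^sup>+x. (\<Sum>j\<in>J. w j x * v (t j x)) + (\<Sum>j\<in>J. w j x * u (t j x)) \<partial>\<mu>)"
      by (simp add: sum.distrib distrib_left)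
    also have "\<dots> = (\<integral>\<^sup>+x. (\<Sum>j\<in>J. w j x * v (t j x)) \<partial>\<mu>) + (\<integral>\<^sup>+x. (\<Sum>j\<in>J. w j x * u (t j x)) \<partial>\<mu>)"
      using um vm by (intro nn_integral_add) auto
    finally show ?case using add u by (simp add: nn_integral_add)
  next
    case (seq U)
    have um: "\<And>j i. j \<in> J \<Longrightarrow> (\<lambda>x. U i (t j x)) \<in> borel_measurable \<mu>"
      by (rule measurable_compose[OF tm seq(1)])
    have u: "\<And>i. U i \<in> borel_measurable \<mu>" using seq(1) by (simp add: mc)
    have inc: "incseq (\<lambda>i x. \<Sum>j\<in>J. w j x * U i (t j x))"
      using seq(3) by (auto simp: incseq_def le_fun_def intro!: sum_mono mult_left_mono)
    have "(\<integral>\<^sup>+x. (\<Sum>j\<in>J. w j x * (SUP i. U i) (t j x)) \<partial>\<mu>)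
        = (\<integral>\<^sup>+x. (SUP i. \<Sum>j\<in>J. w j x * U i (t j x)) \<partial>\<mu>)"
    proof (rule nn_integral_cong)
      fix x
      have "(\<Sum>j\<in>J. w j x * (SUP i. U i) (t j x)) = (\<Sum>j\<in>J. SUP i. w j x * U i (t j x))"
        by (simp only: SUP_apply SUP_mult_left_ennreal)
      also have "\<dots> = (SUP i. \<Sum>j\<in>J. w j x * U i (t j x))"
        using seq(3) by (intro ennreal_SUP_sum[symmetric]) (auto simp: incseq_def le_fun_def intro!: mult_left_mono)
      finally show "(\<Sum>j\<in>J. w j x * (SUP i. U i) (t j x)) = (SUP i. \<Sum>j\<in>J. w j x * U i (t j x))" .
    qed
    also have "\<dots> = (SUP i. \<integral>\<^sup>+x. (\<Sum>j\<in>J. w j x * U i (t j x)) \<partial>\<mu>)"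
      using um by (intro nn_integral_monotone_convergence_SUP[OF inc]) auto
    also have "\<dots> = (SUP i. \<integral>\<^sup>+x. U i x \<partial>\<mu>)" using seq.IH by simp
    also have "\<dots> = (\<integral>\<^sup>+x. (SUP i. U i x) \<partial>\<mu>)"
      using u by (intro nn_integral_monotone_convergence_SUP[OF seq(3), symmetric]) auto
    finally show ?case by (simp add: SUP_apply image_comp)
  qed
qed

lemma invariant_integral:
  fixes f :: "'b \<Rightarrow> real"
  assumes inv: "invariant_prob M P \<mu>" and J: "finite J"
    and w: "\<And>j. j \<in> J \<Longrightarrow> w j \<in> borel_measurable M" and t: "\<And>j. j \<in> J \<Longrightarrow> t j \<in> measurable M M"
    and w0: "\<And>j x. j \<in> J \<Longrightarrow> x \<in> space M \<Longrightarrow> w j x \<ge> 0"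
    and P: "\<And>x B. x \<in> space M \<Longrightarrow> B \<in> sets M \<Longrightarrow> emeasure (P x) B = (\<Sum>j\<in>J. ennreal (w j x) * indicator B (t j x))"
    and f: "f \<in> borel_measurable M" and f0: "\<And>x. x \<in> space M \<Longrightarrow> f x \<ge> 0"
    and g: "\<And>x. x \<in> space M \<Longrightarrow> g x = (\<Sum>j\<in>J. w j x * f (t j x))"
  shows "g \<in> borel_measurable \<mu>" "integrable \<mu> f \<longleftrightarrow> integrable \<mu> g" "integral\<^sup>L \<mu> g = integral\<^sup>L \<mu> f"
proof -
  have s: "sets \<mu> = sets M" and sp: "space \<mu> = space M"
    using inv sets_eq_imp_space_eq unfolding invariant_prob_def by blast+
  note mc = measurable_cong_sets[OF s refl]
  have "(\<lambda>x. \<Sum>j\<in>J. w j x * f (t j x)) \<in> borel_measurable M"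
    using w measurable_compose[OF t f] by (intro borel_measurable_sum borel_measurable_times) auto
  then have "g \<in> borel_measurable M" using g by (subst measurable_cong[where g = "\<lambda>x. \<Sum>j\<in>J. w j x * f (t j x)"]) auto
  then show gm: "g \<in> borel_measurable \<mu>" by (simp add: mc)
  have fm: "f \<in> borel_measurable \<mu>" using f by (simp add: mc)
  have g0: "\<And>x. x \<in> space M \<Longrightarrow> g x \<ge> 0"
    using g w0 f0 measurable_space[OF t] by (simp add: sum_nonneg)
  have "(\<integral>\<^sup>+x. ennreal (f x) \<partial>\<mu>) = (\<integral>\<^sup>+x. (\<Sum>j\<in>J. ennreal (w j x) * ennreal (f (t j x))) \<partial>\<mu>)"
    using w f by (intro invariant_nn_integral[OF inv J _ t P]) auto
  also have "\<dots> = (\<integral>\<^sup>+x. ennreal (g x) \<partial>\<mu>)"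
  proof (rule nn_integral_cong)
    fix x assume "x \<in> space \<mu>"
    then have x: "x \<in> space M" by (simp add: sp)
    have "ennreal (g x) = (\<Sum>j\<in>J. ennreal (w j x * f (t j x)))"
      unfolding g[OF x] using x w0 f0 measurable_space[OF t] by (intro sum_ennreal[symmetric]) simp
    also have "\<dots> = (\<Sum>j\<in>J. ennreal (w j x) * ennreal (f (t j x)))"
      using x w0 f0 measurable_space[OF t] by (intro sum.cong ennreal_mult) auto
    finally show "(\<Sum>j\<in>J. ennreal (w j x) * ennreal (f (t j x))) = ennreal (g x)" ..
  qed
  finally have eq: "(\<integral>\<^sup>+x. ennreal (f x) \<partial>\<mu>) = (\<integral>\<^sup>+x. ennreal (g x) \<partial>\<mu>)" .
  have fg: "AE x in \<mu>. 0 \<le> f x" "AE x in \<mu>. 0 \<le> g x" using f0 g0 by (auto intro!: AE_I2 simp: sp)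
  have iff: "integrable \<mu> h \<longleftrightarrow> (\<integral>\<^sup>+x. ennreal (h x) \<partial>\<mu>) < \<infinity>"
    if "h \<in> borel_measurable \<mu>" "AE x in \<mu>. 0 \<le> h x" for h :: "'b \<Rightarrow> real"
    using that integrableI_nonneg[OF that] nn_integral_eq_integral[of \<mu> h] by (auto simp: less_top[symmetric])
  show "integrable \<mu> f \<longleftrightarrow> integrable \<mu> g"
    using iff[OF fm fg(1)] iff[OF gm fg(2)] eq by simp
  show "integral\<^sup>L \<mu> g = integral\<^sup>L \<mu> f"
    using eq by (simp add: integral_eq_nn_integral[OF fm fg(1)] integral_eq_nn_integral[OF gm fg(2)])
qed

section \<open>The kernel on rays\<close>

text \<open>The matrix \<open>A ** \<rho> ** dagger A\<close>, with the entries written as linear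
  functions of those of \<rho>, from which continuity and measurability can be read off.\<close>

definition push :: "'i::finite cmat \<Rightarrow> 'i cmat \<Rightarrow> 'i cmat" where
  "push A \<rho> = (\<chi> i j. \<Sum>k\<in>UNIV. \<Sum>l\<in>UNIV. A $ i $ k * cnj (A $ j $ l) * \<rho> $ k $ l)"

lemma push_outer: "push A (outer y) = outer (A *v y)"
  by (simp add: push_def outer_def matrix_vector_mult_def vec_eq_iff sum_product mult_ac)

lemma borel_measurable_push [measurable]: "push A \<in> borel_measurable borel"
  unfolding push_def by (intro borel_measurable_continuous_onI continuous_intros)

lemma borel_measurable_trace_mult: "(\<lambda>\<rho>. Re (trace (A ** \<rho>))) \<in> borel_measurable borel"
  unfolding trace_def matrix_matrix_mult_def vec_lambda_beta
  by (intro borel_measurable_continuous_onI continuous_intros)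

lemma ray_scaleR_outer: "ray y = (1 / (norm y)\<^sup>2) *\<^sub>R outer y"
  by (simp add: ray_def scaleR_eq_smult outer_smult csc_def vec_eq_iff outer_def norm_divide power_divide)
    (simp add: scaleR_conv_of_real power2_eq_square)

lemma space_ray_space: "space ray_space = rays"
  by (simp add: ray_space_def space_restrict_space)

lemma measurable_ray_space: "f \<in> borel_measurable borel \<Longrightarrow> f \<in> borel_measurable ray_space"
  unfolding ray_space_def by (rule measurable_restrict_space1)

context monitored
begin

text \<open>\<open>rep_vec\<close> is an arbitrary choice, about whose measurability nothing is
  known. Probabilities and post-measurement states are therefore expressed through the projector
  \<rho> itself.\<close>

definition rp :: "('n, 'p) idx cmat set \<times> 'p mod_ring \<Rightarrow> real \<Rightarrow> ('n, 'p) idx cmat \<Rightarrow> real" where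
  "rp = (\<lambda>(C, m) \<theta> \<rho>. Re (trace ((dagger (K C m \<theta>) ** K C m \<theta>) ** \<rho>)))"

text \<open>Where the branch is inactive, \<rho> itself serves as a default, so that the map
  preserves the set of rays; the weight there is 0.\<close>

definition rt :: "('n, 'p) idx cmat set \<times> 'p mod_ring \<Rightarrow> real \<Rightarrow> ('n, 'p) idx cmat \<Rightarrow> ('n, 'p) idx cmat" where
  "rt = (\<lambda>(C, m) \<theta> \<rho>. if rp (C, m) \<theta> \<rho> > 0 then (1 / rp (C, m) \<theta> \<rho>) *\<^sub>R push (K C m \<theta>) \<rho> else \<rho>)"

lemma rp_eq: "\<rho> \<in> rays \<Longrightarrow> rp (C, m) \<theta> \<rho> = (norm (K C m \<theta> *v rep_vec \<rho>))\<^sup>2"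
proof -
  assume \<rho>: "\<rho> \<in> rays"
  have "rp (C, m) \<theta> (outer (rep_vec \<rho>)) = Re (braket (rep_vec \<rho>) (dagger (K C m \<theta>) *v (K C m \<theta> *v rep_vec \<rho>)))"
    by (simp add: rp_def trace_outer matvec_assoc)
  also have "braket (rep_vec \<rho>) (dagger (K C m \<theta>) *v (K C m \<theta> *v rep_vec \<rho>))
      = braket (K C m \<theta> *v rep_vec \<rho>) (K C m \<theta> *v rep_vec \<rho>)"
    by (simp add: braket_dagger)
  finally show ?thesis by (simp add: braket_self rays_rep_vec(2)[OF \<rho>])
qed

lemma rt_eq:
  assumes \<rho>: "\<rho> \<in> rays" and p: "rp (C, m) \<theta> \<rho> > 0"
  shows "rt (C, m) \<theta> \<rho> = ray (K C m \<theta> *v rep_vec \<rho>)"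
proof -
  have "push (K C m \<theta>) \<rho> = outer (K C m \<theta> *v rep_vec \<rho>)"
    using push_outer[of "K C m \<theta>" "rep_vec \<rho>"] by (simp add: rays_rep_vec(2)[OF \<rho>])
  then show ?thesis using p by (simp add: rt_def ray_scaleR_outer rp_eq[OF \<rho>])
qed

lemma rt_in_rays: "\<rho> \<in> rays \<Longrightarrow> rt J \<theta> \<rho> \<in> rays"
proof (cases J)
  case (Pair C m)
  assume \<rho>: "\<rho> \<in> rays"
  show ?thesis
  proof (cases "rp (C, m) \<theta> \<rho> > 0")
    case True
    then have "K C m \<theta> *v rep_vec \<rho> \<noteq> 0" by (auto simp: rp_eq[OF \<rho>])
    then show ?thesis using rt_eq[OF \<rho> True] by (simp add: Pair ray_in_rays)
  qed (simp add: rt_def Pair \<rho>)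
qed

lemma measurable_rp: "rp J \<theta> \<in> borel_measurable borel"
  by (cases J) (simp add: rp_def borel_measurable_trace_mult)

lemma measurable_rt: "rt J \<theta> \<in> measurable ray_space ray_space"
proof (cases J)
  case (Pair C m)
  have [measurable]: "rp (C, m) \<theta> \<in> borel_measurable borel" by (rule measurable_rp)
  have "rt J \<theta> \<in> borel_measurable borel" unfolding Pair rt_def case_prod_conv by measurable
  then have "rt J \<theta> \<in> borel_measurable ray_space" by (rule measurable_ray_space)
  then show ?thesis
    unfolding ray_space_def[of, where 'i = "'n \<Rightarrow> 'p mod_ring"]
    by (intro measurable_restrict_space2) (auto simp: rt_in_rays space_restrict_space)
qed

lemma finite_branches: "finite (branches :: ('n, 'p) branch set)"
  using fin_cl by (simp add: branches_def)

lemma sum_branches: "(\<Sum>J\<in>(branches :: ('n, 'p) branch set). F J) = (\<Sum>C\<in>Cl. \<Sum>m\<in>UNIV. F (C, m))"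
  by (simp add: branches_def sum.cartesian_product)

lemma emeasure_ray_kernel:
  assumes \<rho>: "\<rho> \<in> space ray_space" and B: "B \<in> sets ray_space"
  shows "emeasure (ray_kernel a q1 \<theta> \<rho>) B
    = (\<Sum>J\<in>branches. ennreal (rp J \<theta> \<rho> / Nc) * indicator B (rt J \<theta> \<rho>))"
proof -
  have \<rho>: "\<rho> \<in> rays" using \<rho> by (simp add: space_ray_space)
  have bp: "branch_prob a q1 J \<theta> \<rho> = rp J \<theta> \<rho>" if "J \<in> branches" for J
    using that by (cases J) (simp add: branches_def branch_prob_eq rp_eq[OF \<rho>])
  have ab: "active_branches a q1 \<theta> \<rho> = {J \<in> branches. rp J \<theta> \<rho> > 0}"
    using bp by (auto simp: active_branches_def)
  have post: "branch_post a q1 J \<theta> \<rho> = rt J \<theta> \<rho>" if "rp J \<theta> \<rho> > 0" for J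
    using that by (cases J) (simp add: branch_post_eq rt_eq[OF \<rho>])
  have "emeasure (ray_kernel a q1 \<theta> \<rho>) B
      = (\<Sum>J\<in>{J \<in> branches. rp J \<theta> \<rho> > 0}. ennreal (branch_weight a q1 J \<theta> \<rho>) * indicator B (branch_post a q1 J \<theta> \<rho>))"
    unfolding ray_kernel_def ab
    using finite_branches B rt_in_rays[OF \<rho>]
    by (intro emeasure_dirac_mixture) (auto simp: space_ray_space post)
  also have "\<dots> = (\<Sum>J\<in>{J \<in> branches. rp J \<theta> \<rho> > 0}. ennreal (rp J \<theta> \<rho> / Nc) * indicator B (rt J \<theta> \<rho>))"
    by (rule sum.cong) (auto simp: branch_weight_def bp post Nc_def)
  also have "\<dots> = (\<Sum>J\<in>branches. ennreal (rp J \<theta> \<rho> / Nc) * indicator B (rt J \<theta> \<rho>))"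
  proof (rule sum.mono_neutral_left)
    show "\<forall>J\<in>branches - {J \<in> branches. rp J \<theta> \<rho> > 0}. ennreal (rp J \<theta> \<rho> / Nc) * indicator B (rt J \<theta> \<rho>) = 0"
    proof
      fix J :: "('n, 'p) branch" assume "J \<in> branches - {J \<in> branches. rp J \<theta> \<rho> > 0}"
      then have "rp J \<theta> \<rho> / Nc \<le> 0" using Nc_pos by (auto simp: divide_le_0_iff)
      then show "ennreal (rp J \<theta> \<rho> / Nc) * indicator B (rt J \<theta> \<rho>) = 0" by (simp add: ennreal_neg)
    qed
  qed (use finite_branches in auto)
  finally show ?thesis .
qed

section \<open>Homogeneous functions as integrands on the space of rays\<close>

definition hom2 :: "(('n, 'p) idx cvec \<Rightarrow> real) \<Rightarrow> bool" where
  "hom2 f \<longleftrightarrow> (\<forall>c y. f (c *s y) = (cmod c)\<^sup>2 * f y)"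

lemma avg_rep_vec:
  assumes f: "hom2 f" and \<rho>: "\<rho> \<in> rays"
  shows "avg a q1 \<theta> f (rep_vec \<rho>) = (\<Sum>J\<in>branches. rp J \<theta> \<rho> / Nc * f (rep_vec (rt J \<theta> \<rho>)))"
proof -
  have "f (K C m \<theta> *v rep_vec \<rho>) = rp (C, m) \<theta> \<rho> * f (rep_vec (rt (C, m) \<theta> \<rho>))" for C m
  proof (cases "K C m \<theta> *v rep_vec \<rho> = 0")
    case True
    have "f (0 *s 0) = (cmod 0)\<^sup>2 * f 0" using f unfolding hom2_def by blast
    then show ?thesis by (simp add: True rp_eq[OF \<rho>])
  next
    case False
    obtain c where c: "rep_vec (ray (K C m \<theta> *v rep_vec \<rho>)) = c *s (K C m \<theta> *v rep_vec \<rho>)"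
      "cmod c = 1 / norm (K C m \<theta> *v rep_vec \<rho>)"
      using rep_vec_ray[OF False] by metis
    have p: "rp (C, m) \<theta> \<rho> > 0" using False by (simp add: rp_eq[OF \<rho>])
    have "f (c *s (K C m \<theta> *v rep_vec \<rho>)) = (cmod c)\<^sup>2 * f (K C m \<theta> *v rep_vec \<rho>)" using f unfolding hom2_def by blast
    then show ?thesis using False
      by (simp add: rt_eq[OF \<rho> p] c rp_eq[OF \<rho>] power_divide)
  qed
  then show ?thesis by (simp add: avg_def sum_branches Nc_def sum_divide_distrib)
qed

definition rmeas :: "(('n, 'p) idx cvec \<Rightarrow> real) \<Rightarrow> bool" where
  "rmeas f \<longleftrightarrow> hom2 f \<and> (\<forall>y. f y \<ge> 0) \<and> (\<lambda>\<rho>. f (rep_vec \<rho>)) \<in> borel_measurable ray_space"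

lemma hom2_avg: "hom2 f \<Longrightarrow> hom2 (avg a q1 \<theta> f)"
  unfolding hom2_def using avg_smult by blast

lemma rmeas_avg:
  assumes f: "rmeas f"
  shows "rmeas (avg a q1 \<theta> f)"
  unfolding rmeas_def
proof (intro conjI allI)
  have h: "hom2 f" and f0: "\<And>y. f y \<ge> 0" and m: "(\<lambda>\<rho>. f (rep_vec \<rho>)) \<in> borel_measurable ray_space"
    using f by (auto simp: rmeas_def)
  show "hom2 (avg a q1 \<theta> f)" by (rule hom2_avg[OF h])
  show "avg a q1 \<theta> f y \<ge> 0" for y using f0 by (simp add: avg_def sum_nonneg)
  have "(\<lambda>\<rho>. \<Sum>J\<in>branches. rp J \<theta> \<rho> / Nc * f (rep_vec (rt J \<theta> \<rho>))) \<in> borel_measurable ray_space"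
    using measurable_compose[OF measurable_rt m] measurable_ray_space[OF measurable_rp]
    by (intro borel_measurable_sum borel_measurable_times borel_measurable_divide borel_measurable_const)
  then show "(\<lambda>\<rho>. avg a q1 \<theta> f (rep_vec \<rho>)) \<in> borel_measurable ray_space"
    by (subst measurable_cong[OF avg_rep_vec[OF h]]) (simp_all add: space_ray_space)
qed

lemma invariant_avg:
  assumes inv: "invariant_prob ray_space (ray_kernel a q1 \<theta>) \<mu>" and f: "rmeas f"
  shows "(\<integral>\<rho>. avg a q1 \<theta> f (rep_vec \<rho>) \<partial>\<mu>) = (\<integral>\<rho>. f (rep_vec \<rho>) \<partial>\<mu>)"
proof -
  have h: "hom2 f" and f0: "\<And>y. f y \<ge> 0" and m: "(\<lambda>\<rho>. f (rep_vec \<rho>)) \<in> borel_measurable ray_space"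
    using f by (auto simp: rmeas_def)
  show ?thesis
  proof (rule invariant_integral(3)[OF inv finite_branches _ measurable_rt _ emeasure_ray_kernel m])
    show "(\<lambda>\<rho>. rp J \<theta> \<rho> / Nc) \<in> borel_measurable ray_space" for J
      using measurable_ray_space[OF measurable_rp] by (intro borel_measurable_divide) auto
    show "0 \<le> rp J \<theta> \<rho> / Nc" if "\<rho> \<in> space ray_space" for J \<rho>
      using that Nc_pos by (cases J) (simp add: space_ray_space rp_eq)
    show "avg a q1 \<theta> f (rep_vec \<rho>) = (\<Sum>J\<in>branches. rp J \<theta> \<rho> / Nc * f (rep_vec (rt J \<theta> \<rho>)))" if "\<rho> \<in> space ray_space" for \<rho>
      using that by (simp add: avg_rep_vec[OF h] space_ray_space)
  qed (simp_all add: f0)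
qed

lemma mana_rep_vec: "\<rho> \<in> rays \<Longrightarrow> mana \<rho> = mfun (rep_vec (\<rho> :: ('n, 'p) idx cmat))"
  using mana_eq_mfun[of "rep_vec \<rho>"] by (simp add: rays_rep_vec)

lemma rmeas_mfun: "rmeas mfun"
  unfolding rmeas_def
proof (intro conjI allI)
  show "hom2 mfun" by (simp add: hom2_def mfun_smult)
  have [measurable]: "(\<lambda>\<rho> :: ('n, 'p) idx cmat. wigner \<rho> u) \<in> borel_measurable borel" for u
    unfolding wigner_def by (intro borel_measurable_divide borel_measurable_trace_mult borel_measurable_const)
  have "(mana :: ('n, 'p) idx cmat \<Rightarrow> real) \<in> borel_measurable borel"
    unfolding mana_def by measurable
  then have "(mana :: ('n, 'p) idx cmat \<Rightarrow> real) \<in> borel_measurable ray_space" by (rule measurable_ray_space)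
  then show "(\<lambda>\<rho> :: ('n, 'p) idx cmat. mfun (rep_vec \<rho>)) \<in> borel_measurable ray_space"
    by (subst measurable_cong[OF mana_rep_vec[symmetric]]) (simp_all add: space_ray_space)
qed (rule mfun_nonneg)

lemma rmeas_fiter: "rmeas (fiter n \<theta>)"
proof (induction n)
  case 0
  then show ?case using rmeas_mfun by (simp add: fiter_def)
next
  case (Suc n)
  then show ?case unfolding fiter_Suc by (rule rmeas_avg)
qed

text \<open>For measurability: the distance from each stabilizer line is written through the
  transition probability, a trace linear in \<rho>, instead of the chosen vector.\<close>

lemma hfun_rep_vec:
  assumes \<rho>: "\<rho> \<in> rays"
  shows "hfun (rep_vec \<rho>) = Min ((\<lambda>s. sqrt (1 - Re (trace (outer (rep_vec s) ** \<rho>)))) ` Stab)"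
proof -
  have "norm (prp (rep_vec s) (rep_vec \<rho>)) = sqrt (1 - Re (trace (outer (rep_vec s) ** \<rho>)))" if s: "s \<in> Stab" for s
  proof -
    have "trace (outer (rep_vec s) ** outer (rep_vec \<rho>)) = braket (rep_vec \<rho>) (outer (rep_vec s) *v rep_vec \<rho>)"
      by (rule trace_outer)
    also have "outer (rep_vec s) *v rep_vec \<rho> = braket (rep_vec s) (rep_vec \<rho>) *s rep_vec s"
      by (simp add: outer_def matrix_vector_mult_def braket_def vec_eq_iff) (simp add: sum_distrib_left mult_ac)
    also have "braket (rep_vec \<rho>) (braket (rep_vec s) (rep_vec \<rho>) *s rep_vec s)
        = braket (rep_vec s) (rep_vec \<rho>) * cnj (braket (rep_vec s) (rep_vec \<rho>))"
      by (simp add: braket_smult_right) (simp add: braket_def mult.commute)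
    finally have "Re (trace (outer (rep_vec s) ** \<rho>)) = (cmod (braket (rep_vec s) (rep_vec \<rho>)))\<^sup>2"
      by (simp add: rays_rep_vec(2)[OF \<rho>] complex_norm_square[symmetric] del: of_real_power)
    then have "1 - Re (trace (outer (rep_vec s) ** \<rho>)) = (norm (prp (rep_vec s) (rep_vec \<rho>)))\<^sup>2"
      using norm_prp[OF rep_vec_norm[OF s], of "rep_vec \<rho>"] by (simp add: rays_rep_vec(1)[OF \<rho>])
    then show ?thesis by simp
  qed
  then have "(\<lambda>s. norm (prp (rep_vec s) (rep_vec \<rho>))) ` Stab = (\<lambda>s. sqrt (1 - Re (trace (outer (rep_vec s) ** \<rho>)))) ` Stab"
    by (rule image_cong[OF refl])
  then show ?thesis by (simp add: hfun_def sdist_def rays_rep_vec(1)[OF \<rho>])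
qed

lemma rmeas_hfun: "rmeas hfun"
  unfolding rmeas_def
proof (intro conjI allI)
  show "hom2 hfun" by (simp add: hom2_def hfun_smult)
  have "(\<lambda>\<rho>. Min ((\<lambda>s. sqrt (1 - Re (trace (outer (rep_vec s) ** \<rho>)))) ` Stab)) \<in> borel_measurable borel"
  proof (rule borel_measurable_Min[OF Stab_finite])
    fix s :: "('n, 'p) idx cmat"
    have [measurable]: "(\<lambda>\<rho>. Re (trace (outer (rep_vec s) ** \<rho>))) \<in> borel_measurable borel" by (rule borel_measurable_trace_mult)
    show "(\<lambda>\<rho>. sqrt (1 - Re (trace (outer (rep_vec s) ** \<rho>)))) \<in> borel_measurable borel" by measurable
  qed
  then have "(\<lambda>\<rho>. Min ((\<lambda>s. sqrt (1 - Re (trace (outer (rep_vec s) ** \<rho>)))) ` Stab)) \<in> borel_measurable ray_space"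
    by (rule measurable_ray_space)
  then show "(\<lambda>\<rho> :: ('n, 'p) idx cmat. hfun (rep_vec \<rho>)) \<in> borel_measurable ray_space"
    by (subst measurable_cong[OF hfun_rep_vec]) (simp_all add: space_ray_space)
qed (rule hfun_nonneg)

end

section \<open>The kernels on the tangent spaces\<close>

lemma dirac_mixture_cong:
  assumes "\<And>j. j \<in> J \<Longrightarrow> w j = w' j" "\<And>j. j \<in> J \<Longrightarrow> t j = t' j"
  shows "dirac_mixture M J w t = dirac_mixture M J w' t'"
proof -
  have p: "point_measure J (\<lambda>j. ennreal (w j)) = point_measure J (\<lambda>j. ennreal (w' j))"
    unfolding point_measure_def using assms(1) by (intro density_cong) (auto simp: AE_count_space)
  show ?thesis unfolding dirac_mixture_def p
    using assms(2) by (intro distr_cong) (auto simp: space_point_measure)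
qed

text \<open>Fatou's lemma: at each point the truncations eventually coincide with
  \<open>f\<close>.\<close>

lemma integrable_of_bounded_truncations:
  fixes f :: "'b \<Rightarrow> real"
  assumes f: "f \<in> borel_measurable M" and f0: "\<And>x. x \<in> space M \<Longrightarrow> f x \<ge> 0"
    and b: "\<And>k :: nat. (\<integral>\<^sup>+x. ennreal (if f x \<le> real k then f x else 0) \<partial>M) \<le> ennreal b"
  shows "integrable M f"
proof (rule integrableI_nonneg[OF f])
  note f [measurable]
  show "AE x in M. 0 \<le> f x" using f0 by auto
  have "(\<integral>\<^sup>+x. ennreal (f x) \<partial>M) = (\<integral>\<^sup>+x. liminf (\<lambda>k. ennreal (if f x \<le> real k then f x else 0)) \<partial>M)"
  proof (rule nn_integral_cong)
    fix x
    have "\<forall>\<^sub>F k in sequentially. f x \<le> real k"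
      using eventually_ge_at_top[of "nat \<lceil>f x\<rceil>"] by eventually_elim linarith
    then have "(\<lambda>k. ennreal (if f x \<le> real k then f x else 0)) \<longlonglongrightarrow> ennreal (f x)"
      by (intro tendsto_eventually) (auto elim: eventually_mono)
    then show "ennreal (f x) = liminf (\<lambda>k. ennreal (if f x \<le> real k then f x else 0))"
      by (intro lim_imp_Liminf[symmetric]) auto
  qed
  also have "\<dots> \<le> liminf (\<lambda>k. \<integral>\<^sup>+x. ennreal (if f x \<le> real k then f x else 0) \<partial>M)"
    by (intro nn_integral_liminf) measurable
  also have "\<dots> \<le> ennreal b"
    using b by (intro order_trans[OF Liminf_le_Limsup] Limsup_bounded) auto
  finally show "(\<integral>\<^sup>+x. ennreal (f x) \<partial>M) < \<infinity>" by (rule order_le_less_trans) simp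
qed

lemma space_tangent_space: "space tangent_space = tangent_union"
  by (simp add: tangent_space_def space_restrict_space)

locale charted = monitored field_type a q1 Nc Dim nn
  for field_type :: "'p::prime_card itself" and a :: "'p mod_ring" and q1 :: "'n::finite" and Nc Dim nn :: real +
  fixes r :: real
  assumes r_pos: "r > 0"
    and chart_inj: "\<And>s. s \<in> (stabilizer_states :: ('n, 'p) idx cmat set) \<Longrightarrow> inj_on (fs_exp s) (tangent_ball r s)"
begin

lemma tangent_union_iff: "(s, v) \<in> tangent_union \<longleftrightarrow> s \<in> Stab \<and> tang s v"
  by (simp add: tangent_union_def tangent_iff)

text \<open>The space consists of finitely many sheets, so measurability may be checked on each
  sheet separately.\<close>

lemma measurable_tangent_space:
  fixes g :: "('n, 'p) tangent_point \<Rightarrow> 'b"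
  assumes g: "\<And>s. s \<in> Stab \<Longrightarrow> (\<lambda>v. g (s, v)) \<in> measurable borel M"
  shows "g \<in> measurable tangent_space M"
proof (rule measurableI)
  fix x :: "('n, 'p) tangent_point" assume "x \<in> space tangent_space"
  then show "g x \<in> space M" using measurable_space[OF g, of "fst x" "snd x"]
    by (cases x) (simp add: space_tangent_space tangent_union_iff)
next
  fix B assume B: "B \<in> sets M"
  let ?A = "\<Union>s\<in>Stab. {s} \<times> ((\<lambda>v. g (s, v)) -` B \<inter> space borel)"
  have "?A \<in> sets borel"
    using Stab_finite measurable_sets[OF g B] by (intro sets.finite_UN borel_Times) auto
  moreover have "g -` B \<inter> space tangent_space = tangent_union \<inter> ?A"
    by (auto simp: space_tangent_space tangent_union_def)
  ultimately show "g -` B \<inter> space tangent_space \<in> sets tangent_space"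
    unfolding tangent_space_def[where 'n = 'n and 'p = 'p] sets_restrict_space by auto
qed

lemma tang_prp: "s \<in> Stab \<Longrightarrow> tang s (prp (rep_vec s) v)"
  by (simp add: tang_def braket_prp rep_vec_norm)

lemma prp_tang: "tang s v \<Longrightarrow> prp (rep_vec s) v = v"
  by (simp add: tang_def prp_def)

text \<open>The Lipschitz condition concerns tangent vectors only. Composition with the projection
  \<open>prp\<close> extends \<nu> to a Lipschitz function on all vectors that agrees with it on the
  tangent space.\<close>

lemma lips_measurable:
  assumes L: "lips L \<nu>"
  shows "case_prod \<nu> \<in> borel_measurable tangent_space"
proof -
  have "(\<lambda>(s, v). \<nu> s (prp (rep_vec s) v)) \<in> borel_measurable tangent_space"
  proof (rule measurable_tangent_space)
    fix s assume s: "s \<in> Stab"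
    have "L-lipschitz_on UNIV (\<lambda>v. \<nu> s (prp (rep_vec s) v))"
    proof (rule lipschitz_onI)
      show "L \<ge> 0" using L by (simp add: lips_def)
      fix v w :: "('n, 'p) idx cvec"
      have "\<bar>\<nu> s (prp (rep_vec s) v) - \<nu> s (prp (rep_vec s) w)\<bar> \<le> L * norm (prp (rep_vec s) v - prp (rep_vec s) w)"
        by (rule lipsD[OF L s tang_prp[OF s] tang_prp[OF s]])
      also have "\<dots> \<le> L * norm (v - w)"
        unfolding prp_diff[symmetric] using \<open>L \<ge> 0\<close> norm_prp_le[OF rep_vec_norm[OF s]] by (rule mult_left_mono[rotated])
      finally show "dist (\<nu> s (prp (rep_vec s) v)) (\<nu> s (prp (rep_vec s) w)) \<le> L * dist v w"
        by (simp add: dist_norm)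
    qed
    then show "(\<lambda>v. (\<lambda>(s, v). \<nu> s (prp (rep_vec s) v)) (s, v)) \<in> borel_measurable borel"
      by (simp add: borel_measurable_continuous_onI lipschitz_on_continuous_on)
  qed
  moreover have "(\<lambda>(s, v). \<nu> s (prp (rep_vec s) v)) x = case_prod \<nu> x" if "x \<in> space tangent_space" for x
    using that by (cases x) (simp add: space_tangent_space tangent_union_iff prp_tang)
  ultimately show ?thesis using measurable_cong by blast
qed

text \<open>A branch of weight 0 leaves the point where it is, so that every step maps the tangent
  union into itself.\<close>

definition tstep :: "(('n, 'p) idx cmat set \<Rightarrow> 'p mod_ring \<Rightarrow> ('n, 'p) idx cmat \<Rightarrow> ('n, 'p) idx cvec)
    \<Rightarrow> ('n, 'p) branch \<Rightarrow> ('n, 'p) tangent_point \<Rightarrow> ('n, 'p) tangent_point" where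
  "tstep \<beta> = (\<lambda>(C, m) (s, v). if wt C m s \<noteq> 0 then (post C m s, Alin C m s v + \<beta> C m s) else (s, v))"

definition twt :: "('n, 'p) branch \<Rightarrow> ('n, 'p) tangent_point \<Rightarrow> real" where
  "twt = (\<lambda>(C, m) (s, v). wt C m s / Nc)"

definition tkernel where
  "tkernel \<beta> x = dirac_mixture tangent_space {J \<in> branches. twt J x \<noteq> 0} (\<lambda>J. twt J x) (\<lambda>J. tstep \<beta> J x)"

lemma active_branches_0: "active_branches a q1 0 s = {J \<in> branches. twt J (s, v) \<noteq> 0}"
  using Nc_pos by (auto simp: active_branches_def branches_def branch_prob_eq twt_def wt_def)

lemma affine_kernel_eq:
  assumes x: "x \<in> tangent_union"
  shows "affine_kernel a q1 r x = tkernel bsh x"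
proof (cases x)
  case (Pair s v)
  have s: "s \<in> Stab" and v: "tang s v" using x by (simp_all add: Pair tangent_union_iff)
  show ?thesis unfolding Pair affine_kernel_def tkernel_def case_prod_conv active_branches_0[of s v]
    using s v Nc_pos
    by (intro dirac_mixture_cong) (auto simp: branches_def twt_def tstep_def branch_weight_eq wt_def[symmetric]
        branch_post_0 branch_lin_eq[OF _ s _ r_pos chart_inj v] branch_shift_eq[OF _ s _ r_pos chart_inj])
qed

lemma linear_kernel_eq:
  assumes x: "x \<in> tangent_union"
  shows "linear_kernel a q1 r x = tkernel (\<lambda>_ _ _. 0) x"
proof (cases x)
  case (Pair s v)
  have s: "s \<in> Stab" and v: "tang s v" using x by (simp_all add: Pair tangent_union_iff)
  show ?thesis unfolding Pair linear_kernel_def tkernel_def case_prod_conv active_branches_0[of s v]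
    using s v Nc_pos
    by (intro dirac_mixture_cong) (auto simp: branches_def twt_def tstep_def branch_weight_eq wt_def[symmetric]
        branch_post_0 branch_lin_eq[OF _ s _ r_pos chart_inj v])
qed

lemma tstep_in:
  assumes \<beta>: "tshift \<beta>" and J: "J \<in> branches" and x: "x \<in> tangent_union"
  shows "tstep \<beta> J x \<in> tangent_union"
  using J x by (cases J; cases x)
    (auto simp: tstep_def branches_def tangent_union_iff intro: post_Stab tang_step[OF \<beta>])

lemma measurable_tstep:
  assumes \<beta>: "tshift \<beta>" and J: "J \<in> branches"
  shows "tstep \<beta> J \<in> measurable tangent_space tangent_space"
proof -
  obtain C m where Jp: "J = (C, m)" by (cases J)
  have "tstep \<beta> J \<in> measurable tangent_space borel"
  proof (rule measurable_tangent_space)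
    fix s assume "s \<in> Stab"
    have "continuous_on UNIV (\<lambda>v. tstep \<beta> J (s, v))"
      unfolding Jp tstep_def case_prod_conv
      by (cases "wt C m s = 0") (auto intro!: continuous_intros linear_continuous_on[OF bounded_linear_Alin])
    then show "(\<lambda>v. tstep \<beta> J (s, v)) \<in> borel_measurable borel" by (rule borel_measurable_continuous_onI)
  qed
  then show ?thesis
    using tstep_in[OF \<beta> J] unfolding tangent_space_def[where 'n = 'n and 'p = 'p]
    by (intro measurable_restrict_space2) (auto simp: space_restrict_space)
qed

lemma measurable_twt: "twt J \<in> borel_measurable tangent_space"
  by (rule measurable_tangent_space) (cases J, simp add: twt_def)

lemma twt_nonneg: "twt J x \<ge> 0"
  using Nc_pos wt_nonneg by (cases J; cases x) (simp add: twt_def)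

lemma emeasure_tkernel:
  assumes \<beta>: "tshift \<beta>" and x: "x \<in> tangent_union" and B: "B \<in> sets tangent_space"
  shows "emeasure (tkernel \<beta> x) B = (\<Sum>J\<in>branches. ennreal (twt J x) * indicator B (tstep \<beta> J x))"
proof -
  have "emeasure (tkernel \<beta> x) B = (\<Sum>J\<in>{J \<in> branches. twt J x \<noteq> 0}. ennreal (twt J x) * indicator B (tstep \<beta> J x))"
    unfolding tkernel_def using finite_branches B tstep_in[OF \<beta> _ x]
    by (intro emeasure_dirac_mixture) (auto simp: space_tangent_space)
  also have "\<dots> = (\<Sum>J\<in>branches. ennreal (twt J x) * indicator B (tstep \<beta> J x))"
    using finite_branches by (intro sum.mono_neutral_left) auto
  finally show ?thesis .
qed

lemma Pgen_eq_sum: "Pgen \<beta> \<nu> s v = (\<Sum>J\<in>branches. twt J (s, v) * case_prod \<nu> (tstep \<beta> J (s, v)))"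
  unfolding Pgen_def sum_branches sum_divide_distrib
  by (intro sum.cong refl) (simp add: twt_def tstep_def)

lemma kernel_op_tkernel:
  assumes \<beta>: "tshift \<beta>" and s: "s \<in> Stab" "tang s v" and f: "f \<in> borel_measurable tangent_space"
  shows "kernel_op (tkernel \<beta>) f (s, v) = Pgen \<beta> (\<lambda>s v. f (s, v)) s v"
proof -
  have x: "(s, v) \<in> tangent_union" using s by (simp add: tangent_union_iff)
  have "kernel_op (tkernel \<beta>) f (s, v) = (\<Sum>J\<in>{J \<in> branches. twt J (s, v) \<noteq> 0}. twt J (s, v) * f (tstep \<beta> J (s, v)))"
    unfolding kernel_op_def tkernel_def
    using finite_branches tstep_in[OF \<beta> _ x] twt_nonneg f
    by (intro integral_dirac_mixture) (auto simp: space_tangent_space)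
  also have "\<dots> = (\<Sum>J\<in>branches. twt J (s, v) * f (tstep \<beta> J (s, v)))"
    using finite_branches by (intro sum.mono_neutral_left) auto
  finally show ?thesis by (simp add: Pgen_eq_sum)
qed

lemma kernel_op_affine: 
  "s \<in> Stab \<Longrightarrow> tang s v \<Longrightarrow> f \<in> borel_measurable tangent_space \<Longrightarrow>
    kernel_op (affine_kernel a q1 r) f (s, v) = Paff (\<lambda>s v. f (s, v)) s v"
  using kernel_op_tkernel[OF tshift_bsh] affine_kernel_eq by (simp add: kernel_op_def tangent_union_iff)

lemma kernel_op_linear: 
  "s \<in> Stab \<Longrightarrow> tang s v \<Longrightarrow> f \<in> borel_measurable tangent_space \<Longrightarrow>
    kernel_op (linear_kernel a q1 r) f (s, v) = Plin (\<lambda>s v. f (s, v)) s v"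
  using kernel_op_tkernel[OF tshift_0] linear_kernel_eq by (simp add: kernel_op_def tangent_union_iff)

section \<open>Monotonicity of the tangent kernels and the first moment of the invariant
  measure\<close>

lemma Pgen_cong:
  assumes \<beta>: "tshift \<beta>" and s: "s \<in> Stab" "tang s v"
    and eq: "\<And>s v. s \<in> Stab \<Longrightarrow> tang s v \<Longrightarrow> \<nu> s v = \<nu>' s v"
  shows "Pgen \<beta> \<nu> s v = Pgen \<beta> \<nu>' s v"
proof -
  have "wt C m s * \<nu> (post C m s) (Alin C m s v + \<beta> C m s) = wt C m s * \<nu>' (post C m s) (Alin C m s v + \<beta> C m s)"
    if "C \<in> Cl" for C m
    using that s by (cases "wt C m s = 0") (auto intro!: eq post_Stab tang_step[OF \<beta>])
  then show ?thesis unfolding Pgen_def by (intro arg_cong2[where f = "(/)"] sum.cong refl) blast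
qed

lemma Pgen_mono:
  assumes \<beta>: "tshift \<beta>" and s: "s \<in> Stab" "tang s v"
    and le: "\<And>s v. s \<in> Stab \<Longrightarrow> tang s v \<Longrightarrow> \<nu> s v \<le> \<nu>' s v"
  shows "Pgen \<beta> \<nu> s v \<le> Pgen \<beta> \<nu>' s v"
proof -
  have "wt C m s * \<nu> (post C m s) (Alin C m s v + \<beta> C m s) \<le> wt C m s * \<nu>' (post C m s) (Alin C m s v + \<beta> C m s)"
    if "C \<in> Cl" for C m
    using that s by (cases "wt C m s = 0") (auto intro!: mult_left_mono wt_nonneg le post_Stab tang_step[OF \<beta>])
  then show ?thesis unfolding Pgen_def using Nc_pos by (intro divide_right_mono sum_mono) auto
qed

lemma Pgen_const: "s \<in> Stab \<Longrightarrow> Pgen \<beta> (\<lambda>_ _. c) s v = c"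
proof -
  assume s: "s \<in> Stab"
  have "(\<Sum>C\<in>Cl. \<Sum>m\<in>UNIV. wt C m s * c) = (\<Sum>C\<in>Cl. c)"
    by (intro sum.cong refl) (simp add: sum_distrib_right[symmetric] wt_sum[OF _ s])
  also have "\<dots> = Nc * c" by (simp add: Nc_def)
  finally show ?thesis using Nc_pos by (simp add: Pgen_def)
qed

lemma lips_norm: "lips 1 (\<lambda>_. norm)"
  by (simp add: lips_def norm_triangle_ineq3)

text \<open>The Lyapunov drift on the tangent spaces: the norm has Lipschitz constant 1, so its
  image has constant \<open>rate\<close>, and \<open>b\<close> is the largest value at the origins
  of the finitely many sheets.\<close>

lemma Paff_norm: "\<exists>b\<ge>0. \<forall>s v. s \<in> Stab \<and> tang s v \<longrightarrow> Paff (\<lambda>_. norm) s v \<le> rate * norm v + b"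
proof -
  define b where "b = Max ((\<lambda>s. \<bar>Paff (\<lambda>_. norm) s 0\<bar>) ` Stab)"
  have b: "\<bar>Paff (\<lambda>_. norm) s 0\<bar> \<le> b" if "s \<in> Stab" for s
    unfolding b_def using Stab_finite that by (intro Max_ge) auto
  obtain s0 where "s0 \<in> Stab" using Stab_nonempty by blast
  then have "b \<ge> 0" using b[of s0] by linarith
  moreover have "Paff (\<lambda>_. norm) s v \<le> rate * norm v + b" if s: "s \<in> Stab" "tang s v" for s v
    using lipsD[OF lips_Pgen[OF lips_norm tshift_bsh] s(1) s(2) tang_simps(1)] b[OF s(1)] by simp
  ultimately show ?thesis by blast
qed

context
  fixes \<mu> :: "('n, 'p) tangent_point measure"
  assumes inv: "invariant_prob tangent_space (affine_kernel a q1 r) \<mu>"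
begin

lemma sets_mu: "sets \<mu> = sets tangent_space" and prob_mu: "prob_space \<mu>" and space_mu: "space \<mu> = tangent_union"
  using inv sets_eq_imp_space_eq[of \<mu> tangent_space] unfolding invariant_prob_def by (auto simp: space_tangent_space)

lemma measurable_mu: "f \<in> borel_measurable \<mu> \<longleftrightarrow> f \<in> borel_measurable tangent_space"
  by (simp add: measurable_cong_sets[OF sets_mu refl])

lemma invariant_Paff:
  assumes m: "case_prod \<nu> \<in> borel_measurable tangent_space" and n: "\<And>s v. s \<in> Stab \<Longrightarrow> tang s v \<Longrightarrow> \<nu> s v \<ge> 0"
  shows "case_prod (Paff \<nu>) \<in> borel_measurable \<mu>"
    "integrable \<mu> (case_prod \<nu>) \<longleftrightarrow> integrable \<mu> (case_prod (Paff \<nu>))"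
    "integral\<^sup>L \<mu> (case_prod (Paff \<nu>)) = integral\<^sup>L \<mu> (case_prod \<nu>)"
proof -
  have w0: "\<And>J x. J \<in> branches \<Longrightarrow> x \<in> space tangent_space \<Longrightarrow> twt J x \<ge> 0" by (rule twt_nonneg)
  have P: "emeasure (affine_kernel a q1 r x) B = (\<Sum>J\<in>branches. ennreal (twt J x) * indicator B (tstep bsh J x))"
    if "x \<in> space tangent_space" "B \<in> sets tangent_space" for x B
    using emeasure_tkernel[OF tshift_bsh _ that(2)] that(1) by (simp add: space_tangent_space affine_kernel_eq)
  have f0: "case_prod \<nu> x \<ge> 0" if "x \<in> space tangent_space" for x
    using that n by (cases x) (simp add: space_tangent_space tangent_union_iff)
  have g: "case_prod (Paff \<nu>) x = (\<Sum>J\<in>branches. twt J x * case_prod \<nu> (tstep bsh J x))" for x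
    by (cases x) (simp add: Pgen_eq_sum)
  note i = invariant_integral[OF inv finite_branches measurable_twt measurable_tstep[OF tshift_bsh] w0 P m f0 g]
  show "case_prod (Paff \<nu>) \<in> borel_measurable \<mu>"
    "integrable \<mu> (case_prod \<nu>) \<longleftrightarrow> integrable \<mu> (case_prod (Paff \<nu>))"
    "integral\<^sup>L \<mu> (case_prod (Paff \<nu>)) = integral\<^sup>L \<mu> (case_prod \<nu>)"
    by (rule i; assumption)+
qed

lemma integrable_bounded:
  fixes \<nu> :: "('n, 'p) idx cmat \<Rightarrow> ('n, 'p) idx cvec \<Rightarrow> real"
  assumes "case_prod \<nu> \<in> borel_measurable tangent_space" "\<And>s v. s \<in> Stab \<Longrightarrow> tang s v \<Longrightarrow> \<bar>\<nu> s v\<bar> \<le> B"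
  shows "integrable \<mu> (case_prod \<nu>)"
proof -
  interpret prob_space \<mu> by (rule prob_mu)
  show ?thesis using assms(2)
    by (intro integrable_const_bound[where B = B] AE_I2) (auto simp: measurable_mu assms(1) space_mu tangent_union_iff)
qed

text \<open>One application of the affine kernel to the truncated norm already bounds the first moment.\<close>

lemma integrable_norm: "integrable \<mu> (\<lambda>(s, v). norm v)"
proof -
  interpret prob_space \<mu> by (rule prob_mu)
  obtain b where b: "b \<ge> 0" and Pb: "\<And>s v. s \<in> Stab \<Longrightarrow> tang s v \<Longrightarrow> Paff (\<lambda>_. norm) s v \<le> rate * norm v + b"
    using Paff_norm by blast
  have nm: "(\<lambda>(s, v). norm v) \<in> borel_measurable (tangent_space :: ('n, 'p) tangent_point measure)"
    using lips_measurable[OF lips_norm] by simp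
  have trunc_lips: "lips 1 (\<lambda>_ v. min (norm v) k)" for k
    unfolding lips_def
  proof (intro conjI ballI allI impI)
    fix v w :: "('n, 'p) idx cvec"
    have "\<bar>norm v - norm w\<bar> \<le> norm (v - w)" by (rule norm_triangle_ineq3)
    then show "\<bar>min (norm v) k - min (norm w) k\<bar> \<le> 1 * norm (v - w)" by (simp add: min_def abs_if split: if_splits)
  qed simp
  have "(\<integral>x. (case x of (s, v) \<Rightarrow> if norm v \<le> k then norm v else 0) \<partial>\<mu>) \<le> b / (1 - rate)
      \<and> integrable \<mu> (\<lambda>(s, v). if norm v \<le> k then norm v else 0)" if k: "k \<ge> 0" for k
  proof
    let ?\<phi> = "\<lambda>(_ :: ('n, 'p) idx cmat) (v :: ('n, 'p) idx cvec). min (norm v) k"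
    let ?c = "\<lambda>(s :: ('n, 'p) idx cmat, v :: ('n, 'p) idx cvec). if norm v \<le> k then norm v else 0"
    have \<phi>m: "case_prod ?\<phi> \<in> borel_measurable tangent_space" by (rule lips_measurable[OF trunc_lips])
    have cm: "?c \<in> borel_measurable tangent_space"
    proof -
      have "(\<lambda>x. if (case x of (s, v) \<Rightarrow> norm v) \<le> k then (case x of (s, v) \<Rightarrow> norm v) else 0)
          \<in> borel_measurable (tangent_space :: ('n, 'p) tangent_point measure)" using nm by measurable
      then show ?thesis by (simp add: case_prod_beta cong: if_cong)
    qed
    show ci: "integrable \<mu> ?c" using integrable_bounded[OF cm, of k] k by auto
    have \<phi>i: "integrable \<mu> (case_prod ?\<phi>)" using integrable_bounded[OF \<phi>m, of k] k by auto
    have eq: "integral\<^sup>L \<mu> (case_prod (Paff ?\<phi>)) = integral\<^sup>L \<mu> (case_prod ?\<phi>)"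
      using k by (intro invariant_Paff(3)[OF \<phi>m]) simp
    have Pi: "integrable \<mu> (case_prod (Paff ?\<phi>))"
      using k \<phi>i by (subst invariant_Paff(2)[OF \<phi>m, symmetric]) auto
    \<comment> \<open>Up to length \<open>k\<close> the capped norm is the norm itself and the drift
      gives the bound. Beyond \<open>k\<close> the capped norm is \<open>k\<close>, its image is at
      most \<open>k\<close>, and \<open>?c\<close> is 0. By invariance the right-hand integral is 0,
      so the bound on the integral of \<open>?c\<close> is independent of \<open>k\<close>.\<close>
    have "(\<integral>x. (1 - rate) * ?c x - b \<partial>\<mu>) \<le> (\<integral>x. case_prod ?\<phi> x - case_prod (Paff ?\<phi>) x \<partial>\<mu>)"
    proof (rule integral_mono)
      show "integrable \<mu> (\<lambda>x. (1 - rate) * ?c x - b)" using ci by simp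
      show "integrable \<mu> (\<lambda>x. case_prod ?\<phi> x - case_prod (Paff ?\<phi>) x)" by (rule Bochner_Integration.integrable_diff[OF \<phi>i Pi])
      fix x assume "x \<in> space \<mu>"
      then obtain s v where x: "x = (s, v)" and s: "s \<in> Stab" "tang s v" by (cases x) (auto simp: space_mu tangent_union_iff)
      have 1: "Paff ?\<phi> s v \<le> rate * norm v + b"
        by (rule order_trans[OF Pgen_mono[OF tshift_bsh s] Pb[OF s]]) simp
      have "Paff ?\<phi> s v \<le> Paff (\<lambda>_ _. k) s v" by (rule Pgen_mono[OF tshift_bsh s]) simp
      then have 2: "Paff ?\<phi> s v \<le> k" by (simp add: Pgen_const[OF s(1)])
      show "(1 - rate) * ?c x - b \<le> case_prod ?\<phi> x - case_prod (Paff ?\<phi>) x"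
        using 1 2 b by (simp add: x min_def left_diff_distrib)
    qed
    also have "\<dots> = 0" unfolding Bochner_Integration.integral_diff[OF \<phi>i Pi] eq by simp
    finally have "(1 - rate) * integral\<^sup>L \<mu> ?c \<le> b" using ci by (simp add: prob_space)
    then show "integral\<^sup>L \<mu> ?c \<le> b / (1 - rate)" using rate by (simp add: pos_le_divide_eq mult.commute)
  qed
  note tr = this
  show ?thesis
  proof (rule integrable_of_bounded_truncations)
    show "(\<lambda>(s, v). norm v) \<in> borel_measurable \<mu>" using nm by (simp add: measurable_mu)
    fix k :: nat
    have "(\<integral>\<^sup>+x. ennreal (if (case x of (s, v) \<Rightarrow> norm v) \<le> real k then (case x of (s, v) \<Rightarrow> norm v) else 0) \<partial>\<mu>)
        = (\<integral>\<^sup>+x. ennreal (case x of (s, v) \<Rightarrow> if norm v \<le> real k then norm v else 0) \<partial>\<mu>)"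
      by (intro nn_integral_cong) (simp add: case_prod_beta)
    also have "\<dots> = ennreal (\<integral>x. (case x of (s, v) \<Rightarrow> if norm v \<le> real k then norm v else 0) \<partial>\<mu>)"
      using tr[of "real k"] by (intro nn_integral_eq_integral) auto
    also have "\<dots> \<le> ennreal (b / (1 - rate))" using tr[of "real k"] by (intro ennreal_leI) auto
    finally show "(\<integral>\<^sup>+x. ennreal (if (case x of (s, v) \<Rightarrow> norm v) \<le> real k then (case x of (s, v) \<Rightarrow> norm v) else 0) \<partial>\<mu>)
      \<le> ennreal (b / (1 - rate))" .
  qed auto
qed

lemma integrable_lips:
  assumes L: "lips L \<nu>"
  shows "integrable \<mu> (case_prod \<nu>)"
proof -
  interpret prob_space \<mu> by (rule prob_mu)
  define b where "b = Max ((\<lambda>s. \<bar>\<nu> s 0\<bar>) ` Stab)"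
  have b: "\<bar>\<nu> s 0\<bar> \<le> b" if "s \<in> Stab" for s
    unfolding b_def using Stab_finite that by (intro Max_ge) auto
  have "integrable \<mu> (\<lambda>x. b + L * (case x of (s, v) \<Rightarrow> norm v))" using integrable_norm by simp
  then show ?thesis
  proof (rule Bochner_Integration.integrable_bound)
    show "case_prod \<nu> \<in> borel_measurable \<mu>" by (simp add: measurable_mu lips_measurable[OF L])
    show "AE x in \<mu>. norm (case_prod \<nu> x) \<le> norm (b + L * (case x of (s, v) \<Rightarrow> norm v))"
    proof (rule AE_I2)
      fix x assume "x \<in> space \<mu>"
      then obtain s v where x: "x = (s, v)" and s: "s \<in> Stab" "tang s v" by (cases x) (auto simp: space_mu tangent_union_iff)
      show "norm (case_prod \<nu> x) \<le> norm (b + L * (case x of (s, v) \<Rightarrow> norm v))"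
        using lipsD[OF L s tang_simps(1)] b[OF s(1)] by (simp add: x)
    qed
  qed
qed

end

end

section \<open>The potential and the right derivative\<close>

context charted
begin

abbreviation tnu :: "('n, 'p) idx cmat \<Rightarrow> ('n, 'p) idx cvec \<Rightarrow> real" where
  "tnu \<equiv> \<lambda>s. tmana (rep_vec s)"

definition qn :: "nat \<Rightarrow> ('n, 'p) idx cmat \<Rightarrow> ('n, 'p) idx cvec \<Rightarrow> real" where
  "qn n = (Plin ^^ n) tnu"

definition upot :: "('n, 'p) idx cmat \<Rightarrow> ('n, 'p) idx cvec \<Rightarrow> real" where
  "upot s v = (\<Sum>n. qn n s v)"

lemma qn_0: "qn 0 = tnu" and qn_Suc: "qn (Suc n) = Plin (qn n)"
  by (simp_all add: qn_def)

lemma lips_qn: "lips L tnu \<Longrightarrow> lips (rate ^ n * L) (qn n)"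
proof (induction n)
  case 0
  then show ?case by (simp add: qn_0)
next
  case (Suc n)
  have "lips (rate * (rate ^ n * L)) (Plin (qn n))" by (rule lips_Pgen[OF Suc.IH[OF Suc.prems] tshift_0])
  then show ?case by (simp add: qn_Suc mult.assoc)
qed

lemma Alin_0: "Alin C m s 0 = 0"
  using Alin_scaleR[of C m s 0 0] by simp

text \<open>The linear kernel moves origins to origins, where the tangent mana vanishes. With the
  contracted Lipschitz constants this yields the geometric decay that makes the potential
  converge.\<close>

lemma qn_at_0: "s \<in> Stab \<Longrightarrow> qn n s 0 = 0"
proof (induction n arbitrary: s)
  case 0
  then show ?case by (simp add: qn_0 tmana_0)
next
  case (Suc n)
  have "wt C m s * qn n (post C m s) (Alin C m s 0 + 0) = 0" if "C \<in> Cl" for C m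
    using Suc.IH[OF post_Stab[OF that Suc.prems]] by (cases "wt C m s = 0") (simp_all add: Alin_0)
  then have "(\<Sum>C\<in>Cl. \<Sum>m\<in>UNIV. wt C m s * qn n (post C m s) (Alin C m s 0 + 0)) = 0"
    by (intro sum.neutral ballI)
  then show ?case unfolding qn_Suc Pgen_def by simp
qed

lemma qn_nonneg: "s \<in> Stab \<Longrightarrow> tang s v \<Longrightarrow> qn n s v \<ge> 0"
proof (induction n arbitrary: s v)
  case 0
  then show ?case unfolding qn_0 tang_def by (intro tmana_nonneg stab_vec_rep_vec)
next
  case (Suc n)
  have "Plin (\<lambda>_ _. 0) s v \<le> Plin (qn n) s v" by (rule Pgen_mono[OF tshift_0 Suc.prems]) (rule Suc.IH)
  then show ?case using Suc.prems by (simp add: qn_Suc Pgen_const)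
qed

lemma qn_le: "lips L tnu \<Longrightarrow> s \<in> Stab \<Longrightarrow> tang s v \<Longrightarrow> \<bar>qn n s v\<bar> \<le> rate ^ n * (L * norm v)"
  using lipsD[OF lips_qn _ _ tang_simps(1), of L s v n] by (simp add: qn_at_0 mult.assoc)

lemma summable_geo: "summable (\<lambda>n. rate ^ n * c)" and suminf_geo: "(\<Sum>n. rate ^ n * c) = c / (1 - rate)"
  using rate summable_geometric[of rate] suminf_geometric[of rate]
  by (simp_all add: suminf_mult2[symmetric] summable_mult2)

lemma summable_qn: "s \<in> Stab \<Longrightarrow> tang s v \<Longrightarrow> summable (\<lambda>n. qn n s v)"
proof -
  assume s: "s \<in> Stab" "tang s v"
  obtain L where L: "lips L tnu" using tmana_lips by blast
  show ?thesis
    by (rule summable_comparison_test'[OF summable_geo[of "L * norm v"], of 0]) (use qn_le[OF L s] in simp)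
qed

lemma lips_upot: "\<exists>L. lips L upot"
proof -
  obtain L where L: "lips L tnu" using tmana_lips by blast
  have L0: "L \<ge> 0" using L by (simp add: lips_def)
  have "lips (L / (1 - rate)) upot"
    unfolding lips_def
  proof (intro conjI ballI allI impI)
    show "L / (1 - rate) \<ge> 0" using L0 rate by simp
    fix s v w assume s: "s \<in> Stab" and "tang s v \<and> tang s w"
    then have v: "tang s v" and w: "tang s w" by auto
    have le: "\<bar>qn n s v - qn n s w\<bar> \<le> rate ^ n * (L * norm (v - w))" for n
      using lipsD[OF lips_qn[OF L] s v w] by (simp add: mult.assoc)
    have sa: "summable (\<lambda>n. \<bar>qn n s v - qn n s w\<bar>)"
      by (rule summable_comparison_test'[OF summable_geo[of "L * norm (v - w)"], of 0]) (use le in simp)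
    have "upot s v - upot s w = (\<Sum>n. qn n s v - qn n s w)"
      unfolding upot_def using summable_qn s v w by (simp add: suminf_diff)
    then have "\<bar>upot s v - upot s w\<bar> \<le> (\<Sum>n. \<bar>qn n s v - qn n s w\<bar>)" using summable_rabs[OF sa] by simp
    also have "\<dots> \<le> (\<Sum>n. rate ^ n * (L * norm (v - w)))" by (rule suminf_le[OF le sa summable_geo])
    also have "\<dots> = L / (1 - rate) * norm (v - w)" by (simp add: suminf_geo)
    finally show "\<bar>upot s v - upot s w\<bar> \<le> L / (1 - rate) * norm (v - w)" .
  qed
  then show ?thesis by blast
qed

lemma upot_nonneg: "s \<in> Stab \<Longrightarrow> tang s v \<Longrightarrow> upot s v \<ge> 0"
  unfolding upot_def by (intro suminf_nonneg summable_qn) (auto intro: qn_nonneg)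

text \<open>The Poisson equation of the linear kernel: applying it termwise removes the zeroth term
  of the series.\<close>

lemma Plin_upot:
  assumes s: "s \<in> Stab" "tang s v"
  shows "Plin upot s v = upot s v - tnu s v"
proof -
  have "(\<lambda>n. wt C m s * qn n (post C m s) (Alin C m s v + 0)) sums (wt C m s * upot (post C m s) (Alin C m s v + 0))"
    if C: "C \<in> Cl" for C m
  proof (cases "wt C m s = 0")
    case False
    have "tang (post C m s) (Alin C m s v + 0)" by (rule tang_step[OF tshift_0 C s(1) False])
    then show ?thesis unfolding upot_def
      by (intro sums_mult summable_sums summable_qn post_Stab[OF C s(1) False])
  qed simp
  then have "(\<lambda>n. (\<Sum>C\<in>Cl. \<Sum>m\<in>UNIV. wt C m s * qn n (post C m s) (Alin C m s v + 0)) / Nc) sums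
      ((\<Sum>C\<in>Cl. \<Sum>m\<in>UNIV. wt C m s * upot (post C m s) (Alin C m s v + 0)) / Nc)"
    by (intro sums_divide sums_sum)
  then have "(\<lambda>n. qn (Suc n) s v) sums Plin upot s v" unfolding qn_Suc Pgen_def .
  moreover have "(\<lambda>n. qn (Suc n) s v) sums (upot s v - qn 0 s v)"
    unfolding upot_def using summable_sums[OF summable_qn[OF s]]
    by (subst sums_Suc_iff[of "\<lambda>n. qn n s v"]) simp
  ultimately show ?thesis using sums_unique2 qn_0 by metis
qed

text \<open>The identification with \<open>qn\<close> and the measurability go together: evaluating
  the next power needs the previous one measurable, which follows because it agrees with a Lipschitz
  function on the tangent union.\<close>

lemma kernel_op_linear_power:
  "(\<forall>s v. s \<in> Stab \<and> tang s v \<longrightarrow> (kernel_op (linear_kernel a q1 r) ^^ n) tangent_mana (s, v) = qn n s v)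
    \<and> (kernel_op (linear_kernel a q1 r) ^^ n) tangent_mana \<in> borel_measurable tangent_space"
proof -
  obtain L where L: "lips L tnu" using tmana_lips by blast
  let ?F = "\<lambda>n. (kernel_op (linear_kernel a q1 r) ^^ n) tangent_mana"
  have m: "?F n \<in> borel_measurable tangent_space"
    if "\<And>s v. s \<in> Stab \<Longrightarrow> tang s v \<Longrightarrow> ?F n (s, v) = qn n s v" for n
  proof -
    have "?F n x = case_prod (qn n) x" if "x \<in> space tangent_space" for x
      using that \<open>\<And>s v. s \<in> Stab \<Longrightarrow> tang s v \<Longrightarrow> ?F n (s, v) = qn n s v\<close>
      by (cases x) (simp add: space_tangent_space tangent_union_iff)
    then show ?thesis using lips_measurable[OF lips_qn[OF L]] measurable_cong by blast
  qed
  have "?F n (s, v) = qn n s v" if "s \<in> Stab" "tang s v" for s v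
    using that
  proof (induction n arbitrary: s v)
    case 0
    then show ?case by (simp add: qn_0 tangent_mana_eq)
  next
    case (Suc n)
    have "?F (Suc n) (s, v) = Plin (\<lambda>s v. ?F n (s, v)) s v"
      using kernel_op_linear[OF Suc.prems m[OF Suc.IH]] by simp
    also have "\<dots> = qn (Suc n) s v" unfolding qn_Suc by (rule Pgen_cong[OF tshift_0 Suc.prems Suc.IH])
    finally show ?case .
  qed
  then show ?thesis using m by blast
qed

lemma mana_potential_eq: "s \<in> Stab \<Longrightarrow> tang s v \<Longrightarrow> mana_potential a q1 r (s, v) = upot s v"
  unfolding mana_potential_def upot_def using kernel_op_linear_power by simp

text \<open>By the Poisson equation the source is the tangent mana plus
  \<open>Paff upot - upot\<close>. The latter has mean 0 under the invariant measure, which is why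
  the two integrals of the theorem agree.\<close>

lemma mana_source_eq:
  assumes s: "s \<in> Stab" "tang s v"
  shows "mana_source a q1 r (s, v) = Paff upot s v - (upot s v - tnu s v)"
proof -
  obtain L where L: "lips L upot" using lips_upot by blast
  have "mana_potential a q1 r x = case_prod upot x" if "x \<in> space tangent_space" for x
    using that mana_potential_eq by (cases x) (simp add: space_tangent_space tangent_union_iff)
  then have m: "mana_potential a q1 r \<in> borel_measurable tangent_space"
    using lips_measurable[OF L] measurable_cong by blast
  show ?thesis
    unfolding mana_source_def kernel_op_affine[OF s m] kernel_op_linear[OF s m] Plin_upot[OF s, symmetric]
    using Pgen_cong[OF tshift_bsh s mana_potential_eq] Pgen_cong[OF tshift_0 s mana_potential_eq] by simp
qed

lemma nu_nonneg: "s \<in> Stab \<Longrightarrow> tang s v \<Longrightarrow> nu n s v \<ge> 0"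
proof (induction n arbitrary: s v)
  case 0
  then show ?case unfolding nu_def tang_def by (simp add: tmana_nonneg stab_vec_rep_vec)
next
  case (Suc n)
  have "Paff (\<lambda>_ _. 0) s v \<le> Paff (nu n) s v" by (rule Pgen_mono[OF tshift_bsh Suc.prems]) (rule Suc.IH)
  then show ?case using Suc.prems by (simp add: nu_def Pgen_const)
qed

section \<open>Integrals against the invariant tangent measure\<close>

context
  fixes \<mu> :: "('n, 'p) tangent_point measure"
  assumes inv: "invariant_prob tangent_space (affine_kernel a q1 r) \<mu>"
begin

lemma integrals_tangent:
  "integrable \<mu> tangent_mana" "integral\<^sup>L \<mu> tangent_mana = integral\<^sup>L \<mu> (case_prod tnu)"
  "integrable \<mu> (mana_source a q1 r)" "integral\<^sup>L \<mu> (mana_source a q1 r) = integral\<^sup>L \<mu> (case_prod tnu)"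
proof -
  obtain L where L: "lips L tnu" using tmana_lips by blast
  obtain L' where L': "lips L' upot" using lips_upot by blast
  have ti: "integrable \<mu> (case_prod tnu)" and ui: "integrable \<mu> (case_prod upot)"
    using integrable_lips[OF inv] L L' by blast+
  have t: "tangent_mana x = case_prod tnu x" if "x \<in> space \<mu>" for x
    using that by (cases x) (simp add: space_mu[OF inv] tangent_union_iff tangent_mana_eq)
  show "integrable \<mu> tangent_mana" using ti by (subst Bochner_Integration.integrable_cong[OF refl t]) auto
  show "integral\<^sup>L \<mu> tangent_mana = integral\<^sup>L \<mu> (case_prod tnu)" by (rule Bochner_Integration.integral_cong[OF refl t])
  note P = invariant_Paff[OF inv lips_measurable[OF L'] upot_nonneg]
  have Pi: "integrable \<mu> (case_prod (Paff upot))" using P(2) ui by blast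
  have src: "mana_source a q1 r x = case_prod (Paff upot) x - (case_prod upot x - case_prod tnu x)" if "x \<in> space \<mu>" for x
    using that by (cases x) (simp add: space_mu[OF inv] tangent_union_iff mana_source_eq)
  note d1 = Bochner_Integration.integrable_diff[OF ui ti]
  note d = Bochner_Integration.integrable_diff[OF Pi d1]
  show "integrable \<mu> (mana_source a q1 r)" using d by (subst Bochner_Integration.integrable_cong[OF refl src]) auto
  have "integral\<^sup>L \<mu> (mana_source a q1 r) = (\<integral>x. case_prod (Paff upot) x - (case_prod upot x - case_prod tnu x) \<partial>\<mu>)"
    by (rule Bochner_Integration.integral_cong[OF refl src])
  also have "\<dots> = integral\<^sup>L \<mu> (case_prod tnu)"
    unfolding Bochner_Integration.integral_diff[OF Pi d1] Bochner_Integration.integral_diff[OF ui ti] using P(3) by simp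
  finally show "integral\<^sup>L \<mu> (mana_source a q1 r) = integral\<^sup>L \<mu> (case_prod tnu)" .
qed

text \<open>By invariance all \<open>nu n\<close> have the same integral, and on each sheet
  \<open>nu n\<close> differs from its value at the origin, common to all sheets, by at most its
  contracted Lipschitz constant times the norm.\<close>

lemma nu_converges:
  assumes L: "lips L tnu" and s0: "s0 \<in> Stab"
  shows "\<bar>integral\<^sup>L \<mu> (case_prod tnu) - nu n s0 0\<bar> \<le> rate ^ n * L * (\<integral>x. (case x of (s, v) \<Rightarrow> norm v) \<partial>\<mu>)"
proof -
  interpret prob_space \<mu> by (rule prob_mu[OF inv])
  have ni: "integrable \<mu> (case_prod (nu n))" for n by (rule integrable_lips[OF inv nu_lips[OF L]])
  have "integral\<^sup>L \<mu> (case_prod (nu n)) = integral\<^sup>L \<mu> (case_prod tnu)"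
  proof (induction n)
    case (Suc n)
    have "nu (Suc n) = Paff (nu n)" by (simp add: nu_def)
    then show ?case using invariant_Paff(3)[OF inv lips_measurable[OF nu_lips[OF L]] nu_nonneg, of n] Suc by simp
  qed (simp add: nu_def)
  then have "integral\<^sup>L \<mu> (case_prod tnu) - nu n s0 0 = (\<integral>x. case_prod (nu n) x - nu n s0 0 \<partial>\<mu>)"
    using ni[of n] by (simp add: prob_space)
  also have "\<bar>\<dots>\<bar> \<le> (\<integral>x. \<bar>case_prod (nu n) x - nu n s0 0\<bar> \<partial>\<mu>)" by (rule integral_abs_bound)
  also have "\<dots> \<le> (\<integral>x. rate ^ n * L * (case x of (s, v) \<Rightarrow> norm v) \<partial>\<mu>)"
  proof (rule integral_mono)
    show "integrable \<mu> (\<lambda>x. \<bar>case_prod (nu n) x - nu n s0 0\<bar>)" using ni[of n] by (intro integrable_abs Bochner_Integration.integrable_diff) auto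
    show "integrable \<mu> (\<lambda>x. rate ^ n * L * (case x of (s, v) \<Rightarrow> norm v))"
      by (rule integrable_mult_right[OF integrable_norm[OF inv]])
    fix x assume "x \<in> space \<mu>"
    then obtain s v where x: "x = (s, v)" and s: "s \<in> Stab" "tang s v" by (cases x) (auto simp: space_mu[OF inv] tangent_union_iff)
    show "\<bar>case_prod (nu n) x - nu n s0 0\<bar> \<le> rate ^ n * L * (case x of (s, v) \<Rightarrow> norm v)"
      using lipsD[OF nu_lips[OF L] s tang_simps(1), of n] nu_0_const[OF s0 s(1), of n] by (simp add: x)
  qed
  also have "\<dots> = rate ^ n * L * (\<integral>x. (case x of (s, v) \<Rightarrow> norm v) \<partial>\<mu>)" by (rule integral_mult_right_zero)
  finally show ?thesis .
qed

end

lemma rmeas_bounded_integrable: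
  assumes inv: "invariant_prob ray_space P \<mu>" and f: "rmeas f" and b: "\<And>y. f y \<le> M * (norm y)\<^sup>2"
  shows "integrable \<mu> (\<lambda>\<rho>. f (rep_vec \<rho>))"
proof -
  have pr: "prob_space \<mu>" and s: "sets \<mu> = sets ray_space" using inv by (auto simp: invariant_prob_def)
  interpret prob_space \<mu> by (rule pr)
  have sp: "space \<mu> = rays" using sets_eq_imp_space_eq[OF s] by (simp add: space_ray_space)
  have f0: "\<And>y. f y \<ge> 0" using f by (simp add: rmeas_def)
  show ?thesis
  proof (rule integrable_const_bound[where B = M])
    show "AE \<rho> in \<mu>. norm (f (rep_vec \<rho>)) \<le> M"
    proof (rule AE_I2)
      fix \<rho> assume "\<rho> \<in> space \<mu>"
      then show "norm (f (rep_vec \<rho>)) \<le> M" using b[of "rep_vec \<rho>"] f0 by (simp add: sp rays_rep_vec(1))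
    qed
    show "(\<lambda>\<rho>. f (rep_vec \<rho>)) \<in> borel_measurable \<mu>" using f by (simp add: rmeas_def measurable_cong_sets[OF s refl])
  qed
qed

section \<open>Stationary means on the space of rays\<close>

context
  fixes \<pi> :: "real \<Rightarrow> ('n, 'p) idx cmat measure"
  assumes ray_inv: "\<And>\<theta>. \<theta> \<in> {0..1} \<Longrightarrow> invariant_prob ray_space (ray_kernel a q1 \<theta>) (\<pi> \<theta>)"
begin

lemma space_pi: "\<theta> \<in> {0..1} \<Longrightarrow> space (\<pi> \<theta>) = rays"
  using ray_inv[of \<theta>] sets_eq_imp_space_eq[of "\<pi> \<theta>" ray_space] by (simp add: invariant_prob_def space_ray_space)

lemma stationary_mana_fiter:
  assumes \<theta>: "\<theta> \<in> {0..1}"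
  shows "(\<integral>\<rho>. fiter n \<theta> (rep_vec \<rho>) \<partial>(\<pi> \<theta>)) = stationary_mana \<pi> \<theta>"
proof (induction n)
  case 0
  show ?case unfolding stationary_mana_def
    by (intro Bochner_Integration.integral_cong refl) (simp add: fiter_def mana_rep_vec space_pi[OF \<theta>])
next
  case (Suc n)
  then show ?case unfolding fiter_Suc using invariant_avg[OF ray_inv[OF \<theta>] rmeas_fiter[of n \<theta>]] by simp
qed

lemma integrable_hfun: "\<theta> \<in> {0..1} \<Longrightarrow> integrable (\<pi> \<theta>) (\<lambda>\<rho>. hfun (rep_vec \<rho>))"
  by (rule rmeas_bounded_integrable[OF ray_inv rmeas_hfun, where M = 1]) (auto simp: hfun_le_norm)

text \<open>Integrate the drift of \<open>avg_hfun\<close>: by invariance the mean of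
  \<open>hfun\<close> appears on both sides, and \<open>rate < 1\<close> allows it to be
  absorbed.\<close>

lemma stationary_hfun: "\<exists>c\<ge>0. \<forall>\<theta>\<in>{0..1}. (\<integral>\<rho>. hfun (rep_vec \<rho>) \<partial>(\<pi> \<theta>)) \<le> c * \<theta>"
proof -
  obtain B where B: "B \<ge> 0" "\<And>\<theta> (y :: ('n, 'p) idx cvec). 0 \<le> \<theta> \<Longrightarrow> \<theta> \<le> 1 \<Longrightarrow>
    avg a q1 \<theta> hfun y \<le> rate * hfun y + B * \<theta> * (norm y)\<^sup>2" using avg_hfun by blast
  have "(\<integral>\<rho>. hfun (rep_vec \<rho>) \<partial>(\<pi> \<theta>)) \<le> (B / (1 - rate)) * \<theta>" if \<theta>: "\<theta> \<in> {0..1}" for \<theta>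
  proof -
    interpret prob_space "\<pi> \<theta>" using ray_inv[OF \<theta>] by (simp add: invariant_prob_def)
    let ?H = "\<integral>\<rho>. hfun (rep_vec \<rho>) \<partial>(\<pi> \<theta>)"
    note hi = integrable_hfun[OF \<theta>]
    have "?H = (\<integral>\<rho>. avg a q1 \<theta> hfun (rep_vec \<rho>) \<partial>(\<pi> \<theta>))"
      by (rule invariant_avg[OF ray_inv[OF \<theta>] rmeas_hfun, symmetric])
    also have "\<dots> \<le> (\<integral>\<rho>. rate * hfun (rep_vec \<rho>) + B * \<theta> \<partial>(\<pi> \<theta>))"
    proof (rule integral_mono)
      have "avg a q1 \<theta> hfun y \<le> 1 * (norm y)\<^sup>2" for y :: "('n, 'p) idx cvec"
      proof -
        have "avg a q1 \<theta> hfun y \<le> avg a q1 \<theta> (\<lambda>y. (norm y)\<^sup>2) y" by (rule avg_mono) (rule hfun_le_norm)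
        then show ?thesis by (simp add: avg_norm)
      qed
      then show "integrable (\<pi> \<theta>) (\<lambda>\<rho>. avg a q1 \<theta> hfun (rep_vec \<rho>))"
        by (rule rmeas_bounded_integrable[OF ray_inv[OF \<theta>] rmeas_avg[OF rmeas_hfun]])
      show "integrable (\<pi> \<theta>) (\<lambda>\<rho>. rate * hfun (rep_vec \<rho>) + B * \<theta>)" using hi by simp
      fix \<rho> assume "\<rho> \<in> space (\<pi> \<theta>)"
      then have "norm (rep_vec \<rho>) = 1" using rays_rep_vec(1) space_pi[OF \<theta>] by blast
      then show "avg a q1 \<theta> hfun (rep_vec \<rho>) \<le> rate * hfun (rep_vec \<rho>) + B * \<theta>"
        using B(2)[of \<theta> "rep_vec \<rho>"] \<theta> by simp
    qed
    also have "\<dots> = rate * ?H + B * \<theta>" using hi by (simp add: prob_space)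
    finally have "?H * (1 - rate) \<le> B * \<theta>" by (simp add: algebra_simps)
    then show ?thesis using rate by (simp add: pos_le_divide_eq)
  qed
  then show ?thesis using B(1) rate by (intro exI[of _ "B / (1 - rate)"]) auto
qed

text \<open>At angle 0 the mean of \<open>hfun\<close> is 0, and \<open>hfun\<close> dominates the
  mana. So the difference quotient of the theorem is the stationary mana divided by
  \<theta>.\<close>

lemma stationary_mana_0: "stationary_mana \<pi> 0 = 0"
proof -
  obtain c where c: "\<And>\<theta>. \<theta> \<in> {0..1} \<Longrightarrow> (\<integral>\<rho>. hfun (rep_vec \<rho>) \<partial>(\<pi> \<theta>)) \<le> c * \<theta>" using stationary_hfun by blast
  obtain E where E: "E \<ge> 0" "\<And>y :: ('n, 'p) idx cvec. mfun y \<le> E * hfun y" using mfun_le_hfun by blast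
  have m: "(\<integral>\<rho>. mfun (rep_vec \<rho>) \<partial>(\<pi> 0)) = stationary_mana \<pi> 0"
    using stationary_mana_fiter[of 0 0] by (simp add: fiter_def)
  have mb: "mfun y \<le> E * (norm y)\<^sup>2" for y :: "('n, 'p) idx cvec"
    using E(2)[of y] mult_left_mono[OF hfun_le_norm E(1), of y] by linarith
  have z: "(0 :: real) \<in> {0..1}" by simp
  have "(\<integral>\<rho>. mfun (rep_vec \<rho>) \<partial>(\<pi> 0)) \<le> (\<integral>\<rho>. E * hfun (rep_vec \<rho>) \<partial>(\<pi> 0))"
    by (rule integral_mono[OF rmeas_bounded_integrable[OF ray_inv[OF z] rmeas_mfun mb] integrable_mult_right[OF integrable_hfun[OF z]] E(2)])
  also have "\<dots> = E * (\<integral>\<rho>. hfun (rep_vec \<rho>) \<partial>(\<pi> 0))" by simp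
  also have "\<dots> \<le> E * 0" using c[OF z] E(1) by (intro mult_left_mono) auto
  finally have "stationary_mana \<pi> 0 \<le> 0" unfolding m by simp
  moreover have "stationary_mana \<pi> 0 \<ge> 0" unfolding m[symmetric] by (intro integral_nonneg_AE AE_I2 mfun_nonneg)
  ultimately show ?thesis by simp
qed

text \<open>The mean of \<open>hfun\<close> is \<open>O(\<theta>)\<close>, so the terms of
  \<open>fiter_compare\<close> proportional to it survive division by \<theta> as constants. The
  order of the quantifiers matters: \<open>c\<close> serves all \<open>n\<close>, \<open>g\<close>
  serves all \<open>R\<close>, and only \<open>Q\<close> may depend on both.\<close>

lemma stationary_mana_approx:
  "\<exists>c\<ge>0. \<forall>n. \<exists>g\<ge>0. \<forall>R\<ge>1. \<exists>Q. \<forall>\<theta> s. 0 < \<theta> \<and> \<theta> \<le> 1 \<and> s \<in> Stab \<longrightarrow>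
    \<bar>stationary_mana \<pi> \<theta> / \<theta> - nu n s 0\<bar> \<le> c * rate ^ n + Q * \<theta> + g / R"
proof -
  obtain h where h: "h \<ge> 0" "\<And>\<theta>. \<theta> \<in> {0..1} \<Longrightarrow> (\<integral>\<rho>. hfun (rep_vec \<rho>) \<partial>(\<pi> \<theta>)) \<le> h * \<theta>"
    using stationary_hfun by blast
  obtain c where c: "c \<ge> 0" and cn: "\<And>n. \<exists>g\<ge>0. \<forall>R\<ge>1. \<exists>Q. \<forall>\<theta> y s. 0 < \<theta> \<and> \<theta> \<le> 1 \<and> norm y = 1 \<and> s \<in> Stab \<longrightarrow>
    \<bar>fiter n \<theta> y - \<theta> * nu n s 0\<bar> \<le> c * rate ^ n * hfun y + Q * \<theta>\<^sup>2 + g * hfun y / R"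
    using fiter_compare by blast
  obtain M where M: "\<And>n \<theta> y. \<bar>fiter n \<theta> y\<bar> \<le> M * (norm y)\<^sup>2" using fiter_bounded by blast
  have "\<exists>g\<ge>0. \<forall>R\<ge>1. \<exists>Q. \<forall>\<theta> s. 0 < \<theta> \<and> \<theta> \<le> 1 \<and> s \<in> Stab \<longrightarrow>
    \<bar>stationary_mana \<pi> \<theta> / \<theta> - nu n s 0\<bar> \<le> (c * h) * rate ^ n + Q * \<theta> + g / R" for n
  proof -
    obtain g where g: "g \<ge> 0" and gR: "\<And>R. R \<ge> 1 \<Longrightarrow> \<exists>Q. \<forall>\<theta> y s. 0 < \<theta> \<and> \<theta> \<le> 1 \<and> norm y = 1 \<and> s \<in> Stab \<longrightarrow>
      \<bar>fiter n \<theta> y - \<theta> * nu n s 0\<bar> \<le> c * rate ^ n * hfun y + Q * \<theta>\<^sup>2 + g * hfun y / R"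
      using cn[of n] by blast
    have "\<exists>Q. \<forall>\<theta> s. 0 < \<theta> \<and> \<theta> \<le> 1 \<and> s \<in> Stab \<longrightarrow>
      \<bar>stationary_mana \<pi> \<theta> / \<theta> - nu n s 0\<bar> \<le> (c * h) * rate ^ n + Q * \<theta> + (g * h) / R" if R: "R \<ge> 1" for R
    proof -
      obtain Q where Q: "\<And>\<theta> y s. 0 < \<theta> \<Longrightarrow> \<theta> \<le> 1 \<Longrightarrow> norm y = 1 \<Longrightarrow> s \<in> Stab \<Longrightarrow>
        \<bar>fiter n \<theta> y - \<theta> * nu n s 0\<bar> \<le> c * rate ^ n * hfun y + Q * \<theta>\<^sup>2 + g * hfun y / R"
        using gR[OF R] by blast
      have "\<bar>stationary_mana \<pi> \<theta> / \<theta> - nu n s 0\<bar> \<le> (c * h) * rate ^ n + Q * \<theta> + (g * h) / R"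
        if \<theta>: "0 < \<theta>" "\<theta> \<le> 1" and s: "s \<in> Stab" for \<theta> s
      proof -
        have \<theta>': "\<theta> \<in> {0..1}" using \<theta> by simp
        interpret prob_space "\<pi> \<theta>" using ray_inv[OF \<theta>'] by (simp add: invariant_prob_def)
        note hi = integrable_hfun[OF \<theta>']
        have fi: "integrable (\<pi> \<theta>) (\<lambda>\<rho>. fiter n \<theta> (rep_vec \<rho>))"
          using M by (intro rmeas_bounded_integrable[OF ray_inv[OF \<theta>'] rmeas_fiter, where M = M]) (metis abs_le_D1)
        let ?k = "c * rate ^ n + g / R"
        have k0: "?k \<ge> 0" using c g R rate by simp
        have "stationary_mana \<pi> \<theta> - \<theta> * nu n s 0 = (\<integral>\<rho>. fiter n \<theta> (rep_vec \<rho>) - \<theta> * nu n s 0 \<partial>(\<pi> \<theta>))"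
          using fi by (simp add: stationary_mana_fiter[OF \<theta>'] prob_space)
        also have "\<bar>\<dots>\<bar> \<le> (\<integral>\<rho>. \<bar>fiter n \<theta> (rep_vec \<rho>) - \<theta> * nu n s 0\<bar> \<partial>(\<pi> \<theta>))" by (rule integral_abs_bound)
        also have "\<dots> \<le> (\<integral>\<rho>. ?k * hfun (rep_vec \<rho>) + Q * \<theta>\<^sup>2 \<partial>(\<pi> \<theta>))"
        proof (rule integral_mono)
          show "integrable (\<pi> \<theta>) (\<lambda>\<rho>. \<bar>fiter n \<theta> (rep_vec \<rho>) - \<theta> * nu n s 0\<bar>)" using fi by simp
          show "integrable (\<pi> \<theta>) (\<lambda>\<rho>. ?k * hfun (rep_vec \<rho>) + Q * \<theta>\<^sup>2)" using hi by simp
          fix \<rho> assume "\<rho> \<in> space (\<pi> \<theta>)"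
          then have "norm (rep_vec \<rho>) = 1" using rays_rep_vec(1) space_pi[OF \<theta>'] by blast
          from Q[OF \<theta> this s] show "\<bar>fiter n \<theta> (rep_vec \<rho>) - \<theta> * nu n s 0\<bar> \<le> ?k * hfun (rep_vec \<rho>) + Q * \<theta>\<^sup>2"
            by (simp add: distrib_right)
        qed
        also have "\<dots> = ?k * (\<integral>\<rho>. hfun (rep_vec \<rho>) \<partial>(\<pi> \<theta>)) + Q * \<theta>\<^sup>2" using hi by (simp add: prob_space)
        also have "\<dots> \<le> ?k * (h * \<theta>) + Q * \<theta>\<^sup>2" using mult_left_mono[OF h(2)[OF \<theta>'] k0] by simp
        also have "\<dots> = \<theta> * ((c * h) * rate ^ n + Q * \<theta> + (g * h) / R)" by (simp add: algebra_simps power2_eq_square)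
        finally have *: "\<bar>stationary_mana \<pi> \<theta> - \<theta> * nu n s 0\<bar> \<le> \<theta> * ((c * h) * rate ^ n + Q * \<theta> + (g * h) / R)" .
        have "\<bar>stationary_mana \<pi> \<theta> / \<theta> - nu n s 0\<bar> = \<bar>stationary_mana \<pi> \<theta> - \<theta> * nu n s 0\<bar> / \<theta>"
        proof -
          have "stationary_mana \<pi> \<theta> / \<theta> - nu n s 0 = (stationary_mana \<pi> \<theta> - \<theta> * nu n s 0) / \<theta>"
            using \<theta> by (simp add: diff_divide_distrib)
          then show ?thesis using \<theta> by (simp add: abs_divide)
        qed
        also have "\<dots> \<le> (c * h) * rate ^ n + Q * \<theta> + (g * h) / R"
          using * \<theta> by (simp only: pos_divide_le_eq mult.commute[of \<theta>])
        finally show ?thesis .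
      qed
      then show ?thesis by blast
    qed
    moreover have "g * h \<ge> 0" using g h(1) by simp
    ultimately show ?thesis by (intro exI[of _ "g * h"]) blast
  qed
  moreover have "c * h \<ge> 0" using c h(1) by simp
  ultimately show ?thesis by blast
qed

text \<open>Choose first \<open>n\<close>, then \<open>R\<close>, then the range of \<theta>, each
  costing a quarter of \<open>e\<close>. The constants still free at each stage are fixed before the
  next choice.\<close>

lemma stationary_mana_derivative:
  assumes inv: "invariant_prob tangent_space (affine_kernel a q1 r) \<mu>"
  shows "((\<lambda>\<theta>. stationary_mana \<pi> \<theta> / \<theta>) \<longlongrightarrow> integral\<^sup>L \<mu> (case_prod tnu)) (at_right 0)"
proof (rule tendstoI)
  fix e :: real assume e: "e > 0"
  let ?\<kappa> = "integral\<^sup>L \<mu> (case_prod tnu)"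
  obtain L where L: "lips L tnu" using tmana_lips by blast
  have L0: "L \<ge> 0" using L by (simp add: lips_def)
  obtain s0 where s0: "s0 \<in> Stab" using Stab_nonempty by blast
  define m1 where "m1 = (\<integral>x. (case x of (s :: ('n, 'p) idx cmat, v :: ('n, 'p) idx cvec) \<Rightarrow> norm v) \<partial>\<mu>)"
  have m1: "m1 \<ge> 0" unfolding m1_def by (intro integral_nonneg_AE AE_I2) auto
  obtain c where c: "c \<ge> 0" and cn: "\<And>n. \<exists>g\<ge>0. \<forall>R\<ge>1. \<exists>Q. \<forall>\<theta> s. 0 < \<theta> \<and> \<theta> \<le> 1 \<and> s \<in> Stab \<longrightarrow>
    \<bar>stationary_mana \<pi> \<theta> / \<theta> - nu n s 0\<bar> \<le> c * rate ^ n + Q * \<theta> + g / R"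
    using stationary_mana_approx by blast
  \<comment> \<open>Joins the two errors that decay with \<open>n\<close>: the comparison with
    \<open>nu n s0 0\<close>, and the distance of that number from the integral of the tangent
    mana.\<close>
  define A where "A = c + L * m1"
  have A: "A \<ge> 0" using c L0 m1 by (simp add: A_def)
  obtain n where n: "rate ^ n < e / (4 * (A + 1))" using real_arch_pow_inv[of "e / (4 * (A + 1))" rate] e A rate by auto
  have "(A + 1) * rate ^ n \<le> (A + 1) * (e / (4 * (A + 1)))" using n A by (intro mult_left_mono) auto
  also have "\<dots> = e / 4" using A by (simp add: field_simps)
  finally have "A * rate ^ n + rate ^ n \<le> e / 4" by (simp add: distrib_right)
  moreover have "rate ^ n \<ge> 0" using rate by simp
  ultimately have An: "A * rate ^ n \<le> e / 4" by linarith
  obtain g where g: "g \<ge> 0" and gR: "\<And>R. R \<ge> 1 \<Longrightarrow> \<exists>Q. \<forall>\<theta> s. 0 < \<theta> \<and> \<theta> \<le> 1 \<and> s \<in> Stab \<longrightarrow>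
    \<bar>stationary_mana \<pi> \<theta> / \<theta> - nu n s 0\<bar> \<le> c * rate ^ n + Q * \<theta> + g / R"
    using cn[of n] by blast
  define R where "R = 1 + 4 * g / e"
  have R: "R \<ge> 1" using g e by (simp add: R_def)
  have gRe: "g / R \<le> e / 4" using g e R by (simp add: R_def field_simps)
  obtain Q where Q: "\<And>\<theta>. 0 < \<theta> \<Longrightarrow> \<theta> \<le> 1 \<Longrightarrow>
    \<bar>stationary_mana \<pi> \<theta> / \<theta> - nu n s0 0\<bar> \<le> c * rate ^ n + Q * \<theta> + g / R"
    using gR[OF R] s0 by blast
  define d where "d = min 1 (e / (4 * (\<bar>Q\<bar> + 1)))"
  have d: "d > 0" using e by (simp add: d_def)
  show "\<forall>\<^sub>F \<theta> in at_right 0. dist (stationary_mana \<pi> \<theta> / \<theta>) ?\<kappa> < e"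
    unfolding eventually_at_right_field
  proof (intro exI[of _ d] conjI d allI impI)
    fix \<theta> :: real assume \<theta>: "0 < \<theta>" "\<theta> < d"
    have "Q * \<theta> \<le> (\<bar>Q\<bar> + 1) * (e / (4 * (\<bar>Q\<bar> + 1)))" using \<theta> by (intro mult_mono) (auto simp: d_def)
    also have "\<dots> = e / 4" by (simp add: field_simps)
    finally have Qe: "Q * \<theta> \<le> e / 4" .
    have 1: "\<bar>stationary_mana \<pi> \<theta> / \<theta> - nu n s0 0\<bar> \<le> c * rate ^ n + Q * \<theta> + g / R"
      using \<theta> by (intro Q) (auto simp: d_def)
    have 2: "\<bar>?\<kappa> - nu n s0 0\<bar> \<le> rate ^ n * L * m1" unfolding m1_def by (rule nu_converges[OF inv L s0])
    have "A * rate ^ n = c * rate ^ n + rate ^ n * L * m1" by (simp add: A_def algebra_simps)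
    then show "dist (stationary_mana \<pi> \<theta> / \<theta>) ?\<kappa> < e"
      unfolding dist_real_def using 1 2 An gRe Qe e by linarith
  qed
qed

end

end

section \<open>Sign of the derivative\<close>

context charted
begin

lemma sum_ell:
  fixes \<phi> w :: "('n, 'p) idx cvec"
  assumes \<phi>: "norm \<phi> = 1" and w: "braket \<phi> w = 0"
  shows "(\<Sum>u\<in>UNIV. ell \<phi> u w) = 0"
proof -
  have "(\<Sum>u\<in>UNIV. wig (\<phi> + w) u) = (\<Sum>u\<in>UNIV. wig \<phi> u) + (\<Sum>u\<in>UNIV. ell \<phi> u w) + (\<Sum>u\<in>UNIV. wig w u)"
    by (simp add: wig_add sum.distrib)
  then show ?thesis by (simp add: sum_wig norm_orthogonal_sum[OF w])
qed

text \<open>By \<open>sum_ell\<close> the differentials add up to 0, because a tangent displacement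
  preserves the norm to first order. Hence \<open>ln 2\<close> times the tangent mana is the sum of
  the nonnegative numbers \<open>\<bar>ell \<phi> u w\<bar> - ell \<phi> u w\<close> over the points
  off the support.\<close>

lemma tmana_zero_ell:
  fixes \<phi> w :: "('n, 'p) idx cvec"
  assumes \<phi>: "norm \<phi> = 1" and w: "braket \<phi> w = 0" and z: "tmana \<phi> w = 0" and u: "u \<notin> lsup \<phi>"
  shows "ell \<phi> u w \<ge> 0"
proof -
  have "(\<Sum>u\<in>lsup \<phi>. ell \<phi> u w) + (\<Sum>u\<in>- lsup \<phi>. ell \<phi> u w) = (\<Sum>u\<in>UNIV. ell \<phi> u w)"
    by (subst sum.union_disjoint[symmetric]) (auto simp: Un_commute)
  then have "(\<Sum>u\<in>lsup \<phi>. ell \<phi> u w) = - (\<Sum>u\<in>- lsup \<phi>. ell \<phi> u w)" using sum_ell[OF \<phi> w] by simp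
  moreover have "(\<Sum>u\<in>lsup \<phi>. ell \<phi> u w) + (\<Sum>u\<in>- lsup \<phi>. \<bar>ell \<phi> u w\<bar>) = 0"
    using z by (simp add: tmana_def)
  ultimately have "(\<Sum>u\<in>- lsup \<phi>. \<bar>ell \<phi> u w\<bar> - ell \<phi> u w) = 0" by (simp add: sum_subtractf)
  moreover have "\<bar>ell \<phi> u w\<bar> - ell \<phi> u w \<ge> 0" for u by simp
  ultimately have "\<forall>u\<in>- lsup \<phi>. \<bar>ell \<phi> u w\<bar> - ell \<phi> u w = 0"
    by (subst (asm) sum_nonneg_eq_0_iff) auto
  then have "\<bar>ell \<phi> u w\<bar> - ell \<phi> u w = 0" using u by blast
  then show ?thesis using abs_ge_zero[of "ell \<phi> u w"] by linarith
qed

abbreviation ket0 :: "('n, 'p) idx cvec" where "ket0 \<equiv> axis 0 1"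

lemma stab_vec_ket0: "stab_vec \<phi> \<longleftrightarrow> (\<exists>U. cliff U \<and> \<phi> = U *v ket0)"
  by (simp add: stab_vec_def zero_fun_def)

lemma braket_ket0_phase_op:
  "braket ket0 (phase_op (q, p) *v v) = omega_pow (dotp p (- (q + q))) * v $ (q + q)"
  unfolding braket_axis_left phase_op_matvec by (simp add: dotp_simps(2)[symmetric])

text \<open>For \<open>q \<noteq> 0\<close> the differentials at \<open>(q, p)\<close> are
  nonnegative for all \<open>p\<close> and are real parts of a character times the amplitude at
  \<open>q + q\<close>. They sum to 0, so all of these real parts vanish. If the amplitude were not
  0, it would be imaginary and all values of the character real, hence of square 1; then
  \<open>t + t = 0\<close>, impossible for \<open>t \<noteq> 0\<close> when the number of levels is
  odd.\<close>

lemma ket0_tmana_zero: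
  assumes w: "braket ket0 w = 0" and z: "tmana ket0 w = 0"
  shows "w = 0"
proof -
  have cp: "real CARD('p) ^ CARD('n) > 0" by simp
  have *: "w $ (q + q) = 0" if q: "q \<noteq> 0" for q
  proof (rule ccontr)
    assume nz: "w $ (q + q) \<noteq> 0"
    have q2: "q + q \<noteq> 0" using double_inject_idx[of q 0] q by (metis add_0)
    define t where "t = - (q + q)"
    have t: "t \<noteq> 0" using q2 by (simp only: t_def neg_equal_0_iff_equal not_False_eq_True)
    have k0: "ket0 $ (q + q) = 0" using q2 by (simp only: axis_def vec_lambda_beta if_False)
    have "(q, p) \<notin> lsup ket0" for p
      unfolding lsup_def mem_Collect_eq wig_def braket_ket0_phase_op k0 using cp by simp
    then have ge: "ell ket0 (q, p) w \<ge> 0" for p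
      using tmana_zero_ell[OF norm_axis_1 w z] by blast
    have e: "ell ket0 (q, p) w = 2 * Re (omega_pow (dotp p t) * w $ (q + q)) / real CARD('p) ^ CARD('n)" for p
      by (simp only: ell_def braket_ket0_phase_op t_def)
    have "(\<Sum>p\<in>UNIV. ell ket0 (q, p) w)
        = 2 * Re ((\<Sum>p\<in>UNIV. omega_pow (dotp p t)) * w $ (q + q)) / real CARD('p) ^ CARD('n)"
      by (simp only: e sum_divide_distrib[symmetric] sum_distrib_left[symmetric] sum_distrib_right[symmetric] Re_sum[symmetric])
    also have "\<dots> = 0" using t by (simp add: sum_omega_pow_dotp)
    finally have "\<forall>p\<in>UNIV. ell ket0 (q, p) w = 0" using ge by (subst (asm) sum_nonneg_eq_0_iff) auto
    then have re: "Re (omega_pow (dotp p t) * w $ (q + q)) = 0" for p using cp by (simp add: e)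
    have "Re (w $ (q + q)) = 0" using re[of 0] by (simp add: dotp_def)
    then have im: "Im (w $ (q + q)) \<noteq> 0" using nz by (simp add: complex_eq_iff)
    have "omega_pow (dotp p (t + t)) = omega_pow (dotp p (0 :: ('n, 'p) idx))" for p
    proof -
      have i0: "Im (omega_pow (dotp p t)) = 0" using re[of p] \<open>Re (w $ (q + q)) = 0\<close> im by simp
      have "(Re (omega_pow (dotp p t)))\<^sup>2 + (Im (omega_pow (dotp p t)))\<^sup>2 = 1"
        using cmod_power2[of "omega_pow (dotp p t)"] by simp
      then have "omega_pow (dotp p t) * omega_pow (dotp p t) = 1"
        using i0 by (simp add: complex_eq_iff power2_eq_square)
      moreover have "dotp p (0 :: ('n, 'p) idx) = 0" by (simp add: dotp_def)
      ultimately show ?thesis by (simp only: dotp_simps(2) omega_pow_add omega_pow_0)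
    qed
    then have "t + t = 0" by (rule idx_eqI_omega)
    then show False using double_inject_idx[of t 0] t by (metis add_0)
  qed
  have "inj (\<lambda>x :: ('n, 'p) idx. x + x)" by (rule injI) (simp only: double_inject_idx)
  then have surj: "surj (\<lambda>x :: ('n, 'p) idx. x + x)" by (rule finite_UNIV_inj_surj[OF finite])
  have "w $ x = 0" for x
  proof (cases "x = 0")
    case True
    then show ?thesis using w by (simp add: braket_axis_left)
  next
    case False
    obtain q where "x = q + q" using surj by (metis surjD)
    then show ?thesis using * False by (cases "q = 0") auto
  qed
  then show ?thesis by (simp add: vec_eq_iff)
qed

text \<open>\<open>ell\<close> is the polarization of \<open>wig\<close>, so the permutation of
  phase points that transports \<open>wig\<close> also transports \<open>ell\<close> and the
  support.\<close>

lemma tmana_cliff: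
  assumes V: "cliff V"
  shows "tmana (V *v \<phi>) (V *v w) = tmana \<phi> (w :: ('n, 'p) idx cvec)"
proof -
  obtain f where f: "bij f" "\<And>y u. wig (V *v y) (f u) = wig y u" using wig_cliff[OF V] by blast
  have ell_eq: "ell s u v = wig (s + v) u - wig s u - wig v u" for s v :: "('n, 'p) idx cvec" and u
    by (simp add: wig_add)
  have e: "ell (V *v \<phi>) (f u) (V *v w) = ell \<phi> u w" for u
    unfolding ell_eq matrix_vector_right_distrib[symmetric] f(2) ..
  have l: "f u \<in> lsup (V *v \<phi>) \<longleftrightarrow> u \<in> lsup \<phi>" for u by (simp add: lsup_def f(2))
  have t: "tmana s v = 1 / ln 2 * (\<Sum>u\<in>UNIV. if u \<in> lsup s then ell s u v else \<bar>ell s u v\<bar>)"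
    for s v :: "('n, 'p) idx cvec"
    by (simp add: tmana_def sum.If_cases Compl_eq)
  have "(\<Sum>u\<in>UNIV. if u \<in> lsup (V *v \<phi>) then ell (V *v \<phi>) u (V *v w) else \<bar>ell (V *v \<phi>) u (V *v w)\<bar>)
      = (\<Sum>u\<in>UNIV. if f u \<in> lsup (V *v \<phi>) then ell (V *v \<phi>) (f u) (V *v w) else \<bar>ell (V *v \<phi>) (f u) (V *v w)\<bar>)"
    by (rule sum.reindex_bij_betw[OF f(1), symmetric])
  then show ?thesis by (simp only: t e l)
qed

lemma tmana_zero:
  assumes s: "s \<in> Stab" "tang s v" and z: "tmana (rep_vec s) v = 0"
  shows "v = 0"
proof -
  obtain V where V: "cliff V" "rep_vec s = V *v ket0" using stab_vec_rep_vec[OF s(1)] stab_vec_ket0 by blast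
  have un: "unitary V" by (rule cliff_unitary[OF V(1)])
  define w where "w = dagger V *v v"
  have v: "v = V *v w" by (simp add: w_def unitary_inverse[OF un])
  have "w = 0"
  proof (rule ket0_tmana_zero)
    show "braket ket0 w = 0" using s(2) by (simp add: tang_def V(2) v unitary_braket[OF un])
    show "tmana ket0 w = 0" using z unfolding V(2) v tmana_cliff[OF V(1)] .
  qed
  then show ?thesis by (simp add: v)
qed

section \<open>Tangent maps for one and for several qudits\<close>

lemma one_qudit_trivial:
  assumes n: "CARD('n) = 1" and C: "C \<in> Cl" and s: "s \<in> Stab" and wt: "wt C m s \<noteq> 0"
  shows "Alin C m s v = 0" "bsh C m s = 0"
proof -
  have j: "j = q1" for j :: 'n using n by (metis card_1_singletonE UNIV_I singletonD)
  let ?U = "rep_unitary C"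
  define w where "w = dagger ?U *v axis (\<lambda>_ :: 'n. m) (1 :: complex)"
  have line: "dagger ?U *v (meas q1 m *v y) = y $ (\<lambda>_. m) *s w" for y
  proof -
    have "meas q1 m *v y = y $ (\<lambda>_. m) *s axis (\<lambda>_. m) 1"
    proof (rule vec_eq_iff[THEN iffD2], rule allI)
      fix x :: "('n, 'p) idx"
      have "x q1 = m \<longleftrightarrow> x = (\<lambda>_. m)" using j by (auto simp: fun_eq_iff) metis
      then show "(meas q1 m *v y) $ x = (y $ (\<lambda>_. m) *s axis (\<lambda>_. m) 1) $ x"
        by (auto simp: meas_matvec axis_def)
    qed
    then show ?thesis by (simp add: w_def matvec_smult)
  qed
  have nz: "K C m 0 *v rep_vec s \<noteq> 0" using wt by (auto simp: wt_def)
  note ab = active_branch[OF C s nz]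
  let ?\<sigma> = "rep_vec (post C m s)"
  obtain c0 where c0: "K C m 0 *v rep_vec s = c0 *s w" unfolding KU_0_matvec line by blast
  have "c0 \<noteq> 0" using nz c0 by auto
  then have "w = inverse c0 *s (c0 *s w)" by (simp add: vector_smult_assoc)
  also have "\<dots> = (inverse c0 * amp C m s) *s ?\<sigma>" by (simp only: c0[symmetric] ab(3) vector_smult_assoc)
  finally obtain c where w: "w = c *s ?\<sigma>" by blast
  have "prp ?\<sigma> (d *s w) = 0" for d
    using rep_vec_norm[OF ab(1)] by (simp add: w prp_smult prp_self)
  then show "Alin C m s v = 0" "bsh C m s = 0"
    unfolding Alin_def bsh_def KU_0_matvec KD_matvec line by simp_all
qed

text \<open>The Clifford unitary turns \<open>s\<close> into a superposition, with quadratic phases,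
  of the strings \<open>scl l e\<close>, whose letters at \<open>q1\<close> and \<open>j2\<close>
  agree. Unrotated, the outcome \<open>m\<close> leaves only the string with letter \<open>m\<close>
  at both places. The derivative of the rotation acts on \<open>q1\<close> alone and moves amplitude
  from the string with letters \<open>k\<close> to the one with \<open>m\<close> at
  \<open>q1\<close> and \<open>k\<close> at \<open>j2\<close>, so the first-order change is not
  along the post-measurement state.\<close>

lemma shift_nonzero:
  assumes n: "CARD('n) \<ge> 2" and p: "CARD('p) > 2" and a: "CARD('p) > 3 \<Longrightarrow> a \<noteq> 0" and s: "s \<in> Stab"
  shows "\<exists>C\<in>Cl. \<exists>m. wt C m s \<noteq> 0 \<and> bsh C m s \<noteq> 0"
proof -
  obtain m k :: "'p mod_ring" where mk: "m \<noteq> k" "rot_deriv a $ m $ k \<noteq> 0" using rot_deriv_off_diagonal[OF p a] by blast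
  have "\<exists>j2. j2 \<noteq> q1"
  proof (rule ccontr)
    assume "\<nexists>j2. j2 \<noteq> q1"
    then have "(UNIV :: 'n set) = {q1}" by auto
    then have "CARD('n) = card {q1}" by (simp only:)
    then show False using n by simp
  qed
  then obtain j2 where j2: "j2 \<noteq> q1" by blast
  define e :: "('n, 'p) idx" where "e = unit_idx q1 + unit_idx j2"
  have e1: "e q1 = 1" "e j2 = 1" using j2 by (simp_all add: e_def unit_idx_def)
  have e_other: "scl l e q1 = l" "scl l e j2 = l" for l using e1 by (simp_all add: scl_def)
  obtain B where B: "cliff B" "rep_vec s = B *v ket0" using stab_vec_rep_vec[OF s] stab_vec_ket0 by blast
  let ?V = "quad_gate 1 0 e"
  have cU: "cliff (?V ** dagger B)" by (intro cliff_mult cliff_quad_gate cliff_dagger B) simp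
  define C where "C = proj_class (?V ** dagger B)"
  have C: "C \<in> Cl" unfolding C_def proj_class_in_proj_clifford_iff[OF cliff_unitary[OF cU]] by (rule cU)
  obtain c where c: "cmod c = 1" "rep_unitary C = csc c (?V ** dagger B)"
    using rep_unitary_proj_class C_def by blast
  define \<phi> where "\<phi> = rep_unitary C *v rep_vec s"
  have \<phi>V: "\<phi> = c *s (?V *v ket0)"
    by (simp add: \<phi>_def c(2) csc_matvec matvec_assoc B(2) unitary_inverse[OF cliff_unitary[OF B(1)]])
  have \<phi>: "\<phi> $ x = c * (complex_of_real (1 / sqrt (real CARD('p))) *
      (\<Sum>l\<in>UNIV. omega_pow (l * l) * (if x = scl l e then 1 else 0)))" for x
  proof -
    have "(weyl (scl l 0) (scl l e) *v ket0) $ x = (if x = scl l e then 1 else 0)" for l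
      by (simp add: weyl_matvec axis_def scl_def dotp_def)
    then show ?thesis by (simp add: \<phi>V quad_gate_matvec)
  qed
  have sq: "complex_of_real (1 / sqrt (real CARD('p))) \<noteq> 0" by simp
  have cn: "c \<noteq> 0" using c by auto
  have scl_eq: "scl l e = scl l' e \<longleftrightarrow> l = l'" for l l' using e_other by metis
  have \<phi>_on: "\<phi> $ scl l e \<noteq> 0" for l
  proof -
    have "(\<Sum>l'\<in>UNIV. omega_pow (l' * l') * (if scl l e = scl l' e then 1 else 0)) = omega_pow (l * l)"
      by (simp add: scl_eq if_distrib cong: if_cong)
    then have "\<phi> $ scl l e = c * (complex_of_real (1 / sqrt (real CARD('p))) * omega_pow (l * l))" by (simp only: \<phi>)
    moreover have "omega_pow (l * l) \<noteq> 0" using cmod_omega_pow[of "l * l"] by (metis norm_zero zero_neq_one)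
    ultimately show ?thesis using sq cn by simp
  qed
  have \<phi>_off: "\<phi> $ x = 0" if "x q1 \<noteq> x j2" for x
  proof -
    have "x \<noteq> scl l e" for l using that e_other by metis
    then show ?thesis by (simp add: \<phi>)
  qed
  have un: "unitary (rep_unitary C)" by (rule rep_unitary_unitary[OF C])
  have Kw: "rep_unitary C *v (K C m 0 *v rep_vec s) = meas q1 m *v \<phi>"
    by (simp add: KU_0_matvec unitary_inverse[OF un] \<phi>_def)
  have "(meas q1 m *v \<phi>) $ scl m e \<noteq> 0" using \<phi>_on by (simp add: meas_matvec e_other)
  then have nz: "K C m 0 *v rep_vec s \<noteq> 0" using Kw by auto
  then have wt: "wt C m s \<noteq> 0" by (simp add: wt_def)
  note ab = active_branch[OF C s nz]
  have "bsh C m s \<noteq> 0"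
  proof
    let ?\<sigma> = "rep_vec (post C m s)"
    \<comment> \<open>The string with letter \<open>m\<close> at the measured qudit and
      \<open>k\<close> at \<open>j2\<close>: the unrotated branch vanishes there, while the
      off-diagonal entry of \<open>rot_deriv a\<close> reaches it from
      \<open>scl k e\<close>.\<close>
    let ?x = "(scl k e)(q1 := m)"
    let ?KD = "KD a q1 (rep_unitary C) m *v rep_vec s"
    assume "bsh C m s = 0"
    then have "prp ?\<sigma> ?KD = 0" using ab(2) by (simp add: bsh_def)
    then have kd: "?KD = braket ?\<sigma> ?KD *s ?\<sigma>" using prp_decomp[of ?KD ?\<sigma>] by simp
    have "?\<sigma> = inverse (amp C m s) *s (amp C m s *s ?\<sigma>)" using ab(2) by (simp add: vector_smult_assoc)
    then have \<sigma>: "?\<sigma> = inverse (amp C m s) *s (K C m 0 *v rep_vec s)" by (simp only: ab(3))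
    obtain d where d: "?KD = d *s (K C m 0 *v rep_vec s)"
      using kd \<sigma> by (metis vector_smult_assoc)
    have "meas q1 m *v (on_qudit q1 (rot_deriv a) *v \<phi>) = rep_unitary C *v ?KD"
      by (simp add: KD_matvec unitary_inverse[OF un] \<phi>_def)
    also have "\<dots> = d *s (meas q1 m *v \<phi>)" by (simp only: d matvec_smult Kw)
    finally have eq: "(meas q1 m *v (on_qudit q1 (rot_deriv a) *v \<phi>)) $ ?x = d * (meas q1 m *v \<phi>) $ ?x" by simp
    have "\<phi> $ ?x = 0" using mk(1) j2 by (intro \<phi>_off) (simp add: e_other)
    then have r0: "(on_qudit q1 (rot_deriv a) *v \<phi>) $ ?x = 0" using eq by (simp add: meas_matvec)
    have "(on_qudit q1 (rot_deriv a) *v \<phi>) $ ?x = (\<Sum>l\<in>UNIV. rot_deriv a $ m $ l * \<phi> $ ((scl k e)(q1 := l)))"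
      by (simp add: on_qudit_matvec)
    also have "\<dots> = (\<Sum>l\<in>UNIV. if l = k then rot_deriv a $ m $ k * \<phi> $ scl k e else 0)"
    proof (rule sum.cong[OF refl])
      fix l :: "'p mod_ring"
      show "rot_deriv a $ m $ l * \<phi> $ ((scl k e)(q1 := l)) = (if l = k then rot_deriv a $ m $ k * \<phi> $ scl k e else 0)"
      proof (cases "l = k")
        case True
        have "(scl k e)(q1 := k) = scl k e" using e_other(1)[of k] by (metis fun_upd_triv)
        then show ?thesis by (simp add: True)
      next
        case False
        have "\<phi> $ ((scl k e)(q1 := l)) = 0" using False j2 by (intro \<phi>_off) (simp add: e_other)
        then show ?thesis by (simp add: False)
      qed
    qed
    also have "\<dots> = rot_deriv a $ m $ k * \<phi> $ scl k e" by simp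
    finally show False using r0 mk(2) \<phi>_on[of k] by simp
  qed
  then show ?thesis using C wt by blast
qed

context
  fixes \<mu> :: "('n, 'p) tangent_point measure"
  assumes inv: "invariant_prob tangent_space (affine_kernel a q1 r) \<mu>"
begin

lemma tnu_nonneg: "s \<in> Stab \<Longrightarrow> tang s v \<Longrightarrow> tnu s v \<ge> 0"
  using qn_nonneg[of s v 0] by (simp add: qn_0)

lemma slope_nonneg: "integral\<^sup>L \<mu> (case_prod tnu) \<ge> 0"
  by (intro integral_nonneg_AE AE_I2) (auto simp: space_mu[OF inv] tangent_union_iff intro: tnu_nonneg)

lemma slope_Paff: "integral\<^sup>L \<mu> (case_prod (Paff tnu)) = integral\<^sup>L \<mu> (case_prod tnu)"
  and integrable_tnu: "integrable \<mu> (case_prod tnu)" "integrable \<mu> (case_prod (Paff tnu))"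
proof -
  obtain L where L: "lips L tnu" using tmana_lips by blast
  show "integral\<^sup>L \<mu> (case_prod (Paff tnu)) = integral\<^sup>L \<mu> (case_prod tnu)"
    by (rule invariant_Paff(3)[OF inv lips_measurable[OF L] tnu_nonneg])
  show "integrable \<mu> (case_prod tnu)" by (rule integrable_lips[OF inv L])
  show "integrable \<mu> (case_prod (Paff tnu))" by (rule integrable_lips[OF inv lips_Pgen[OF L tshift_bsh]])
qed

lemma slope_one_qudit:
  assumes n: "CARD('n) = 1"
  shows "integral\<^sup>L \<mu> (case_prod tnu) = 0"
proof -
  have "Paff tnu s v = 0" if s: "s \<in> Stab" for s v
  proof -
    have "wt C m s * tnu (post C m s) (Alin C m s v + bsh C m s) = 0" if "C \<in> Cl" for C m
      using one_qudit_trivial[OF n that s] by (cases "wt C m s = 0") (simp_all add: tmana_0)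
    then have "(\<Sum>C\<in>Cl. \<Sum>m\<in>UNIV. wt C m s * tnu (post C m s) (Alin C m s v + bsh C m s)) = 0"
      by (intro sum.neutral ballI)
    then show ?thesis unfolding Pgen_def by simp
  qed
  then have "integral\<^sup>L \<mu> (case_prod (Paff tnu)) = (\<integral>x. 0 \<partial>\<mu>)"
    by (intro Bochner_Integration.integral_cong refl) (auto simp: space_mu[OF inv] tangent_union_iff)
  then show ?thesis by (simp add: slope_Paff)
qed

text \<open>If the integral were 0, the tangent mana and its image under the affine kernel would
  both vanish almost everywhere, hence at some common point. The vector there is 0, so all shifts of
  the active branches from that state would vanish, against \<open>shift_nonzero\<close>.\<close>

lemma slope_pos:
  assumes n: "CARD('n) \<ge> 2" and p: "CARD('p) > 2" and a: "CARD('p) > 3 \<Longrightarrow> a \<noteq> 0"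
  shows "integral\<^sup>L \<mu> (case_prod tnu) > 0"
proof (rule ccontr)
  assume "\<not> ?thesis"
  then have z: "integral\<^sup>L \<mu> (case_prod tnu) = 0" using slope_nonneg by simp
  have P0: "Paff tnu s v \<ge> 0" if s: "s \<in> Stab" "tang s v" for s v
  proof -
    have "Paff (\<lambda>_ _. 0) s v \<le> Paff tnu s v" by (rule Pgen_mono[OF tshift_bsh s]) (rule tnu_nonneg)
    then show ?thesis by (simp add: Pgen_const[OF s(1)])
  qed
  have nonneg: "AE x in \<mu>. 0 \<le> case_prod \<nu> x" if "\<And>s v. s \<in> Stab \<Longrightarrow> tang s v \<Longrightarrow> \<nu> s v \<ge> 0"
    for \<nu> :: "('n, 'p) idx cmat \<Rightarrow> ('n, 'p) idx cvec \<Rightarrow> real"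
  proof (rule AE_I2)
    fix x assume "x \<in> space \<mu>"
    then show "0 \<le> case_prod \<nu> x" using that by (cases x) (simp add: space_mu[OF inv] tangent_union_iff)
  qed
  have "AE x in \<mu>. case_prod tnu x = 0"
    by (rule iffD1[OF integral_nonneg_eq_0_iff_AE[OF integrable_tnu(1) nonneg[OF tnu_nonneg]] z])
  moreover have "AE x in \<mu>. case_prod (Paff tnu) x = 0"
    by (rule iffD1[OF integral_nonneg_eq_0_iff_AE[OF integrable_tnu(2) nonneg[OF P0]] slope_Paff[unfolded z]])
  moreover have "AE x in \<mu>. x \<in> tangent_union" by (rule AE_I2) (simp add: space_mu[OF inv])
  ultimately have "AE x in \<mu>. x \<in> tangent_union \<and> case_prod tnu x = 0 \<and> case_prod (Paff tnu) x = 0" by auto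
  then have "\<exists>x. x \<in> tangent_union \<and> case_prod tnu x = 0 \<and> case_prod (Paff tnu) x = 0"
  proof (rule contrapos_pp)
    assume "\<nexists>x. x \<in> tangent_union \<and> case_prod tnu x = 0 \<and> case_prod (Paff tnu) x = 0"
    then have "(AE x in \<mu>. x \<in> tangent_union \<and> case_prod tnu x = 0 \<and> case_prod (Paff tnu) x = 0) \<longleftrightarrow> (AE x in \<mu>. False)"
      by (intro AE_cong) blast
    then show "\<not> (AE x in \<mu>. x \<in> tangent_union \<and> case_prod tnu x = 0 \<and> case_prod (Paff tnu) x = 0)"
      using prob_space.AE_False[OF prob_mu[OF inv]] by simp
  qed
  then obtain s v where s: "s \<in> Stab" "tang s v" and t0: "tnu s v = 0" and Pz: "Paff tnu s v = 0"
    by (auto simp: tangent_union_iff)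
  have v: "v = 0" by (rule tmana_zero[OF s t0])
  have nn: "wt C m s * tnu (post C m s) (Alin C m s v + bsh C m s) \<ge> 0" if "C \<in> Cl" for C m
    using tnu_nonneg[OF post_Stab[OF that s(1)] tang_step[OF tshift_bsh that s(1)]] wt_nonneg
    by (cases "wt C m s = 0") auto
  obtain C m where C: "C \<in> Cl" and wt: "wt C m s \<noteq> 0" and b: "bsh C m s \<noteq> 0"
    using shift_nonzero[OF n p a s(1)] by blast
  have "(\<Sum>C\<in>Cl. \<Sum>m\<in>UNIV. wt C m s * tnu (post C m s) (Alin C m s v + bsh C m s)) = 0"
    using Pz Nc_pos by (simp add: Pgen_def)
  then have "(\<Sum>m\<in>UNIV. wt C m s * tnu (post C m s) (Alin C m s v + bsh C m s)) = 0"
    by (rule sum_nonneg_0[OF fin_cl _ _ C, rotated]) (rule sum_nonneg, rule nn)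
  then have "wt C m s * tnu (post C m s) (Alin C m s v + bsh C m s) = 0"
    by (rule sum_nonneg_0[OF finite _ _ UNIV_I, rotated]) (rule nn[OF C])
  then have "tnu (post C m s) (bsh C m s) = 0" using wt by (simp add: v Alin_0)
  then have "bsh C m s = 0"
    using tmana_zero[OF post_Stab[OF C s(1) wt]] tang_step[OF tshift_bsh C s(1) wt, of v] by (simp add: v Alin_0)
  then show False using b by simp
qed

end

end

text \<open>For an infinite set \<open>card\<close> is 0, and division by 0 makes every branch
  weight 0. The kernel would then be the zero measure, which leaves no probability measure
  invariant.\<close>

lemma finite_proj_clifford:
  assumes inv: "invariant_prob ray_space (ray_kernel a q1 \<theta>) (\<mu> :: ('n::finite, 'p::prime_card) idx cmat measure)"
  shows "finite (proj_clifford :: ('n, 'p) idx cmat set set)"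
proof (rule ccontr)
  assume "\<not> ?thesis"
  then have c: "card (proj_clifford :: ('n, 'p) idx cmat set set) = 0" by simp
  have z: "emeasure (ray_kernel a q1 \<theta> \<rho>) B = 0" for \<rho> :: "('n, 'p) idx cmat" and B
    unfolding ray_kernel_def by (rule emeasure_dirac_mixture_0) (simp add: branch_weight_def c)
  have "prob_space \<mu>" and s: "sets \<mu> = sets ray_space"
    and e: "emeasure \<mu> (space ray_space) = (\<integral>\<^sup>+x. emeasure (ray_kernel a q1 \<theta> x) (space ray_space) \<partial>\<mu>)"
    using inv unfolding invariant_prob_def by auto
  then show False using prob_space.emeasure_space_1[of \<mu>] sets_eq_imp_space_eq[OF s] by (simp add: z)
qed

theorem theoremD41:
  fixes a :: "'p::prime_card mod_ring"
    and q1 :: "'n::finite"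
    and r :: real
    and \<pi> :: "real \<Rightarrow> ('n \<Rightarrow> 'p mod_ring) cmat measure"
    and \<pi>hat :: "(('n \<Rightarrow> 'p mod_ring) cmat \<times> ('n \<Rightarrow> 'p mod_ring) cvec) measure"
  assumes "odd CARD('p)"
    and "CARD('p) > 3 \<Longrightarrow> a \<noteq> 0"
    and "admissible_radius TYPE('n) TYPE('p) r"
    and "\<And>\<theta>. \<theta> \<in> {0..1} \<Longrightarrow> invariant_prob ray_space (ray_kernel a q1 \<theta>) (\<pi> \<theta>)"
    and "invariant_prob tangent_space (affine_kernel a q1 r) \<pi>hat"
  shows "integrable \<pi>hat (mana_source a q1 r) \<and> integrable \<pi>hat tangent_mana \<and>
    (\<exists>\<kappa>::real.
      ((\<lambda>\<theta>. (stationary_mana \<pi> \<theta> - stationary_mana \<pi> 0) / \<theta>) \<longlongrightarrow> \<kappa>) (at_right 0) \<and>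
      \<kappa> = (\<integral>x. mana_source a q1 r x \<partial>\<pi>hat) \<and>
      \<kappa> = (\<integral>x. tangent_mana x \<partial>\<pi>hat) \<and>
      \<kappa> \<ge> 0 \<and>
      (CARD('n) = 1 \<longrightarrow> \<kappa> = 0) \<and>
      (CARD('n) \<ge> 2 \<longrightarrow> \<kappa> > 0) \<and>
      (\<lambda>\<theta>. stationary_mana \<pi> \<theta> - \<kappa> * \<theta>) \<in> o[at_right 0](\<lambda>\<theta>. \<theta>))"
proof -
  have p2: "CARD('p) > 2"
  proof -
    have "CARD('p) \<ge> 2" by (rule prime_ge_2_nat[OF prime_card])
    moreover have "CARD('p) \<noteq> 2" using assms(1) by auto
    ultimately show ?thesis by simp
  qed
  interpret charted "TYPE('p)" a q1 "real (card (proj_clifford :: ('n, 'p) idx cmat set set))"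
    "real CARD('p) ^ CARD('n)" "real CARD('n)" r
  proof unfold_locales
    show "(2 :: 'p mod_ring) \<noteq> 0"
    proof
      assume "(2 :: 'p mod_ring) = 0"
      then have "of_nat 2 = (0 :: 'p mod_ring)" by simp
      then have "CARD('p) dvd 2" by (rule of_nat_0_mod_ring_dvd)
      then show False using p2 dvd_imp_le[of "CARD('p)" 2] by simp
    qed
    \<comment> \<open>Any angle in the unit interval would do; 0 is taken.\<close>
    show "finite (proj_clifford :: ('n, 'p) idx cmat set set)" by (rule finite_proj_clifford[OF assms(4)[of 0]]) simp
    show "r > 0" using assms(3) by (simp add: admissible_radius_def)
    show "inj_on (fs_exp s) (tangent_ball r s)" if "s \<in> stabilizer_states" for s :: "('n, 'p) idx cmat"
      using assms(3) that unfolding admissible_radius_def Let_def by blast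
  qed (rule refl)+
  let ?\<kappa> = "integral\<^sup>L \<pi>hat (case_prod tnu)"
  note m0 = stationary_mana_0[OF assms(4)]
  note ints = integrals_tangent[OF assms(5)]
  have lim: "((\<lambda>\<theta>. stationary_mana \<pi> \<theta> / \<theta>) \<longlongrightarrow> ?\<kappa>) (at_right 0)"
    by (rule stationary_mana_derivative[OF assms(4,5)])
  have little: "(\<lambda>\<theta>. stationary_mana \<pi> \<theta> - ?\<kappa> * \<theta>) \<in> o[at_right 0](\<lambda>\<theta>. \<theta>)"
  proof (rule smalloI_tendsto)
    have 1: "((\<lambda>\<theta>. stationary_mana \<pi> \<theta> / \<theta> - ?\<kappa>) \<longlongrightarrow> ?\<kappa> - ?\<kappa>) (at_right 0)" by (intro tendsto_diff lim tendsto_const)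
    have 2: "\<forall>\<^sub>F \<theta> in at_right 0. stationary_mana \<pi> \<theta> / \<theta> - ?\<kappa> = (stationary_mana \<pi> \<theta> - ?\<kappa> * \<theta>) / \<theta>"
      using eventually_at_right_less[of "0 :: real"]
    proof eventually_elim
      fix \<theta> :: real assume "0 < \<theta>"
      then have "?\<kappa> * \<theta> / \<theta> = ?\<kappa>" by (intro nonzero_mult_div_cancel_right) auto
      then show "stationary_mana \<pi> \<theta> / \<theta> - ?\<kappa> = (stationary_mana \<pi> \<theta> - ?\<kappa> * \<theta>) / \<theta>"
        by (simp only: diff_divide_distrib)
    qed
    show "((\<lambda>\<theta>. (stationary_mana \<pi> \<theta> - ?\<kappa> * \<theta>) / \<theta>) \<longlongrightarrow> 0) (at_right 0)"
      using Lim_transform_eventually[OF 1 2] by (simp only: diff_self)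
    show "\<forall>\<^sub>F \<theta> :: real in at_right 0. \<theta> \<noteq> 0"
      using eventually_at_right_less[of "0 :: real"] by eventually_elim simp
  qed
  show ?thesis
  proof (intro conjI exI[of _ ?\<kappa>] impI)
    show "integrable \<pi>hat (mana_source a q1 r)" "integrable \<pi>hat tangent_mana"
      "?\<kappa> = integral\<^sup>L \<pi>hat (mana_source a q1 r)" "?\<kappa> = integral\<^sup>L \<pi>hat tangent_mana"
      using ints by simp_all
    show "((\<lambda>\<theta>. (stationary_mana \<pi> \<theta> - stationary_mana \<pi> 0) / \<theta>) \<longlongrightarrow> ?\<kappa>) (at_right 0)"
      using lim by (simp only: m0 diff_0_right)
    show "?\<kappa> \<ge> 0" by (rule slope_nonneg[OF assms(5)])
    show "?\<kappa> = 0" if "CARD('n) = 1" by (rule slope_one_qudit[OF assms(5) that])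
    show "?\<kappa> > 0" if "CARD('n) \<ge> 2" by (rule slope_pos[OF assms(5) that p2 assms(2)])
    show "(\<lambda>\<theta>. stationary_mana \<pi> \<theta> - ?\<kappa> * \<theta>) \<in> o[at_right 0](\<lambda>\<theta>. \<theta>)" by (rule little)
  qed
qed

end
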